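(* Let $0<\gamma<1$, let $\rho^+,\rho^-$ be constants, and let $z_0$ be an initial interface satisfying the arc-chord condition for the two-dimensional gravity two-phase Stokes free boundary problem with densities $\rho^\pm$. (i) If $z_0\in C^{\gamma}(\mathbb{T})$, then for every $T>0$ there exists a weak solution $z(\alpha,t)\in C([0,T];C^{\gamma})$ with $z(\cdot,0)=z_0$. (ii) If $z_0\in W^{1,\infty}(\mathbb{T})$, then for every $T>0$ there exists a weak solution $z(\alpha,t)\in C([0,T];W^{1,\infty})$ with $z(\cdot,0)=z_0$.
   Context: $\mathbb{T}=\mathbb{R}/2\pi\mathbb{Z}$. An interface is a continuous curve $z=(z_1,z_2):\mathbb{R}\to\mathbb{R}^2$ with $z(\alpha+2\pi k)=(2\pi k,0)+z(\alpha)$ for all $k\in\mathbb{Z}$; "$z\in C^{\gamma}$" (resp. $W^{1,\infty}$) means that the periodic function $z(\alpha)-(\alpha,0)$ lies in that space on $\mathbb{T}$. The arc-chord condition is: there is $c>0$ with $|z(\alpha)-z(\beta)|\ge c|\alpha-\beta|$ for all $\alpha,\beta\in\mathbb{R}$. The curve $\Gamma(t)=\{z(\alpha,t)\}$ separates $\mathbb{T}\times\mathbb{R}$ into the upper domain $\Omega^+(t)$ (unbounded as $x_2\to+\infty$) and the lower domain $\Omega^-(t)$ (unbounded as $x_2\to-\infty$). The density is the patch $\rho(x,t)=\rho^\pm$ for $x\in\Omega^\pm(t)$ (with, say, the value $\rho^-$ on $\Gamma(t)$), and the velocity is $u=\mathcal{S}*(0,\rho)^T$ (convolution on $\mathbb{T}\times\mathbb{R}$),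 the solution of $-\Delta u=-\nabla p-(0,\rho)^T$, $\nabla\cdot u=0$, where $$\mathcal{S}(y)=\frac{1}{8\pi}\log\big(2(\cosh y_2-\cos y_1)\big)\, I-\frac{y_2}{8\pi(\cosh y_2-\cos y_1)}\begin{pmatrix}-\sinh y_2&\sin y_1\\ \sin y_1&\sinh y_2\end{pmatrix}.$$ The interface moves with the fluid: $z_t=u(z,t)$. A weak solution means a density patch, with interface $z$ transported by the flow of $u$ (Lagrangian solution), such that $(\rho,u)$ solves $\partial_t\rho+\nabla\cdot(u\rho)=0$ in the sense of distributions together with the Stokes equations above. *)

theory Defs
  imports "HOL-Analysis.Analysis" "HOL-Probability.Essential_Supremum"
begin

(* Functions on the torus T = R/2 pi Z are represented by 2 pi-periodic functions on the line.
   Likewise, subsets of and functions on T x R are represented by their lifts to the plane,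
   2 pi-periodic in the first coordinate, and integrals over T x R are taken over cell. *)

definition cell :: "(real \<times> real) set" where
  "cell = {0..2 * pi} \<times> UNIV"

section \<open>Interfaces\<close>

definition interface :: "(real \<Rightarrow> real \<times> real) \<Rightarrow> bool" where
  "interface z \<longleftrightarrow> continuous_on UNIV z \<and>
     (\<forall>\<alpha> (k::int). z (\<alpha> + 2 * pi * of_int k) = (2 * pi * of_int k, 0) + z \<alpha>)"

definition arc_chord :: "(real \<Rightarrow> real \<times> real) \<Rightarrow> bool" where
  "arc_chord z \<longleftrightarrow> (\<exists>c>0. \<forall>\<alpha> \<beta>. norm (z \<alpha> - z \<beta>) \<ge> c * \<bar>\<alpha> - \<beta>\<bar>)"

definition perturbation :: "(real \<Rightarrow> real \<times> real) \<Rightarrow> real \<Rightarrow> real \<times> real" where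
  "perturbation z = (\<lambda>\<alpha>. z \<alpha> - (\<alpha>, 0))"

(* The component of the complement of the curve containing a half plane {x. snd x > M}.
   Since such a half plane is periodic and connected, this is also the lift of the
   corresponding component in T x R. *)
definition upper_domain :: "(real \<Rightarrow> real \<times> real) \<Rightarrow> (real \<times> real) set" where
  "upper_domain z = {x. \<exists>M. \<forall>y. snd y > M \<longrightarrow> connected_component (- range z) x y}"

definition lower_domain :: "(real \<Rightarrow> real \<times> real) \<Rightarrow> (real \<times> real) set" where
  "lower_domain z = {x. \<exists>M. \<forall>y. snd y < M \<longrightarrow> connected_component (- range z) x y}"

definition separating :: "(real \<Rightarrow> real \<times> real) \<Rightarrow> bool" where
  "separating z \<longleftrightarrow> upper_domain z \<inter> lower_domain z = {} \<and>
     upper_domain z \<union> lower_domain z = - range z"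

(* On a separating curve itself the density takes the value of the lower fluid. *)
definition patch :: "real \<Rightarrow> real \<Rightarrow> (real \<Rightarrow> real \<times> real) \<Rightarrow> real \<times> real \<Rightarrow> real" where
  "patch \<rho>p \<rho>m z x = (if x \<in> upper_domain z then \<rho>p else \<rho>m)"

section \<open>Smooth test functions\<close>

primrec C_k :: "nat \<Rightarrow> ('a::euclidean_space \<Rightarrow> real) \<Rightarrow> bool" where
  "C_k 0 f \<longleftrightarrow> continuous_on UNIV f"
| "C_k (Suc k) f \<longleftrightarrow> (\<forall>x. f differentiable (at x)) \<and>
     (\<forall>v. C_k k (\<lambda>x. frechet_derivative f (at x) v))"

definition smooth :: "('a::euclidean_space \<Rightarrow> real) \<Rightarrow> bool" where
  "smooth f \<longleftrightarrow> (\<forall>k. C_k k f)"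

definition laplacian :: "('a::euclidean_space \<Rightarrow> real) \<Rightarrow> 'a \<Rightarrow> real" where
  "laplacian f x =
     (\<Sum>e\<in>Basis. frechet_derivative (\<lambda>y. frechet_derivative f (at y) e) (at x) e)"

definition periodic_x1 :: "(real \<times> real \<Rightarrow> real) \<Rightarrow> bool" where
  "periodic_x1 f \<longleftrightarrow> (\<forall>x. f (x + (2 * pi, 0)) = f x)"

definition space_test :: "(real \<times> real \<Rightarrow> real) \<Rightarrow> bool" where
  "space_test \<phi> \<longleftrightarrow> smooth \<phi> \<and> periodic_x1 \<phi> \<and>
     (\<exists>M. \<forall>x. \<phi> x \<noteq> 0 \<longrightarrow> \<bar>snd x\<bar> \<le> M)"

(* Compactly supported in the open set (0,T) x (T x R). *)
definition spacetime_test :: "real \<Rightarrow> (real \<times> (real \<times> real) \<Rightarrow> real) \<Rightarrow> bool" where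
  "spacetime_test T \<phi> \<longleftrightarrow> smooth \<phi> \<and> (\<forall>t. periodic_x1 (\<lambda>x. \<phi> (t, x))) \<and>
     (\<exists>a b M. 0 < a \<and> b < T \<and>
        (\<forall>t x. \<phi> (t, x) \<noteq> 0 \<longrightarrow> a \<le> t \<and> t \<le> b \<and> \<bar>snd x\<bar> \<le> M))"

section \<open>Function spaces\<close>

(* Norms take values in [0,\<infinity>]; a periodic function belongs to the space iff its norm is finite.
   For periodic f, the supremum over the line is the supremum over T with its distance. *)
definition holder_norm :: "real \<Rightarrow> (real \<Rightarrow> real \<times> real) \<Rightarrow> ennreal" where
  "holder_norm \<gamma> f = (SUP \<alpha>. ennreal (norm (f \<alpha>))) +
     (SUP (\<alpha>, \<beta>) \<in> {(\<alpha>, \<beta>). \<alpha> \<noteq> \<beta>}. ennreal (norm (f \<alpha> - f \<beta>) / \<bar>\<alpha> - \<beta>\<bar> powr \<gamma>))"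

definition weak_deriv :: "(real \<Rightarrow> real \<times> real) \<Rightarrow> (real \<Rightarrow> real \<times> real) \<Rightarrow> bool" where
  "weak_deriv f g \<longleftrightarrow>
     g \<in> borel_measurable borel \<and> (\<forall>\<alpha>. g (\<alpha> + 2 * pi) = g \<alpha>) \<and>
     set_integrable lborel {0..2 * pi} f \<and> set_integrable lborel {0..2 * pi} g \<and>
     (\<forall>\<phi>. smooth \<phi> \<and> (\<forall>\<alpha>. \<phi> (\<alpha> + 2 * pi) = \<phi> \<alpha>) \<longrightarrow>
        (LINT \<alpha>:{0..2 * pi}|lborel. deriv \<phi> \<alpha> *\<^sub>R f \<alpha>) =
        - (LINT \<alpha>:{0..2 * pi}|lborel. \<phi> \<alpha> *\<^sub>R g \<alpha>))"

definition Linf_norm :: "(real \<Rightarrow> real \<times> real) \<Rightarrow> ennreal" where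
  "Linf_norm f = esssup lborel (\<lambda>\<alpha>. ennreal (norm (f \<alpha>)))"

(* The weak derivative is unique almost everywhere, so the infimum ranges over at most one
   value; it is \<infinity> if there is no weak derivative. *)
definition W1inf_norm :: "(real \<Rightarrow> real \<times> real) \<Rightarrow> ennreal" where
  "W1inf_norm f = Linf_norm f + (INF g \<in> {g. weak_deriv f g}. Linf_norm g)"

(* z lies in C([0,T]; E), where E is the space with norm N *)
definition continuous_into ::
  "((real \<Rightarrow> real \<times> real) \<Rightarrow> ennreal) \<Rightarrow> real \<Rightarrow> (real \<Rightarrow> real \<Rightarrow> real \<times> real) \<Rightarrow> bool" where
  "continuous_into N T z \<longleftrightarrow>
     (\<forall>t\<in>{0..T}. N (perturbation (z t)) < \<infinity>) \<and>
     (\<forall>s\<in>{0..T}.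
        ((\<lambda>t. N (\<lambda>\<alpha>. perturbation (z t) \<alpha> - perturbation (z s) \<alpha>)) \<longlongrightarrow> 0)
          (at s within {0..T}))"

section \<open>Stokes flow and weak solutions\<close>

(* The matrix S(y) applied to the vector f. *)
definition stokeslet :: "real \<times> real \<Rightarrow> real \<times> real \<Rightarrow> real \<times> real" where
  "stokeslet = (\<lambda>(y1, y2) (f1, f2).
     (1 / (8 * pi) * ln (2 * (cosh y2 - cos y1))) *\<^sub>R (f1, f2)
     - (y2 / (8 * pi * (cosh y2 - cos y1))) *\<^sub>R
         (- sinh y2 * f1 + sin y1 * f2, sin y1 * f1 + sinh y2 * f2))"

definition velocity :: "(real \<times> real \<Rightarrow> real) \<Rightarrow> real \<times> real \<Rightarrow> real \<times> real" where
  "velocity \<rho> x = (LINT y:cell|lborel. stokeslet (x - y) (0, \<rho> y))"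

(* -\<Delta>u = -\<nabla>p - (0,\<rho>) and div u = 0 on T x R in the sense of distributions *)
definition stokes ::
  "(real \<times> real \<Rightarrow> real) \<Rightarrow> (real \<times> real \<Rightarrow> real \<times> real) \<Rightarrow> (real \<times> real \<Rightarrow> real) \<Rightarrow> bool" where
  "stokes \<rho> u p \<longleftrightarrow>
     periodic_x1 p \<and> (\<forall>M. set_integrable lborel ({0..2 * pi} \<times> {-M..M}) p) \<and>
     (\<forall>\<phi>. space_test \<phi> \<longrightarrow>
        (\<forall>e\<in>Basis. has_bochner_integral lborel
           (\<lambda>x. indicator cell x *
              ((u x \<bullet> e) * laplacian \<phi> x + p x * frechet_derivative \<phi> (at x) e
                - ((0, \<rho> x) \<bullet> e) * \<phi> x)) 0) \<and>
        has_bochner_integral lborel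
          (\<lambda>x. indicator cell x * frechet_derivative \<phi> (at x) (u x)) 0)"

(* \<partial>\<^sub>t\<rho> + div (u \<rho>) = 0 on (0,T) x (T x R) in the sense of distributions; the derivative of a test
   function in direction (1, u) is \<partial>\<^sub>t\<phi> + u \<bullet> \<nabla>\<phi>. *)
definition continuity_equation ::
  "real \<Rightarrow> (real \<Rightarrow> real \<times> real \<Rightarrow> real) \<Rightarrow> (real \<Rightarrow> real \<times> real \<Rightarrow> real \<times> real) \<Rightarrow> bool" where
  "continuity_equation T \<rho> u \<longleftrightarrow>
     (\<forall>\<phi>. spacetime_test T \<phi> \<longrightarrow>
        has_bochner_integral lborel
          (\<lambda>(t, x). indicator ({0..T} \<times> cell) (t, x) *
             (\<rho> t x * frechet_derivative \<phi> (at (t, x)) (1, u t x))) 0)"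

definition is_flow ::
  "real \<Rightarrow> (real \<Rightarrow> real \<times> real \<Rightarrow> real \<times> real) \<Rightarrow> (real \<Rightarrow> real \<times> real \<Rightarrow> real \<times> real) \<Rightarrow> bool" where
  "is_flow T u X \<longleftrightarrow>
     (\<forall>x. X 0 x = x \<and>
        (\<forall>t\<in>{0..T}. ((\<lambda>s. X s x) has_vector_derivative u t (X t x)) (at t within {0..T})))"

(* Interface and density are transported by the flow; in particular z satisfies z_t = u(z,t). *)
definition lagrangian ::
  "real \<Rightarrow> (real \<Rightarrow> real \<times> real \<Rightarrow> real) \<Rightarrow> (real \<Rightarrow> real \<times> real \<Rightarrow> real \<times> real) \<Rightarrow>
   (real \<Rightarrow> real \<Rightarrow> real \<times> real) \<Rightarrow> bool" where
  "lagrangian T \<rho> u z \<longleftrightarrow>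
     (\<exists>X. is_flow T u X \<and>
        (\<forall>t\<in>{0..T}. (\<forall>\<alpha>. z t \<alpha> = X t (z 0 \<alpha>)) \<and> (\<forall>x. \<rho> t (X t x) = \<rho> 0 x)))"

definition weak_solution ::
  "real \<Rightarrow> real \<Rightarrow> real \<Rightarrow> (real \<Rightarrow> real \<Rightarrow> real \<times> real) \<Rightarrow> bool" where
  "weak_solution \<rho>p \<rho>m T z \<longleftrightarrow>
     (let \<rho> = (\<lambda>t. patch \<rho>p \<rho>m (z t)); u = (\<lambda>t. velocity (\<rho> t)) in
        (\<forall>t\<in>{0..T}. interface (z t) \<and> separating (z t)) \<and>
        lagrangian T \<rho> u z \<and>
        continuity_equation T \<rho> u \<and>
        (\<forall>t\<in>{0..T}. \<exists>p. stokes (\<rho> t) (u t) p))"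

end

theory Submission
  imports Defs "HOL-Complex_Analysis.Complex_Analysis"
begin

text \<open>The velocity of a density \<open>\<rho>\<close> is its convolution with the vector field \<open>K = kern\<close>, and
  \<open>|K a - K b| \<le> |a - b| (m a + m b)\<close> for a periodic function \<open>m\<close> that is integrable over a cell. Hence, if \<open>X\<close>
  preserves the area and commutes with the period, the field \<open>x \<mapsto> \<integral> \<rho> y K (x - X y) dy\<close> is Lipschitz in \<open>x\<close> and,
  for the supremum distance, in \<open>X\<close>, with constants depending only on a bound for \<open>\<rho>\<close>. The flow equation
  \<open>\<partial>\<^sub>t X = \<integral> \<rho>\<^sub>0 y K (X - X y) dy\<close> is therefore an ordinary differential equation with a globally Lipschitz
  right hand side on the closed set of area preserving maps with bounded displacement. One stays in this
  set by implicit midpoint steps, which preserve the area exactly because the field is divergence free and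
  the dimension is two: if \<open>tr A = 0\<close>, then \<open>det (1 + A) = det (1 - A)\<close>.

  Each \<open>X t\<close> is bi-Lipschitz and \<open>X t - X s\<close> has Lipschitz constant \<open>O(|t - s|)\<close>, so that \<open>z t = X t \<circ> z\<^sub>0\<close>
  inherits the regularity of \<open>z\<^sub>0\<close> and is continuous in time. A periodic simple curve separates the plane by the
  Jordan curve theorem applied to its image under \<open>exp (x\<^sub>2 + i x\<^sub>1)\<close>; the flow carries the two domains along. The
  continuity equation follows by the change of variables \<open>x = X t y\<close> from the fundamental theorem of calculus
  along trajectories, and the Stokes equations follow from the identities for the fundamental solution.\<close>

text \<open>The density does not decay, so the convolution defining the velocity converges only
  through a cancellation: for a vertical force the logarithm and the quotient in
  \<open>stokeslet\<close> both grow like the height, and their difference decays exponentially. Its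
  gradient is singular like one over the distance, which is integrable in the plane; this is the
  origin of \<open>m\<close>. The density jumps across the curve, so it is never differentiated or
  compared at two times: it stays attached to labels and only positions vary. Area preservation then
  does two things. It gives the integral of \<open>m (x - X y)\<close> over a cell the same value
  for all \<open>x\<close> and \<open>X\<close>, so that constants do not deteriorate and the flow
  is global in time; and it identifies the label integral with the convolution over the transported
  patch. Picard iterates of the integral equation and explicit Euler steps leave the set of area
  preserving maps, where this bound is lost: for a trace free \<open>A\<close> an Euler step has
  Jacobian 1 + h^2 det A. The midpoint step is handled by comparing two maps with equal
  Jacobian.\<close>

type_synonym plane = "real \<times> real"

section \<open>Evolution equations for bounded Lipschitz fields\<close>

text \<open>The iterates of the scheme stay in \<open>E\<close>, and step sizes are halved from
  level to level so that consecutive polygons can be compared step by step. Their distance is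
  summable, so completeness gives a limit and closedness keeps it in \<open>E\<close>. The
  conclusion is a quadratic estimate looking forward from \<open>s\<close>, the form in which the
  discrete estimate survives the limit.\<close>

lemma one_step_evolution:
  fixes F :: "'b::banach \<Rightarrow> 'b" and \<Psi> :: "real \<Rightarrow> 'b \<Rightarrow> 'b"
  assumes cl: "closed E" and w0: "w0 \<in> E"
    and U: "\<And>w. w \<in> E \<Longrightarrow> norm (F w) \<le> U"
    and L: "\<And>v w. v \<in> E \<Longrightarrow> w \<in> E \<Longrightarrow> norm (F v - F w) \<le> L * norm (v - w)"
    and h0: "0 < h0" and L0: "0 \<le> L" and C0: "0 \<le> C"
    and \<Psi>E: "\<And>h w. 0 < h \<Longrightarrow> h \<le> h0 \<Longrightarrow> w \<in> E \<Longrightarrow> \<Psi> h w \<in> E"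
    and \<Psi>: "\<And>h w. 0 < h \<Longrightarrow> h \<le> h0 \<Longrightarrow> w \<in> E \<Longrightarrow> norm (\<Psi> h w - w - h *\<^sub>R F w) \<le> C * h\<^sup>2"
  obtains W K where "W 0 = w0" "\<And>t. 0 \<le> t \<Longrightarrow> W t \<in> E" "0 \<le> K"
    "\<And>s t. 0 \<le> s \<Longrightarrow> s \<le> t \<Longrightarrow> norm (W t - W s - (t - s) *\<^sub>R F (W s)) \<le> K * (t - s)\<^sup>2"
proof -
  have U0: "0 \<le> U" using U[OF w0] norm_ge_zero order_trans by blast
  define h where "h n = h0 / 2 ^ n" for n :: nat
  define S where "S n k = (\<Psi> (h n) ^^ k) w0" for n k
  \<comment> \<open>One step of size \<open>h\<close> moves a point by at most
    \<open>h * U'\<close>. \<open>D\<close> adds the local error of one coarse step, that of two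
    half steps, and the drift of \<open>F\<close> between the half steps.\<close>
  define U' where "U' = U + C * h0"
  define D where "D = 2 * C + L * U'"
  have hpos: "0 < h n" and hle: "h n \<le> h0" for n
    using h0 by (auto simp: h_def field_simps)
  have hS: "h (Suc n) = h n / 2" for n by (simp add: h_def)
  have hlim: "h \<longlonglongrightarrow> 0"
    unfolding h_def by (rule LIMSEQ_divide_realpow_zero) simp
  have U'0: "0 \<le> U'" using U0 C0 h0 by (simp add: U'_def)
  have D0: "0 \<le> D" using C0 L0 U'0 by (simp add: D_def)
  have S0: "S n 0 = w0" for n by (simp add: S_def)
  have SS: "S n (Suc k) = \<Psi> (h n) (S n k)" for n k by (simp add: S_def)
  have SE: "S n k \<in> E" for n k
    by (induction k) (auto simp: S0 w0 SS intro!: \<Psi>E hpos hle)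
  have step: "norm (S n (Suc k) - S n k - h n *\<^sub>R F (S n k)) \<le> C * (h n)\<^sup>2" for n k
    unfolding SS by (intro \<Psi> hpos hle SE)
  have step2: "norm (S n (Suc k) - S n k) \<le> h n * U'" for n k
  proof -
    have "norm (S n (Suc k) - S n k) \<le> norm (S n (Suc k) - S n k - h n *\<^sub>R F (S n k)) + norm (h n *\<^sub>R F (S n k))"
      by (metis diff_add_cancel norm_triangle_ineq)
    also have "\<dots> \<le> C * (h n)\<^sup>2 + h n * U"
      using step[of n k] U[OF SE, of n k] hpos[of n] by (intro add_mono) (auto intro!: mult_left_mono)
    also have "C * (h n)\<^sup>2 \<le> C * h0 * h n"
      using hle[of n] hpos[of n] C0 by (simp add: power2_eq_square mult_left_mono mult.assoc)
    finally show ?thesis by (simp add: U'_def algebra_simps)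
  qed
  have incr1: "norm (S n (k + m) - S n k) \<le> real m * h n * U'" for n k m
  proof (induction m)
    case (Suc m)
    have "norm (S n (k + Suc m) - S n k) \<le> norm (S n (Suc (k + m)) - S n (k+m)) + norm (S n (k + m) - S n k)"
      using norm_triangle_ineq[of "S n (Suc (k + m)) - S n (k+m)" "S n (k + m) - S n k"] by simp
    also have "\<dots> \<le> h n * U' + real m * h n * U'" using step2 Suc by (intro add_mono) auto
    finally show ?case by (simp add: algebra_simps)
  qed simp
  \<comment> \<open>\<open>m\<close> consecutive steps against a single Euler step of length
    \<open>m * h n\<close>: the local errors add up, and \<open>F\<close> drifts by at most
    \<open>L * U'\<close> times the elapsed time.\<close>
  have incr2: "norm (S n (k + m) - S n k - (real m * h n) *\<^sub>R F (S n k))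
      \<le> real m * C * (h n)\<^sup>2 + L * U' * (real m * h n)\<^sup>2" for n k m
  proof (induction m)
    case (Suc m)
    have eq: "S n (k + Suc m) - S n k - (real (Suc m) * h n) *\<^sub>R F (S n k)
      = (S n (Suc (k + m)) - S n (k+m) - h n *\<^sub>R F (S n (k+m)))
        + (S n (k + m) - S n k - (real m * h n) *\<^sub>R F (S n k))
        + h n *\<^sub>R (F (S n (k+m)) - F (S n k))" by (simp add: algebra_simps)
    have "norm (h n *\<^sub>R (F (S n (k+m)) - F (S n k))) \<le> h n * (L * (real m * h n * U'))"
    proof -
      have "norm (F (S n (k+m)) - F (S n k)) \<le> L * (real m * h n * U')"
        using L[OF SE SE, of n "k+m" n k] mult_left_mono[OF incr1[of n k m] L0] by linarith
      then show ?thesis using hpos[of n] by (simp add: mult_left_mono)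
    qed
    then have "norm (S n (k + Suc m) - S n k - (real (Suc m) * h n) *\<^sub>R F (S n k)) \<le>
      C * (h n)\<^sup>2 + (real m * C * (h n)\<^sup>2 + L * U' * (real m * h n)\<^sup>2) + h n * (L * (real m * h n * U'))"
      unfolding eq using step[of n "k+m"] Suc
      by (intro norm_triangle_le add_mono) auto
    also have "\<dots> = real (Suc m) * C * (h n)\<^sup>2 + L * U' * (h n)\<^sup>2 * (real m * real m + real m)"
      by (simp add: algebra_simps power2_eq_square)
    also have "\<dots> \<le> real (Suc m) * C * (h n)\<^sup>2 + L * U' * (h n)\<^sup>2 * (real (Suc m) * real (Suc m))"
      using L0 U'0 by (intro add_left_mono mult_left_mono) (auto simp: algebra_simps)
    finally show ?case by (simp add: power2_eq_square algebra_simps)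
  qed simp
  \<comment> \<open>One step of level \<open>n\<close> against two of the next level. A difference
    present before the step grows by the factor \<open>1 + L * h n\<close>; the exponential bounds
    the product of these factors (discrete Gronwall).\<close>
  have compare: "norm (S n k - S (Suc n) (2 * k)) \<le> D * h n * (real k * h n) * exp (L * (real k * h n))" for n k
  proof (induction k)
    case 0 show ?case by (simp add: S0)
  next
    case (Suc k)
    define s v where "s = S n k" and "v = S (Suc n) (2 * k)"
    have eq: "S n (Suc k) - S (Suc n) (2 * Suc k) =
      (S n (Suc k) - s - h n *\<^sub>R F s) - (S (Suc n) (2 * k + 2) - v - (real 2 * h (Suc n)) *\<^sub>R F v)
       + (s - v) + h n *\<^sub>R (F s - F v)"
      by (simp add: hS algebra_simps)
    have 1: "norm (S n (Suc k) - s - h n *\<^sub>R F s) \<le> C * (h n)\<^sup>2" unfolding s_def by (rule step)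
    have 2: "norm (S (Suc n) (2 * k + 2) - v - (real 2 * h (Suc n)) *\<^sub>R F v) \<le> C * (h n)\<^sup>2 + L * U' * (h n)\<^sup>2"
    proof -
      have "real 2 * C * (h (Suc n))\<^sup>2 + L * U' * (real 2 * h (Suc n))\<^sup>2 = C * (h n)\<^sup>2 / 2 + L * U' * (h n)\<^sup>2"
        by (simp add: hS power_divide)
      moreover have "0 \<le> C * (h n)\<^sup>2" using C0 by simp
      ultimately show ?thesis using incr2[of "Suc n" "2 * k" 2] unfolding v_def by linarith
    qed
    have 3: "norm (h n *\<^sub>R (F s - F v)) \<le> h n * (L * norm (s - v))"
      using L[OF SE SE, of n k "Suc n" "2*k"] hpos[of n] by (simp add: s_def v_def)
    have "norm (S n (Suc k) - S (Suc n) (2 * Suc k)) \<le> C * (h n)\<^sup>2 + (C * (h n)\<^sup>2 + L * U' * (h n)\<^sup>2) + norm (s - v) + h n * (L * norm (s - v))"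
    proof -
      have tri: "norm (a - b + c + d) \<le> norm a + norm b + norm c + norm d" for a b c d :: 'b
        using norm_triangle_ineq[of "a - b + c" d] norm_triangle_ineq[of "a - b" c] norm_triangle_ineq4[of a b] by linarith
      show ?thesis unfolding eq using 1 2 3 by (intro order_trans[OF tri]) linarith
    qed
    also have "\<dots> = D * (h n)\<^sup>2 + (1 + L * h n) * norm (s - v)" by (simp add: D_def algebra_simps)
    also have "\<dots> \<le> D * (h n)\<^sup>2 + exp (L * h n) * (D * h n * (real k * h n) * exp (L * (real k * h n)))"
      using Suc unfolding s_def v_def
      by (intro add_left_mono mult_mono) (auto simp: exp_ge_add_one_self)
    also have "\<dots> = D * (h n)\<^sup>2 + D * (h n)\<^sup>2 * real k * exp (L * (real (Suc k) * h n))"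
      by (simp add: exp_add[symmetric] algebra_simps power2_eq_square)
    finally have c1: "norm (S n (Suc k) - S (Suc n) (2 * Suc k)) \<le> D * (h n)\<^sup>2 + D * (h n)\<^sup>2 * real k * exp (L * (real (Suc k) * h n))" .
    have c2: "D * (h n)\<^sup>2 \<le> D * (h n)\<^sup>2 * exp (L * (real (Suc k) * h n))"
    proof -
      have "1 \<le> exp (L * (real (Suc k) * h n))" using L0 hpos[of n] by simp
      from mult_left_mono[OF this, of "D * (h n)\<^sup>2"] show ?thesis using D0 by simp
    qed
    have "D * h n * (real (Suc k) * h n) * exp (L * (real (Suc k) * h n))
      = D * (h n)\<^sup>2 * exp (L * (real (Suc k) * h n)) + D * (h n)\<^sup>2 * real k * exp (L * (real (Suc k) * h n))"
      by (simp add: power2_eq_square ring_distribs)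
    then show ?case using c1 c2 by linarith
  qed
  define V where "V n t = S n (nat \<lfloor>t / h n\<rfloor>)" for n t
  have VE: "V n t \<in> E" for n t unfolding V_def by (rule SE)
  have fl: "real (nat \<lfloor>t / h n\<rfloor>) * h n \<le> t" "t - h n \<le> real (nat \<lfloor>t / h n\<rfloor>) * h n" if "0 \<le> t" for t n
  proof -
    have "real (nat \<lfloor>t / h n\<rfloor>) = of_int \<lfloor>t / h n\<rfloor>" using that hpos[of n] by simp
    moreover have "of_int \<lfloor>t / h n\<rfloor> \<le> t / h n" "t / h n - 1 \<le> of_int \<lfloor>t / h n\<rfloor>" by linarith+
    ultimately show "real (nat \<lfloor>t / h n\<rfloor>) * h n \<le> t" "t - h n \<le> real (nat \<lfloor>t / h n\<rfloor>) * h n"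
      using hpos[of n] by (simp_all only: pos_le_divide_eq pos_divide_le_eq) (simp_all add: field_simps)
  qed
  have Vdiff: "norm (V (Suc n) t - V n t) \<le> (D * t * exp (L * t) + U') * h n" if "0 \<le> t" for n t
  proof -
    define k where "k = nat \<lfloor>t / h n\<rfloor>"
    have kh: "real k * h n \<le> t" using fl(1)[OF that] by (simp add: k_def)
    \<comment> \<open>By time \<open>t\<close> the finer polygon has made \<open>2 * k\<close> or
      \<open>2 * k + 1\<close> steps; the odd case costs one more step, which is the
      \<open>U'\<close> term.\<close>
    have "nat \<lfloor>t / h (Suc n)\<rfloor> = 2 * k \<or> nat \<lfloor>t / h (Suc n)\<rfloor> = Suc (2 * k)"
    proof -
      have "t / h (Suc n) = 2 * (t / h n)" by (simp add: hS)
      moreover have "\<lfloor>2 * (t / h n)\<rfloor> = 2 * \<lfloor>t / h n\<rfloor> \<or> \<lfloor>2 * (t / h n)\<rfloor> = 2 * \<lfloor>t / h n\<rfloor> + 1" by linarith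
      moreover have "0 \<le> \<lfloor>t / h n\<rfloor>" using that hpos[of n] by simp
      ultimately show ?thesis unfolding k_def by (metis One_nat_def Suc_eq_plus1 add_cancel_right_left nat_add_distrib nat_mult_distrib nat_numeral nat_one_as_int zero_le_numeral zero_less_one_class.zero_le_one mult_nonneg_nonneg of_nat_1)
    qed
    then have "norm (V (Suc n) t - S (Suc n) (2 * k)) \<le> h (Suc n) * U'"
      using step2[of "Suc n" "2 * k"] hpos[of "Suc n"] U'0 unfolding V_def by auto
    also have "\<dots> \<le> h n * U'" using hpos[of n] U'0 by (simp add: hS)
    finally have 1: "norm (V (Suc n) t - S (Suc n) (2 * k)) \<le> h n * U'" .
    have "norm (S n k - S (Suc n) (2 * k)) \<le> D * h n * (real k * h n) * exp (L * (real k * h n))" by (rule compare)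
    also have "\<dots> \<le> D * h n * t * exp (L * t)"
      using D0 hpos[of n] kh L0 that by (intro mult_mono) (auto intro!: mult_left_mono)
    finally have 2: "norm (S (Suc n) (2 * k) - V n t) \<le> D * h n * t * exp (L * t)"
      unfolding V_def k_def[symmetric] by (simp add: norm_minus_commute)
    have "norm (V (Suc n) t - V n t) \<le> h n * U' + D * h n * t * exp (L * t)"
      using norm_triangle_le[OF add_mono[OF 1 2]] by simp
    then show ?thesis by (simp add: algebra_simps)
  qed
  have conv: "convergent (\<lambda>n. V n t)" if "0 \<le> t" for t
  proof -
    have "summable (\<lambda>n. (D * t * exp (L * t) + U') * h n)"
    proof -
      have "summable (\<lambda>n. (1/2::real) ^ n)" by (rule summable_geometric) simp
      then have "summable (\<lambda>n. ((D * t * exp (L * t) + U') * h0) * (1/2::real) ^ n)" by (rule summable_mult)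
      then show ?thesis by (simp add: h_def field_simps power_divide)
    qed
    then have "summable (\<lambda>n. V (Suc n) t - V n t)"
      by (rule summable_comparison_test'[where N=0]) (use Vdiff[OF that] in auto)
    then have "convergent (\<lambda>n. \<Sum>i<n. V (Suc i) t - V i t)" by (simp add: summable_iff_convergent)
    moreover have "(\<Sum>i<n. V (Suc i) t - V i t) = V n t - V 0 t" for n
      using sum_lessThan_telescope[of "\<lambda>n. V n t" n] by simp
    ultimately have "convergent (\<lambda>n. V n t - V 0 t)" by simp
    then show ?thesis using convergent_diff_const_right_iff by blast
  qed
  define W where "W t = lim (\<lambda>n. V n t)" for t
  have Wlim: "(\<lambda>n. V n t) \<longlonglongrightarrow> W t" if "0 \<le> t" for t
    using conv[OF that] unfolding W_def by (simp add: convergent_LIMSEQ_iff)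
  have WE: "W t \<in> E" if "0 \<le> t" for t
    by (rule closed_sequentially[OF cl _ Wlim[OF that]]) (rule VE)
  have W0: "W 0 = w0" 
    using Wlim[of 0] by (simp add: V_def S0 LIMSEQ_const_iff)
  have FW: "(\<lambda>n. F (V n t)) \<longlonglongrightarrow> F (W t)" if "0 \<le> t" for t
  proof (rule tendstoI)
    fix e :: real assume e: "0 < e"
    have "eventually (\<lambda>n. dist (V n t) (W t) < e / (L + 1)) sequentially"
      using Wlim[OF that] e L0 by (intro tendstoD) auto
    then show "eventually (\<lambda>n. dist (F (V n t)) (F (W t)) < e) sequentially"
    proof eventually_elim
      case (elim n)
      have "dist (F (V n t)) (F (W t)) \<le> L * dist (V n t) (W t)"
        using L[OF VE WE[OF that], of n t] by (simp add: dist_norm)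
      also have "\<dots> \<le> (L + 1) * dist (V n t) (W t)" by (simp add: mult_right_mono)
      also have "\<dots> < e" using elim L0 by (simp add: field_simps)
      finally show ?case .
    qed
  qed
  \<comment> \<open>Limit of \<open>incr2\<close>: \<open>real (m n) * h n\<close> tends to
    \<open>t - s\<close>, and the accumulated local error carries a further factor
    \<open>h n\<close>. Only the drift term remains, so \<open>K\<close> is
    \<open>L * U'\<close>.\<close>
  have main: "norm (W t - W s - (t - s) *\<^sub>R F (W s)) \<le> (L * U') * (t - s)\<^sup>2" if st: "0 \<le> s" "s \<le> t" for s t
  proof -
    have t0: "0 \<le> t" using st by simp
    define m where "m n = nat \<lfloor>t / h n\<rfloor> - nat \<lfloor>s / h n\<rfloor>" for n
    have le: "nat \<lfloor>s / h n\<rfloor> \<le> nat \<lfloor>t / h n\<rfloor>" for n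
      using st hpos[of n] by (intro nat_mono floor_mono divide_right_mono) auto
    have km: "nat \<lfloor>s / h n\<rfloor> + m n = nat \<lfloor>t / h n\<rfloor>" for n unfolding m_def using le[of n] by simp
    have lim1: "(\<lambda>n. real (nat \<lfloor>x / h n\<rfloor>) * h n) \<longlonglongrightarrow> x" if "0 \<le> x" for x
    proof (rule tendsto_sandwich[of "\<lambda>n. x - h n" _ _ "\<lambda>n. x"])
      show "(\<lambda>n. x - h n) \<longlonglongrightarrow> x" using tendsto_diff[OF tendsto_const[of x] hlim] by simp
    qed (use fl[OF that] in auto)
    have mh: "(\<lambda>n. real (m n) * h n) \<longlonglongrightarrow> t - s"
    proof -
      have "real (m n) * h n = real (nat \<lfloor>t / h n\<rfloor>) * h n - real (nat \<lfloor>s / h n\<rfloor>) * h n" for n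
        unfolding m_def using le[of n] by (simp add: of_nat_diff left_diff_distrib)
      then show ?thesis using tendsto_diff[OF lim1[OF t0] lim1[OF st(1)]] by simp
    qed
    have bd: "norm (V n t - V n s - (real (m n) * h n) *\<^sub>R F (V n s)) \<le> (real (m n) * h n) * C * h n + L * U' * (real (m n) * h n)\<^sup>2" for n
      using incr2[of n "nat \<lfloor>s / h n\<rfloor>" "m n"] unfolding km V_def by (simp add: power2_eq_square mult.assoc mult.left_commute)
    have l1: "(\<lambda>n. norm (V n t - V n s - (real (m n) * h n) *\<^sub>R F (V n s))) \<longlonglongrightarrow> norm (W t - W s - (t - s) *\<^sub>R F (W s))"
      by (intro tendsto_intros Wlim mh FW t0 st)
    have l2: "(\<lambda>n. (real (m n) * h n) * C * h n + L * U' * (real (m n) * h n)\<^sup>2) \<longlonglongrightarrow> (t - s) * C * 0 + L * U' * (t - s)\<^sup>2"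
      by (intro tendsto_intros mh hlim)
    show ?thesis using LIMSEQ_le[OF l1 l2] bd by auto
  qed
  show thesis by (rule that[OF W0 WE _ main]) (use L0 U'0 in auto)
qed

text \<open>The hypothesis looks forward from \<open>s\<close> and so gives right derivatives at
  once. For \<open>y < t\<close> it is applied at \<open>y\<close>, and passing from
  \<open>F (W y)\<close> to \<open>F (W t)\<close> costs a second quadratic term by the Lipschitz
  bound along \<open>W\<close>; \<open>B\<close> collects both.\<close>

lemma evolution_has_vector_derivative:
  fixes F :: "'b::real_normed_vector \<Rightarrow> 'b" and W :: "real \<Rightarrow> 'b"
  assumes K: "\<And>s t. 0 \<le> s \<Longrightarrow> s \<le> t \<Longrightarrow> norm (W t - W s - (t - s) *\<^sub>R F (W s)) \<le> K * (t - s)\<^sup>2"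
    and U: "\<And>t. 0 \<le> t \<Longrightarrow> norm (F (W t)) \<le> U"
    and L: "\<And>s t. 0 \<le> s \<Longrightarrow> 0 \<le> t \<Longrightarrow> norm (F (W t) - F (W s)) \<le> L * norm (W t - W s)"
    and L0: "0 \<le> L" "0 \<le> K" and t: "t \<in> {0..T}"
  shows "(W has_vector_derivative F (W t)) (at t within {0..T})"
proof -
  define B where "B = K + L * (U + K * T)"
  have U0: "0 \<le> U" using U[of 0] norm_ge_zero order_trans by blast
  have bd: "norm (W y - W t - (y - t) *\<^sub>R F (W t)) \<le> B * (y - t)\<^sup>2" if y: "y \<in> {0..T}" for y
  proof (cases "t \<le> y")
    case True
    have "K * (y - t)\<^sup>2 \<le> B * (y - t)\<^sup>2" unfolding B_def using L0 U0 t by (intro mult_right_mono) auto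
    then show ?thesis using K[of t y] True t by auto
  next
    case False
    then have yt: "y \<le> t" "0 \<le> y" using y by auto
    have a: "norm (W t - W y - (t - y) *\<^sub>R F (W y)) \<le> K * (t - y)\<^sup>2" using K yt by auto
    have "norm (W t - W y) \<le> norm (W t - W y - (t - y) *\<^sub>R F (W y)) + norm ((t - y) *\<^sub>R F (W y))"
      by (metis diff_add_cancel norm_triangle_ineq)
    also have "\<dots> \<le> K * (t - y)\<^sup>2 + (t - y) * U"
      using a U[OF yt(2)] yt by (intro add_mono) (auto intro!: mult_left_mono)
    also have "K * (t - y)\<^sup>2 \<le> K * T * (t - y)"
      using yt t L0 by (simp add: power2_eq_square mult.assoc mult_left_mono mult_right_mono)
    finally have b: "norm (W t - W y) \<le> (U + K * T) * (t - y)" by (simp add: algebra_simps)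
    have c: "norm ((t - y) *\<^sub>R (F (W t) - F (W y))) \<le> (t - y) * (L * ((U + K * T) * (t - y)))"
    proof -
      have "norm (F (W t) - F (W y)) \<le> L * ((U + K * T) * (t - y))"
        using L[of y t] mult_left_mono[OF b L0(1)] yt t by auto
      then show ?thesis using yt by (simp add: mult_left_mono)
    qed
    have "W y - W t - (y - t) *\<^sub>R F (W t) = - (W t - W y - (t - y) *\<^sub>R F (W y)) + (t - y) *\<^sub>R (F (W t) - F (W y))"
      by (simp add: algebra_simps)
    moreover have "norm (- p + q) \<le> norm p + norm q" for p q :: 'b
      using norm_triangle_ineq[of "- p" q] by simp
    ultimately have "norm (W y - W t - (y - t) *\<^sub>R F (W t)) \<le>
        norm (W t - W y - (t - y) *\<^sub>R F (W y)) + norm ((t - y) *\<^sub>R (F (W t) - F (W y)))" by metis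
    also have "\<dots> \<le> K * (t - y)\<^sup>2 + (t - y) * (L * ((U + K * T) * (t - y)))"
      using a c by (rule add_mono)
    also have "\<dots> = B * (y - t)\<^sup>2" by (simp add: B_def power2_eq_square algebra_simps)
    finally show ?thesis .
  qed
  have B0: "0 \<le> B" using L0 U0 t by (auto simp: B_def)
  show ?thesis unfolding has_vector_derivative_def has_derivative_within_alt2
  proof (intro conjI allI impI bounded_linear_scaleR_left)
    fix e :: real assume e: "0 < e"
    have "eventually (\<lambda>y. norm (y - t) < e / (B + 1)) (at t within {0..T})"
      using e B0 by (intro order_tendstoD(2)[of _ 0]) (auto intro!: tendsto_eq_intros)
    moreover have "eventually (\<lambda>y. y \<in> {0..T}) (at t within {0..T})" by (simp add: eventually_at_filter)
    ultimately show "\<forall>\<^sub>F y in at t within {0..T}. norm (W y - W t - (y - t) *\<^sub>R F (W t)) \<le> e * norm (y - t)"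
    proof eventually_elim
      case (elim y)
      have "B * (y - t)\<^sup>2 = (B * norm (y - t)) * norm (y - t)" by (simp add: power2_eq_square)
      also have "\<dots> \<le> e * norm (y - t)"
      proof (rule mult_right_mono)
        have "B * norm (y - t) \<le> (B + 1) * norm (y - t)" by (simp add: mult_right_mono)
        also have "\<dots> \<le> e" using elim B0 by (simp add: field_simps)
        finally show "B * norm (y - t) \<le> e" .
      qed simp
      finally show ?case using bd[OF elim(2)] by simp
    qed
  qed
qed

section \<open>Periodic maps preserving the area\<close>

text \<open>Area preservation is the pushforward identity on the whole plane rather than on the
  cell, whose image is in general not the cell; the folding lemmas below recover integrals over the
  cell. The pushforward form passes to compositions and to uniform limits.\<close>

definition measure_preserving_map :: "(plane \<Rightarrow> plane) \<Rightarrow> bool" where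
  "measure_preserving_map X \<longleftrightarrow> continuous_on UNIV X \<and> (\<forall>y. X (y + (2 * pi, 0)) = X y + (2 * pi, 0)) \<and>
     distr lborel borel X = lborel"

lemma measure_preserving_mapD:
  assumes "measure_preserving_map X"
  shows "continuous_on UNIV X" "X (y + (2 * pi, 0)) = X y + (2 * pi, 0)" "distr lborel borel X = lborel"
    "X \<in> borel_measurable borel"
  using assms unfolding measure_preserving_map_def by (blast intro: borel_measurable_continuous_onI)+

lemma abs_fst_le_norm: "\<bar>fst z\<bar> \<le> norm z" and abs_snd_le_norm: "\<bar>snd z\<bar> \<le> norm z" for z :: "plane"
  by (cases z; simp add: norm_fst_le[where 'a=real, simplified] norm_snd_le[where 'a=real, simplified] norm_prod_def)+

lemma norm_le_abs_sum: "norm z \<le> \<bar>fst z\<bar> + \<bar>snd z\<bar>" for z :: "plane"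
  using norm_Pair_le[of "fst z" "snd z"] unfolding prod.collapse real_norm_def .

lemma shift_int:
  fixes g :: "plane \<Rightarrow> 'a" 
  assumes "\<And>y. g (y + (2 * pi, 0)) = g y"
  shows "g (y + (2 * pi * of_int k, 0)) = g y"
proof -
  have n: "g (y + (2 * pi * of_nat n, 0)) = g y" for n y
  proof (induction n)
    case (Suc n)
    have "y + (2 * pi * of_nat (Suc n), 0) = (y + (2 * pi * of_nat n, 0)) + (2 * pi, 0)"
      by (cases y) (simp add: algebra_simps)
    then show ?case using assms[of "y + (2 * pi * of_nat n, 0)"] Suc by metis
  qed (simp add: zero_prod_def[symmetric])
  show ?thesis
  proof (cases "k \<ge> 0")
    case True then show ?thesis using n[of y "nat k"] by simp
  next
    case False
    then have "g ((y + (2 * pi * of_int k, 0)) + (2 * pi * of_nat (nat (-k)), 0)) = g (y + (2 * pi * of_int k, 0))"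
      by (intro n)
    moreover have "(y + (2 * pi * of_int k, 0)) + (2 * pi * of_nat (nat (-k)), 0) = y"
      using False by (cases y) (simp add: algebra_simps)
    ultimately show ?thesis by simp
  qed
qed

lemma equivariant_int:
  fixes X :: "plane \<Rightarrow> plane" 
  assumes "\<And>y. X (y + (2 * pi, 0)) = X y + (2 * pi, 0)"
  shows "X (y + (2 * pi * of_int k, 0)) = X y + (2 * pi * of_int k, 0)"
proof -
  have "(\<lambda>y. X y - (fst y, 0)) (y + (2 * pi * of_int k, 0)) = (\<lambda>y. X y - (fst y, 0)) y"
    by (rule shift_int) (use assms in \<open>auto simp: algebra_simps prod_eq_iff\<close>)
  then show ?thesis by (simp add: algebra_simps prod_eq_iff)
qed

lemma lborel_distr_shift: "distr lborel borel (\<lambda>y. y + c) = (lborel :: plane measure)"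
proof -
  have "(\<lambda>y. y + c) = (+) c" by (auto simp: add.commute)
  then show ?thesis using lborel_distr_plus[of c] by metis
qed

lemma measure_preserving_map_shift: "measure_preserving_map (\<lambda>y. y + c)"
  unfolding measure_preserving_map_def
  by (auto intro!: continuous_intros lborel_distr_shift)

lemma measure_preserving_map_id: "measure_preserving_map (\<lambda>y. y)"
  using measure_preserving_map_shift[of 0] by simp

lemma measure_preserving_map_comp:
  assumes "measure_preserving_map X" "measure_preserving_map Y"
  shows "measure_preserving_map (\<lambda>y. X (Y y))"
proof -
  note X = measure_preserving_mapD[OF assms(1)] and Y = measure_preserving_mapD[OF assms(2)]
  have "distr lborel borel (\<lambda>y. X (Y y)) = distr (distr lborel borel Y) borel X"
    by (subst distr_distr) (use X Y in \<open>auto simp: o_def\<close>)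
  then show ?thesis unfolding measure_preserving_map_def using X Y
    by (auto intro: continuous_on_compose2[OF X(1) Y(1)])
qed

text \<open>Half open, so that its translates by the period tile the plane exactly; it differs from
  \<open>cell\<close> by a null set.\<close>

definition hcell :: "plane set" where "hcell = {0..<2 * pi} \<times> UNIV"

lemma hcell_borel [measurable]: "hcell \<in> sets borel"
proof -
  have "hcell = {x. 0 \<le> fst x} \<inter> {x. fst x < 2 * pi}" by (auto simp: hcell_def)
  also have "\<dots> \<in> sets borel"
    by (intro sets.Int borel_closed borel_open closed_Collect_le open_Collect_less continuous_intros)
  finally show ?thesis .
qed

lemma cell_borel [measurable]: "cell \<in> sets borel"
proof -
  have "cell = {x. 0 \<le> fst x} \<inter> {x. fst x \<le> 2 * pi}" by (auto simp: cell_def)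
  also have "\<dots> \<in> sets borel"
    by (intro sets.Int borel_closed borel_open closed_Collect_le open_Collect_less continuous_intros)
  finally show ?thesis .
qed

lemma AE_cell_hcell: "AE y in lborel. indicator cell y = (indicator hcell y :: 'a::zero_neq_one)"
proof -
  have "{2 * pi} \<times> UNIV \<in> null_sets (lborel \<Otimes>\<^sub>M lborel :: plane measure)"
    by (rule lborel.times_in_null_sets1) auto
  then have "AE y in lborel. y \<notin> {2 * pi :: real} \<times> (UNIV :: real set)"
    by (intro AE_not_in) (simp add: lborel_prod)
  then show ?thesis by eventually_elim (auto simp: cell_def hcell_def indicator_def)
qed

lemma hcell_shift_unique: "\<exists>!k::int. y + (2 * pi * of_int k, 0) \<in> hcell"
proof -
  have eq: "(y + (2 * pi * of_int k, 0) \<in> hcell) \<longleftrightarrow> (k = - \<lfloor>fst y / (2 * pi)\<rfloor>)" for k :: int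
  proof -
    have "(y + (2 * pi * of_int k, 0) \<in> hcell) \<longleftrightarrow> 0 \<le> fst y + 2 * pi * of_int k \<and> fst y + 2 * pi * of_int k < 2 * pi"
      by (cases y) (auto simp: hcell_def)
    also have "\<dots> \<longleftrightarrow> - of_int k \<le> fst y / (2 * pi) \<and> fst y / (2 * pi) < - of_int k + 1"
    proof -
      have p: "(2 * pi) > 0" by simp
      show ?thesis unfolding pos_le_divide_eq[OF p] pos_divide_less_eq[OF p] by (auto simp: algebra_simps)
    qed
    also have "\<dots> \<longleftrightarrow> \<lfloor>fst y / (2 * pi)\<rfloor> = - k" by (auto simp: floor_eq_iff)
    finally show ?thesis by auto
  qed
  show ?thesis unfolding eq by auto
qed

lemma nn_integral_hcell_shift: "(\<integral>\<^sup>+k. indicator hcell (y + (2 * pi * of_int k, 0)) \<partial>count_space (UNIV::int set)) = 1"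
proof -
  obtain k0 :: int where k0: "\<And>k. (y + (2 * pi * of_int k, 0) \<in> hcell) \<longleftrightarrow> k = k0"
    using hcell_shift_unique[of y] by metis
  have "(\<integral>\<^sup>+k. indicator hcell (y + (2 * pi * of_int k, 0)) \<partial>count_space (UNIV::int set)) = (\<integral>\<^sup>+k. indicator {k0} k \<partial>count_space (UNIV::int set))"
    by (rule nn_integral_cong) (auto simp: indicator_def k0)
  also have "\<dots> = 1" by simp
  finally show ?thesis .
qed

lemma nn_integral_lborel_map:
  assumes X: "measure_preserving_map X" and [measurable]: "g \<in> borel_measurable borel"
  shows "(\<integral>\<^sup>+y. g (X y) \<partial>lborel) = (\<integral>\<^sup>+y. g y \<partial>lborel)"
proof -
  note [measurable] = measure_preserving_mapD(4)[OF X]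
  have "(\<integral>\<^sup>+y. g y \<partial>lborel) = (\<integral>\<^sup>+y. g y \<partial>distr lborel borel X)" using measure_preserving_mapD(3)[OF X] by simp
  also have "\<dots> = (\<integral>\<^sup>+y. g (X y) \<partial>lborel)" by (subst nn_integral_distr) auto
  finally show ?thesis by simp
qed

text \<open>Unfolding: exactly one translate of \<open>X y\<close> lies in \<open>hcell\<close>, so
  the sum over \<open>k\<close> of \<open>indicator hcell (s k (X y))\<close> is 1. Inserting it,
  exchanging sum and integral, translating \<open>y\<close> in each term and resumming leaves an
  integral over the whole plane, to which the pushforward identity applies.\<close>

lemma nn_integral_hcell_fold:
  fixes g :: "plane \<Rightarrow> ennreal"
  assumes X: "measure_preserving_map X" and g[measurable]: "g \<in> borel_measurable borel"
    and per: "\<And>y. g (y + (2 * pi, 0)) = g y"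
  shows "(\<integral>\<^sup>+y. indicator hcell y * g (X y) \<partial>lborel) = (\<integral>\<^sup>+y. indicator hcell y * g y \<partial>lborel)"
proof -
  note [measurable] = measure_preserving_mapD(4)[OF X]
  define s where "s k y = y + (2 * pi * of_int k, 0 :: real)" for k :: int and y :: "plane"
  have [measurable]: "s k \<in> borel_measurable borel" for k unfolding s_def by measurable
  have sX: "X (s k y) = s k (X y)" for k y unfolding s_def by (rule equivariant_int) (rule measure_preserving_mapD(2)[OF X])
  have sg: "g (s k y) = g y" for k y unfolding s_def by (rule shift_int) (rule per)
  have sneg: "s (-k) (s k y) = y" "s k (s (-k) y) = y" for k y by (auto simp: s_def zero_prod_def[symmetric])
  have smp: "measure_preserving_map (s k)" for k unfolding s_def by (rule measure_preserving_map_shift)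
  have one: "(\<integral>\<^sup>+k. indicator hcell (s k y) \<partial>count_space UNIV) = 1" for y
    using nn_integral_hcell_shift[of y] by (simp add: s_def)
  have one': "(\<integral>\<^sup>+k. indicator hcell (s (-k) y) \<partial>count_space UNIV) = 1" for y
  proof -
    have "(\<integral>\<^sup>+k. indicator hcell (s (-k) y) \<partial>count_space UNIV) = (\<integral>\<^sup>+k. indicator hcell (s k y) \<partial>count_space (UNIV :: int set))"
      by (rule nn_integral_bij_count_space[of uminus UNIV UNIV "\<lambda>k. indicator hcell (s k y)"]) (auto intro!: bij_uminus)
    then show ?thesis using one by simp
  qed
  have "(\<integral>\<^sup>+y. indicator hcell y * g (X y) \<partial>lborel)
      = (\<integral>\<^sup>+y. (\<integral>\<^sup>+k. indicator hcell y * g (X y) * indicator hcell (s k (X y)) \<partial>count_space UNIV) \<partial>lborel)"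
    by (subst nn_integral_cmult) (auto simp: one)
  also have "\<dots> = (\<integral>\<^sup>+k. (\<integral>\<^sup>+y. indicator hcell y * g (X y) * indicator hcell (s k (X y)) \<partial>lborel) \<partial>count_space UNIV)"
    by (rule nn_integral_count_space_nn_integral) auto
  also have "\<dots> = (\<integral>\<^sup>+k. (\<integral>\<^sup>+y. indicator hcell (s (-k) y) * g (X y) * indicator hcell (X y) \<partial>lborel) \<partial>count_space UNIV)"
  proof (rule nn_integral_cong)
    fix k :: int
    have "(\<integral>\<^sup>+y. indicator hcell (s (-k) (s k y)) * g (X (s k y)) * indicator hcell (X (s k y)) \<partial>lborel)
      = (\<integral>\<^sup>+y. indicator hcell (s (-k) y) * g (X y) * indicator hcell (X y) \<partial>lborel)"
      by (rule nn_integral_lborel_map[OF smp]) auto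
    then show "(\<integral>\<^sup>+y. indicator hcell y * g (X y) * indicator hcell (s k (X y)) \<partial>lborel) = (\<integral>\<^sup>+y. indicator hcell (s (-k) y) * g (X y) * indicator hcell (X y) \<partial>lborel)"
      by (simp add: sX sg sneg)
  qed
  also have "\<dots> = (\<integral>\<^sup>+y. (\<integral>\<^sup>+k. indicator hcell (s (-k) y) * g (X y) * indicator hcell (X y) \<partial>count_space UNIV) \<partial>lborel)"
    by (rule nn_integral_count_space_nn_integral[symmetric]) auto
  also have "\<dots> = (\<integral>\<^sup>+y. indicator hcell (X y) * g (X y) \<partial>lborel)"
  proof (rule nn_integral_cong)
    fix y
    have "(\<integral>\<^sup>+k. indicator hcell (s (-k) y) * g (X y) * indicator hcell (X y) \<partial>count_space UNIV)
      = (\<integral>\<^sup>+k. (g (X y) * indicator hcell (X y)) * indicator hcell (s (-k) y) \<partial>count_space UNIV)"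
      by (simp add: mult_ac)
    also have "\<dots> = (g (X y) * indicator hcell (X y)) * 1" unfolding one'[of y, symmetric] by (rule nn_integral_cmult) simp
    finally show "(\<integral>\<^sup>+k. indicator hcell (s (-k) y) * g (X y) * indicator hcell (X y) \<partial>count_space UNIV) = indicator hcell (X y) * g (X y)"
      by (simp add: mult.commute)
  qed
  also have "\<dots> = (\<integral>\<^sup>+y. indicator hcell y * g y \<partial>lborel)"
    by (rule nn_integral_lborel_map[OF X, of "\<lambda>y. indicator hcell y * g y"]) auto
  finally show ?thesis .
qed

lemma nn_integral_cell_hcell: "(\<integral>\<^sup>+y. indicator cell y * (g y :: ennreal) \<partial>lborel) = (\<integral>\<^sup>+y. indicator hcell y * g y \<partial>lborel)"
proof (rule nn_integral_cong_AE)
  show "AE y in lborel. indicator cell y * g y = indicator hcell y * g y"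
    using AE_cell_hcell[where 'a=ennreal] by eventually_elim simp
qed

lemma nn_integral_cell_fold:
  fixes g :: "plane \<Rightarrow> ennreal"
  assumes X: "measure_preserving_map X" and g: "g \<in> borel_measurable borel"
    and per: "\<And>y. g (y + (2 * pi, 0)) = g y"
  shows "(\<integral>\<^sup>+y. indicator cell y * g (X y) \<partial>lborel) = (\<integral>\<^sup>+y. indicator cell y * g y \<partial>lborel)"
  using nn_integral_hcell_fold[OF assms] by (simp add: nn_integral_cell_hcell)

lemma integrable_cell_iff:
  fixes g :: "plane \<Rightarrow> 'b::{banach, second_countable_topology}"
  assumes [measurable]: "g \<in> borel_measurable borel"
  shows "integrable lborel (\<lambda>y. indicator cell y *\<^sub>R g y) \<longleftrightarrow> (\<integral>\<^sup>+y. indicator cell y * ennreal (norm (g y)) \<partial>lborel) < \<infinity>"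
proof -
  have "ennreal (norm (indicator cell y *\<^sub>R g y)) = indicator cell y * ennreal (norm (g y))" for y
    by (auto simp: indicator_def)
  then show ?thesis by (simp add: integrable_iff_bounded)
qed

lemma integrable_cell_fold:
  fixes g :: "plane \<Rightarrow> 'b::{banach, second_countable_topology}"
  assumes X: "measure_preserving_map X" and g[measurable]: "g \<in> borel_measurable borel"
    and per: "\<And>y. g (y + (2 * pi, 0)) = g y"
  shows "integrable lborel (\<lambda>y. indicator cell y *\<^sub>R g (X y)) \<longleftrightarrow> integrable lborel (\<lambda>y. indicator cell y *\<^sub>R g y)"
proof -
  note [measurable] = measure_preserving_mapD(4)[OF X]
  show ?thesis
    by (subst (1 2) integrable_cell_iff) (auto simp: nn_integral_cell_fold[OF X, of "\<lambda>y. ennreal (norm (g y))"] per)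
qed

lemma integral_cell_fold_real:
  fixes g :: "plane \<Rightarrow> real"
  assumes X: "measure_preserving_map X" and g[measurable]: "g \<in> borel_measurable borel"
    and per: "\<And>y. g (y + (2 * pi, 0)) = g y" and int: "integrable lborel (\<lambda>y. indicator cell y *\<^sub>R g y)"
  shows "(LBINT y. indicator cell y *\<^sub>R g (X y)) = (LBINT y. indicator cell y *\<^sub>R g y)"
proof -
  note [measurable] = measure_preserving_mapD(4)[OF X]
  have int': "integrable lborel (\<lambda>y. indicator cell y *\<^sub>R g (X y))" using integrable_cell_fold[OF X g per] int by simp
  have e: "(\<integral>\<^sup>+y. ennreal (indicator cell y *\<^sub>R h y) \<partial>lborel) = (\<integral>\<^sup>+y. indicator cell y * ennreal (h y) \<partial>lborel)"
    "(\<integral>\<^sup>+y. ennreal (- (indicator cell y *\<^sub>R h y)) \<partial>lborel) = (\<integral>\<^sup>+y. indicator cell y * ennreal (- h y) \<partial>lborel)"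
    for h :: "plane \<Rightarrow> real"
    by (intro nn_integral_cong; auto simp: indicator_def)+
  have f: "(\<integral>\<^sup>+y. indicator cell y * ennreal (g (X y)) \<partial>lborel) = (\<integral>\<^sup>+y. indicator cell y * ennreal (g y) \<partial>lborel)"
    "(\<integral>\<^sup>+y. indicator cell y * ennreal (- g (X y)) \<partial>lborel) = (\<integral>\<^sup>+y. indicator cell y * ennreal (- g y) \<partial>lborel)"
    using nn_integral_cell_fold[OF X, of "\<lambda>y. ennreal (g y)"] nn_integral_cell_fold[OF X, of "\<lambda>y. ennreal (- g y)"] per by simp_all
  show ?thesis unfolding real_lebesgue_integral_def[OF int] real_lebesgue_integral_def[OF int'] e f ..
qed

lemma integral_cell_fold:
  fixes g :: "plane \<Rightarrow> 'b::euclidean_space"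
  assumes X: "measure_preserving_map X" and g[measurable]: "g \<in> borel_measurable borel"
    and per: "\<And>y. g (y + (2 * pi, 0)) = g y" and int: "integrable lborel (\<lambda>y. indicator cell y *\<^sub>R g y)"
  shows "(LBINT y. indicator cell y *\<^sub>R g (X y)) = (LBINT y. indicator cell y *\<^sub>R g y)"
proof (rule euclidean_eqI)
  fix b :: 'b assume "b \<in> Basis"
  have int': "integrable lborel (\<lambda>y. indicator cell y *\<^sub>R g (X y))" using integrable_cell_fold[OF X g per] int by simp
  have ib: "integrable lborel (\<lambda>y. indicator cell y *\<^sub>R (g y \<bullet> b))"
    using integrable_inner_left[OF int, of b] by simp
  show "(LBINT y. indicator cell y *\<^sub>R g (X y)) \<bullet> b = (LBINT y. indicator cell y *\<^sub>R g y) \<bullet> b"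
    using integral_cell_fold_real[OF X, of "\<lambda>y. g y \<bullet> b"] ib per int int'
    by (simp add: integral_inner_left[symmetric])
qed

text \<open>The preimage of a box under \<open>X\<close> lies between the preimages of a slightly
  smaller and a slightly larger box under a nearby area preserving map. Boxes determine Lebesgue
  measure.\<close>

lemma measure_preserving_map_limit:
  assumes cont: "continuous_on UNIV X" and eq: "\<And>y. X (y + (2 * pi, 0)) = X y + (2 * pi, 0)"
    and approx: "\<And>e. 0 < e \<Longrightarrow> \<exists>Y. measure_preserving_map Y \<and> (\<forall>y. norm (Y y - X y) \<le> e)"
  shows "measure_preserving_map X"
proof -
  have [measurable]: "X \<in> borel_measurable borel" using cont by (rule borel_measurable_continuous_onI)
  have near: "emeasure lborel (X -` A) \<le> emeasure lborel B"
    if A[measurable]: "A \<in> sets borel" and B[measurable]: "B \<in> sets borel" and e: "0 < e" and sub: "\<And>x y. x \<in> A \<Longrightarrow> norm (y - x) \<le> e \<Longrightarrow> y \<in> B" for A B e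
  proof -
    obtain Y where Y: "measure_preserving_map Y" and close: "\<And>y. norm (Y y - X y) \<le> e" using approx[OF e] by auto
    note [measurable] = measure_preserving_mapD(4)[OF Y]
    have "Y -` B \<inter> space lborel \<in> sets lborel" by measurable
    then have m: "Y -` B \<in> sets lborel" by simp
    have "emeasure lborel (X -` A) \<le> emeasure lborel (Y -` B)"
    proof (intro emeasure_mono subsetI)
      show "y \<in> Y -` B" if "y \<in> X -` A" for y using sub[of "X y" "Y y"] that close[of y] by auto
    qed (use m in auto)
    also have "\<dots> = emeasure (distr lborel borel Y) B" by (subst emeasure_distr) auto
    also have "\<dots> = emeasure lborel B" using measure_preserving_mapD(3)[OF Y] by simp
    finally show ?thesis .
  qed
  have near': "emeasure lborel A \<le> emeasure lborel (X -` B)"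
    if A[measurable]: "A \<in> sets borel" and B[measurable]: "B \<in> sets borel" and e: "0 < e" and sub: "\<And>x y. x \<in> A \<Longrightarrow> norm (y - x) \<le> e \<Longrightarrow> y \<in> B" for A B e
  proof -
    obtain Y where Y: "measure_preserving_map Y" and close: "\<And>y. norm (Y y - X y) \<le> e" using approx[OF e] by auto
    note [measurable] = measure_preserving_mapD(4)[OF Y]
    have "X -` B \<inter> space lborel \<in> sets lborel" by measurable
    then have m: "X -` B \<in> sets lborel" by simp
    have "emeasure lborel A = emeasure (distr lborel borel Y) A" using measure_preserving_mapD(3)[OF Y] by simp
    also have "\<dots> = emeasure lborel (Y -` A)" by (subst emeasure_distr) auto
    also have "\<dots> \<le> emeasure lborel (X -` B)"
    proof (intro emeasure_mono subsetI)
      show "y \<in> X -` B" if "y \<in> Y -` A" for y using sub[of "Y y" "X y"] that close[of y] by (auto simp: norm_minus_commute)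
    qed (use m in auto)
    finally show ?thesis .
  qed
  have "lborel = distr lborel borel X"
  proof (rule lborel_eqI)
    fix l u :: "plane"
    assume lu: "\<And>b. b \<in> Basis \<Longrightarrow> l \<bullet> b \<le> u \<bullet> b"
    obtain a b c d where l: "l = (a, c)" and u: "u = (b, d)" by (cases l, cases u) auto
    have ab: "a \<le> b" and cd: "c \<le> d" using lu[of "(1,0)"] lu[of "(0,1)"] by (auto simp: l u Basis_prod_def)
    have bx: "box (p, q) (r, s) = {p<..<r} \<times> {q<..<s}" for p q r s :: real
      by (auto simp: box_def Basis_prod_def)
    have em: "emeasure lborel (box (p, q) (r, s)) = ennreal ((max 0 (r - p)) * (max 0 (s - q)))" for p q r s :: real
    proof -
      have "emeasure lborel ({p<..<r} \<times> {q<..<s}) = emeasure lborel {p<..<r} * emeasure lborel {q<..<s}"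
        unfolding lborel_prod[symmetric] by (rule lborel.emeasure_pair_measure_Times) auto
      also have "\<dots> = ennreal (max 0 (r - p)) * ennreal (max 0 (s - q))" by (auto simp: max_def ennreal_neg)
      finally show ?thesis by (simp add: bx ennreal_mult)
    qed
    have emX: "emeasure (distr lborel borel X) (box l u) = emeasure lborel (X -` box l u)"
      by (subst emeasure_distr) auto
    have up: "emeasure lborel (X -` box l u) \<le> ennreal ((b - a + 2 * e) * (d - c + 2 * e))" if e: "0 < e" for e
    proof -
      have "emeasure lborel (X -` box l u) \<le> emeasure lborel (box (a - e, c - e) (b + e, d + e))"
      proof (rule near[of _ _ "e/2"])
        fix x y :: "plane" assume x: "x \<in> box l u" and n: "norm (y - x) \<le> e / 2"
        have "\<bar>fst y - fst x\<bar> \<le> e/2" "\<bar>snd y - snd x\<bar> \<le> e/2"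
          using n abs_fst_le_norm[of "y - x"] abs_snd_le_norm[of "y - x"] by auto
        then show "y \<in> box (a - e, c - e) (b + e, d + e)" using x e unfolding l u bx mem_Times_iff greaterThanLessThan_iff fst_conv snd_conv abs_le_iff by linarith
      qed (use e in auto)
      also have "\<dots> = ennreal ((b - a + 2 * e) * (d - c + 2 * e))"
        unfolding em using ab cd e by (simp add: max_def algebra_simps)
      finally show ?thesis .
    qed
    have lo: "ennreal (max 0 (b - a - 2 * e) * max 0 (d - c - 2 * e)) \<le> emeasure lborel (X -` box l u)" if e: "0 < e" for e
    proof -
      have "emeasure lborel (box (a + e, c + e) (b - e, d - e)) \<le> emeasure lborel (X -` box l u)"
      proof (rule near'[of _ _ "e/2"])
        fix x y :: "plane" assume x: "x \<in> box (a + e, c + e) (b - e, d - e)" and n: "norm (y - x) \<le> e / 2"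
        have "\<bar>fst y - fst x\<bar> \<le> e/2" "\<bar>snd y - snd x\<bar> \<le> e/2"
          using n abs_fst_le_norm[of "y - x"] abs_snd_le_norm[of "y - x"] by auto
        then show "y \<in> box l u" using x e unfolding l u bx mem_Times_iff greaterThanLessThan_iff fst_conv snd_conv abs_le_iff by linarith
      qed (use e in auto)
      then show ?thesis unfolding em by (simp add: algebra_simps)
    qed
    have tz: "(\<lambda>n. 1 / real (Suc n)) \<longlonglongrightarrow> 0" using LIMSEQ_inverse_real_of_nat by (simp add: inverse_eq_divide)
    have "emeasure lborel (X -` box l u) \<le> ennreal ((b - a) * (d - c))"
    proof (rule LIMSEQ_le_const)
      have "(\<lambda>n. ennreal ((b - a + 2 * (1 / real (Suc n))) * (d - c + 2 * (1 / real (Suc n))))) \<longlonglongrightarrow> ennreal ((b - a + 2 * 0) * (d - c + 2 * 0))"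
        by (intro tendsto_intros tz)
      then show "(\<lambda>n. ennreal ((b - a + 2 * (1 / real (Suc n))) * (d - c + 2 * (1 / real (Suc n))))) \<longlonglongrightarrow> ennreal ((b - a) * (d - c))" by simp
    qed (intro exI allI impI up, simp)
    moreover have "ennreal ((b - a) * (d - c)) \<le> emeasure lborel (X -` box l u)"
    proof (rule LIMSEQ_le_const2)
      have "(\<lambda>n. ennreal (max 0 (b - a - 2 * (1 / real (Suc n))) * max 0 (d - c - 2 * (1 / real (Suc n))))) \<longlonglongrightarrow> ennreal (max 0 (b - a - 2 * 0) * max 0 (d - c - 2 * 0))"
        by (intro tendsto_intros tz)
      then show "(\<lambda>n. ennreal (max 0 (b - a - 2 * (1 / real (Suc n))) * max 0 (d - c - 2 * (1 / real (Suc n))))) \<longlonglongrightarrow> ennreal ((b - a) * (d - c))"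
        using ab cd by simp
    qed (intro exI allI impI lo, simp)
    moreover have "(\<Prod>b\<in>Basis. (u - l) \<bullet> b) = (b - a) * (d - c)"
      by (simp add: l u Basis_prod_def image_iff)
    ultimately show "emeasure (distr lborel borel X) (box l u) = ennreal (\<Prod>b\<in>Basis. (u - l) \<bullet> b)"
      unfolding emX by (metis order_antisym)
  qed simp
  then show ?thesis unfolding measure_preserving_map_def using cont eq by auto
qed

section \<open>Lipschitz functions as primitives of bounded densities\<close>

lemma interval_measure_Ioo:
  fixes F :: "real \<Rightarrow> real"
  assumes mono: "\<And>x y. x \<le> y \<Longrightarrow> F x \<le> F y" and cont: "continuous_on UNIV F" and le: "a \<le> b"
  shows "emeasure (interval_measure F) {a<..<b} = ennreal (F b - F a)"
proof -
  have rc: "\<And>a. continuous (at_right a) F"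
    using cont by (simp add: continuous_on_eq_continuous_at continuous_at_imp_continuous_at_within)
  have "emeasure (interval_measure F) {b..b} = ennreal (F b - F b)"
    by (rule emeasure_interval_measure_Icc) (use mono cont in auto)
  then have n: "{b} \<in> null_sets (interval_measure F)" by (simp add: null_sets_def)
  have "emeasure (interval_measure F) ({a<..b} - {b}) = emeasure (interval_measure F) {a<..b}"
    by (rule emeasure_Diff_null_set[OF n]) simp
  moreover have "{a<..b} - {b} = {a<..<b}" by auto
  ultimately show ?thesis using emeasure_interval_measure_Ioc[OF le mono rc] by simp
qed

text \<open>The nondecreasing functions \<open>F 1\<close> and \<open>F (-1)\<close> add up to the
  identity, so their Stieltjes measures add up to Lebesgue measure and each is absolutely
  continuous. Radon-Nikodym gives \<open>F 1\<close> a density between 0 and 1, from which that of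
  \<open>f\<close> is read off; no differentiation theorem is involved.\<close>

lemma lipschitz_density:
  fixes f :: "real \<Rightarrow> real"
  assumes lip: "\<And>x y. \<bar>f x - f y\<bar> \<le> L * \<bar>x - y\<bar>" and L: "0 < L"
  obtains g where "g \<in> borel_measurable borel" "\<And>x. \<bar>g x\<bar> \<le> L"
    "\<And>a b. a \<le> b \<Longrightarrow> (LBINT x. indicator {a..b} x * g x) = f b - f a"
proof -
  have contf: "continuous_on UNIV f"
  proof (rule lipschitz_on_continuous_on)
    show "L-lipschitz_on UNIV f" using lip L by (auto simp: lipschitz_on_def dist_real_def)
  qed
  define F where "F s x = (L * x + s * f x) / (2 * L)" for s x :: real
  have contF: "continuous_on UNIV (F s)" for s unfolding F_def using L by (intro continuous_intros contf) auto
  have monoF: "F s x \<le> F s y" if "s = 1 \<or> s = -1" "x \<le> y" for s x y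
  proof -
    have "\<bar>f y - f x\<bar> \<le> L * (y - x)" using lip[of y x] that by simp
    then have "L * x + s * f x \<le> L * y + s * f y" using that by (auto simp: abs_le_iff algebra_simps)
    then show ?thesis unfolding F_def using L by (intro divide_right_mono) auto
  qed
  have Fsum: "F 1 x + F (-1) x = x" for x using L by (simp add: F_def field_simps)
  define \<nu> where "\<nu> s = interval_measure (F s)" for s
  have s\<nu>: "sets (\<nu> s) = sets borel" for s by (simp add: \<nu>_def)
  have \<nu>I: "emeasure (\<nu> s) {a<..<b} = ennreal (F s b - F s a)" if "s = 1 \<or> s = -1" "a \<le> b" for s a b
    unfolding \<nu>_def by (rule interval_measure_Ioo) (use monoF contF that in auto)
  define M where "M = measure_of UNIV (sets borel) (\<lambda>A. emeasure (\<nu> 1) A + emeasure (\<nu> (-1)) A)"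
  have sM: "sets M = sets borel" unfolding M_def using sets.sigma_sets_eq[of borel] by (simp add: sets_measure_of_conv)
  have eM: "emeasure M A = emeasure (\<nu> 1) A + emeasure (\<nu> (-1)) A" if A: "A \<in> sets borel" for A
  proof (rule emeasure_measure_of[OF M_def])
    show "positive (sets M) (\<lambda>A. emeasure (\<nu> 1) A + emeasure (\<nu> (-1)) A)" by (simp add: positive_def)
    show "countably_additive (sets M) (\<lambda>A. emeasure (\<nu> 1) A + emeasure (\<nu> (-1)) A)"
      unfolding countably_additive_def sM
    proof (intro allI impI)
      fix B :: "nat \<Rightarrow> real set" assume B: "range B \<subseteq> sets borel" "disjoint_family B"
      have "(\<Sum>i. emeasure (\<nu> s) (B i)) = emeasure (\<nu> s) (\<Union>i. B i)" for s
        by (rule suminf_emeasure) (use B in \<open>auto simp: s\<nu>\<close>)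
      then show "(\<Sum>i. emeasure (\<nu> 1) (B i) + emeasure (\<nu> (-1)) (B i)) = emeasure (\<nu> 1) (\<Union>i. B i) + emeasure (\<nu> (-1)) (\<Union>i. B i)"
        by (simp add: suminf_add[symmetric])
    qed
  qed (use A sM in auto)
  have lM: "lborel = M"
  proof (rule lborel_eqI)
    fix l u :: real assume "\<And>b. b \<in> Basis \<Longrightarrow> l \<bullet> b \<le> u \<bullet> b"
    then have lu: "l \<le> u" by auto
    have "emeasure M (box l u) = ennreal (F 1 u - F 1 l) + ennreal (F (-1) u - F (-1) l)"
      by (subst eM) (use lu in \<open>auto simp: box_real \<nu>I\<close>)
    also have "\<dots> = ennreal ((F 1 u - F 1 l) + (F (-1) u - F (-1) l))"
      using monoF[of _ l u] lu by (intro ennreal_plus[symmetric]) auto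
    also have "(F 1 u - F 1 l) + (F (-1) u - F (-1) l) = u - l" using Fsum[of u] Fsum[of l] by linarith
    finally show "emeasure M (box l u) = ennreal (prod ((\<bullet>) (u - l)) Basis)" by simp
  qed (rule sM)
  have ac: "absolutely_continuous lborel (\<nu> s)" if "s = 1 \<or> s = -1" for s
    unfolding absolutely_continuous_def
  proof
    fix A :: "real set" assume "A \<in> null_sets lborel"
    then have A: "A \<in> sets borel" "emeasure M A = 0" by (auto simp: null_sets_def lM[symmetric])
    then show "A \<in> null_sets (\<nu> s)" using that eM[of A] by (auto simp: null_sets_def s\<nu>)
  qed
  have "\<exists>g\<in>borel_measurable lborel. density lborel g = \<nu> s" if "s = 1 \<or> s = -1" for s
    by (rule sigma_finite_measure.Radon_Nikodym[OF lborel.sigma_finite_measure_axioms ac[OF that]]) (simp add: s\<nu>)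
  then obtain g where g: "\<And>s. s = 1 \<or> s = -1 \<Longrightarrow> g s \<in> borel_measurable borel" "\<And>s. s = 1 \<or> s = -1 \<Longrightarrow> density lborel (g s) = \<nu> s"
    by (metis measurable_lborel2)
  have [measurable]: "g 1 \<in> borel_measurable borel" "g (-1) \<in> borel_measurable borel" using g(1) by auto
  have "density lborel (\<lambda>x. g 1 x + g (-1) x) = density lborel (\<lambda>x. 1)"
  proof (rule measure_eqI)
    fix A assume "A \<in> sets (density lborel (\<lambda>x. g 1 x + g (-1) x))"
    then have A [measurable]: "A \<in> sets borel" by simp
    have "emeasure (density lborel (\<lambda>x. g 1 x + g (-1) x)) A = (\<integral>\<^sup>+x. g 1 x * indicator A x + g (-1) x * indicator A x \<partial>lborel)"
      by (subst emeasure_density) (auto simp: distrib_right)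
    also have "\<dots> = emeasure (density lborel (g 1)) A + emeasure (density lborel (g (-1))) A"
      by (subst nn_integral_add) (auto simp: emeasure_density)
    also have "\<dots> = emeasure M A" using g(2) eM by simp
    finally show "emeasure (density lborel (\<lambda>x. g 1 x + g (-1) x)) A = emeasure (density lborel (\<lambda>x. 1)) A"
      by (simp add: density_1 lM[symmetric])
  qed simp
  then have "AE x in lborel. g 1 x + g (-1) x = 1"
    by (intro sigma_finite_measure.density_unique[OF lborel.sigma_finite_measure_axioms]) auto
  then have g1: "AE x in lborel. g 1 x \<le> 1" by eventually_elim (metis le_iff_add)
  \<comment> \<open>Inverts \<open>F 1\<close>: \<open>f x = 2 * L * F 1 x - L * x\<close>. The
    truncation at 1 changes the density on a null set only and makes the bound hold at every
    point.\<close>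
  define h where "h x = 2 * L * min 1 (enn2real (g 1 x)) - L" for x
  have hm [measurable]: "h \<in> borel_measurable borel" unfolding h_def by measurable
  have hb: "\<bar>h x\<bar> \<le> L" for x
  proof -
    have "0 \<le> min 1 (enn2real (g 1 x))" "min 1 (enn2real (g 1 x)) \<le> 1" by auto
    then have "0 \<le> 2 * L * min 1 (enn2real (g 1 x))" "2 * L * min 1 (enn2real (g 1 x)) \<le> 2 * L * 1"
      using L by (auto intro!: mult_left_mono)
    then show ?thesis by (simp add: h_def abs_le_iff)
  qed
  have "(LBINT x. indicator {a..b} x * h x) = f b - f a" if ab: "a \<le> b" for a b
  proof -
    have "(\<integral>\<^sup>+x. ennreal (indicator {a..b} x * min 1 (enn2real (g 1 x))) \<partial>lborel) = (\<integral>\<^sup>+x. g 1 x * indicator {a..b} x \<partial>lborel)"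
    proof (rule nn_integral_cong_AE)
      show "AE x in lborel. ennreal (indicator {a..b} x * min 1 (enn2real (g 1 x))) = g 1 x * indicator {a..b} x"
        using g1
      proof eventually_elim
        case (elim x)
        then have "g 1 x = ennreal (enn2real (g 1 x))" by (metis ennreal_enn2real ennreal_one_less_top order_le_less_trans less_top)
        moreover from this elim have "enn2real (g 1 x) \<le> 1" by (metis enn2real_nonneg ennreal_1 ennreal_le_iff zero_le_one)
        ultimately show ?case by (auto simp: indicator_def)
      qed
    qed
    also have "\<dots> = emeasure (\<nu> 1) {a..b}" using g(2)[of 1] by (subst emeasure_density[symmetric]) auto
    also have "\<dots> = ennreal (F 1 b - F 1 a)" unfolding \<nu>_def
      by (rule emeasure_interval_measure_Icc) (use monoF contF ab in auto)
    finally have i1: "(LBINT x. indicator {a..b} x * min 1 (enn2real (g 1 x))) = F 1 b - F 1 a"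
      using monoF[of 1 a b] ab by (intro integral_eq_nn_integral[THEN trans]) (auto simp: indicator_def)
    have int: "integrable lborel (\<lambda>x. indicator {a..b} x * min 1 (enn2real (g 1 x)))" 
    proof -
      have "integrable lborel (\<lambda>x. indicator {a..b} x *\<^sub>R min 1 (enn2real (g 1 x)))"
        by (rule integrableI_bounded_set_indicator[where B = 1]) (use ab in auto)
      then show ?thesis by simp
    qed
    have int2: "integrable lborel (\<lambda>x. indicator {a..b} x * L)"
      by (intro integrable_mult_left integrable_real_indicator) (use ab in auto)
    have "(LBINT x. indicator {a..b} x * h x) = (LBINT x. 2 * L * (indicator {a..b} x * min 1 (enn2real (g 1 x))) - indicator {a..b} x * L)"
      by (intro Bochner_Integration.integral_cong) (auto simp: h_def indicator_def)
    also have "\<dots> = 2 * L * (F 1 b - F 1 a) - (b - a) * L"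
      using int int2 ab by (simp add: i1)
    also have "\<dots> = f b - f a" using L by (simp add: F_def field_simps)
    finally show ?thesis .
  qed
  then show thesis using hm hb by (intro that[of h]) auto
qed

text \<open>Both sides integrate \<open>h x * g s\<close> over the triangle
  \<open>0 \<le> s \<le> x \<le> c\<close>. This is integration by parts in a form that suits a
  bounded measurable \<open>g\<close>.\<close>

lemma fubini_primitive:
  fixes h g :: "real \<Rightarrow> real"
  assumes [measurable]: "h \<in> borel_measurable borel" "g \<in> borel_measurable borel"
    and hb: "\<And>x. x \<in> {0..c} \<Longrightarrow> \<bar>h x\<bar> \<le> A" and gb: "\<And>x. \<bar>g x\<bar> \<le> B"
  shows "(LBINT x. indicator {0..c} x * (h x * (LBINT s. indicator {0..x} s * g s)))
    = (LBINT s. indicator {0..c} s * (g s * (LBINT x. indicator {s..c} x * h x)))"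
proof -
  define k where "k x s = indicator {0..c} x * indicator {0..c} s * (if s \<le> x then h x * g s else 0)" for x s :: real
  have A0: "\<bar>h x * g s\<bar> \<le> A * B" if "x \<in> {0..c}" for x s
    unfolding abs_mult using hb[OF that] gb[of s] by (intro mult_mono) auto
  have [measurable]: "(\<lambda>p. k (fst p) (snd p)) \<in> borel_measurable (lborel \<Otimes>\<^sub>M lborel)" unfolding k_def by measurable
  have int: "integrable (lborel \<Otimes>\<^sub>M lborel) (\<lambda>(x, s). k x s)"
  proof -
    have "integrable (lborel \<Otimes>\<^sub>M lborel) (\<lambda>p. indicator ({0..c} \<times> {0..c}) p *\<^sub>R (if snd p \<le> fst p then indicator {0..c} (fst p) * h (fst p) * g (snd p) else 0))"
    proof (rule integrableI_bounded_set_indicator[where B = "\<bar>A * B\<bar>"])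
      have "emeasure (lborel \<Otimes>\<^sub>M lborel) ({0..c} \<times> {0..c}) = ennreal (max 0 c) * ennreal (max 0 c)"
        by (subst lborel.emeasure_pair_measure_Times) (auto simp: max_def)
      then show "emeasure (lborel \<Otimes>\<^sub>M lborel) ({0..c} \<times> {0..c}) < \<infinity>" by (simp add: ennreal_mult_less_top)
      show "AE x in lborel \<Otimes>\<^sub>M lborel. x \<in> {0..c} \<times> {0..c} \<longrightarrow> norm (if snd x \<le> fst x then indicator {0..c} (fst x) * h (fst x) * g (snd x) else 0) \<le> \<bar>A * B\<bar>"
      proof (intro AE_I2 impI)
        fix p :: "plane" assume "p \<in> {0..c} \<times> {0..c}"
        then have "\<bar>h (fst p) * g (snd p)\<bar> \<le> A * B" by (intro A0) auto
        then show "norm (if snd p \<le> fst p then indicator {0..c} (fst p) * h (fst p) * g (snd p) else 0) \<le> \<bar>A * B\<bar>"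
          by (auto simp: indicator_def)
      qed
    qed measurable
    moreover have "(\<lambda>p. indicator ({0..c} \<times> {0..c}) p *\<^sub>R (if snd p \<le> fst p then indicator {0..c} (fst p) * h (fst p) * g (snd p) else 0)) = (\<lambda>(x, s). k x s)"
      by (auto simp: fun_eq_iff k_def indicator_def)
    ultimately show ?thesis by simp
  qed
  have "(LBINT x. (LBINT s. k x s)) = (LBINT s. (LBINT x. k x s))"
    using lborel_pair.Fubini_integral[OF int] by simp
  moreover have "(LBINT s. k x s) = indicator {0..c} x * (h x * (LBINT s. indicator {0..x} s * g s))" for x
  proof -
    have "(LBINT s. k x s) = (LBINT s. (indicator {0..c} x * h x) * (indicator {0..x} s * g s))"
      by (intro Bochner_Integration.integral_cong) (auto simp: k_def indicator_def)
    then show ?thesis by simp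
  qed
  moreover have "(LBINT x. k x s) = indicator {0..c} s * (g s * (LBINT x. indicator {s..c} x * h x))" for s
  proof -
    have "(LBINT x. k x s) = (LBINT x. (indicator {0..c} s * g s) * (indicator {s..c} x * h x))"
      by (intro Bochner_Integration.integral_cong) (auto simp: k_def indicator_def)
    then show ?thesis by simp
  qed
  ultimately show ?thesis by simp
qed

section \<open>Function spaces on the circle\<close>

lemma holder_norm_le:
  assumes "\<And>\<alpha>. norm (f \<alpha>) \<le> B" "\<And>\<alpha> \<beta>. norm (f \<alpha> - f \<beta>) \<le> H * \<bar>\<alpha> - \<beta>\<bar> powr \<gamma>" "0 \<le> B" "0 \<le> H"
  shows "holder_norm \<gamma> f \<le> ennreal (B + H)"
proof -
  have "(SUP \<alpha>. ennreal (norm (f \<alpha>))) \<le> ennreal B" by (intro SUP_least ennreal_leI assms)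
  moreover have "(SUP (\<alpha>, \<beta>) \<in> {(\<alpha>, \<beta>). \<alpha> \<noteq> \<beta>}. ennreal (norm (f \<alpha> - f \<beta>) / \<bar>\<alpha> - \<beta>\<bar> powr \<gamma>)) \<le> ennreal H"
  proof (intro SUP_least, clarsimp intro!: ennreal_leI)
    fix a b :: real assume "a \<noteq> b"
    then show "norm (f a - f b) / \<bar>a - b\<bar> powr \<gamma> \<le> H" using assms(2)[of a b] by (simp add: pos_divide_le_eq)
  qed
  ultimately show ?thesis unfolding holder_norm_def using assms by (simp add: add_mono)
qed

lemma holder_norm_finite:
  assumes "holder_norm \<gamma> f < \<infinity>"
  obtains B H where "0 \<le> B" "0 \<le> H" "\<And>\<alpha>. norm (f \<alpha>) \<le> B" "\<And>\<alpha> \<beta>. norm (f \<alpha> - f \<beta>) \<le> H * \<bar>\<alpha> - \<beta>\<bar> powr \<gamma>"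
proof -
  define B where "B = (SUP \<alpha>. ennreal (norm (f \<alpha>)))"
  define H where "H = (SUP (\<alpha>, \<beta>) \<in> {(\<alpha>, \<beta>). \<alpha> \<noteq> \<beta>}. ennreal (norm (f \<alpha> - f \<beta>) / \<bar>\<alpha> - \<beta>\<bar> powr \<gamma>))"
  have fin: "B < \<infinity>" "H < \<infinity>" using assms unfolding holder_norm_def B_def[symmetric] H_def[symmetric] by auto
  have "norm (f \<alpha>) \<le> enn2real B" for \<alpha>
  proof -
    have "ennreal (norm (f \<alpha>)) \<le> B" unfolding B_def by (rule SUP_upper) simp
    then show ?thesis using fin enn2real_mono[of "ennreal (norm (f \<alpha>))" B] by (simp add: less_top)
  qed
  moreover have "norm (f \<alpha> - f \<beta>) \<le> enn2real H * \<bar>\<alpha> - \<beta>\<bar> powr \<gamma>" for \<alpha> \<beta>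
  proof (cases "\<alpha> = \<beta>")
    case False
    have "ennreal (norm (f \<alpha> - f \<beta>) / \<bar>\<alpha> - \<beta>\<bar> powr \<gamma>) \<le> H"
      unfolding H_def by (rule SUP_upper2[of "(\<alpha>, \<beta>)"]) (use False in auto)
    then have "norm (f \<alpha> - f \<beta>) / \<bar>\<alpha> - \<beta>\<bar> powr \<gamma> \<le> enn2real H"
      using fin enn2real_mono[of "ennreal (norm (f \<alpha> - f \<beta>) / \<bar>\<alpha> - \<beta>\<bar> powr \<gamma>)" H] by (simp add: less_top)
    then show ?thesis using False by (simp add: pos_divide_le_eq)
  qed simp
  ultimately show thesis by (intro that[of "enn2real B" "enn2real H"]) auto
qed

section \<open>Smooth periodic functions of one variable\<close>

lemma frechet_derivative_real:
  fixes f :: "real \<Rightarrow> real"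
  assumes "(f has_real_derivative d) (at x)" shows "frechet_derivative f (at x) v = v * d" "f differentiable (at x)"
proof -
  have h: "(f has_derivative (\<lambda>v. d * v)) (at x)" using assms by (simp add: has_field_derivative_def)
  show "frechet_derivative f (at x) v = v * d" using frechet_derivative_at[OF h] by (metis mult.commute)
  show "f differentiable (at x)" using h by (auto simp: differentiable_def)
qed

lemma C_k_SucI:
  fixes f :: "real \<Rightarrow> real"
  assumes "\<And>x. (f has_real_derivative f' x) (at x)" "\<And>v. C_k k (\<lambda>x. v * f' x)"
  shows "C_k (Suc k) f"
  using assms by (simp add: frechet_derivative_real[OF assms(1)])

lemma C_k_SucD:
  fixes f :: "real \<Rightarrow> real"
  assumes "C_k (Suc k) f"
  obtains f' where "\<And>x. (f has_real_derivative f' x) (at x)" "C_k k f'"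
proof -
  have d: "f differentiable (at x)" for x using assms by simp
  define f' where "f' x = frechet_derivative f (at x) 1" for x
  have "(f has_real_derivative f' x) (at x)" for x
  proof -
    have 1: "(f has_derivative frechet_derivative f (at x)) (at x)" using d frechet_derivative_works by blast
    have "frechet_derivative f (at x) v = f' x * v" for v
      using linear_cmul[OF has_derivative_linear[OF 1], of v 1] by (simp add: f'_def mult.commute)
    then have "frechet_derivative f (at x) = (*) (f' x)" by (intro ext)
    then show ?thesis using 1 by (simp add: has_field_derivative_def)
  qed
  moreover have "C_k k f'" using assms unfolding f'_def by simp
  ultimately show thesis by (rule that)
qed

lemma C_k_continuous: fixes f :: "real \<Rightarrow> real" shows "C_k k f \<Longrightarrow> continuous_on UNIV f"
proof (cases k)
  case (Suc j) assume "C_k k f"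
  then have "C_k (Suc j) f" by (simp only: Suc)
  then have "f differentiable (at x)" for x by simp
  then show ?thesis by (intro continuous_at_imp_continuous_on ballI differentiable_imp_continuous_within)
qed simp

lemma C_k_down: fixes f :: "real \<Rightarrow> real" shows "C_k (Suc k) f \<Longrightarrow> C_k k f"
proof (induction k arbitrary: f)
  case 0 then have "continuous_on UNIV f" by (rule C_k_continuous)
  then show ?case by simp
next
  case (Suc k)
  from Suc.prems have 1: "\<And>x. f differentiable (at x)" "\<And>v. C_k (Suc k) (\<lambda>x. frechet_derivative f (at x) v)" by auto
  then show ?case using Suc.IH by simp
qed

text \<open>Products and sums go through one induction, because the derivative of a product is a sum
  of products.\<close>

lemma C_k_mult: fixes f g :: "real \<Rightarrow> real" 
  shows "C_k k f \<Longrightarrow> C_k k g \<Longrightarrow> C_k k (\<lambda>x. f x * g x)"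
    and "C_k k f \<Longrightarrow> C_k k g \<Longrightarrow> C_k k (\<lambda>x. f x + g x)"
proof -
  have const: "C_k k (\<lambda>x::real. c)" for k and c :: real
  proof (induction k arbitrary: c)
    case (Suc k) 
    have "((\<lambda>x::real. c) has_real_derivative 0) (at x)" for x by simp
    then show ?case by (rule C_k_SucI) (use Suc[of 0] in simp)
  qed simp
  have *: "(\<forall>f g. C_k k f \<longrightarrow> C_k k g \<longrightarrow> C_k k (\<lambda>x::real. f x * g x :: real)) \<and> (\<forall>f g. C_k k f \<longrightarrow> C_k k g \<longrightarrow> C_k k (\<lambda>x::real. f x + g x :: real))"
  proof (induction k)
    case 0 then show ?case by (auto intro: continuous_intros)
  next
    case (Suc k)
    have IHm: "C_k k (\<lambda>x. f x * g x :: real)" if "C_k k f" "C_k k g" for f g :: "real \<Rightarrow> real" using Suc that by blast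
    have IHa: "C_k k (\<lambda>x::real. f x + g x :: real)" if "C_k k f" "C_k k g" for f g :: "real \<Rightarrow> real" using Suc that by blast
    show ?case
    proof (intro conjI allI impI)
      fix f g :: "real \<Rightarrow> real" assume f: "C_k (Suc k) f" and g: "C_k (Suc k) g"
      obtain f' where f': "\<And>x. (f has_real_derivative f' x) (at x)" "C_k k f'" using C_k_SucD[OF f] by blast
      obtain g' where g': "\<And>x. (g has_real_derivative g' x) (at x)" "C_k k g'" using C_k_SucD[OF g] by blast
      show "C_k (Suc k) (\<lambda>x. f x * g x)"
      proof (rule C_k_SucI)
        show "((\<lambda>x. f x * g x) has_real_derivative f' x * g x + g' x * f x) (at x)" for x
          by (rule DERIV_mult[OF f'(1) g'(1)])
        show "C_k k (\<lambda>x. v * (f' x * g x + g' x * f x))" for v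
          by (rule IHm[OF const IHa[OF IHm[OF f'(2) C_k_down[OF g]] IHm[OF g'(2) C_k_down[OF f]]]])
      qed
      show "C_k (Suc k) (\<lambda>x. f x + g x)"
      proof (rule C_k_SucI)
        show "((\<lambda>x. f x + g x) has_real_derivative f' x + g' x) (at x)" for x
          by (rule DERIV_add[OF f'(1) g'(1)])
        show "C_k k (\<lambda>x. v * (f' x + g' x))" for v
          by (rule IHm[OF const IHa[OF f'(2) g'(2)]])
      qed
    qed
  qed
  show "C_k k f \<Longrightarrow> C_k k g \<Longrightarrow> C_k k (\<lambda>x. f x * g x)" using * by blast
  show "C_k k f \<Longrightarrow> C_k k g \<Longrightarrow> C_k k (\<lambda>x. f x + g x)" using * by blast
qed

lemma C_k_const: "C_k k (\<lambda>x::real. c)"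
proof (induction k arbitrary: c)
  case (Suc k) 
  have "((\<lambda>x::real. c) has_real_derivative 0) (at x)" for x by simp
  then show ?case by (rule C_k_SucI) (use Suc[of 0] in simp)
qed simp

lemma C_k_sin_cos: "C_k k (sin :: real \<Rightarrow> real) \<and> C_k k (cos :: real \<Rightarrow> real)"
proof (induction k)
  case (Suc k)
  have "C_k (Suc k) (sin :: real \<Rightarrow> real)"
    by (rule C_k_SucI[where f' = cos]) (use Suc C_k_mult(1)[OF C_k_const] in auto)
  moreover have "C_k (Suc k) (cos :: real \<Rightarrow> real)"
  proof (rule C_k_SucI[where f' = "\<lambda>x. - sin x"])
    show "C_k k (\<lambda>x::real. v * - sin x)" for v using C_k_mult(1)[OF C_k_const[of k "- v"], of sin] Suc by simp
  qed (auto intro: derivative_eq_intros)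
  ultimately show ?case by blast
qed (auto intro: continuous_intros)

text \<open>Trigonometric polynomials enter as polynomials restricted to the circle, the form in
  which Stone-Weierstrass delivers them.\<close>

lemma smooth_trig_polynomial:
  fixes p :: "plane \<Rightarrow> real"
  assumes "real_polynomial_function p"
  shows "smooth (\<lambda>x. p (cos x, sin x))"
  using assms
proof (induction p rule: real_polynomial_function.induct)
  case (linear f)
  interpret f: bounded_linear f by fact
  have "f (cos x, sin x) = cos x * f (1, 0) + sin x * f (0, 1)" for x
  proof -
    have "(cos x, sin x) = cos x *\<^sub>R (1, 0) + sin x *\<^sub>R (0, 1)" by simp
    then have "f (cos x, sin x) = f (cos x *\<^sub>R (1, 0) + sin x *\<^sub>R (0, 1))" by (simp only:)
    then show ?thesis by (simp only: f.add f.scaleR real_scaleR_def)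
  qed
  then have eq: "(\<lambda>x. f (cos x, sin x)) = (\<lambda>x. cos x * f (1, 0) + sin x * f (0, 1))" by (rule ext)
  show ?case unfolding smooth_def eq
    by (intro allI C_k_mult C_k_const C_k_sin_cos[THEN conjunct1] C_k_sin_cos[THEN conjunct2])
next
  case (const c) show ?case unfolding smooth_def using C_k_const by blast
next
  case (add f g) then show ?case unfolding smooth_def using C_k_mult(2) by blast
next
  case (mult f g) then show ?case unfolding smooth_def using C_k_mult(1) by blast
qed

lemma primitive_exists:
  fixes P :: "real \<Rightarrow> real"
  assumes "continuous_on UNIV P"
  obtains \<phi> where "\<And>x. (\<phi> has_real_derivative P x) (at x)"
proof -
  define \<phi> where "\<phi> u = (LBINT y=ereal 0..ereal u. P y)" for u
  have "(\<phi> has_real_derivative P x) (at x)" for x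
  proof -
    define a b where "a = - \<bar>x\<bar> - 1" and "b = \<bar>x\<bar> + 1"
    have "((\<lambda>u. LBINT y=ereal 0..ereal u. P y) has_vector_derivative P x) (at x within {a..b})"
      by (rule interval_integral_FTC2) (auto simp: a_def b_def intro: continuous_on_subset[OF assms])
    then have "(\<phi> has_vector_derivative P x) (at x within {a..b})" unfolding \<phi>_def .
    moreover have "x \<in> interior {a..b}" by (auto simp: a_def b_def)
    then have "at x within {a..b} = at x" by (rule at_within_interior)
    ultimately have "(\<phi> has_vector_derivative P x) (at x)" by simp
    then show ?thesis unfolding has_real_derivative_iff_has_vector_derivative .
  qed
  then show thesis by (rule that)
qed

lemma periodic_of_mean_zero:
  fixes \<phi> P :: "real \<Rightarrow> real"
  assumes d: "\<And>x. (\<phi> has_real_derivative P x) (at x)" and per: "\<And>x. P (x + 2 * pi) = P x"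
    and mean: "\<phi> (2 * pi) = \<phi> 0"
  shows "\<phi> (x + 2 * pi) = \<phi> x"
proof -
  have "((\<lambda>x. \<phi> (x + 2 * pi) - \<phi> x) has_real_derivative 0) (at y)" for y
  proof -
    have "((\<lambda>x. \<phi> (x + 2 * pi)) has_real_derivative P (y + 2 * pi)) (at y)"
      using DERIV_shift[of \<phi> "P (y + 2 * pi)" y "2 * pi"] d by simp
    from DERIV_diff[OF this d[of y]] show ?thesis by (simp add: per)
  qed
  then have "(\<lambda>x. \<phi> (x + 2 * pi) - \<phi> x) x = (\<lambda>x. \<phi> (x + 2 * pi) - \<phi> x) 0"
    by (intro DERIV_isconst_all) auto
  then show ?thesis using mean by simp
qed

text \<open>The parametrisation of the circle by a compact interval is a closed map, and
  \<open>F\<close> is constant on its fibres, so \<open>F\<close> descends to a continuous function.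
  \<open>H\<close> picks some parameter in the fibre.\<close>

lemma circle_factor:
  fixes F :: "real \<Rightarrow> real"
  assumes c: "continuous_on {0..2 * pi} F" and e: "F 0 = F (2 * pi)"
  obtains H :: "plane \<Rightarrow> real" where "continuous_on ((\<lambda>x. (cos x, sin x)) ` {0..2 * pi}) H"
    "\<And>x. x \<in> {0..2 * pi} \<Longrightarrow> H (cos x, sin x) = F x"
proof -
  define q where "q x = (cos x, sin x)" for x :: real
  define H where "H w = F (SOME x. x \<in> {0..2 * pi} \<and> q x = w)" for w
  have H: "H (q x) = F x" if x: "x \<in> {0..2 * pi}" for x
  proof -
    define y where "y = (SOME y. y \<in> {0..2 * pi} \<and> q y = q x)"
    have y: "y \<in> {0..2 * pi}" "q y = q x" using someI[of "\<lambda>y. y \<in> {0..2 * pi} \<and> q y = q x" x] x by (auto simp: y_def)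
    then have "sin y = sin x \<and> cos y = cos x" by (simp add: q_def)
    then obtain n :: int where n: "y = x + 2 * pi * n" using sin_cos_eq_iff by metis
    then have "n = 0 \<or> n = 1 \<or> n = -1"
    proof -
      have "\<bar>2 * pi * of_int n\<bar> \<le> 2 * pi * 1" using y x n by auto
      then have "\<bar>of_int n :: real\<bar> \<le> 1" by (simp add: abs_mult)
      then have "\<bar>n\<bar> \<le> 1" by linarith
      then show ?thesis by linarith
    qed
    then have "F y = F x"
    proof (elim disjE)
      assume "n = 1"
      then have "y = x + 2 * pi" using n by simp
      then have "x = 0" "y = 2 * pi" using x y by auto
      then show ?thesis using e by simp
    next
      assume "n = -1"
      then have "y = x - 2 * pi" using n by simp
      then have "x = 2 * pi" "y = 0" using x y by auto
      then show ?thesis using e by simp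
    qed (use n in simp)
    then show ?thesis by (simp add: H_def y_def)
  qed
  have cq: "continuous_on S q" for S unfolding q_def by (intro continuous_intros)
  have "continuous_on (q ` {0..2 * pi}) H"
    unfolding continuous_on_closed_vimage[OF compact_imp_closed[OF compact_continuous_image[OF cq compact_Icc]]]
  proof (intro allI impI)
    fix B :: "real set" assume B: "closed B"
    have "H -` B \<inter> q ` {0..2 * pi} = q ` (F -` B \<inter> {0..2 * pi})" using H by auto
    moreover have "closed (F -` B \<inter> {0..2 * pi})" using c B by (simp add: continuous_on_closed_vimage)
    then have "compact (F -` B \<inter> {0..2 * pi})" using closed_Int_compact[of "F -` B \<inter> {0..2 * pi}" "{0..2 * pi}"] by (simp add: inf.assoc)
    ultimately show "closed (H -` B \<inter> q ` {0..2 * pi})"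
      using compact_imp_closed[OF compact_continuous_image[OF cq]] by simp
  qed
  then show thesis using H by (intro that[of H]) (auto simp: q_def)
qed

lemma trig_approximation:
  fixes F :: "real \<Rightarrow> real"
  assumes c: "continuous_on {0..2 * pi} F" and e: "F 0 = F (2 * pi)" and "0 < \<epsilon>"
  obtains P where "smooth P" "\<And>x. P (x + 2 * pi) = P x" "\<And>x. x \<in> {0..2 * pi} \<Longrightarrow> \<bar>F x - P x\<bar> < \<epsilon>"
proof -
  obtain H :: "plane \<Rightarrow> real" where H: "continuous_on ((\<lambda>x. (cos x, sin x)) ` {0..2 * pi}) H"
    "\<And>x. x \<in> {0..2 * pi} \<Longrightarrow> H (cos x, sin x) = F x" using circle_factor[OF c e] by blast
  have K: "compact ((\<lambda>x::real. (cos x, sin x)) ` {0..2 * pi})" by (intro compact_continuous_image continuous_intros compact_Icc)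
  obtain p where p: "real_polynomial_function p" "\<And>w. w \<in> (\<lambda>x. (cos x, sin x)) ` {0..2 * pi} \<Longrightarrow> \<bar>H w - p w\<bar> < \<epsilon>"
    using Stone_Weierstrass_real_polynomial_function[OF K H(1) \<open>0 < \<epsilon>\<close>] by blast
  show thesis
  proof (rule that[of "\<lambda>x. p (cos x, sin x)"])
    show "smooth (\<lambda>x. p (cos x, sin x))" by (rule smooth_trig_polynomial[OF p(1)])
    show "p (cos (x + 2 * pi), sin (x + 2 * pi)) = p (cos x, sin x)" for x by simp
    show "\<bar>F x - p (cos x, sin x)\<bar> < \<epsilon>" if "x \<in> {0..2 * pi}" for x using p(2)[of "(cos x, sin x)"] H(2)[OF that] that by auto
  qed
qed

lemma continuous_periodic_bounded:
  fixes f :: "real \<Rightarrow> 'a::real_normed_vector"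
  assumes c: "continuous_on UNIV f" and per: "\<And>x. f (x + 2 * pi) = f x"
  obtains B where "0 \<le> B" "\<And>x. norm (f x) \<le> B"
proof -
  have "compact (f ` {0..2 * pi})" by (intro compact_continuous_image continuous_on_subset[OF c]) auto
  from compact_imp_bounded[OF this] obtain B where "\<forall>y\<in>f ` {0..2 * pi}. norm y \<le> B" unfolding bounded_iff by (elim exE)
  then have B: "x \<in> {0..2 * pi} \<Longrightarrow> norm (f x) \<le> B" for x by simp
  have "norm (f x) \<le> B" for x
  proof -
    define k where "k = \<lfloor>x / (2 * pi)\<rfloor>"
    define t where "t = x / (2 * pi) - of_int k"
    have t: "0 \<le> t" "t \<le> 1" unfolding t_def k_def by linarith+
    have "x - 2 * pi * of_int k = 2 * pi * t" by (simp add: t_def field_simps)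
    then have b: "norm (f (x - 2 * pi * of_int k)) \<le> B" using t by (simp add: B)
    have "f x = f (x - 2 * pi * of_int k)"
      using shift_int[of "\<lambda>p. f (fst p)" "(x - 2 * pi * of_int k, 0)" k] per by simp
    then show ?thesis using b by simp
  qed
  moreover have "0 \<le> B" by (rule order_trans[OF norm_ge_zero B[of 0]]) simp
  ultimately show thesis using that by blast
qed

lemma set_lint_continuous:
  fixes f :: "real \<Rightarrow> real"
  assumes "continuous_on {a..b} f"
  shows "integrable lborel (\<lambda>x. indicator {a..b} x * f x)"
  using borel_integrable_atLeastAtMost'[OF assms] by (simp add: set_integrable_def)

lemma set_lint_bounded:
  fixes g :: "real \<Rightarrow> real"
  assumes [measurable]: "g \<in> borel_measurable borel" and "\<And>x. \<bar>g x\<bar> \<le> B"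
  shows "integrable lborel (\<lambda>x. indicator {a..b} x * g x)"
proof -
  have "integrable lborel (\<lambda>x. indicator {a..b} x *\<^sub>R g x)"
    by (rule integrableI_bounded_set_indicator[where B = B]) (use assms(2) in \<open>auto simp: emeasure_lborel_Icc_eq\<close>)
  then show ?thesis by simp
qed

lemma set_lint_bounded_le:
  fixes g :: "real \<Rightarrow> real"
  assumes m: "g \<in> borel_measurable borel" and b: "\<And>x. \<bar>g x\<bar> \<le> B" and ab: "a \<le> b"
  shows "\<bar>LBINT x. indicator {a..b} x * g x\<bar> \<le> B * (b - a)"
proof -
  have "\<bar>LBINT x. indicator {a..b} x * g x\<bar> \<le> (LBINT x. indicator {a..b} x * B)"
    unfolding real_norm_def[symmetric]
  proof (rule Bochner_Integration.integral_norm_bound_integral[OF set_lint_bounded[OF m b]])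
    show "integrable lborel (\<lambda>x. indicator {a..b} x * B)"
      by (intro integrable_mult_left integrable_real_indicator) (use ab in auto)
    show "norm (indicator {a..b} x * g x) \<le> indicator {a..b} x * B" for x
      by (cases "x \<in> {a..b}") (simp_all add: b)
  qed
  also have "\<dots> = B * (b - a)" using ab by simp
  finally show ?thesis .
qed

lemma FTC_lint:
  fixes \<phi> :: "real \<Rightarrow> real"
  assumes d: "\<And>x. (\<phi> has_real_derivative P x) (at x)" and c: "continuous_on UNIV P" and ab: "a \<le> b"
  shows "(LBINT x. indicator {a..b} x * P x) = \<phi> b - \<phi> a"
  using integral_FTC_Icc_real[OF ab, of \<phi> P] d c
  by (simp add: mult.commute continuous_on_eq_continuous_at has_field_derivative_at_within)

section \<open>Weak derivatives of periodic functions\<close>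

lemma primitive_parts:
  fixes \<phi> P g :: "real \<Rightarrow> real"
  assumes \<phi>: "\<And>x. (\<phi> has_real_derivative P x) (at x)" and Pc: "continuous_on UNIV P"
    and Pper: "\<And>x. P (x + 2 * pi) = P x" and \<phi>per: "\<And>x. \<phi> (x + 2 * pi) = \<phi> x"
    and g[measurable]: "g \<in> borel_measurable borel" and gb: "\<And>x. \<bar>g x\<bar> \<le> B"
  shows "(LBINT x. indicator {0..2 * pi} x * (P x * (LBINT s. indicator {0..x} s * g s)))
    = \<phi> (2 * pi) * (LBINT s. indicator {0..2 * pi} s * g s) - (LBINT s. indicator {0..2 * pi} s * (\<phi> s * g s))"
proof -
  have \<phi>c: "continuous_on UNIV \<phi>" by (intro continuous_at_imp_continuous_on ballI DERIV_isCont[OF \<phi>])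
  obtain A where A: "\<And>x. norm (P x) \<le> A" using continuous_periodic_bounded[OF Pc Pper] by blast
  have Pm: "P \<in> borel_measurable borel" by (rule borel_measurable_continuous_onI[OF Pc])
  have \<phi>m [measurable]: "\<phi> \<in> borel_measurable borel" by (rule borel_measurable_continuous_onI[OF \<phi>c])
  have "(LBINT x. indicator {0..2 * pi} x * (P x * (LBINT s. indicator {0..x} s * g s))) = (LBINT s. indicator {0..2 * pi} s * (g s * (LBINT x. indicator {s..2 * pi} x * P x)))"
    by (rule fubini_primitive[OF Pm g _ gb, of _ A]) (use A in auto)
  also have "\<dots> = (LBINT s. \<phi> (2 * pi) * (indicator {0..2 * pi} s * g s) - indicator {0..2 * pi} s * (\<phi> s * g s))"
  proof (intro Bochner_Integration.integral_cong refl)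
    fix s :: real
    show "indicator {0..2 * pi} s * (g s * (LBINT x. indicator {s..2 * pi} x * P x)) = \<phi> (2 * pi) * (indicator {0..2 * pi} s * g s) - indicator {0..2 * pi} s * (\<phi> s * g s)"
    proof (cases "s \<in> {0..2 * pi}")
      case True
      then have "(LBINT x. indicator {s..2 * pi} x * P x) = \<phi> (2 * pi) - \<phi> s" by (intro FTC_lint[OF \<phi> Pc]) simp
      with True show ?thesis by (simp only: indicator_simps(1)[OF True]) (simp add: algebra_simps)
    qed simp
  qed
  also have "\<dots> = \<phi> (2 * pi) * (LBINT s. indicator {0..2 * pi} s * g s) - (LBINT s. indicator {0..2 * pi} s * (\<phi> s * g s))"
  proof -
    obtain A' where A': "0 \<le> A'" "\<And>x. norm (\<phi> x) \<le> A'" using continuous_periodic_bounded[OF \<phi>c \<phi>per] by blast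
    have b: "\<bar>\<phi> x * g x\<bar> \<le> A' * B" for x
      unfolding abs_mult by (rule mult_mono) (use A' gb in auto)
    have m: "(\<lambda>x. \<phi> x * g x) \<in> borel_measurable borel" by measurable
    have "integrable lborel (\<lambda>x. indicator {0..2 * pi} x * (\<phi> x * g x))"
      by (rule set_lint_bounded[OF m b])
    moreover have "integrable lborel (\<lambda>x. indicator {0..2 * pi} x * g x)" by (rule set_lint_bounded[OF g gb])
    ultimately show ?thesis by simp
  qed
  finally show ?thesis .
qed

text \<open>The difference \<open>F\<close> of \<open>f\<close> and the primitive of
  \<open>g\<close> is orthogonal to derivatives of smooth periodic functions, that is, to smooth
  periodic functions of mean zero. With its mean \<open>c\<close> removed it is orthogonal to all
  smooth periodic functions and hence, by uniform trigonometric approximation, to itself.\<close>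

lemma du_Bois_Reymond:
  fixes f g :: "real \<Rightarrow> real"
  assumes f: "continuous_on UNIV f" and fper: "\<And>x. f (x + 2 * pi) = f x"
    and g[measurable]: "g \<in> borel_measurable borel" and gb: "\<And>x. \<bar>g x\<bar> \<le> B"
    and weak: "\<And>\<phi> \<phi>'. smooth \<phi> \<Longrightarrow> (\<And>x. \<phi> (x + 2 * pi) = \<phi> x) \<Longrightarrow> (\<And>x. (\<phi> has_real_derivative \<phi>' x) (at x)) \<Longrightarrow>
      (LBINT x. indicator {0..2 * pi} x * (\<phi>' x * f x)) = - (LBINT x. indicator {0..2 * pi} x * (\<phi> x * g x))"
    and x: "x \<in> {0..2 * pi}"
  shows "f x = f 0 + (LBINT s. indicator {0..x} s * g s)"
proof -
  define G where "G x = (LBINT s. indicator {0..x} s * g s)" for x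
  have gi: "integrable lborel (\<lambda>x. indicator {a..b} x * g x)" for a b by (rule set_lint_bounded[OF g gb])
  have Gdiff: "G b - G a = (LBINT s. indicator {a<..b} s * g s)" if "0 \<le> a" "a \<le> b" for a b
  proof -
    have "G b - G a = (LBINT s. indicator {0..b} s * g s - indicator {0..a} s * g s)"
      unfolding G_def by (rule Bochner_Integration.integral_diff[symmetric, OF gi gi])
    also have "\<dots> = (LBINT s. indicator {a<..b} s * g s)"
      by (intro Bochner_Integration.integral_cong) (use that in \<open>auto simp: indicator_def\<close>)
    finally show ?thesis .
  qed
  have AEeq: "(LBINT s. indicator {a<..b} s * g s) = (LBINT s. indicator {a..b} s * g s)" for a b
    by (rule integral_cong_AE) (use AE_lborel_singleton[of a] in \<open>auto elim!: eventually_mono simp: indicator_def\<close>)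
  have Glip: "\<bar>G b - G a\<bar> \<le> B * (b - a)" if "0 \<le> a" "a \<le> b" for a b
    unfolding Gdiff[OF that] AEeq by (rule set_lint_bounded_le[OF g gb that(2)])
  have B0: "0 \<le> B" using gb[of 0] by linarith
  have Gc: "continuous_on {0..2 * pi} G"
  proof (rule lipschitz_on_continuous_on)
    show "B-lipschitz_on {0..2 * pi} G"
    proof (rule lipschitz_onI)
      fix a b assume ab: "a \<in> {0..2 * pi}" "b \<in> {0..2 * pi}"
      show "dist (G a) (G b) \<le> B * dist a b"
        using Glip[of a b] Glip[of b a] ab by (cases "a \<le> b") (auto simp: dist_real_def abs_minus_commute)
    qed (rule B0)
  qed
  define m where "m = (LBINT x. indicator {0..2 * pi} x * g x)"
  have one: "smooth (\<lambda>x::real. 1)" unfolding smooth_def using C_k_const by blast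
  \<comment> \<open>Testing with the constant 1 shows that \<open>g\<close> has mean zero, so its
    primitive \<open>G\<close> takes equal values at the two ends.\<close>
  have "(LBINT x. indicator {0..2 * pi} x * (0 * f x)) = - (LBINT x. indicator {0..2 * pi} x * (1 * g x))"
    by (rule weak[OF one]) auto
  then have m0: "G (2 * pi) = 0" by (simp add: G_def)
  define F where "F x = f x - G x" for x
  have Fc: "continuous_on {0..2 * pi} F" unfolding F_def by (intro continuous_intros continuous_on_subset[OF f] Gc) auto
  have G00: "G 0 = 0" 
  proof -
    have "G 0 = (LBINT s. indicator {0<..0} s * g s)" unfolding G_def AEeq ..
    then show ?thesis by simp
  qed
  have Fe: "F 0 = F (2 * pi)" using fper[of 0] m0 G00 by (simp add: F_def)
  have orth: "(LBINT x. indicator {0..2 * pi} x * (P x * F x)) = 0"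
    if P: "smooth P" "\<And>x. P (x + 2 * pi) = P x" and mean: "(LBINT x. indicator {0..2 * pi} x * P x) = 0" for P
  proof -
    have Pc: "continuous_on UNIV P" using P(1) C_k_continuous unfolding smooth_def by blast
    obtain \<phi> where \<phi>: "\<And>x. (\<phi> has_real_derivative P x) (at x)" using primitive_exists[OF Pc] by blast
    have \<phi>c: "continuous_on UNIV \<phi>" by (intro continuous_at_imp_continuous_on ballI DERIV_isCont[OF \<phi>])
    have "\<phi> (2 * pi) = \<phi> 0" using FTC_lint[OF \<phi> Pc, of 0 "2 * pi"] mean by simp
    then have \<phi>per: "\<phi> (x + 2 * pi) = \<phi> x" for x by (rule periodic_of_mean_zero[OF \<phi> P(2)])
    have "C_k k \<phi>" for k
    proof (cases k)
      case (Suc j)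
      have "C_k j (\<lambda>x. v * P x)" for v using P(1) C_k_mult(1)[OF C_k_const] unfolding smooth_def by blast
      then show ?thesis unfolding Suc by (rule C_k_SucI[OF \<phi>])
    qed (use \<phi>c in simp)
    then have "smooth \<phi>" by (simp add: smooth_def)
    from weak[OF this \<phi>per \<phi>] have w: "(LBINT x. indicator {0..2 * pi} x * (P x * f x)) = - (LBINT x. indicator {0..2 * pi} x * (\<phi> x * g x))" .
    have PG: "(LBINT x. indicator {0..2 * pi} x * (P x * G x)) = - (LBINT s. indicator {0..2 * pi} s * (\<phi> s * g s))"
      using primitive_parts[OF \<phi> Pc P(2) \<phi>per g gb] m0 by (simp add: G_def)
    have "(LBINT x. indicator {0..2 * pi} x * (P x * F x)) = (LBINT x. indicator {0..2 * pi} x * (P x * f x) - indicator {0..2 * pi} x * (P x * G x))"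
      by (intro Bochner_Integration.integral_cong refl) (simp add: F_def right_diff_distrib)
    also have "\<dots> = 0"
    proof -
      have Pc': "continuous_on {0..2 * pi} P" and fc': "continuous_on {0..2 * pi} f"
        by (rule continuous_on_subset[OF Pc], simp, rule continuous_on_subset[OF f], simp)
      have "integrable lborel (\<lambda>x. indicator {0..2 * pi} x * (P x * f x))" "integrable lborel (\<lambda>x. indicator {0..2 * pi} x * (P x * G x))"
        by (intro set_lint_continuous continuous_on_mult Pc' fc' Gc)+
      then show ?thesis by (simp add: w PG)
    qed
    finally show ?thesis .
  qed
  define c where "c = (LBINT x. indicator {0..2 * pi} x * F x) / (2 * pi)"
  have Fi: "integrable lborel (\<lambda>x. indicator {0..2 * pi} x * F x)" by (rule set_lint_continuous[OF Fc])
  have Ii: "(LBINT x. indicator {0..2 * pi} x * a) = 2 * pi * a" "integrable lborel (\<lambda>x. indicator {0..2 * pi} x * a)" for a :: real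
    by (simp, intro integrable_mult_left integrable_real_indicator, auto)
  define F0 where "F0 x = F x - c" for x
  have F0c: "continuous_on {0..2 * pi} F0" unfolding F0_def by (intro continuous_intros Fc)
  have orth0: "(LBINT x. indicator {0..2 * pi} x * (P x * F0 x)) = 0"
    if P: "smooth P" "\<And>x. P (x + 2 * pi) = P x" for P
  proof -
    have Pc: "continuous_on UNIV P" using P(1) C_k_continuous unfolding smooth_def by blast
    have Pi: "integrable lborel (\<lambda>x. indicator {0..2 * pi} x * P x)" by (rule set_lint_continuous[OF continuous_on_subset[OF Pc]]) simp
    define a where "a = (LBINT x. indicator {0..2 * pi} x * P x) / (2 * pi)"
    have s: "smooth (\<lambda>x. P x - a)"
    proof -
      have "C_k k (\<lambda>x. P x + (- a))" for k
        by (rule C_k_mult(2)[OF _ C_k_const]) (use P(1) in \<open>simp add: smooth_def\<close>)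
      then show ?thesis by (simp add: smooth_def)
    qed
    have IP: "(LBINT x. indicator {0..2 * pi} x * P x) = 2 * pi * a" by (simp add: a_def)
    have IF: "(LBINT x. indicator {0..2 * pi} x * F x) = 2 * pi * c" by (simp add: c_def)
    have "(LBINT x. indicator {0..2 * pi} x * (P x - a)) = (LBINT x. indicator {0..2 * pi} x * P x - indicator {0..2 * pi} x * a)"
      by (simp only: right_diff_distrib)
    also have "\<dots> = 0" unfolding Bochner_Integration.integral_diff[OF Pi Ii(2)] IP Ii(1) by simp
    finally have o: "(LBINT x. indicator {0..2 * pi} x * ((P x - a) * F x)) = 0"
      by (intro orth[OF s]) (simp_all add: P(2))
    have PFi: "integrable lborel (\<lambda>x. indicator {0..2 * pi} x * ((P x - a) * F x))"
      by (intro set_lint_continuous continuous_on_mult continuous_on_diff continuous_on_const Fc) (rule continuous_on_subset[OF Pc], simp)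
    have aF: "integrable lborel (\<lambda>x. a * (indicator {0..2 * pi} x * F x))" using Fi by (rule integrable_mult_right)
    have cP: "integrable lborel (\<lambda>x. c * (indicator {0..2 * pi} x * P x))" using Pi by (rule integrable_mult_right)
    have "(LBINT x. indicator {0..2 * pi} x * (P x * F0 x)) = (LBINT x. indicator {0..2 * pi} x * ((P x - a) * F x) + (a * (indicator {0..2 * pi} x * F x) - c * (indicator {0..2 * pi} x * P x)))"
      by (intro Bochner_Integration.integral_cong refl) (simp add: F0_def ring_distribs)
    also have "\<dots> = 0 + (a * (2 * pi * c) - c * (2 * pi * a))"
      unfolding Bochner_Integration.integral_add[OF PFi Bochner_Integration.integrable_diff[OF aF cP]] Bochner_Integration.integral_diff[OF aF cP] o integral_mult_right_zero IP IF ..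
    finally show ?thesis by simp
  qed
  have F0e: "F0 0 = F0 (2 * pi)" using Fe by (simp add: F0_def)
  define I where "I = (LBINT x. indicator {0..2 * pi} x * (F0 x)\<^sup>2)"
  define J where "J = (LBINT x. indicator {0..2 * pi} x * \<bar>F0 x\<bar>)"
  have Ji: "integrable lborel (\<lambda>x. indicator {0..2 * pi} x * \<bar>F0 x\<bar>)" by (intro set_lint_continuous continuous_intros F0c)
  have I2: "integrable lborel (\<lambda>x. indicator {0..2 * pi} x * (F0 x)\<^sup>2)" by (intro set_lint_continuous continuous_intros F0c)
  \<comment> \<open>\<open>I\<close> is also the integral of \<open>F0 * (F0 - P)\<close>, since
    \<open>P\<close> integrates to zero against \<open>F0\<close>.\<close>
  have small: "I \<le> \<epsilon> * J" if \<epsilon>: "0 < \<epsilon>" for \<epsilon>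
  proof -
    obtain P where P: "smooth P" "\<And>x. P (x + 2 * pi) = P x" "\<And>x. x \<in> {0..2 * pi} \<Longrightarrow> \<bar>F0 x - P x\<bar> < \<epsilon>"
      using trig_approximation[OF F0c F0e \<epsilon>] by blast
    have Pc: "continuous_on UNIV P" using P(1) C_k_continuous unfolding smooth_def by blast
    have PFi: "integrable lborel (\<lambda>x. indicator {0..2 * pi} x * (P x * F0 x))"
      by (intro set_lint_continuous continuous_on_mult F0c) (rule continuous_on_subset[OF Pc], simp)
    have "I = I - (LBINT x. indicator {0..2 * pi} x * (P x * F0 x))" using orth0[OF P(1,2)] by simp
    also have "\<dots> = (LBINT x. indicator {0..2 * pi} x * (F0 x)\<^sup>2 - indicator {0..2 * pi} x * (P x * F0 x))"
      unfolding I_def by (rule Bochner_Integration.integral_diff[symmetric, OF I2 PFi])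
    also have "\<dots> \<le> (LBINT x. \<epsilon> * (indicator {0..2 * pi} x * \<bar>F0 x\<bar>))"
    proof (rule integral_mono)
      fix x :: real
      show "indicator {0..2 * pi} x * (F0 x)\<^sup>2 - indicator {0..2 * pi} x * (P x * F0 x) \<le> \<epsilon> * (indicator {0..2 * pi} x * \<bar>F0 x\<bar>)"
      proof (cases "x \<in> {0..2 * pi}")
        case True
        have "(F0 x)\<^sup>2 - P x * F0 x \<le> \<bar>(F0 x - P x) * F0 x\<bar>" by (simp add: power2_eq_square left_diff_distrib)
        also have "\<dots> \<le> \<epsilon> * \<bar>F0 x\<bar>" unfolding abs_mult using P(3)[OF True] by (intro mult_right_mono) auto
        finally show ?thesis using True by simp
      qed simp
    qed (use I2 PFi Ji in auto)
    also have "\<dots> = \<epsilon> * J" using Ji by (simp add: J_def)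
    finally show ?thesis .
  qed
  have J0: "0 \<le> J" unfolding J_def by (intro integral_nonneg_AE AE_I2) simp
  have "I \<le> 0"
  proof (rule field_le_epsilon)
    fix e :: real assume e: "0 < e"
    have "I \<le> (e / (J + 1)) * J" using e J0 by (intro small) simp
    also have "\<dots> = e * (J / (J + 1))" by simp
    also have "\<dots> \<le> e * 1" using e J0 by (intro mult_left_mono) auto
    finally show "I \<le> 0 + e" by simp
  qed
  moreover have "I = integral {0..2 * pi} (\<lambda>x. (F0 x)\<^sup>2)"
    unfolding I_def using set_borel_integral_eq_integral(2)[of "{0..2 * pi}" "\<lambda>x. (F0 x)\<^sup>2"] I2
    by (simp add: set_lebesgue_integral_def set_integrable_def)
  moreover have "0 \<le> integral {0..2 * pi} (\<lambda>x. (F0 x)\<^sup>2)"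
    by (intro Henstock_Kurzweil_Integration.integral_nonneg integrable_continuous_interval continuous_intros F0c) auto
  ultimately have "integral (cbox 0 (2 * pi)) (\<lambda>x. (F0 x)\<^sup>2) = 0" by simp
  moreover have "((\<lambda>x. (F0 x)\<^sup>2) has_integral integral (cbox 0 (2 * pi)) (\<lambda>x. (F0 x)\<^sup>2)) (cbox 0 (2 * pi))"
    by (intro integrable_integral integrable_continuous) (use F0c in \<open>auto intro!: continuous_intros\<close>)
  ultimately have z: "(F0 y)\<^sup>2 = 0" if "y \<in> {0..2 * pi}" for y
    by (intro has_integral_0_cbox_imp_0[of 0 "2 * pi" "\<lambda>x. (F0 x)\<^sup>2"]) (use that F0c in \<open>auto intro!: continuous_intros simp: box_real not_le[THEN iffD2, OF pi_gt_zero]\<close>)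
  have "F x = F 0" using z[of x] z[of 0] x by (simp add: F0_def)
  then show ?thesis by (simp add: F_def G00) (simp add: G_def)
qed

text \<open>The constant \<open>f 0\<close> is split off, so that the rest is a primitive vanishing
  at 0 and \<open>primitive_parts\<close> applies; the constant contributes nothing because the
  derivative \<open>P\<close> of a periodic function has mean zero.\<close>

lemma weak_primitive:
  fixes f g :: "real \<Rightarrow> real"
  assumes g: "g \<in> borel_measurable borel" and gb: "\<And>x. \<bar>g x\<bar> \<le> B"
    and fg: "\<And>a b. a \<le> b \<Longrightarrow> (LBINT x. indicator {a..b} x * g x) = f b - f a"
    and per: "f (2 * pi) = f 0"
    and \<phi>: "\<And>x. (\<phi> has_real_derivative P x) (at x)" and Pc: "continuous_on UNIV P"
    and Pper: "\<And>x. P (x + 2 * pi) = P x" and \<phi>per: "\<And>x. \<phi> (x + 2 * pi) = \<phi> x"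
  shows "(LBINT x. indicator {0..2 * pi} x * (P x * f x)) = - (LBINT s. indicator {0..2 * pi} s * (\<phi> s * g s))"
proof -
  have "continuous_on {0..2 * pi} f"
  proof (rule lipschitz_on_continuous_on)
    show "B-lipschitz_on {0..2 * pi} f"
    proof (rule lipschitz_onI)
      have 1: "\<bar>f b - f a\<bar> \<le> B * (b - a)" if "a \<le> b" for a b
        using set_lint_bounded_le[OF g gb that] fg[OF that] by simp
      show "dist (f a) (f b) \<le> B * dist a b" for a b
        using 1[of a b] 1[of b a] by (cases "a \<le> b") (auto simp: dist_real_def abs_minus_commute)
      show "0 \<le> B" using gb[of 0] by linarith
    qed
  qed
  then have Pf: "integrable lborel (\<lambda>x. indicator {0..2 * pi} x * (P x * (f x - f 0)))"
    by (intro set_lint_continuous continuous_on_mult continuous_on_diff continuous_on_const) (rule continuous_on_subset[OF Pc], simp)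
  have Pi: "integrable lborel (\<lambda>x. indicator {0..2 * pi} x * P x)"
    by (rule set_lint_continuous) (rule continuous_on_subset[OF Pc], simp)
  have P0: "(LBINT x. indicator {0..2 * pi} x * P x) = 0" using FTC_lint[OF \<phi> Pc, of 0 "2 * pi"] \<phi>per[of 0] by simp
  have "(LBINT x. indicator {0..2 * pi} x * (P x * f x)) = (LBINT x. indicator {0..2 * pi} x * (P x * (f x - f 0)) + f 0 * (indicator {0..2 * pi} x * P x))"
    by (intro Bochner_Integration.integral_cong refl) (simp add: algebra_simps)
  also have "\<dots> = (LBINT x. indicator {0..2 * pi} x * (P x * (f x - f 0)))"
    using Pf Pi P0 by simp
  also have "\<dots> = (LBINT x. indicator {0..2 * pi} x * (P x * (LBINT s. indicator {0..x} s * g s)))"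
  proof (intro Bochner_Integration.integral_cong refl)
    fix x :: real
    show "indicator {0..2 * pi} x * (P x * (f x - f 0)) = indicator {0..2 * pi} x * (P x * (LBINT s. indicator {0..x} s * g s))"
      using fg[of 0 x] by (cases "x \<in> {0..2 * pi}") simp_all
  qed
  also have "\<dots> = - (LBINT s. indicator {0..2 * pi} s * (\<phi> s * g s))"
    unfolding primitive_parts[OF \<phi> Pc Pper \<phi>per g gb] using fg[of 0 "2 * pi"] per by simp
  finally show ?thesis .
qed

lemma smooth_derivative:
  fixes \<phi> :: "real \<Rightarrow> real"
  assumes "smooth \<phi>" and per: "\<And>x. \<phi> (x + 2 * pi) = \<phi> x"
  shows "(\<phi> has_real_derivative deriv \<phi> x) (at x)" "continuous_on UNIV (deriv \<phi>)" "deriv \<phi> (x + 2 * pi) = deriv \<phi> x"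
proof -
  have "C_k (Suc 0) \<phi>" using assms by (simp add: smooth_def)
  then obtain \<phi>' where \<phi>': "\<And>x. (\<phi> has_real_derivative \<phi>' x) (at x)" "C_k 0 \<phi>'" using C_k_SucD by blast
  then have e: "deriv \<phi> = \<phi>'" by (auto simp: DERIV_imp_deriv)
  show "(\<phi> has_real_derivative deriv \<phi> x) (at x)" "continuous_on UNIV (deriv \<phi>)" using \<phi>' by (simp_all add: e)
  have "(\<lambda>x. \<phi> (x + 2 * pi)) = \<phi>" using per by auto
  moreover have "((\<lambda>x. \<phi> (x + 2 * pi)) has_real_derivative \<phi>' (x + 2 * pi)) (at x)"
    using DERIV_shift[of \<phi> "\<phi>' (x + 2 * pi)" x "2 * pi"] \<phi>' by simp
  ultimately have "(\<phi> has_real_derivative \<phi>' (x + 2 * pi)) (at x)" by simp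
  then show "deriv \<phi> (x + 2 * pi) = deriv \<phi> x" unfolding e using \<phi>'(1) DERIV_unique by blast
qed

lemma Linf_norm_le:
  assumes "f \<in> borel_measurable borel" "\<And>x. norm (f x) \<le> B"
  shows "Linf_norm f \<le> ennreal B"
  unfolding Linf_norm_def by (rule esssup_I) (use assms in \<open>auto intro: ennreal_leI\<close>)

text \<open>Each component has a density bounded by \<open>L\<close>, and the pair of densities is a
  weak derivative of norm at most \<open>2 * L\<close>. The bound serves both the curve at one time
  and the difference of the curves at two times.\<close>

lemma W1inf_norm_le:
  fixes f :: "real \<Rightarrow> plane"
  assumes lip: "\<And>x y. norm (f x - f y) \<le> L * \<bar>x - y\<bar>" and L: "0 < L"
    and per: "\<And>x. f (x + 2 * pi) = f x" and bd: "\<And>x. norm (f x) \<le> B"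
  shows "W1inf_norm f \<le> ennreal (B + 2 * L)"
proof -
  have cont: "continuous_on UNIV f"
  proof (rule lipschitz_on_continuous_on)
    show "L-lipschitz_on UNIV f" using lip L by (auto simp: lipschitz_on_def dist_norm)
  qed
  have l1: "\<bar>fst (f x) - fst (f y)\<bar> \<le> L * \<bar>x - y\<bar>" and l2: "\<bar>snd (f x) - snd (f y)\<bar> \<le> L * \<bar>x - y\<bar>" for x y
    using lip[of x y] abs_fst_le_norm[of "f x - f y"] abs_snd_le_norm[of "f x - f y"] by auto
  obtain g1 where g1: "g1 \<in> borel_measurable borel" "\<And>x. \<bar>g1 x\<bar> \<le> L"
    "\<And>a b. a \<le> b \<Longrightarrow> (LBINT x. indicator {a..b} x * g1 x) = fst (f b) - fst (f a)"
    using lipschitz_density[of "\<lambda>x. fst (f x)", OF l1 L] by blast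
  obtain g2 where g2: "g2 \<in> borel_measurable borel" "\<And>x. \<bar>g2 x\<bar> \<le> L"
    "\<And>a b. a \<le> b \<Longrightarrow> (LBINT x. indicator {a..b} x * g2 x) = snd (f b) - snd (f a)"
    using lipschitz_density[of "\<lambda>x. snd (f x)", OF l2 L] by blast
  \<comment> \<open>\<open>weak_deriv\<close> asks for a derivative that is periodic on the line, so
    the densities are read at the representative \<open>r x\<close> in \<open>[0, 2 pi)\<close>; on
    the cell this alters them at most at the right end.\<close>
  define r where "r x = x - 2 * pi * of_int \<lfloor>x / (2 * pi)\<rfloor>" for x :: real
  have [measurable]: "r \<in> borel_measurable borel" unfolding r_def by measurable
  note [measurable] = g1(1) g2(1)
  define g where "g x = (g1 (r x), g2 (r x))" for x
  have gm [measurable]: "g \<in> borel_measurable borel" unfolding g_def by (intro borel_measurable_Pair) measurable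
  have [measurable]: "(\<lambda>s. fst (g s)) \<in> borel_measurable borel" "(\<lambda>s. snd (g s)) \<in> borel_measurable borel" unfolding g_def by simp_all
  have gper: "g (x + 2 * pi) = g x" for x
  proof -
    have "(x + 2 * pi) / (2 * pi) = x / (2 * pi) + 1" by (simp add: field_simps)
    then have "\<lfloor>(x + 2 * pi) / (2 * pi)\<rfloor> = \<lfloor>x / (2 * pi)\<rfloor> + 1" by simp
    then have "r (x + 2 * pi) = r x" by (simp add: r_def algebra_simps)
    then show ?thesis by (simp add: g_def)
  qed
  have rx: "r x = x" if "x \<in> {0..<2 * pi}" for x
  proof -
    have "0 \<le> x / (2 * pi)" "x / (2 * pi) < 1" using that by auto
    then have "\<lfloor>x / (2 * pi)\<rfloor> = 0" by linarith
    then show ?thesis by (simp add: r_def)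
  qed
  have gae: "AE x in lborel. x \<in> {0..2 * pi} \<longrightarrow> g x = (g1 x, g2 x)"
    using AE_lborel_singleton[of "2 * pi"] by eventually_elim (auto simp: g_def rx)
  have gb: "norm (g x) \<le> 2 * L" for x
    using norm_Pair_le[of "g1 (r x)" "g2 (r x)"] g1(2)[of "r x"] g2(2)[of "r x"] unfolding g_def real_norm_def by linarith
  have "weak_deriv f g"
    unfolding weak_deriv_def
  proof (intro conjI allI impI)
    show "g \<in> borel_measurable borel" by (rule gm)
    show "g (\<alpha> + 2 * pi) = g \<alpha>" for \<alpha> by (rule gper)
    show "set_integrable lborel {0..2 * pi} f"
      by (rule borel_integrable_atLeastAtMost') (rule continuous_on_subset[OF cont], simp)
    show "set_integrable lborel {0..2 * pi} g"
      unfolding set_integrable_def by (rule integrableI_bounded_set_indicator[where B = "2 * L"]) (use gb in auto)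
    fix \<phi> :: "real \<Rightarrow> real" assume \<phi>: "smooth \<phi> \<and> (\<forall>\<alpha>. \<phi> (\<alpha> + 2 * pi) = \<phi> \<alpha>)"
    then have sm: "smooth \<phi>" and \<phi>per: "\<And>x. \<phi> (x + 2 * pi) = \<phi> x" by auto
    note d = smooth_derivative[OF sm \<phi>per]
    have \<phi>c: "continuous_on UNIV \<phi>" by (intro continuous_at_imp_continuous_on ballI DERIV_isCont[OF d(1)])
    have [measurable]: "\<phi> \<in> borel_measurable borel" by (rule borel_measurable_continuous_onI[OF \<phi>c])
    obtain A where A: "0 \<le> A" "\<And>x. norm (\<phi> x) \<le> A" using continuous_periodic_bounded[OF \<phi>c \<phi>per] by blast
    have i1: "integrable lborel (\<lambda>\<alpha>. indicator {0..2 * pi} \<alpha> *\<^sub>R (deriv \<phi> \<alpha> *\<^sub>R f \<alpha>))"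
      using borel_integrable_atLeastAtMost'[of 0 "2 * pi" "\<lambda>\<alpha>. deriv \<phi> \<alpha> *\<^sub>R f \<alpha>"] continuous_on_subset[OF cont, of "{0..2 * pi}"] continuous_on_subset[OF d(2), of "{0..2 * pi}"]
      by (simp add: set_integrable_def continuous_on_scaleR)
    have i2: "integrable lborel (\<lambda>\<alpha>. indicator {0..2 * pi} \<alpha> *\<^sub>R (\<phi> \<alpha> *\<^sub>R g \<alpha>))"
    proof (rule integrableI_bounded_set_indicator[where B = "A * (2 * L)"])
      show "AE x in lborel. x \<in> {0..2 * pi} \<longrightarrow> norm (\<phi> x *\<^sub>R g x) \<le> A * (2 * L)"
        using A gb by (intro AE_I2 impI) (auto intro!: mult_mono)
    qed auto
    have p1: "(LBINT x. indicator {0..2 * pi} x * (deriv \<phi> x * fst (f x))) = - (LBINT s. indicator {0..2 * pi} s * (\<phi> s * g1 s))"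
      by (rule weak_primitive[OF g1 _ d(1,2,3) \<phi>per]) (use per[of 0] in simp_all)
    have p2: "(LBINT x. indicator {0..2 * pi} x * (deriv \<phi> x * snd (f x))) = - (LBINT s. indicator {0..2 * pi} s * (\<phi> s * g2 s))"
      by (rule weak_primitive[OF g2 _ d(1,2,3) \<phi>per]) (use per[of 0] in simp_all)
    have e1: "(LBINT s. indicator {0..2 * pi} s * (\<phi> s * fst (g s))) = (LBINT s. indicator {0..2 * pi} s * (\<phi> s * g1 s))"
      by (rule integral_cong_AE) (measurable, use gae in \<open>auto elim!: eventually_mono simp: indicator_def\<close>)
    have e2: "(LBINT s. indicator {0..2 * pi} s * (\<phi> s * snd (g s))) = (LBINT s. indicator {0..2 * pi} s * (\<phi> s * g2 s))"
      by (rule integral_cong_AE) (measurable, use gae in \<open>auto elim!: eventually_mono simp: indicator_def\<close>)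
    show "(LINT \<alpha>:{0..2 * pi}|lborel. deriv \<phi> \<alpha> *\<^sub>R f \<alpha>) = - (LINT \<alpha>:{0..2 * pi}|lborel. \<phi> \<alpha> *\<^sub>R g \<alpha>)"
      unfolding set_lebesgue_integral_def
    proof (rule prod_eqI)
      show "fst (LBINT x. indicator {0..2 * pi} x *\<^sub>R deriv \<phi> x *\<^sub>R f x) = fst (- (LBINT x. indicator {0..2 * pi} x *\<^sub>R \<phi> x *\<^sub>R g x))"
        using integral_bounded_linear[OF bounded_linear_fst i1] integral_bounded_linear[OF bounded_linear_fst i2] p1 e1 by (simp add: mult.assoc)
      show "snd (LBINT x. indicator {0..2 * pi} x *\<^sub>R deriv \<phi> x *\<^sub>R f x) = snd (- (LBINT x. indicator {0..2 * pi} x *\<^sub>R \<phi> x *\<^sub>R g x))"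
        using integral_bounded_linear[OF bounded_linear_snd i1] integral_bounded_linear[OF bounded_linear_snd i2] p2 e2 by (simp add: mult.assoc)
    qed
  qed
  then have "(INF g\<in>{g. weak_deriv f g}. Linf_norm g) \<le> Linf_norm g" by (intro INF_lower) simp
  also have "\<dots> \<le> ennreal (2 * L)" by (rule Linf_norm_le[OF gm gb])
  finally have 1: "(INF g\<in>{g. weak_deriv f g}. Linf_norm g) \<le> ennreal (2 * L)" .
  have 2: "Linf_norm f \<le> ennreal B" by (rule Linf_norm_le[OF borel_measurable_continuous_onI[OF cont] bd])
  have "0 \<le> B" using bd[of 0] norm_ge_zero order_trans by blast
  then show ?thesis unfolding W1inf_norm_def using add_mono[OF 2 1] L by simp
qed

text \<open>Points of the same period fall under the hypothesis; for neighbouring periods the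
  comparison passes through the common end point, where \<open>f (2 * pi) = f 0\<close>; points of
  periods further apart are at least \<open>2 * pi\<close> from each other, as far as any two
  representatives can be.\<close>

lemma periodic_lipschitz:
  fixes f :: "real \<Rightarrow> real"
  assumes per: "\<And>x. f (x + 2 * pi) = f x" and M: "0 \<le> M"
    and lip: "\<And>x y. x \<in> {0..2 * pi} \<Longrightarrow> y \<in> {0..2 * pi} \<Longrightarrow> \<bar>f x - f y\<bar> \<le> M * \<bar>x - y\<bar>"
  shows "\<bar>f x - f y\<bar> \<le> M * \<bar>x - y\<bar>"
proof -
  have main: "\<bar>f x - f y\<bar> \<le> M * \<bar>x - y\<bar>" if xy: "x \<le> y" for x y
  proof -
    define k l where "k = \<lfloor>x / (2 * pi)\<rfloor>" and "l = \<lfloor>y / (2 * pi)\<rfloor>"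
    define s t where "s = x / (2 * pi) - of_int k" and "t = y / (2 * pi) - of_int l"
    have st: "0 \<le> s" "s \<le> 1" "0 \<le> t" "t \<le> 1" unfolding s_def t_def k_def l_def by linarith+
    have x: "x = 2 * pi * s + 2 * pi * of_int k" and y: "y = 2 * pi * t + 2 * pi * of_int l" by (simp_all add: s_def t_def field_simps)
    have sh: "f (a + 2 * pi * of_int n) = f a" for a and n :: int
      using shift_int[of "\<lambda>p. f (fst p)" "(a, 0)" n] per by simp
    have fx: "f x = f (2 * pi * s)" "f y = f (2 * pi * t)" unfolding x y by (rule sh)+
    have in1: "2 * pi * s \<in> {0..2 * pi}" "2 * pi * t \<in> {0..2 * pi}" using st by auto
    have kl: "k \<le> l" unfolding k_def l_def using xy by (intro floor_mono divide_right_mono) auto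
    consider "l = k" | "l = k + 1" | "k + 2 \<le> l" using kl by linarith
    then show ?thesis
    proof cases
      case 1
      then have "x - y = 2 * pi * s - 2 * pi * t" unfolding x y by simp
      then show ?thesis unfolding fx using lip[OF in1] by simp
    next
      case 2
      have "f (2 * pi) = f 0" using per[of 0] by simp
      then have "\<bar>f (2 * pi * s) - f (2 * pi * t)\<bar> \<le> \<bar>f (2 * pi * s) - f (2 * pi)\<bar> + \<bar>f 0 - f (2 * pi * t)\<bar>" by linarith
      also have "\<dots> \<le> M * \<bar>2 * pi * s - 2 * pi\<bar> + M * \<bar>0 - 2 * pi * t\<bar>" using in1 by (intro add_mono lip) auto
      also have "\<dots> = M * \<bar>x - y\<bar>"
      proof -
        have "2 * pi * s \<le> 2 * pi" "0 \<le> 2 * pi * t" using in1 by auto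
        then have "\<bar>2 * pi * s - 2 * pi\<bar> = 2 * pi - 2 * pi * s" "\<bar>0 - 2 * pi * t\<bar> = 2 * pi * t" by auto
        moreover have "\<bar>x - y\<bar> = 2 * pi - 2 * pi * s + 2 * pi * t" using xy 2 x y by (simp add: algebra_simps)
        ultimately show ?thesis by (simp only: distrib_left)
      qed
      finally show ?thesis unfolding fx .
    next
      case 3
      have "2 * pi * (of_int (k + 2) :: real) \<le> 2 * pi * of_int l" using 3 by (intro mult_left_mono) (simp_all only: of_int_le_iff, simp)
      moreover have "2 * pi * (of_int (k + 2) :: real) = 2 * pi * of_int k + 4 * pi" by (simp add: algebra_simps)
      moreover have "2 * pi * s \<le> 2 * pi" "0 \<le> 2 * pi * t" using in1 by auto
      ultimately have "2 * pi \<le> y - x" unfolding x y by linarith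
      moreover have "0 \<le> 2 * pi * s" "2 * pi * s \<le> 2 * pi" "0 \<le> 2 * pi * t" "2 * pi * t \<le> 2 * pi" using in1 by auto
      then have "\<bar>2 * pi * s - 2 * pi * t\<bar> \<le> 2 * pi" unfolding abs_le_iff by linarith
      ultimately have "M * \<bar>2 * pi * s - 2 * pi * t\<bar> \<le> M * \<bar>x - y\<bar>" using M by (intro mult_left_mono) auto
      then show ?thesis unfolding fx using lip[OF in1] by linarith
    qed
  qed
  show ?thesis using main[of x y] main[of y x] by (cases "x \<le> y") (auto simp: abs_minus_commute)
qed

text \<open>Converse to \<open>W1inf_norm_le\<close>. A weak derivative with essential supremum
  \<open>M\<close> is replaced by zero on the null set where it exceeds \<open>M\<close>; then
  \<open>du_Bois_Reymond\<close> exhibits each component of \<open>f\<close> as a primitive of a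
  function bounded by \<open>M\<close>. The constant \<open>2 * M\<close> comes from adding the two
  components.\<close>

lemma W1inf_norm_finite:
  fixes f :: "real \<Rightarrow> plane"
  assumes cont: "continuous_on UNIV f" and per: "\<And>x. f (x + 2 * pi) = f x" and fin: "W1inf_norm f < \<infinity>"
  obtains L where "0 \<le> L" "\<And>x y. norm (f x - f y) \<le> L * \<bar>x - y\<bar>"
proof -
  have "(INF g\<in>{g. weak_deriv f g}. Linf_norm g) < \<infinity>" using fin unfolding W1inf_norm_def by auto
  then obtain g where wd: "weak_deriv f g" and lg: "Linf_norm g < \<infinity>" unfolding INF_less_iff by auto
  have gm [measurable]: "g \<in> borel_measurable borel" using wd by (simp add: weak_deriv_def)
  define M where "M = enn2real (Linf_norm g)"
  have "AE x in lborel. ennreal (norm (g x)) \<le> Linf_norm g" unfolding Linf_norm_def by (rule esssup_AE)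
  then have ae: "AE x in lborel. norm (g x) \<le> M"
  proof eventually_elim
    case (elim x) then show ?case using enn2real_mono[OF elim] lg by (simp add: M_def less_top)
  qed
  have M0: "0 \<le> M" by (simp add: M_def)
  have weak: "(LBINT x. indicator {0..2 * pi} x * (\<phi>' x * p (f x))) = - (LBINT x. indicator {0..2 * pi} x * (\<phi> x * (if norm (g x) \<le> M then p (g x) else 0)))"
    if bl: "bounded_linear p" and sm: "smooth \<phi>" and \<phi>per: "\<And>x. \<phi> (x + 2 * pi) = \<phi> x" and \<phi>': "\<And>x. (\<phi> has_real_derivative \<phi>' x) (at x)" for p \<phi> \<phi>'
  proof -
    interpret p: bounded_linear p by fact
    have [measurable]: "p \<in> borel_measurable borel" by (intro borel_measurable_continuous_onI linear_continuous_on bl)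
    have e: "deriv \<phi> = \<phi>'" using \<phi>' by (auto simp: DERIV_imp_deriv)
    note d = smooth_derivative[OF sm \<phi>per]
    have \<phi>c: "continuous_on UNIV \<phi>" by (intro continuous_at_imp_continuous_on ballI DERIV_isCont[OF \<phi>'])
    have [measurable]: "\<phi> \<in> borel_measurable borel" by (rule borel_measurable_continuous_onI[OF \<phi>c])
    obtain A where A: "0 \<le> A" "\<And>x. norm (\<phi> x) \<le> A" using continuous_periodic_bounded[OF \<phi>c \<phi>per] by blast
    have i1: "integrable lborel (\<lambda>\<alpha>. indicator {0..2 * pi} \<alpha> *\<^sub>R (deriv \<phi> \<alpha> *\<^sub>R f \<alpha>))"
      using borel_integrable_atLeastAtMost'[of 0 "2 * pi" "\<lambda>\<alpha>. deriv \<phi> \<alpha> *\<^sub>R f \<alpha>"] continuous_on_subset[OF cont, of "{0..2 * pi}"] continuous_on_subset[OF d(2), of "{0..2 * pi}"]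
      by (simp add: set_integrable_def continuous_on_scaleR)
    have i2: "integrable lborel (\<lambda>\<alpha>. indicator {0..2 * pi} \<alpha> *\<^sub>R (\<phi> \<alpha> *\<^sub>R g \<alpha>))"
    proof (rule integrableI_bounded_set_indicator[where B = "A * M"])
      show "AE x in lborel. x \<in> {0..2 * pi} \<longrightarrow> norm (\<phi> x *\<^sub>R g x) \<le> A * M"
        using ae by eventually_elim (use A in \<open>auto intro!: mult_mono\<close>)
    qed auto
    have "(LINT \<alpha>:{0..2 * pi}|lborel. deriv \<phi> \<alpha> *\<^sub>R f \<alpha>) = - (LINT \<alpha>:{0..2 * pi}|lborel. \<phi> \<alpha> *\<^sub>R g \<alpha>)"
      using wd sm \<phi>per unfolding weak_deriv_def by blast
    then have "p (LBINT \<alpha>. indicator {0..2 * pi} \<alpha> *\<^sub>R (deriv \<phi> \<alpha> *\<^sub>R f \<alpha>)) = - p (LBINT \<alpha>. indicator {0..2 * pi} \<alpha> *\<^sub>R (\<phi> \<alpha> *\<^sub>R g \<alpha>))"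
      unfolding set_lebesgue_integral_def by (simp add: linear_neg[OF bounded_linear.linear[OF bl]])
    then have "(LBINT x. indicator {0..2 * pi} x * (\<phi>' x * p (f x))) = - (LBINT x. indicator {0..2 * pi} x * (\<phi> x * p (g x)))"
      using integral_bounded_linear[OF bl i1] integral_bounded_linear[OF bl i2] by (simp add: p.scaleR e mult.assoc)
    also have "(LBINT x. indicator {0..2 * pi} x * (\<phi> x * p (g x))) = (LBINT x. indicator {0..2 * pi} x * (\<phi> x * (if norm (g x) \<le> M then p (g x) else 0)))"
      by (rule integral_cong_AE) (measurable, use ae in \<open>auto elim!: eventually_mono\<close>)
    finally show ?thesis .
  qed
  have comp: "\<bar>p (f x) - p (f y)\<bar> \<le> M * \<bar>x - y\<bar>" if bl: "bounded_linear p" and pb: "\<And>z. \<bar>p z\<bar> \<le> norm z" for p x y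
  proof (rule periodic_lipschitz)
    show "p (f (x + 2 * pi)) = p (f x)" for x by (simp add: per)
    have pc: "continuous_on UNIV (\<lambda>x. p (f x))" by (intro bounded_linear.continuous_on[OF bl] cont)
    have [measurable]: "p \<in> borel_measurable borel" by (intro borel_measurable_continuous_onI linear_continuous_on bl)
    define h where "h x = (if norm (g x) \<le> M then p (g x) else 0)" for x
    have hm: "h \<in> borel_measurable borel" unfolding h_def by measurable
    have hb: "\<bar>h x\<bar> \<le> M" for x using pb[of "g x"] M0 by (auto simp: h_def)
    have prim: "p (f x) = p (f 0) + (LBINT s. indicator {0..x} s * h s)" if x: "x \<in> {0..2 * pi}" for x
      by (rule du_Bois_Reymond[OF pc _ hm hb _ x]) (use per weak[OF bl] in \<open>simp_all add: h_def\<close>)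
    have le: "\<bar>p (f b) - p (f a)\<bar> \<le> M * (b - a)" if ab: "a \<in> {0..2 * pi}" "b \<in> {0..2 * pi}" "a \<le> b" for a b
    proof -
      have hi: "integrable lborel (\<lambda>x. indicator {c..d} x * h x)" for c d by (rule set_lint_bounded[OF hm hb])
      have "p (f b) - p (f a) = (LBINT s. indicator {0..b} s * h s - indicator {0..a} s * h s)"
        unfolding prim[OF ab(1)] prim[OF ab(2)] Bochner_Integration.integral_diff[OF hi hi] by simp
      also have "\<dots> = (LBINT s. indicator {a..b} s * h s)"
        by (rule integral_cong_AE) (use hm AE_lborel_singleton[of a] ab in \<open>auto elim!: eventually_mono simp: indicator_def\<close>)
      finally show ?thesis using set_lint_bounded_le[OF hm hb ab(3)] by simp
    qed
    show "\<bar>p (f x) - p (f y)\<bar> \<le> M * \<bar>x - y\<bar>" if "x \<in> {0..2 * pi}" "y \<in> {0..2 * pi}" for x y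
      using le[of x y] le[of y x] that by (cases "x \<le> y") (auto simp: abs_minus_commute)
  qed (rule M0)
  show thesis
  proof (rule that[of "2 * M"])
    show "norm (f x - f y) \<le> 2 * M * \<bar>x - y\<bar>" for x y
      using comp[OF bounded_linear_fst abs_fst_le_norm, of x y] comp[OF bounded_linear_snd abs_snd_le_norm, of x y]
        norm_le_abs_sum[of "f x - f y"] by simp
  qed (use M0 in simp)
qed

section \<open>The Stokeslet\<close>

text \<open>The variable \<open>q = exp (- |y2| + i y1)\<close> is periodic, has modulus at most 1,
  equals 1 exactly at the lattice points where the kernel is singular, and tends to 0 at both ends
  of the cylinder. Kernel estimates become estimates in \<open>q\<close> and
  \<open>1 - q\<close>.\<close>

definition nome :: "plane \<Rightarrow> complex" where
  "nome y = exp (Complex (- \<bar>snd y\<bar>) (fst y))"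

lemma norm_nome: "norm (nome y) = exp (- \<bar>snd y\<bar>)"
  by (simp add: nome_def)

lemma Re_nome: "Re (nome y) = exp (- \<bar>snd y\<bar>) * cos (fst y)"
  and Im_nome: "Im (nome y) = exp (- \<bar>snd y\<bar>) * sin (fst y)"
  by (simp_all add: nome_def Re_exp Im_exp)

text \<open>\<open>q / (1 - q)\<close> measures the gradient of the logarithm of the gap beyond its
  limits at infinity: \<open>sinh |y2| / gap\<close> is 1 plus twice its real part, and
  \<open>sin y1 / gap\<close> is twice its imaginary part.\<close>

definition nome_ratio :: "plane \<Rightarrow> complex" where
  "nome_ratio y = nome y / (1 - nome y)"

definition gap :: "plane \<Rightarrow> real" where
  "gap y = cosh (snd y) - cos (fst y)"

lemma gap_eq: "2 * gap y * norm (nome y) = (norm (1 - nome y))\<^sup>2"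
proof -
  have e: "exp (- \<bar>snd y\<bar>) * exp \<bar>snd y\<bar> = 1" by (simp add: exp_minus)
  have c: "cosh (snd y) = (exp \<bar>snd y\<bar> + exp (- \<bar>snd y\<bar>)) / 2" by (cases "snd y \<ge> 0") (auto simp: cosh_def)
  have "(norm (1 - nome y))\<^sup>2 = (1 - exp (- \<bar>snd y\<bar>) * cos (fst y))\<^sup>2 + (exp (- \<bar>snd y\<bar>) * sin (fst y))\<^sup>2"
    unfolding cmod_power2 by (simp add: Re_nome Im_nome)
  also have "\<dots> = 1 - 2 * exp (- \<bar>snd y\<bar>) * cos (fst y) + (exp (- \<bar>snd y\<bar>))\<^sup>2 * ((cos (fst y))\<^sup>2 + (sin (fst y))\<^sup>2)"
    by algebra
  also have "\<dots> = 2 * gap y * norm (nome y)"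
  proof -
    have "exp (- \<bar>snd y\<bar>) * exp \<bar>snd y\<bar> + (exp (- \<bar>snd y\<bar>))\<^sup>2 = 2 * cosh (snd y) * exp (- \<bar>snd y\<bar>)"
      unfolding c by (simp add: power2_eq_square algebra_simps)
    then show ?thesis unfolding gap_def norm_nome e sin_cos_squared_add2 by (simp add: algebra_simps)
  qed
  finally show ?thesis by simp
qed

lemma gap_nonneg: "0 \<le> gap y"
  unfolding gap_def using cosh_real_ge_1[of "snd y"] cos_le_one[of "fst y"] by linarith

lemma nome_eq_1_iff: "nome y = 1 \<longleftrightarrow> gap y = 0"
proof -
  have "nome y = 1 \<longleftrightarrow> (norm (1 - nome y))\<^sup>2 = 0" by auto
  also have "\<dots> \<longleftrightarrow> gap y = 0" unfolding gap_eq[symmetric] by (simp add: nome_def)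
  finally show ?thesis .
qed

lemma nome_ratio_parts:
  "Re (nome_ratio y) = (cos (fst y) - exp (- \<bar>snd y\<bar>)) / (2 * gap y)"
  "Im (nome_ratio y) = sin (fst y) / (2 * gap y)"
proof -
  have n: "norm (nome y) \<noteq> 0" by (simp add: nome_def)
  have g: "(norm (1 - nome y))\<^sup>2 = 2 * gap y * exp (- \<bar>snd y\<bar>)" using gap_eq[of y] by (simp add: norm_nome)
  have d: "nome_ratio y = nome y * cnj (1 - nome y) / of_real ((norm (1 - nome y))\<^sup>2)"
    unfolding nome_ratio_def by (rule complex_div_cnj)
  have c1: "(cos (fst y))\<^sup>2 + (sin (fst y))\<^sup>2 = 1" by simp
  have "Re (nome y * cnj (1 - nome y)) = exp (- \<bar>snd y\<bar>) * (cos (fst y) - exp (- \<bar>snd y\<bar>) * ((cos (fst y))\<^sup>2 + (sin (fst y))\<^sup>2))"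
  proof -
    have "Re (z * cnj (1 - z)) = Re z - (Re z)\<^sup>2 - (Im z)\<^sup>2" for z by (simp add: power2_eq_square algebra_simps)
    then have "Re (nome y * cnj (1 - nome y)) = exp (- \<bar>snd y\<bar>) * cos (fst y) - (exp (- \<bar>snd y\<bar>) * cos (fst y))\<^sup>2 - (exp (- \<bar>snd y\<bar>) * sin (fst y))\<^sup>2"
      unfolding Re_nome[symmetric] Im_nome[symmetric] by blast
    then show ?thesis by algebra
  qed
  then have re: "Re (nome y * cnj (1 - nome y)) = exp (- \<bar>snd y\<bar>) * (cos (fst y) - exp (- \<bar>snd y\<bar>))" unfolding c1 by simp
  have im: "Im (nome y * cnj (1 - nome y)) = exp (- \<bar>snd y\<bar>) * sin (fst y)"
    by (simp add: Re_nome Im_nome algebra_simps)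
  have cancel: "e * x / (2 * gap y * e) = x / (2 * gap y)" if "e \<noteq> 0" for e x :: real using that by simp
  show "Re (nome_ratio y) = (cos (fst y) - exp (- \<bar>snd y\<bar>)) / (2 * gap y)"
    unfolding d Re_divide_of_real re g by (rule cancel) simp
  show "Im (nome_ratio y) = sin (fst y) / (2 * gap y)"
    unfolding d Im_divide_of_real im g by (rule cancel) simp
qed

definition kern :: "plane \<Rightarrow> plane" where
  "kern y = stokeslet y (0, 1)"

lemma stokeslet_eq: "stokeslet y (0, c) = c *\<^sub>R kern y"
  unfolding kern_def stokeslet_def by (cases y) (simp add: algebra_simps)

lemma kern_gap:
  "kern y = (- (snd y * sin (fst y) / (8 * pi * gap y)), ln (2 * gap y) / (8 * pi) - snd y * sinh (snd y) / (8 * pi * gap y))"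
  unfolding kern_def stokeslet_def gap_def by (cases y) simp

text \<open>The linear growth of \<open>ln (2 * gap y)\<close> and that of
  \<open>snd y * sinh (snd y) / gap y\<close> have cancelled; what is left is governed by
  \<open>q\<close> and decays exponentially. Where \<open>gap y = 0\<close>, both sides consist of
  the default values of \<open>ln 0\<close> and of division by 0.\<close>

lemma kern_nome:
  "4 * pi * fst (kern y) = - (snd y * Im (nome_ratio y))"
  "4 * pi * snd (kern y) = ln (norm (1 - nome y)) - \<bar>snd y\<bar> * Re (nome_ratio y)"
proof -
  show "4 * pi * fst (kern y) = - (snd y * Im (nome_ratio y))"
    unfolding kern_gap nome_ratio_parts by (simp add: field_simps)
  show "4 * pi * snd (kern y) = ln (norm (1 - nome y)) - \<bar>snd y\<bar> * Re (nome_ratio y)"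
  proof (cases "gap y = 0")
    case True
    then have "nome y = 1" by (simp add: nome_eq_1_iff)
    then show ?thesis using True unfolding kern_gap nome_ratio_parts by simp
  next
    case False
    define r where "r = \<bar>snd y\<bar>"
    have g0: "gap y > 0" using False gap_nonneg[of y] by simp
    have "2 * gap y * exp (- r) = (norm (1 - nome y))\<^sup>2" using gap_eq[of y] by (simp add: norm_nome r_def)
    moreover have "0 < norm (1 - nome y)" using False nome_eq_1_iff[of y] by auto
    ultimately have l: "ln (2 * gap y) - r = 2 * ln (norm (1 - nome y))"
    proof -
      assume a: "2 * gap y * exp (- r) = (norm (1 - nome y))\<^sup>2" and b: "0 < norm (1 - nome y)"
      have "ln (2 * gap y * exp (- r)) = ln (2 * gap y) + ln (exp (- r))" using g0 by (intro ln_mult_pos) auto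
      moreover have "ln ((norm (1 - nome y))\<^sup>2) = 2 * ln (norm (1 - nome y))" using b by (simp add: ln_realpow)
      ultimately show ?thesis unfolding a by simp
    qed
    have s: "snd y * sinh (snd y) = r * sinh r" by (cases "snd y \<ge> 0") (auto simp: r_def)
    have gp: "gap y = cosh r - cos (fst y)" by (cases "snd y \<ge> 0") (auto simp: r_def gap_def)
    have cs: "cosh r - sinh r = exp (- r)" by (rule cosh_minus_sinh)
    have "r - r * sinh r / gap y = - 2 * r * Re (nome_ratio y)"
    proof -
      have "r - r * sinh r / gap y = r * (gap y - sinh r) / gap y" using g0 by (simp add: field_simps)
      also have "gap y - sinh r = exp (- r) - cos (fst y)" using gp cs by linarith
      also have "r * (exp (- r) - cos (fst y)) / gap y = - 2 * r * Re (nome_ratio y)"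
        unfolding nome_ratio_parts r_def[symmetric] using g0 by (simp add: field_simps)
      finally show ?thesis .
    qed
    then have "ln (2 * gap y) - r * sinh r / gap y = 2 * ln (norm (1 - nome y)) - 2 * r * Re (nome_ratio y)"
      using l by linarith
    moreover have "4 * pi * snd (kern y) = (ln (2 * gap y) - r * sinh r / gap y) / 2"
      unfolding kern_gap s by (simp add: field_simps)
    ultimately show ?thesis by (simp add: r_def)
  qed
qed

text \<open>Valued in the extended reals, with the value infinity where \<open>nome y = 1\<close>.
  There \<open>kern\<close> has a meaningless default value, and infinity keeps the size bound and
  the Lipschitz inequality true at every point.\<close>

definition majorant :: "plane \<Rightarrow> ennreal" where
  "majorant y = ennreal ((2 + \<bar>snd y\<bar>) * norm (nome y)) / ennreal (norm (1 - nome y))"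

lemma majorant_top: "nome y = 1 \<Longrightarrow> majorant y = top"
  by (simp add: majorant_def ennreal_divide_zero)

lemma majorant_ennreal: "nome y \<noteq> 1 \<Longrightarrow> majorant y = ennreal ((2 + \<bar>snd y\<bar>) * norm (nome_ratio y))"
  by (simp add: majorant_def nome_ratio_def divide_ennreal norm_divide)

lemma nome_measurable [measurable]: "nome \<in> borel_measurable borel"
  unfolding nome_def by (intro borel_measurable_continuous_onI continuous_intros)

lemma majorant_measurable [measurable]: "majorant \<in> borel_measurable borel"
proof -
  have [measurable]: "(\<lambda>y. snd y) \<in> borel_measurable (borel :: plane measure)"
    by (intro borel_measurable_continuous_onI continuous_intros)
  show ?thesis unfolding majorant_def by measurable
qed

lemma nome_shift: "nome (y + (2 * pi, 0)) = nome y"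
  by (simp add: complex_eq_iff Re_nome Im_nome)

lemma majorant_shift: "majorant (y + (2 * pi, 0)) = majorant y"
  unfolding majorant_def nome_shift by simp

lemma majorant_minus: "majorant (- y) = majorant y"
proof -
  have "nome (- y) = cnj (nome y)" by (simp add: complex_eq_iff Re_nome Im_nome)
  moreover have "norm (1 - cnj (nome y)) = norm (1 - nome y)"
    by (metis complex_cnj_diff complex_cnj_one complex_mod_cnj)
  ultimately show ?thesis unfolding majorant_def by simp
qed

lemma norm_one_minus_nome_ge: "1 - exp (- \<bar>snd y\<bar>) \<le> norm (1 - nome y)"
  using norm_triangle_ineq2[of 1 "nome y"] by (simp add: norm_nome)

text \<open>\<open>1 - exp (- r)\<close> is at least \<open>r / (1 + r)\<close>. Thus a factor
  \<open>|snd y|\<close> absorbs one power of the singularity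
  \<open>1 / |1 - nome y|\<close>.\<close>

lemma radius_le_nome: "\<bar>snd y\<bar> \<le> (1 + \<bar>snd y\<bar>) * norm (1 - nome y)"
proof -
  define r where "r = \<bar>snd y\<bar>"
  have "1 + r \<le> exp r" by (rule exp_ge_add_one_self)
  then have "exp (- r) * (1 + r) \<le> exp (- r) * exp r" by (intro mult_left_mono) auto
  also have "\<dots> = 1" by (simp add: exp_minus)
  finally have "r \<le> (1 + r) * (1 - exp (- r))" by (simp add: algebra_simps)
  also have "\<dots> \<le> (1 + r) * norm (1 - nome y)"
    using norm_one_minus_nome_ge[of y] by (intro mult_left_mono) (auto simp: r_def)
  finally show ?thesis by (simp add: r_def)
qed

text \<open>\<open>nome b\<close> is \<open>nome a\<close> times \<open>exp d\<close> with
  \<open>norm d \<le> norm (a - b) \<le> 1\<close>, and the derivative of \<open>exp\<close> has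
  modulus at most 3 on the unit disc.\<close>

lemma nome_diff:
  assumes "norm (a - b) \<le> 1"
  shows "norm (nome a - nome b) \<le> 3 * norm (a - b) * norm (nome a)"
proof -
  define d where "d = Complex (- \<bar>snd b\<bar> + \<bar>snd a\<bar>) (fst b - fst a)"
  have nb: "nome b = nome a * exp d"
  proof -
    have "Complex (- \<bar>snd b\<bar>) (fst b) = Complex (- \<bar>snd a\<bar>) (fst a) + d" by (simp add: d_def complex_eq_iff)
    then show ?thesis unfolding nome_def by (simp add: exp_add)
  qed
  have nd: "norm d \<le> norm (a - b)"
  proof -
    have "norm d = sqrt ((- \<bar>snd b\<bar> + \<bar>snd a\<bar>)\<^sup>2 + (fst b - fst a)\<^sup>2)" by (simp add: d_def cmod_def)
    also have "\<dots> \<le> sqrt ((snd a - snd b)\<^sup>2 + (fst a - fst b)\<^sup>2)"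
      by (intro real_sqrt_le_mono add_mono) (auto simp: power2_commute[of "fst b"] intro!: abs_le_square_iff[THEN iffD1])
    also have "\<dots> = norm (a - b)" by (simp add: norm_prod_def add.commute)
    finally show ?thesis .
  qed
  have "norm (exp d - exp 0) \<le> 3 * norm (d - 0)"
  proof (rule field_differentiable_bound[where S = "cball 0 1" and f = exp and f' = exp])
    fix z :: complex assume "z \<in> cball 0 1"
    then have "exp (Re z) \<le> exp 1" using complex_Re_le_cmod[of z] by simp
    also have "\<dots> \<le> 3" by (rule exp_le)
    finally show "norm (exp z) \<le> 3" by simp
  qed (use nd assms in \<open>auto intro!: derivative_eq_intros\<close>)
  then have "norm (exp d - 1) \<le> 3 * norm (a - b)" using nd by simp
  moreover have "nome a - nome b = - (nome a * (exp d - 1))" by (simp add: nb algebra_simps)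
  ultimately show ?thesis by (simp add: norm_mult mult_left_mono mult.commute)
qed

text \<open>The logarithm is estimated from both sides by \<open>ln t \<le> t - 1\<close>, applied
  to \<open>A = |1 - q|\<close> and to \<open>1 / A\<close>: the first gives at most
  \<open>|q|\<close>, the second at most \<open>|q| / A\<close>.\<close>

lemma kern_bound_real:
  assumes "nome y \<noteq> 1"
  shows "norm (kern y) \<le> (2 + \<bar>snd y\<bar>) * norm (nome_ratio y)"
proof -
  define A m r where "A = norm (1 - nome y)" and "m = norm (nome_ratio y)" and "r = \<bar>snd y\<bar>"
  have A0: "0 < A" using assms by (simp add: A_def)
  have m: "m = norm (nome y) / A" by (simp add: m_def A_def nome_ratio_def norm_divide)
  have m0: "0 \<le> m" by (simp add: m_def)
  have n1: "norm (nome y) \<le> 1" by (simp add: norm_nome)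
  have A2: "A \<le> 2" using norm_triangle_ineq4[of 1 "nome y"] n1 by (simp add: A_def)
  have "ln A \<le> A - 1" using A0 by (rule ln_le_minus_one)
  also have "\<dots> \<le> norm (nome y)" using norm_triangle_ineq4[of 1 "nome y"] by (simp add: A_def)
  also have "\<dots> \<le> 2 * m" using A0 A2 by (simp add: m field_simps mult_right_mono)
  finally have l1: "ln A \<le> 2 * m" .
  have "- ln A = ln (1 / A)" using A0 by (simp add: ln_div)
  also have "\<dots> \<le> 1 / A - 1" using A0 by (intro ln_le_minus_one) auto
  also have "\<dots> = (1 - A) / A" using A0 by (simp add: field_simps)
  also have "\<dots> \<le> m" unfolding m
    using norm_triangle_ineq2[of 1 "1 - nome y"] A0 by (intro divide_right_mono) (auto simp: A_def)
  finally have l2: "- ln A \<le> 2 * m" using m0 by linarith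
  have k1: "\<bar>4 * pi * fst (kern y)\<bar> \<le> r * m" 
    unfolding kern_nome by (auto simp: abs_mult r_def m_def abs_Im_le_cmod mult_left_mono)
  have "\<bar>r * Re (nome_ratio y)\<bar> \<le> r * m"
    by (auto simp: abs_mult r_def m_def abs_Re_le_cmod mult_left_mono)
  then have k2: "\<bar>4 * pi * snd (kern y)\<bar> \<le> 2 * m + r * m"
    using l1 l2 unfolding kern_nome A_def[symmetric] r_def[symmetric] by linarith
  have "norm (kern y) \<le> \<bar>fst (kern y)\<bar> + \<bar>snd (kern y)\<bar>" by (rule norm_le_abs_sum)
  then have "4 * pi * norm (kern y) \<le> 4 * pi * (\<bar>fst (kern y)\<bar> + \<bar>snd (kern y)\<bar>)" by simp
  also have "\<dots> = \<bar>4 * pi * fst (kern y)\<bar> + \<bar>4 * pi * snd (kern y)\<bar>" by (simp add: abs_mult distrib_left)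
  also have "\<dots> \<le> 2 * ((2 + r) * m)" using k1 k2 m0 by (simp add: algebra_simps)
  also have "\<dots> \<le> 4 * pi * ((2 + r) * m)" using pi_gt3 m0 by (intro mult_right_mono) (auto simp: r_def)
  finally show ?thesis by (simp add: m_def r_def)
qed

text \<open>A difference of two values of \<open>nome_ratio\<close> has the product
  \<open>(1 - nome a) * (1 - nome b)\<close> in the denominator, too singular by one power. The
  height that multiplies it removes one of the factors through \<open>radius_le_nome\<close>. The
  logarithms are compared through the quotient of their arguments.\<close>

lemma kern_diff_real:
  assumes a: "nome a \<noteq> 1" and b: "nome b \<noteq> 1" and ab: "norm (a - b) \<le> 1"
  shows "norm (kern a - kern b) \<le> norm (a - b) * ((2 + \<bar>snd a\<bar>) * norm (nome_ratio a) + (2 + \<bar>snd b\<bar>) * norm (nome_ratio b))"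
proof -
  define d Ma Mb where "d = norm (a - b)" and "Ma = (2 + \<bar>snd a\<bar>) * norm (nome_ratio a)" and "Mb = (2 + \<bar>snd b\<bar>) * norm (nome_ratio b)"
  have d0: "0 \<le> d" and Ma0: "0 \<le> Ma" and Mb0: "0 \<le> Mb" by (auto simp: d_def Ma_def Mb_def)
  have ma: "2 * norm (nome_ratio a) \<le> Ma" and mb: "2 * norm (nome_ratio b) \<le> Mb"
    unfolding Ma_def Mb_def by (auto intro!: mult_right_mono)
  have sd: "\<bar>snd a - snd b\<bar> \<le> d" "\<bar>\<bar>snd a\<bar> - \<bar>snd b\<bar>\<bar> \<le> d"
    using abs_snd_le_norm[of "a - b"] by (auto simp: d_def)
  have ba: "norm (b - a) = d" by (simp add: d_def norm_minus_commute)
  have q1: "norm (nome a - nome b) \<le> 3 * d * norm (nome a)" using nome_diff[OF ab] by (simp add: d_def)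
  have q2: "norm (nome a - nome b) \<le> 3 * d * norm (nome b)" using nome_diff[of b a] ba ab by (simp add: d_def norm_minus_commute)
  have A0: "0 < norm (1 - nome a)" "0 < norm (1 - nome b)" using a b by auto
  have lnd: "ln (norm (1 - nome u)) - ln (norm (1 - nome v)) \<le> 3 * d * norm (nome_ratio v)"
    if "0 < norm (1 - nome u)" "0 < norm (1 - nome v)" "norm (nome u - nome v) \<le> 3 * d * norm (nome v)" for u v
  proof -
    have "ln (norm (1 - nome u)) - ln (norm (1 - nome v)) = ln (norm (1 - nome u) / norm (1 - nome v))"
      using that by (simp add: ln_div)
    also have "\<dots> \<le> norm (1 - nome u) / norm (1 - nome v) - 1" using that by (intro ln_le_minus_one) auto
    also have "\<dots> = (norm (1 - nome u) - norm (1 - nome v)) / norm (1 - nome v)" using that by (simp add: field_simps)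
    also have "\<dots> \<le> norm (nome u - nome v) / norm (1 - nome v)"
      using that norm_triangle_ineq2[of "1 - nome u" "1 - nome v"] 
      by (intro divide_right_mono) (auto simp: norm_minus_commute)
    also have "\<dots> \<le> 3 * d * norm (nome v) / norm (1 - nome v)" using that by (intro divide_right_mono) auto
    finally show ?thesis by (simp add: nome_ratio_def norm_divide)
  qed
  have L1: "\<bar>ln (norm (1 - nome a)) - ln (norm (1 - nome b))\<bar> \<le> 3 * d * (norm (nome_ratio a) + norm (nome_ratio b))"
  proof -
    have "0 \<le> 3 * d * norm (nome_ratio a)" "0 \<le> 3 * d * norm (nome_ratio b)" using d0 by auto
    then show ?thesis
      using lnd[OF A0 q2] lnd[OF A0(2) A0(1)] q1 by (simp add: norm_minus_commute distrib_left abs_le_iff)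
  qed
  have wd: "nome_ratio a - nome_ratio b = (nome a - nome b) / ((1 - nome a) * (1 - nome b))"
    unfolding nome_ratio_def using a b by (simp add: field_simps)
  have W: "norm (of_real s * nome_ratio a - of_real t * nome_ratio b) \<le> 4 * d * Ma"
    if s: "\<bar>s - t\<bar> \<le> d" "\<bar>t\<bar> = \<bar>snd b\<bar>" for s t :: real
  proof -
    have 1: "norm (of_real (s - t) * nome_ratio a) \<le> d * Ma"
    proof -
      have "norm (nome_ratio a) \<le> Ma" using ma norm_ge_zero[of "nome_ratio a"] by linarith
      then show ?thesis unfolding norm_mult norm_of_real using s d0 by (intro mult_mono) auto
    qed
    have "norm (of_real t * (nome_ratio a - nome_ratio b)) = (\<bar>snd b\<bar> / norm (1 - nome b)) * (norm (nome a - nome b) / norm (1 - nome a))"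
      unfolding wd norm_mult norm_of_real norm_divide s by simp
    also have "\<dots> \<le> (1 + \<bar>snd b\<bar>) * (3 * d * norm (nome a) / norm (1 - nome a))"
      using A0 q1 radius_le_nome[of b] by (intro mult_mono divide_right_mono) (auto simp: pos_divide_le_eq)
    also have "\<dots> = 3 * d * ((1 + \<bar>snd b\<bar>) * norm (nome_ratio a))" by (simp add: nome_ratio_def norm_divide)
    also have "\<dots> \<le> 3 * d * Ma"
    proof -
      have "1 + \<bar>snd b\<bar> \<le> 2 + \<bar>snd a\<bar>" using sd ab by (auto simp: d_def)
      then show ?thesis unfolding Ma_def using d0 by (intro mult_left_mono mult_right_mono) auto
    qed
    finally have 2: "norm (of_real t * (nome_ratio a - nome_ratio b)) \<le> 3 * d * Ma" .
    have "of_real s * nome_ratio a - of_real t * nome_ratio b = of_real (s - t) * nome_ratio a + of_real t * (nome_ratio a - nome_ratio b)"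
      by (simp add: algebra_simps)
    then show ?thesis using norm_triangle_le[OF add_mono[OF 1 2]] by (simp add: algebra_simps)
  qed
  have k1: "\<bar>4 * pi * fst (kern a) - 4 * pi * fst (kern b)\<bar> \<le> 4 * d * Ma"
  proof -
    have "\<bar>Im (of_real (snd a) * nome_ratio a - of_real (snd b) * nome_ratio b)\<bar> \<le> 4 * d * Ma"
      by (rule order_trans[OF abs_Im_le_cmod W]) (use sd in auto)
    then show ?thesis unfolding kern_nome by (simp add: abs_minus_commute)
  qed
  have k2: "\<bar>4 * pi * snd (kern a) - 4 * pi * snd (kern b)\<bar> \<le> 3 * d * (norm (nome_ratio a) + norm (nome_ratio b)) + 4 * d * Ma"
  proof -
    have "\<bar>Re (of_real \<bar>snd a\<bar> * nome_ratio a - of_real \<bar>snd b\<bar> * nome_ratio b)\<bar> \<le> 4 * d * Ma"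
      by (rule order_trans[OF abs_Re_le_cmod W]) (use sd in auto)
    then show ?thesis using L1 unfolding kern_nome by simp
  qed
  have "norm (kern a - kern b) \<le> \<bar>fst (kern a - kern b)\<bar> + \<bar>snd (kern a - kern b)\<bar>"
    by (rule norm_le_abs_sum)
  then have "norm (kern a - kern b) \<le> \<bar>fst (kern a) - fst (kern b)\<bar> + \<bar>snd (kern a) - snd (kern b)\<bar>" by simp
  then have "4 * pi * norm (kern a - kern b) \<le> 4 * pi * (\<bar>fst (kern a) - fst (kern b)\<bar> + \<bar>snd (kern a) - snd (kern b)\<bar>)" by simp
  also have "\<dots> = \<bar>4 * pi * fst (kern a) - 4 * pi * fst (kern b)\<bar> + \<bar>4 * pi * snd (kern a) - 4 * pi * snd (kern b)\<bar>"
  proof -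
    have "4 * pi * u - 4 * pi * v = 4 * pi * (u - v)" for u v :: real by (simp add: algebra_simps)
    then show ?thesis by (simp only: abs_mult distrib_left) simp
  qed
  also have "\<dots> \<le> 4 * d * Ma + (3 * d * (norm (nome_ratio a) + norm (nome_ratio b)) + 4 * d * Ma)" using k1 k2 by (rule add_mono)
  \<comment> \<open>The terms add up to at most 9.5 times \<open>d * Ma\<close> plus 1.5 times
    \<open>d * Mb\<close>; they are rounded up to 12, which is below \<open>4 * pi\<close>.\<close>
  also have "\<dots> \<le> 12 * (d * (Ma + Mb))"
  proof -
    have "d * (2 * norm (nome_ratio a)) \<le> d * Ma" "d * (2 * norm (nome_ratio b)) \<le> d * Mb"
      using ma mb d0 by (auto intro!: mult_left_mono)
    moreover have "0 \<le> d * Ma" "0 \<le> d * Mb" using d0 Ma0 Mb0 by auto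
    ultimately show ?thesis by (simp add: algebra_simps) 
  qed
  also have "\<dots> \<le> 4 * pi * (d * (Ma + Mb))" using pi_gt3 d0 Ma0 Mb0 by (intro mult_right_mono) auto
  finally show ?thesis by (simp add: d_def Ma_def Mb_def)
qed

lemma kern_bound: "ennreal (norm (kern y)) \<le> majorant y"
  by (cases "nome y = 1") (simp_all add: majorant_top majorant_ennreal kern_bound_real ennreal_leI)

lemma kern_lipschitz: "ennreal (norm (kern a - kern b)) \<le> ennreal (norm (a - b)) * (majorant a + majorant b)"
proof (cases "a = b \<or> nome a = 1 \<or> nome b = 1")
  case True
  then show ?thesis
    by (cases "a = b") (auto simp: majorant_top ennreal_mult_top)
next
  case False
  have "norm (kern a - kern b) \<le> norm (a - b) * ((2 + \<bar>snd a\<bar>) * norm (nome_ratio a) + (2 + \<bar>snd b\<bar>) * norm (nome_ratio b))"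
  proof (cases "norm (a - b) \<le> 1")
    case True
    then show ?thesis using False kern_diff_real by auto
  next
    \<comment> \<open>At distances above 1 the sizes of the two values suffice.\<close>
    case big: False
    have "norm (kern a - kern b) \<le> norm (kern a) + norm (kern b)" by (rule norm_triangle_ineq4)
    also have "\<dots> \<le> 1 * ((2 + \<bar>snd a\<bar>) * norm (nome_ratio a) + (2 + \<bar>snd b\<bar>) * norm (nome_ratio b))"
      using kern_bound_real[of a] kern_bound_real[of b] False by simp
    also have "\<dots> \<le> norm (a - b) * ((2 + \<bar>snd a\<bar>) * norm (nome_ratio a) + (2 + \<bar>snd b\<bar>) * norm (nome_ratio b))"
      using big by (intro mult_right_mono) auto
    finally show ?thesis .
  qed
  then show ?thesis using False
    by (simp add: majorant_ennreal ennreal_mult[symmetric] ennreal_plus[symmetric] ennreal_leI del: ennreal_plus)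
qed

lemma sin_ge_half: assumes "0 \<le> x" "x \<le> pi / 2" shows "x / 2 \<le> sin x"
proof (cases "x \<le> pi / 3")
  case True
  have "(\<lambda>x. sin x - x / 2) 0 \<le> (\<lambda>x. sin x - x / 2) x"
  proof (rule DERIV_nonneg_imp_nondecreasing[OF assms(1)])
    fix t assume t: "0 \<le> t" "t \<le> x"
    have "cos (pi / 3) \<le> cos t" using t True by (intro cos_monotone_0_pi_le) auto
    then have "0 \<le> cos t - 1 / 2" by (simp add: cos_60)
    moreover have "((\<lambda>x. sin x - x / 2) has_real_derivative cos t - 1 / 2) (at t)" by (auto intro!: derivative_eq_intros)
    ultimately show "\<exists>y. ((\<lambda>x. sin x - x / 2) has_real_derivative y) (at t) \<and> 0 \<le> y" by blast
  qed
  then show ?thesis by simp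
next
  case False
  have "sin (pi / 3) \<le> sin x" using False assms by (intro sin_monotone_2pi_le) auto
  moreover have "sin (pi / 3) = sqrt 3 / 2" by (rule sin_60)
  moreover have "8 / 5 \<le> sqrt 3" by (rule real_le_rsqrt) (simp add: power2_eq_square)
  moreover have "x / 2 \<le> 4 / 5" using assms pi_less_4 pi_approx by simp
  ultimately show ?thesis by linarith
qed

text \<open>With \<open>s = sin (y1 / 2)\<close> one has
  \<open>|1 - q|^2 = (1 - exp (-r))^2 + 4 exp (-r) s^2\<close>. For \<open>r \<le> 1\<close> the
  inequality between arithmetic and geometric mean bounds this below by a multiple of
  \<open>r * s\<close>, so the point singularity is dominated by a product of inverse square roots
  in the two coordinates. Tonelli then gives integrability over the cell without polar coordinates;
  the second factor is made of integrands of the Gamma function.\<close>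

lemma majorant_product_bound:
  assumes "0 < y1" "y1 < 2 * pi" "y2 \<noteq> 0"
  shows "majorant (y1, y2) \<le> ennreal (12 * (y1 powr (-1/2) + (2 * pi - y1) powr (-1/2)))
     * ennreal ((\<bar>y2\<bar> powr (-1/2) + \<bar>y2\<bar> powr 1) / exp \<bar>y2\<bar>)"
proof -
  define r s where "r = \<bar>y2\<bar>" and "s = sin (y1 / 2)"
  define p q where "p = y1 powr (-1/2)" and "q = (2 * pi - y1) powr (-1/2)"
  define t where "t = p + q"
  have r0: "0 < r" using assms by (simp add: r_def)
  have s0: "0 < s" unfolding s_def using assms by (intro sin_gt_zero) auto
  define A where "A = norm (1 - nome (y1, y2))"
  have gp: "A\<^sup>2 = 2 * (cosh r - cos y1) * exp (- r)"
    using gap_eq[of "(y1, y2)"] by (cases "y2 \<ge> 0") (auto simp: A_def norm_nome gap_def r_def)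
  have ce: "cosh r = (exp r + exp (- r)) / 2" by (simp add: cosh_def)
  have er: "exp r * exp (- r) = 1" by (simp add: exp_minus)
  have cy: "cos y1 = 1 - 2 * s\<^sup>2" using cos_double_sin[of "y1 / 2"] by (simp add: s_def)
  have A2: "A\<^sup>2 = (1 - exp (- r))\<^sup>2 + 4 * exp (- r) * s\<^sup>2"
  proof -
    have "A\<^sup>2 = exp r * exp (- r) + exp (- r) * exp (- r) - 2 * cos y1 * exp (- r)" unfolding gp ce by (simp add: algebra_simps)
    then show ?thesis unfolding er cy by (simp add: power2_eq_square algebra_simps)
  qed
  have A0: "0 < A" 
  proof -
    have "0 < A\<^sup>2" unfolding A2 using s0 by (intro add_nonneg_pos) auto
    then show ?thesis by (simp add: A_def)
  qed
  have n: "nome (y1, y2) \<noteq> 1" using A0 by (auto simp: A_def)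
  have tpos: "0 < p" "0 < q" using assms by (auto simp: p_def q_def)
  have st: "1 / sqrt s \<le> 2 * t"
  proof -
    have half: "1 / sqrt (sin x) \<le> 2 * (2 * x) powr (-1/2)" if x: "0 < x" "x \<le> pi / 2" for x
    proof -
      have "x / 2 \<le> sin x" using x by (intro sin_ge_half) auto
      then have "1 / sqrt (sin x) \<le> 1 / sqrt (x / 2)" using x by (intro divide_left_mono real_sqrt_le_mono mult_pos_pos) auto
      also have "\<dots> = 2 / sqrt (2 * x)" 
      proof -
        have "sqrt (2 * x) = 2 * sqrt (x / 2)" using real_sqrt_mult[of 4 "x/2"] by simp
        then show ?thesis by simp
      qed
      also have "\<dots> = 2 * (2 * x) powr (-1/2)" using x by (simp add: powr_minus_divide powr_half_sqrt)
      finally show ?thesis .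
    qed
    show ?thesis
    proof (cases "y1 \<le> pi")
      case True
      then have "1 / sqrt s \<le> 2 * p" using half[of "y1 / 2"] assms by (simp add: s_def p_def)
      also have "\<dots> \<le> 2 * t" using tpos by (simp add: t_def)
      finally show ?thesis .
    next
      case False
      have "s = sin (pi - y1 / 2)" by (simp add: s_def)
      then have "1 / sqrt s \<le> 2 * q" using half[of "pi - y1 / 2"] False assms by (simp add: algebra_simps q_def)
      also have "\<dots> \<le> 2 * t" using tpos by (simp add: t_def)
      finally show ?thesis .
    qed
  qed
  have s1: "sqrt s \<le> 1" by (simp add: s_def)
  have "1 \<le> 1 / sqrt s" using s0 s1 by simp
  then have t1: "1 \<le> 2 * t" using st by linarith
  have "(2 + r) * exp (- r) / A \<le> (12 * t) * ((r powr (-1/2) + r powr 1) / exp r)"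
  proof (cases "r \<le> 1")
    case True
    have "2 * ((1 - exp (- r)) * (2 * exp (- r / 2) * s)) \<le> A\<^sup>2"
    proof -
      have e2: "exp (- r) = (exp (- r / 2))\<^sup>2" by (simp add: power2_eq_square exp_add[symmetric])
      have "0 \<le> ((1 - exp (- r)) - (2 * exp (- r / 2) * s))\<^sup>2" by simp
      also have "\<dots> = (1 - exp (- r))\<^sup>2 + 4 * (exp (- r / 2))\<^sup>2 * s\<^sup>2 - 2 * ((1 - exp (- r)) * (2 * exp (- r / 2) * s))"
        by (simp add: power2_eq_square algebra_simps)
      finally show ?thesis unfolding A2 e2[symmetric] by simp
    qed
    moreover have "r * exp (- r) \<le> 1 - exp (- r)"
    proof -
      have "exp (- r) * (1 + r) \<le> exp (- r) * exp r" using exp_ge_add_one_self[of r] by (intro mult_left_mono) auto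
      then show ?thesis by (simp add: exp_minus algebra_simps)
    qed
    then have "(r * exp (- r)) * (2 * exp (- r / 2) * s) \<le> (1 - exp (- r)) * (2 * exp (- r / 2) * s)"
      using s0 by (intro mult_right_mono) auto
    ultimately have "2 * ((r * exp (- r)) * (2 * exp (- r / 2) * s)) \<le> A\<^sup>2" by linarith
    then have "4 * r * s * (exp (- r) * exp (- r / 2)) \<le> A\<^sup>2" by (simp add: mult_ac)
    moreover have "(exp (- r))\<^sup>2 \<le> exp (- r) * exp (- r / 2)"
      using r0 by (simp add: power2_eq_square)
    then have "4 * r * s * (exp (- r))\<^sup>2 \<le> 4 * r * s * (exp (- r) * exp (- r / 2))"
      using r0 s0 by (intro mult_left_mono) auto
    ultimately have "4 * r * s * (exp (- r))\<^sup>2 \<le> A\<^sup>2" by (rule order_trans[rotated])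
    then have "(2 * sqrt r * sqrt s * exp (- r))\<^sup>2 \<le> A\<^sup>2" using r0 s0 by (simp add: power_mult_distrib)
    then have lo: "2 * sqrt r * sqrt s * exp (- r) \<le> A" by (rule power2_le_imp_le) (use A0 in simp)
    have p: "0 < 2 * sqrt r * sqrt s * exp (- r)" using r0 s0 by simp
    have "(2 + r) * exp (- r) / A \<le> 3 * exp (- r) / (2 * sqrt r * sqrt s * exp (- r))"
      using lo p True r0 by (intro frac_le) auto
    also have "\<dots> = (3 / 2) * (1 / sqrt r) * (1 / sqrt s)" by simp
    also have "\<dots> \<le> (3 / 2) * (1 / sqrt r) * (2 * t)" using st r0 by (intro mult_left_mono) auto
    also have "\<dots> = (3 * t) * r powr (-1/2)" using r0 by (simp add: powr_minus_divide powr_half_sqrt)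
    also have "\<dots> \<le> (12 * t) * ((r powr (-1/2) + r powr 1) / exp r)"
    proof -
      have "exp r \<le> exp 1" using True by simp
      then have "exp r \<le> 3" using exp_le by linarith
      then have "r powr (-1/2) * exp r \<le> r powr (-1/2) * 3" by (intro mult_left_mono) auto
      also have "\<dots> \<le> 4 * (r powr (-1/2) + r powr 1)" using r0 by simp
      finally have "r powr (-1/2) \<le> 4 * ((r powr (-1/2) + r powr 1) / exp r)" by (simp add: field_simps)
      then have "(3 * t) * r powr (-1/2) \<le> (3 * t) * (4 * ((r powr (-1/2) + r powr 1) / exp r))"
        using t1 by (intro mult_left_mono) auto
      also have "\<dots> = (12 * t) * ((r powr (-1/2) + r powr 1) / exp r)" by simp
      finally show ?thesis .
    qed
    finally show ?thesis .
  next
    case False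
    have "exp (- r) \<le> 1 / 2"
    proof -
      have "2 \<le> exp r" using exp_ge_add_one_self[of r] False by linarith
      then show ?thesis by (simp add: exp_minus field_simps)
    qed
    then have lo: "1 / 2 \<le> A" using norm_one_minus_nome_ge[of "(y1, y2)"] by (simp add: A_def r_def)
    have "(2 + r) * exp (- r) / A \<le> (3 * r) * exp (- r) / (1 / 2)"
      using lo False by (intro frac_le mult_right_mono) auto
    also have "\<dots> = 6 * (r / exp r)" by (simp add: exp_minus field_simps)
    also have "\<dots> \<le> 6 * (2 * t) * ((r powr (-1/2) + r powr 1) / exp r)"
      using t1 r0 by (intro mult_mono divide_right_mono) auto
    finally show ?thesis by simp
  qed
  then have "ennreal ((2 + r) * exp (- r) / A) \<le> ennreal ((12 * t) * ((r powr (-1/2) + r powr 1) / exp r))"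
    by (rule ennreal_leI)
  moreover have "majorant (y1, y2) = ennreal ((2 + r) * exp (- r) / A)"
    unfolding majorant_def using A0 by (simp add: divide_ennreal norm_nome r_def A_def)
  moreover have "ennreal (12 * t) * ennreal ((r powr (-1/2) + r powr 1) / exp r) = ennreal ((12 * t) * ((r powr (-1/2) + r powr 1) / exp r))"
    by (rule ennreal_mult[symmetric]) (use tpos in \<open>auto simp: t_def\<close>)
  ultimately have "majorant (y1, y2) \<le> ennreal (12 * t) * ennreal ((r powr (-1/2) + r powr 1) / exp r)" by metis
  then show ?thesis unfolding t_def p_def q_def r_def .
qed

lemma nn_integral_powr_finite: "(\<integral>\<^sup>+x. indicator {0..2 * pi} x * ennreal (x powr (-1/2)) \<partial>lborel) < \<infinity>"
proof -
  have "(\<lambda>x. x powr (-1/2)) integrable_on {0..2 * pi}"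
    by (rule integrable_on_powr_from_0) auto
  then obtain I where "((\<lambda>x. x powr (-1/2)) has_integral I) {0..2 * pi}" by (auto simp: integrable_on_def)
  then have "((\<lambda>x. if x \<in> {0..2*pi} then x powr (-1/2) else 0) has_integral I) UNIV" by (simp only: has_integral_restrict_UNIV)
  then have "(\<integral>\<^sup>+x. ennreal (if x \<in> {0..2*pi} then x powr (-1/2) else 0) \<partial>lborel) = ennreal I"
    by (intro nn_integral_has_integral_lborel) auto
  moreover have "(\<integral>\<^sup>+x. indicator {0..2 * pi} x * ennreal (x powr (-1/2)) \<partial>lborel) = (\<integral>\<^sup>+x. ennreal (if x \<in> {0..2*pi} then x powr (-1/2) else 0) \<partial>lborel)"
    by (intro nn_integral_cong) (auto simp: indicator_def)
  ultimately show ?thesis by simp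
qed

lemma nn_integral_Gamma_finite:
  fixes a :: real assumes "- 1 < a"
  shows "(\<integral>\<^sup>+x. ennreal (\<bar>x\<bar> powr a / exp \<bar>x\<bar>) \<partial>lborel) < \<infinity>"
proof -
  define h where "h x = (if x \<in> {0..} then x powr a / exp x else 0)" for x :: real
  have [measurable]: "h \<in> borel_measurable borel" unfolding h_def by measurable
  have "((\<lambda>t. t powr ((a + 1) - 1) / exp t) has_integral Gamma (a + 1)) {0..}"
    by (rule Gamma_integral_real) (use assms in auto)
  then have "(h has_integral Gamma (a + 1)) UNIV" unfolding h_def by (simp only: has_integral_restrict_UNIV add_diff_cancel_right')
  moreover have "0 \<le> h x" for x by (simp add: h_def)
  ultimately have e: "(\<integral>\<^sup>+x. ennreal (h x) \<partial>lborel) = ennreal (Gamma (a + 1))"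
    by (intro nn_integral_has_integral_lborel) auto
  have e': "(\<integral>\<^sup>+x. ennreal (h (- x)) \<partial>lborel) = ennreal (Gamma (a + 1))"
    using nn_integral_real_affine[of "\<lambda>x. ennreal (h x)" "-1" 0] e by simp
  have "(\<integral>\<^sup>+x. ennreal (\<bar>x\<bar> powr a / exp \<bar>x\<bar>) \<partial>lborel) \<le> (\<integral>\<^sup>+x. ennreal (h x) + ennreal (h (- x)) \<partial>lborel)"
    by (intro nn_integral_mono) (auto simp: h_def)
  also have "\<dots> = ennreal (Gamma (a + 1)) + ennreal (Gamma (a + 1))" by (subst nn_integral_add) (auto simp: e e')
  also have "\<dots> < \<infinity>" by simp
  finally show ?thesis .
qed

lemma majorant_integral_finite: "(\<integral>\<^sup>+y. indicator cell y * majorant y \<partial>lborel) < \<infinity>"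
proof -
  define f where "f x = indicator {0..2 * pi} x * ennreal (12 * (x powr (-1/2) + (2 * pi - x) powr (-1/2)))" for x :: real
  define g where "g x = ennreal ((\<bar>x\<bar> powr (-1/2) + \<bar>x\<bar> powr 1) / exp \<bar>x\<bar>)" for x :: real
  have [measurable]: "f \<in> borel_measurable borel" "g \<in> borel_measurable borel" unfolding f_def g_def by measurable
  have nullset: "AE y :: plane in lborel. fst y \<noteq> c" "AE y :: plane in lborel. snd y \<noteq> c" for c
  proof -
    have "{c} \<times> UNIV \<in> null_sets (lborel \<Otimes>\<^sub>M lborel :: plane measure)"
      by (rule lborel.times_in_null_sets1) auto
    then have "AE y in lborel. y \<notin> {c} \<times> (UNIV :: real set)" by (intro AE_not_in) (simp add: lborel_prod)
    then show "AE y :: plane in lborel. fst y \<noteq> c" by eventually_elim auto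
    have "UNIV \<times> {c} \<in> null_sets (lborel \<Otimes>\<^sub>M lborel :: plane measure)"
      by (rule lborel.times_in_null_sets2) auto
    then have "AE y in lborel. y \<notin> (UNIV :: real set) \<times> {c}" by (intro AE_not_in) (simp add: lborel_prod)
    then show "AE y :: plane in lborel. snd y \<noteq> c" by eventually_elim auto
  qed
  have "(\<integral>\<^sup>+y. indicator cell y * majorant y \<partial>lborel) \<le> (\<integral>\<^sup>+y. f (fst y) * g (snd y) \<partial>lborel)"
  proof (rule nn_integral_mono_AE)
    show "AE y in lborel. indicator cell y * majorant y \<le> f (fst y) * g (snd y)"
      using nullset(1)[of 0] nullset(1)[of "2 * pi"] nullset(2)[of 0]
    proof eventually_elim
      case (elim y)
      show ?case
      proof (cases "y \<in> cell")
        case True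
        then show ?thesis using majorant_product_bound[of "fst y" "snd y"] elim
          by (cases y) (auto simp: cell_def f_def g_def)
      qed simp
    qed
  qed
  also have "\<dots> = (\<integral>\<^sup>+x. f x \<partial>lborel) * (\<integral>\<^sup>+x. g x \<partial>lborel)"
  proof -
    have "(\<integral>\<^sup>+y. f (fst y) * g (snd y) \<partial>lborel) = (\<integral>\<^sup>+x. (\<integral>\<^sup>+z. f x * g z \<partial>lborel) \<partial>lborel)"
      unfolding lborel_prod[symmetric] by (subst lborel.nn_integral_fst[symmetric]) auto
    then show ?thesis by (simp add: nn_integral_cmult nn_integral_multc)
  qed
  also have "\<dots> < \<infinity>"
  proof -
    have "(\<integral>\<^sup>+x. indicator {0..2 * pi} x * ennreal ((2 * pi - x) powr (-1/2)) \<partial>lborel)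
      = (\<integral>\<^sup>+x. indicator {0..2 * pi} x * ennreal (x powr (-1/2)) \<partial>lborel)"
    proof -
      have "(\<integral>\<^sup>+x. indicator {0..2 * pi} x * ennreal (x powr (-1/2)) \<partial>lborel)
        = (\<integral>\<^sup>+x. indicator {0..2 * pi} (2 * pi + -1 * x) * ennreal ((2 * pi + -1 * x) powr (-1/2)) \<partial>lborel)"
        using nn_integral_real_affine[of "\<lambda>x. indicator {0..2 * pi} x * ennreal (x powr (-1/2))" "-1" "2 * pi"] by simp
      also have "\<dots> = (\<integral>\<^sup>+x. indicator {0..2 * pi} x * ennreal ((2 * pi - x) powr (-1/2)) \<partial>lborel)"
        by (intro nn_integral_cong) (auto simp: indicator_def)
      finally show ?thesis by simp
    qed
    moreover have "(\<integral>\<^sup>+x. f x \<partial>lborel) = (\<integral>\<^sup>+x. 12 * (indicator {0..2 * pi} x * ennreal (x powr (-1/2)) + indicator {0..2 * pi} x * ennreal ((2 * pi - x) powr (-1/2))) \<partial>lborel)"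
      by (intro nn_integral_cong) (auto simp: f_def indicator_def ennreal_mult)
    ultimately have "(\<integral>\<^sup>+x. f x \<partial>lborel) = 12 * ((\<integral>\<^sup>+x. indicator {0..2 * pi} x * ennreal (x powr (-1/2)) \<partial>lborel) + (\<integral>\<^sup>+x. indicator {0..2 * pi} x * ennreal (x powr (-1/2)) \<partial>lborel))"
      by (simp add: nn_integral_cmult nn_integral_add)
    then have "(\<integral>\<^sup>+x. f x \<partial>lborel) < \<infinity>" using nn_integral_powr_finite by (simp add: ennreal_mult_less_top)
    moreover have "(\<integral>\<^sup>+x. g x \<partial>lborel) = (\<integral>\<^sup>+x. ennreal (\<bar>x\<bar> powr (-1/2) / exp \<bar>x\<bar>) + ennreal (\<bar>x\<bar> powr 1 / exp \<bar>x\<bar>) \<partial>lborel)"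
      by (intro nn_integral_cong) (simp add: g_def add_divide_distrib)
    then have "(\<integral>\<^sup>+x. g x \<partial>lborel) < \<infinity>"
      using nn_integral_Gamma_finite[of "-1/2"] nn_integral_Gamma_finite[of 1] by (simp add: nn_integral_add)
    ultimately show ?thesis by (simp add: ennreal_mult_less_top)
  qed
  finally show ?thesis .
qed

section \<open>Velocity of a transported density\<close>

text \<open>\<open>majorant\<close> is even and periodic and \<open>X\<close> preserves the area, so
  its mass over a cell depends neither on the centre \<open>x\<close> nor on \<open>X\<close>. The
  uniform constants of the flow rest on this.\<close>

lemma majorant_reflect: 
  assumes X: "measure_preserving_map X"
  shows "(\<integral>\<^sup>+y. indicator cell y * majorant (x - X y) \<partial>lborel) = (\<integral>\<^sup>+y. indicator cell y * majorant y \<partial>lborel)"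
proof -
  have m: "majorant (x - z) = majorant (z - x)" for z using majorant_minus[of "z - x"] by simp
  have per: "majorant (y + (2 * pi, 0) - x) = majorant (y - x)" for y
    using majorant_shift[of "y - x"] by (simp add: algebra_simps)
  have "(\<integral>\<^sup>+y. indicator cell y * majorant (X y - x) \<partial>lborel) = (\<integral>\<^sup>+y. indicator cell y * majorant (y - x) \<partial>lborel)"
    by (rule nn_integral_cell_fold[OF X]) (use per in auto)
  also have "\<dots> = (\<integral>\<^sup>+y. indicator cell y * majorant y \<partial>lborel)"
    using nn_integral_cell_fold[OF measure_preserving_map_shift[of "- x"], of majorant] by (simp add: majorant_shift)
  finally show ?thesis by (simp add: m)
qed

definition majorant_mass :: real where
  "majorant_mass = enn2real (\<integral>\<^sup>+y. indicator cell y * majorant y \<partial>lborel)"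

lemma majorant_mass: "(\<integral>\<^sup>+y. indicator cell y * majorant y \<partial>lborel) = ennreal majorant_mass"
  and majorant_mass_nonneg: "0 \<le> majorant_mass"
  using majorant_integral_finite by (simp_all add: majorant_mass_def less_top)

lemma AE_nome:
  assumes X: "measure_preserving_map X"
  shows "AE y in lborel. y \<in> cell \<longrightarrow> nome (x - X y) \<noteq> 1"
proof -
  note [measurable] = measure_preserving_mapD(4)[OF X]
  have "AE y in lborel. indicator cell y * majorant (x - X y) \<noteq> \<infinity>"
  proof (rule nn_integral_PInf_AE)
    show "(\<integral>\<^sup>+y. indicator cell y * majorant (x - X y) \<partial>lborel) \<noteq> \<infinity>"
      unfolding majorant_reflect[OF X] majorant_mass by simp
  qed measurable
  then show ?thesis by eventually_elim (auto simp: majorant_top)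
qed

lemma kern_shift: "kern (y + (2 * pi, 0)) = kern y"
  unfolding kern_gap gap_def by simp

lemma kern_measurable [measurable]: "kern \<in> borel_measurable borel"
proof -
  have [measurable]: "(\<lambda>y. snd y) \<in> borel_measurable (borel :: plane measure)"
    "(\<lambda>y. fst y) \<in> borel_measurable (borel :: plane measure)"
    by (intro borel_measurable_continuous_onI continuous_intros)+
  have [measurable]: "(\<lambda>y. sinh (snd y)) \<in> borel_measurable (borel :: plane measure)"
    "(\<lambda>y. cosh (snd y)) \<in> borel_measurable (borel :: plane measure)"
    by (intro borel_measurable_continuous_onI continuous_intros)+
  have "(\<lambda>y. kern y) \<in> borel_measurable borel"
    unfolding kern_gap gap_def by (intro borel_measurable_Pair) measurable
  then show ?thesis by simp
qed

section \<open>Differential of the kernel\<close>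

definition kern_deriv :: "plane \<Rightarrow> plane \<Rightarrow> plane" where
  "kern_deriv y h = (let d = (sin (fst y) * fst h + sinh (snd y) * snd h) / gap y in
    (- (snd h * (sin (fst y) / gap y) + snd y * (cos (fst y) * fst h / gap y - sin (fst y) / gap y * d)) / (8 * pi),
     d / (8 * pi) - (snd h * (sinh (snd y) / gap y) + snd y * (cosh (snd y) * snd h / gap y - sinh (snd y) / gap y * d)) / (8 * pi)))"

lemma kern_has_derivative:
  assumes "nome y \<noteq> 1" shows "(kern has_derivative kern_deriv y) (at y)"
proof -
  have g: "0 < gap y" using assms gap_nonneg[of y] nome_eq_1_iff[of y] by simp
  have dg: "(gap has_derivative (\<lambda>h. sin (fst y) * fst h + sinh (snd y) * snd h)) (at y)"
    unfolding gap_def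
    by (auto intro!: derivative_eq_intros DERIV_compose_FDERIV[of cosh "sinh (snd y)" snd y snd] has_derivative_snd simp: fun_eq_iff)
  have s: "((\<lambda>y. sin (fst y)) has_derivative (\<lambda>h. cos (fst y) * fst h)) (at y)"
    "((\<lambda>y. sinh (snd y)) has_derivative (\<lambda>h. cosh (snd y) * snd h)) (at y)"
    by (auto intro!: derivative_eq_intros DERIV_compose_FDERIV[of sinh "cosh (snd y)" snd y snd] has_derivative_snd simp: fun_eq_iff mult.commute)
  define d where "d h = (sin (fst y) * fst h + sinh (snd y) * snd h) / gap y" for h
  have P: "((\<lambda>y. sin (fst y) / gap y) has_derivative (\<lambda>h. cos (fst y) * fst h / gap y - sin (fst y) / gap y * d h)) (at y)"
    by (rule has_derivative_eq_rhs[OF has_derivative_divide'[OF s(1) dg]]) (use g in \<open>auto simp: d_def fun_eq_iff diff_divide_distrib\<close>)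
  have Q: "((\<lambda>y. sinh (snd y) / gap y) has_derivative (\<lambda>h. cosh (snd y) * snd h / gap y - sinh (snd y) / gap y * d h)) (at y)"
    by (rule has_derivative_eq_rhs[OF has_derivative_divide'[OF s(2) dg]]) (use g in \<open>auto simp: d_def fun_eq_iff diff_divide_distrib\<close>)
  have sn: "(snd has_derivative snd) (at y)" by (rule bounded_linear_imp_has_derivative[OF bounded_linear_snd])
  have L: "((\<lambda>y. ln (2 * gap y)) has_derivative d) (at y)"
  proof -
    have "((\<lambda>y. ln (2 * gap y)) has_derivative (\<lambda>h. 2 * (sin (fst y) * fst h + sinh (snd y) * snd h) * inverse (2 * gap y))) (at y)"
      by (rule has_derivative_ln[OF _ has_derivative_mult_right[OF dg]]) (use g in simp)
    moreover have "(\<lambda>h. 2 * (sin (fst y) * fst h + sinh (snd y) * snd h) * inverse (2 * gap y)) = d"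
      using g by (auto simp: d_def fun_eq_iff field_simps)
    ultimately show ?thesis by metis
  qed
  have 1: "((\<lambda>y. - (snd y * (sin (fst y) / gap y)) / (8 * pi)) has_derivative (\<lambda>h. fst (kern_deriv y h))) (at y)"
    by (rule has_derivative_eq_rhs[OF bounded_linear.has_derivative[OF bounded_linear_divide, of _ _ _ "8 * pi", OF has_derivative_minus[OF has_derivative_mult[OF sn P]]]])
      (simp add: kern_deriv_def d_def Let_def fun_eq_iff add.commute)
  have 2: "((\<lambda>y. ln (2 * gap y) / (8 * pi) - (snd y * (sinh (snd y) / gap y)) / (8 * pi)) has_derivative (\<lambda>h. snd (kern_deriv y h))) (at y)"
    by (rule has_derivative_eq_rhs[OF has_derivative_diff[OF bounded_linear.has_derivative[OF bounded_linear_divide, of _ _ _ "8 * pi", OF L] bounded_linear.has_derivative[OF bounded_linear_divide, of _ _ _ "8 * pi", OF has_derivative_mult[OF sn Q]]]])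
      (simp add: kern_deriv_def d_def Let_def fun_eq_iff add.commute)
  have "kern z = (- (snd z * (sin (fst z) / gap z)) / (8 * pi), ln (2 * gap z) / (8 * pi) - (snd z * (sinh (snd z) / gap z)) / (8 * pi))" for z
    unfolding kern_gap by (simp add: mult_ac)
  then have "kern = (\<lambda>z. (- (snd z * (sin (fst z) / gap z)) / (8 * pi), ln (2 * gap z) / (8 * pi) - (snd z * (sinh (snd z) / gap z)) / (8 * pi)))" by blast
  then show ?thesis using has_derivative_Pair[OF 1 2] by simp
qed

text \<open>The kernel is divergence free because \<open>sin^2 + sinh^2\<close> factors as
  \<open>gap * (cos + cosh)\<close>. At the singular points every quotient has the default value
  0.\<close>

lemma kern_deriv_trace: "fst (kern_deriv y (1, 0)) + snd (kern_deriv y (0, 1)) = 0"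
proof (cases "gap y = 0")
  case False
  have "(sin (fst y))\<^sup>2 + (sinh (snd y))\<^sup>2 = gap y * (cos (fst y) + cosh (snd y))"
  proof -
    have a: "(sin (fst y))\<^sup>2 = 1 - (cos (fst y))\<^sup>2" and b: "(sinh (snd y))\<^sup>2 = (cosh (snd y))\<^sup>2 - 1"
      by (simp_all add: sin_squared_eq sinh_square_eq)
    show ?thesis unfolding gap_def a b by algebra
  qed
  then have "(sin (fst y))\<^sup>2 / (gap y * gap y) + (sinh (snd y))\<^sup>2 / (gap y * gap y) = cos (fst y) / gap y + cosh (snd y) / gap y"
    using False by (simp flip: add_divide_distrib)
  then have E: "cos (fst y) / gap y - sin (fst y) / gap y * (sin (fst y) / gap y) = - (cosh (snd y) / gap y - sinh (snd y) / gap y * (sinh (snd y) / gap y))"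
    by (simp add: power2_eq_square)
  have "- (s * A) / p + (q / p - (q + s * B) / p) = 0" if "A = - B" for A B q s p :: real
    using that by (simp add: add_divide_distrib)
  from this[OF E, of "snd y" "8 * pi" "sinh (snd y) / gap y"]
  show ?thesis unfolding kern_deriv_def Let_def by simp
qed (simp add: kern_deriv_def Let_def)

lemma kern_deriv_measurable [measurable]: "(\<lambda>y. kern_deriv y h) \<in> borel_measurable borel"
proof -
  have [measurable]: "(\<lambda>y. snd y) \<in> borel_measurable (borel :: plane measure)"
    "(\<lambda>y. fst y) \<in> borel_measurable (borel :: plane measure)"
    by (intro borel_measurable_continuous_onI continuous_intros)+
  have [measurable]: "(\<lambda>y. sinh (snd y)) \<in> borel_measurable (borel :: plane measure)"
    "(\<lambda>y. cosh (snd y)) \<in> borel_measurable (borel :: plane measure)"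
    by (intro borel_measurable_continuous_onI continuous_intros)+
  show ?thesis
    unfolding kern_deriv_def gap_def Let_def by (intro borel_measurable_Pair) measurable
qed

lemma isCont_nome: "isCont nome y"
proof -
  have "continuous_on UNIV nome" unfolding nome_def by (intro continuous_intros)
  then show ?thesis unfolding continuous_on_eq_continuous_at[OF open_UNIV] by blast
qed

lemma isCont_majorant:
  assumes "nome y \<noteq> 1" shows "isCont (\<lambda>y. (2 + \<bar>snd y\<bar>) * norm (nome_ratio y)) y"
proof -
  have "isCont nome y" by (rule isCont_nome)
  then show ?thesis using assms unfolding nome_ratio_def by (intro continuous_intros) auto
qed

lemma eventually_nome:
  assumes "nome y \<noteq> 1" shows "eventually (\<lambda>z. nome z \<noteq> 1) (nhds y)"
proof -
  have "isCont nome y" by (rule isCont_nome)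
  then have "(nome \<longlongrightarrow> nome y) (nhds y)" by (simp add: continuous_at tendsto_at_iff_tendsto_nhds)
  then show ?thesis by (rule tendsto_imp_eventually_ne) (rule assms)
qed

lemma majorant_tendsto:
  assumes y: "nome y \<noteq> 1" and s: "s \<longlonglongrightarrow> y" shows "(\<lambda>n. majorant (s n)) \<longlonglongrightarrow> majorant y"
proof -
  have "(\<lambda>n. (2 + \<bar>snd (s n)\<bar>) * norm (nome_ratio (s n))) \<longlonglongrightarrow> (2 + \<bar>snd y\<bar>) * norm (nome_ratio y)"
    using isCont_tendsto_compose[OF isCont_majorant[OF y] s] .
  then have "(\<lambda>n. ennreal ((2 + \<bar>snd (s n)\<bar>) * norm (nome_ratio (s n)))) \<longlonglongrightarrow> majorant y"
    unfolding majorant_ennreal[OF y] by (rule tendsto_ennrealI)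
  moreover have "eventually (\<lambda>n. nome (s n) \<noteq> 1) sequentially"
    using eventually_nome[OF y] s by (rule eventually_compose_filterlim)
  then have "eventually (\<lambda>n. ennreal ((2 + \<bar>snd (s n)\<bar>) * norm (nome_ratio (s n))) = majorant (s n)) sequentially"
    by eventually_elim (simp add: majorant_ennreal)
  ultimately show ?thesis by (rule Lim_transform_eventually)
qed

text \<open>The Lipschitz inequality for \<open>kern\<close> passes to the limit along difference
  quotients at the points \<open>y + t n *\<^sub>R h\<close>; the majorant is continuous away from
  its singularities, so the moving end point does no harm.\<close>

lemma kern_deriv_bound: "ennreal (norm (kern_deriv y h)) \<le> ennreal (norm h) * (majorant y + majorant y)"
proof (cases "nome y = 1 \<or> h = 0")
  case True
  then show ?thesis by (cases "h = 0") (auto simp: majorant_top ennreal_mult_top kern_deriv_def zero_prod_def[symmetric])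
next
  case False
  then have y: "nome y \<noteq> 1" and h: "h \<noteq> 0" by auto
  define t where "t n = 1 / real (Suc n)" for n
  have t0: "t \<longlonglongrightarrow> 0" unfolding t_def using LIMSEQ_inverse_real_of_nat by (simp add: inverse_eq_divide)
  have tp: "0 < t n" for n by (simp add: t_def)
  define s where "s n = y + t n *\<^sub>R h" for n
  have s: "s \<longlonglongrightarrow> y" unfolding s_def using tendsto_add[OF tendsto_const[of y] tendsto_scaleR[OF t0 tendsto_const[of h]]] by simp
  have "((\<lambda>t. kern (y + t *\<^sub>R h)) has_derivative (\<lambda>t. kern_deriv y (t *\<^sub>R h))) (at 0)"
  proof -
    have "((\<lambda>t. y + t *\<^sub>R h) has_derivative (\<lambda>t. t *\<^sub>R h)) (at 0)" by (auto intro!: derivative_eq_intros)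
    moreover have "(kern has_derivative kern_deriv y) (at (y + 0 *\<^sub>R h))" using kern_has_derivative[OF y] by simp
    ultimately show ?thesis by (rule has_derivative_compose)
  qed
  moreover have "kern_deriv y (t *\<^sub>R h) = t *\<^sub>R kern_deriv y h" for t
    using has_derivative_linear[OF kern_has_derivative[OF y]] by (simp add: linear_cmul)
  ultimately have "((\<lambda>t. kern (y + t *\<^sub>R h)) has_vector_derivative kern_deriv y h) (at 0)"
    by (simp add: has_vector_derivative_def)
  then have v: "((\<lambda>t. B (kern (y + t *\<^sub>R h))) has_real_derivative B (kern_deriv y h)) (at 0)" if "bounded_linear B" for B
    using bounded_linear.has_vector_derivative[OF that] by (simp add: has_real_derivative_iff_has_vector_derivative)
  have ft: "filterlim t (at 0) sequentially" using t0 tp by (intro filterlim_atI) (auto simp: less_imp_neq[symmetric])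
  have "(\<lambda>n. (B (kern (y + t n *\<^sub>R h)) - B (kern y)) / t n) \<longlonglongrightarrow> B (kern_deriv y h)" if "bounded_linear B" for B
    using filterlim_compose[OF v[OF that, unfolded DERIV_def] ft] by simp
  from tendsto_Pair[OF this[OF bounded_linear_fst] this[OF bounded_linear_snd]]
  have "(\<lambda>n. (kern (s n) - kern y) /\<^sub>R t n) \<longlonglongrightarrow> kern_deriv y h"
    by (simp add: s_def divide_inverse mult.commute scaleR_prod_def)
  then have 1: "(\<lambda>n. ennreal (norm ((kern (s n) - kern y) /\<^sub>R t n))) \<longlonglongrightarrow> ennreal (norm (kern_deriv y h))"
    by (intro tendsto_ennrealI tendsto_norm)
  have 2: "(\<lambda>n. ennreal (norm h) * (majorant (s n) + majorant y)) \<longlonglongrightarrow> ennreal (norm h) * (majorant y + majorant y)"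
    by (intro ennreal_tendsto_cmult tendsto_add majorant_tendsto[OF y s] tendsto_const) simp
  have 3: "ennreal (norm ((kern (s n) - kern y) /\<^sub>R t n)) \<le> ennreal (norm h) * (majorant (s n) + majorant y)" for n
  proof -
    have "ennreal (norm ((kern (s n) - kern y) /\<^sub>R t n)) = ennreal (1 / t n) * ennreal (norm (kern (s n) - kern y))"
      using tp[of n] by (simp add: ennreal_mult[symmetric] divide_inverse abs_of_pos mult.commute)
    also have "\<dots> \<le> ennreal (1 / t n) * (ennreal (norm (s n - y)) * (majorant (s n) + majorant y))"
      by (intro mult_left_mono kern_lipschitz) simp
    also have "norm (s n - y) = t n * norm h" using tp[of n] by (simp add: s_def)
    also have "ennreal (1 / t n) * (ennreal (t n * norm h) * (majorant (s n) + majorant y)) = (ennreal (1 / t n) * ennreal (t n * norm h)) * (majorant (s n) + majorant y)"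
      by (simp add: mult.assoc)
    also have "ennreal (1 / t n) * ennreal (t n * norm h) = ennreal (norm h)"
      using tp[of n] by (simp add: ennreal_mult[symmetric])
    finally show ?thesis .
  qed
  show ?thesis by (rule LIMSEQ_le[OF 1 2]) (use 3 in auto)
qed

text \<open>Dominated convergence with dominating functions \<open>g n\<close> that vary with
  \<open>n\<close>: Fatou is applied to \<open>g n - f n\<close>, using that all \<open>g n\<close>
  and their limit have the same finite integral. It is made for majorants centred at
  \<open>x + s n\<close>, whose singularity moves with \<open>n\<close>.\<close>

lemma dominated_by_converging:
  fixes f g :: "nat \<Rightarrow> 'a \<Rightarrow> ennreal"
  assumes [measurable]: "\<And>n. f n \<in> borel_measurable M" "\<And>n. g n \<in> borel_measurable M" "G \<in> borel_measurable M"
    and le: "\<And>n. AE x in M. f n x \<le> g n x"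
    and f0: "AE x in M. (\<lambda>n. f n x) \<longlonglongrightarrow> 0" and gG: "AE x in M. (\<lambda>n. g n x) \<longlonglongrightarrow> G x"
    and c: "\<And>n. (\<integral>\<^sup>+x. g n x \<partial>M) = ennreal c" "(\<integral>\<^sup>+x. G x \<partial>M) = ennreal c"
  shows "(\<lambda>n. \<integral>\<^sup>+x. f n x \<partial>M) \<longlonglongrightarrow> 0"
proof -
  define a where "a n = (\<integral>\<^sup>+x. f n x \<partial>M)" for n
  have ale: "a n \<le> ennreal c" for n unfolding a_def c(1)[of n, symmetric] by (rule nn_integral_mono_AE[OF le])
  have diff: "(\<integral>\<^sup>+x. g n x - f n x \<partial>M) = ennreal c - a n" for n
    unfolding a_def c(1)[of n, symmetric]
    by (rule nn_integral_diff[OF _ _ _ le]) (use ale[of n] in \<open>auto simp: a_def[symmetric] top_unique\<close>)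
  have "AE x in M. G x \<noteq> \<infinity>" by (rule nn_integral_PInf_AE) (auto simp: c)
  with f0 gG have "AE x in M. (\<lambda>n. g n x - f n x) \<longlonglongrightarrow> G x"
  proof eventually_elim
    case (elim x)
    have "(\<lambda>n. g n x - f n x) \<longlonglongrightarrow> G x - 0" using elim by (intro tendsto_diff_ennreal) auto
    then show ?case by simp
  qed
  then have "AE x in M. G x = liminf (\<lambda>n. g n x - f n x)"
    by eventually_elim (simp add: lim_imp_Liminf)
  then have "(\<integral>\<^sup>+x. G x \<partial>M) = (\<integral>\<^sup>+x. liminf (\<lambda>n. g n x - f n x) \<partial>M)" by (rule nn_integral_cong_AE)
  also have "\<dots> \<le> liminf (\<lambda>n. \<integral>\<^sup>+x. g n x - f n x \<partial>M)" by (rule nn_integral_liminf) measurable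
  finally have L: "ennreal c \<le> liminf (\<lambda>n. ennreal c - a n)" unfolding c diff .
  have "a \<longlonglongrightarrow> 0"
  proof (rule order_tendstoI)
    fix e :: ennreal assume e: "0 < e"
    show "eventually (\<lambda>n. a n < e) sequentially"
    proof (cases "ennreal c = 0")
      case True then show ?thesis using ale e by (simp add: order_le_less_trans)
    next
      case False
      have "ennreal c - e < ennreal c" using False e by (intro ennreal_between) (auto simp: zero_less_iff_neq_zero)
      then have "eventually (\<lambda>n. ennreal c - e < ennreal c - a n) sequentially" using L less_LiminfD order_less_le_trans by blast
      then show ?thesis
      proof eventually_elim
        case (elim n) show ?case
        proof (rule ccontr)
          assume "\<not> a n < e" then have "ennreal c - a n \<le> ennreal c - e" by (intro ennreal_minus_mono) auto
          then show False using elim by simp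
        qed
      qed
    qed
  qed simp
  then show ?thesis unfolding a_def .
qed

text \<open>Velocity at \<open>x\<close> when the particle with label \<open>y\<close> sits at
  \<open>X y\<close> and carries the density \<open>\<rho> y\<close>. For the flow maps it is the
  convolution with the transported density (\<open>velocity_transported\<close>); integrating over
  labels lets \<open>\<rho>\<close> be discontinuous while the dependence on \<open>X\<close> stays
  Lipschitz.\<close>

definition transport_velocity :: "(plane \<Rightarrow> real) \<Rightarrow> (plane \<Rightarrow> plane) \<Rightarrow> plane \<Rightarrow> plane" where
  "transport_velocity \<rho> X x = (LBINT y. indicator cell y *\<^sub>R (\<rho> y *\<^sub>R kern (x - X y)))"

locale bounded_density =
  fixes \<rho> :: "plane \<Rightarrow> real" and R :: real
  assumes \<rho>_measurable [measurable]: "\<rho> \<in> borel_measurable borel" and \<rho>_bound: "\<And>y. \<bar>\<rho> y\<bar> \<le> R"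
begin

lemma R_nonneg: "0 \<le> R"
  using \<rho>_bound[of 0] by linarith

definition C_vel :: real where "C_vel = 2 * R * majorant_mass"

lemma C_vel_nonneg: "0 \<le> C_vel"
  using R_nonneg majorant_mass_nonneg by (simp add: C_vel_def)

lemma weighted_majorant:
  assumes X: "measure_preserving_map X" and Y: "measure_preserving_map Y" and a: "0 \<le> a"
  shows "(\<integral>\<^sup>+y. indicator cell y * (ennreal (R * a) * (majorant (x - X y) + majorant (x' - Y y))) \<partial>lborel) = ennreal (C_vel * a)"
proof -
  note [measurable] = measure_preserving_mapD(4)[OF X] measure_preserving_mapD(4)[OF Y]
  have "(\<integral>\<^sup>+y. indicator cell y * (ennreal (R * a) * (majorant (x - X y) + majorant (x' - Y y))) \<partial>lborel)
    = (\<integral>\<^sup>+y. ennreal (R * a) * (indicator cell y * majorant (x - X y) + indicator cell y * majorant (x' - Y y)) \<partial>lborel)"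
    by (intro nn_integral_cong) (auto simp: indicator_def)
  also have "\<dots> = ennreal (R * a) * ((\<integral>\<^sup>+y. indicator cell y * majorant (x - X y) \<partial>lborel) + (\<integral>\<^sup>+y. indicator cell y * majorant (x' - Y y) \<partial>lborel))"
    by (subst nn_integral_cmult) (auto intro!: arg_cong2[of _ _ _ _ "(*)"] nn_integral_add)
  also have "\<dots> = ennreal (R * a) * (ennreal majorant_mass + ennreal majorant_mass)"
    unfolding majorant_reflect[OF X] majorant_reflect[OF Y] majorant_mass ..
  also have "\<dots> = ennreal (C_vel * a)"
    using R_nonneg majorant_mass_nonneg a by (simp add: C_vel_def ennreal_mult[symmetric] ennreal_plus[symmetric] mult_ac del: ennreal_plus)
  finally show ?thesis .
qed

text \<open>Each of the two majorants carries the mass \<open>majorant_mass\<close>, whence the 2 in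
  \<open>C_vel\<close>. The bounds on the field, on its differences and on its differential are all
  instances.\<close>

lemma norm_integral_le:
  assumes X: "measure_preserving_map X" and Y: "measure_preserving_map Y" and a: "0 \<le> a"
    and f[measurable]: "f \<in> borel_measurable borel"
    and le: "\<And>y. ennreal (norm (f y)) \<le> ennreal a * (majorant (x - X y) + majorant (x' - Y y))"
  shows "integrable lborel (\<lambda>y. indicator cell y *\<^sub>R (\<rho> y *\<^sub>R (f y :: plane)))"
    and "norm (LBINT y. indicator cell y *\<^sub>R (\<rho> y *\<^sub>R f y)) \<le> C_vel * a"
proof -
  have bd: "(\<integral>\<^sup>+y. ennreal (norm (indicator cell y *\<^sub>R (\<rho> y *\<^sub>R f y))) \<partial>lborel) \<le> ennreal (C_vel * a)"
    unfolding weighted_majorant[OF X Y a, of x x', symmetric]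
  proof (rule nn_integral_mono)
    fix y
    have "ennreal (norm (\<rho> y *\<^sub>R f y)) = ennreal \<bar>\<rho> y\<bar> * ennreal (norm (f y))" by (simp add: ennreal_mult)
    also have "\<dots> \<le> ennreal R * (ennreal a * (majorant (x - X y) + majorant (x' - Y y)))"
      by (intro mult_mono ennreal_leI \<rho>_bound le) auto
    also have "\<dots> = ennreal (R * a) * (majorant (x - X y) + majorant (x' - Y y))"
      using R_nonneg a by (simp add: ennreal_mult mult.assoc)
    finally show "ennreal (norm (indicator cell y *\<^sub>R (\<rho> y *\<^sub>R f y))) \<le> indicator cell y * (ennreal (R * a) * (majorant (x - X y) + majorant (x' - Y y)))"
      by (auto simp: indicator_def)
  qed
  show int: "integrable lborel (\<lambda>y. indicator cell y *\<^sub>R (\<rho> y *\<^sub>R f y))"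
    unfolding integrable_iff_bounded using bd by (auto intro: order_le_less_trans)
  have "ennreal (norm (LBINT y. indicator cell y *\<^sub>R (\<rho> y *\<^sub>R f y))) \<le> ennreal (C_vel * a)"
    using integral_norm_bound_ennreal[OF int] bd by (rule order_trans)
  then show "norm (LBINT y. indicator cell y *\<^sub>R (\<rho> y *\<^sub>R f y)) \<le> C_vel * a"
    using C_vel_nonneg a by (simp add: ennreal_le_iff)
qed

lemma kern_double_bound: "ennreal (norm (kern z)) \<le> ennreal 1 * (majorant z + majorant z)"
  using order_trans[OF kern_bound[of z], of "majorant z + majorant z"] by simp

context
  fixes X assumes X: "measure_preserving_map X"
begin

lemma X_measurable [measurable]: "X \<in> borel_measurable borel"
  by (rule measure_preserving_mapD(4)[OF X])

lemma transport_velocity_integrable: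
  "integrable lborel (\<lambda>y. indicator cell y *\<^sub>R (\<rho> y *\<^sub>R kern (x - X y)))"
  by (rule norm_integral_le(1)[OF X X _ _ kern_double_bound]) auto

lemma transport_velocity_bound: "norm (transport_velocity \<rho> X x) \<le> C_vel"
  unfolding transport_velocity_def using norm_integral_le(2)[OF X X _ _ kern_double_bound, of x] by simp

text \<open>\<open>kern_lipschitz\<close> is integrated against the density, and the mass of both
  majorants is independent of point and map. Equal maps give the Lipschitz bound in the point,
  different maps the dependence of the field on the flow, in particular on time.\<close>

lemma transport_velocity_diff:
  assumes Y: "measure_preserving_map Y" and d: "\<And>y. norm ((x - X y) - (x' - Y y)) \<le> d" and d0: "0 \<le> d"
  shows "norm (transport_velocity \<rho> X x - transport_velocity \<rho> Y x') \<le> C_vel * d"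
proof -
  note [measurable] = measure_preserving_mapD(4)[OF Y]
  have i1: "integrable lborel (\<lambda>y. indicator cell y *\<^sub>R (\<rho> y *\<^sub>R kern (x' - Y y)))"
    by (rule norm_integral_le(1)[OF Y Y _ _ kern_double_bound]) auto
  have "transport_velocity \<rho> X x - transport_velocity \<rho> Y x' = (LBINT y. indicator cell y *\<^sub>R (\<rho> y *\<^sub>R (kern (x - X y) - kern (x' - Y y))))"
    unfolding transport_velocity_def by (subst Bochner_Integration.integral_diff[symmetric, OF transport_velocity_integrable i1]) (simp add: scaleR_diff_right)
  also have "norm \<dots> \<le> C_vel * d"
  proof (rule norm_integral_le(2)[OF X Y d0])
    show "ennreal (norm (kern (x - X y) - kern (x' - Y y))) \<le> ennreal d * (majorant (x - X y) + majorant (x' - Y y))" for y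
      by (rule order_trans[OF kern_lipschitz]) (intro mult_right_mono ennreal_leI d, simp)
  qed measurable
  finally show ?thesis .
qed

lemma transport_velocity_lipschitz:
  "norm (transport_velocity \<rho> X x - transport_velocity \<rho> X x') \<le> C_vel * norm (x - x')"
  by (rule transport_velocity_diff[OF X]) auto

lemma transport_velocity_shift: "transport_velocity \<rho> X (x + (2 * pi, 0)) = transport_velocity \<rho> X x"
proof -
  have "kern (x + (2 * pi, 0) - X y) = kern (x - X y)" for y
    using kern_shift[of "x - X y"] by (simp add: algebra_simps)
  then show ?thesis unfolding transport_velocity_def by simp
qed

text \<open>Differentiation under the integral sign, with a derivative as singular as the majorant.
  The remainder of the difference quotient tends to 0 for almost every \<open>y\<close> in the cell,
  namely where \<open>x - X y\<close> is not singular, and is dominated by majorants centred at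
  \<open>x\<close> and at the moving point \<open>x + s n\<close>; hence
  \<open>dominated_by_converging\<close>. The trace vanishes already under the integral.\<close>

lemma transport_velocity_derivative:
  "\<exists>D. (transport_velocity \<rho> X has_derivative D) (at x) \<and> fst (D (1, 0)) + snd (D (0, 1)) = 0"
proof -
  define D where "D h = (LBINT y. indicator cell y *\<^sub>R (\<rho> y *\<^sub>R kern_deriv (x - X y) h))" for h
  have meas [measurable]: "(\<lambda>y. kern_deriv (x - X y) h) \<in> borel_measurable borel" for h
  proof -
    have "(\<lambda>y. kern_deriv y h) \<circ> (\<lambda>y. x - X y) \<in> borel_measurable borel" by (rule measurable_comp[of _ _ borel]) measurable
    then show ?thesis by (simp add: o_def)
  qed
  have Dint: "integrable lborel (\<lambda>y. indicator cell y *\<^sub>R (\<rho> y *\<^sub>R kern_deriv (x - X y) h))" for h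
    by (rule norm_integral_le(1)[OF X X _ _ kern_deriv_bound]) auto
  have Dbd: "norm (D h) \<le> C_vel * norm h" for h
    unfolding D_def by (rule norm_integral_le(2)[OF X X _ _ kern_deriv_bound]) auto
  have lin: "kern_deriv z (h + k) = kern_deriv z h + kern_deriv z k" "kern_deriv z (c *\<^sub>R h) = c *\<^sub>R kern_deriv z h" for z h k c
    unfolding kern_deriv_def Let_def by (simp_all add: algebra_simps add_divide_distrib diff_divide_distrib)
  have "bounded_linear D"
  proof (rule bounded_linear_intro)
    show "D (h + k) = D h + D k" for h k
      unfolding D_def by (subst Bochner_Integration.integral_add[symmetric, OF Dint Dint]) (simp add: lin scaleR_add_right)
    show "D (c *\<^sub>R h) = c *\<^sub>R D h" for c h
      unfolding D_def by (subst integral_scaleR_right[symmetric]) (simp add: lin mult_ac)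
    show "norm (D h) \<le> norm h * C_vel" for h using Dbd[of h] by (simp add: mult.commute)
  qed
  moreover have "((\<lambda>h. norm (transport_velocity \<rho> X (x + h) - transport_velocity \<rho> X x - D h) / norm h) \<longlongrightarrow> 0) (at 0)"
    unfolding tendsto_at_iff_sequentially
  proof (intro allI impI, unfold o_def)
    fix s :: "nat \<Rightarrow> plane" assume s0: "\<forall>n. s n \<in> UNIV - {0}" and s: "s \<longlonglongrightarrow> 0"
    have sn: "0 < norm (s n)" for n using s0 by simp
    define r where "r n y = kern (x + s n - X y) - kern (x - X y) - kern_deriv (x - X y) (s n)" for n y
    have [measurable]: "r n \<in> borel_measurable borel" for n unfolding r_def by measurable
    define f where "f n y = indicator cell y * (ennreal R * ennreal (norm (r n y) / norm (s n)))" for n y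
    define g where "g n y = indicator cell y * (ennreal (R * 1) * (majorant (x + s n - X y) + majorant (x - X y))) + indicator cell y * (ennreal (R * 1) * (majorant (x - X y) + majorant (x - X y)))" for n y
    define G where "G y = indicator cell y * (ennreal (R * 1) * (majorant (x - X y) + majorant (x - X y))) + indicator cell y * (ennreal (R * 1) * (majorant (x - X y) + majorant (x - X y)))" for y
    have ae: "AE y in lborel. y \<in> cell \<longrightarrow> nome (x - X y) \<noteq> 1" by (rule AE_nome[OF X])
      have fg: "AE y in lborel. f n y \<le> g n y" for n
      proof (intro AE_I2)
        fix y
        have "ennreal (norm (r n y) / norm (s n)) = ennreal (1 / norm (s n)) * ennreal (norm (r n y))"
          using sn[of n] by (simp add: ennreal_mult[symmetric])
        also have "\<dots> \<le> ennreal (1 / norm (s n)) * (ennreal (norm (s n)) * (majorant (x + s n - X y) + majorant (x - X y)) + ennreal (norm (s n)) * (majorant (x - X y) + majorant (x - X y)))"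
        proof (intro mult_left_mono)
          have "ennreal (norm (r n y)) \<le> ennreal (norm (kern (x + s n - X y) - kern (x - X y)) + norm (kern_deriv (x - X y) (s n)))"
            unfolding r_def by (intro ennreal_leI norm_triangle_ineq4)
          also have "\<dots> = ennreal (norm (kern (x + s n - X y) - kern (x - X y))) + ennreal (norm (kern_deriv (x - X y) (s n)))" by simp
          also have "\<dots> \<le> ennreal (norm (s n)) * (majorant (x + s n - X y) + majorant (x - X y)) + ennreal (norm (s n)) * (majorant (x - X y) + majorant (x - X y))"
            using kern_lipschitz[of "x + s n - X y" "x - X y"] kern_deriv_bound[of "x - X y" "s n"] by (intro add_mono) simp_all
          finally show "ennreal (norm (r n y)) \<le> \<dots>" .
        qed simp
        also have "\<dots> = (ennreal (1 / norm (s n)) * ennreal (norm (s n))) * ((majorant (x + s n - X y) + majorant (x - X y)) + (majorant (x - X y) + majorant (x - X y)))"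
          by (simp add: distrib_left mult.assoc)
        also have "ennreal (1 / norm (s n)) * ennreal (norm (s n)) = 1" using sn[of n] by (simp add: ennreal_mult[symmetric])
        finally show "f n y \<le> g n y" unfolding f_def g_def
          by (auto simp: indicator_def distrib_left[symmetric] intro!: mult_left_mono)
      qed
      have gint: "(\<integral>\<^sup>+y. g n y \<partial>lborel) = ennreal (C_vel * 1 + C_vel * 1)" for n
      proof -
        have "(\<integral>\<^sup>+y. g n y \<partial>lborel) = ennreal (C_vel * 1) + ennreal (C_vel * 1)"
          unfolding g_def by (subst nn_integral_add) (measurable, simp only: weighted_majorant[OF X X zero_le_one])
        also have "\<dots> = ennreal (C_vel * 1 + C_vel * 1)" using C_vel_nonneg by (subst ennreal_plus) auto
        finally show ?thesis .
      qed
    have "(\<lambda>n. \<integral>\<^sup>+y. f n y \<partial>lborel) \<longlonglongrightarrow> 0"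
    proof (rule dominated_by_converging[where g = g and G = G and c = "C_vel * 1 + C_vel * 1"])
      show "AE y in lborel. f n y \<le> g n y" for n by (rule fg)
      show "AE y in lborel. (\<lambda>n. f n y) \<longlonglongrightarrow> 0" using ae
      proof eventually_elim
        case (elim y)
        show ?case
        proof (cases "y \<in> cell")
          case True
          then have "(kern has_derivative kern_deriv (x - X y)) (at (x - X y))" using elim by (intro kern_has_derivative) auto
          then have "((\<lambda>h. norm (kern (x - X y + h) - kern (x - X y) - kern_deriv (x - X y) h) / norm h) \<longlongrightarrow> 0) (at 0)"
            unfolding has_derivative_at by blast
          from this[unfolded tendsto_at_iff_sequentially, rule_format, of s] s0 s
          have "(\<lambda>n. norm (r n y) / norm (s n)) \<longlonglongrightarrow> 0" by (simp add: o_def r_def algebra_simps)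
          from tendsto_mult_ennreal[OF tendsto_const[of "ennreal R"] tendsto_ennrealI[OF this]]
          show ?thesis using True by (simp add: f_def)
        qed (simp add: f_def)
      qed
      show "AE y in lborel. (\<lambda>n. g n y) \<longlonglongrightarrow> G y" using ae
      proof eventually_elim
        case (elim y)
        show ?case
        proof (cases "y \<in> cell")
          case True
          have "(\<lambda>n. x + s n - X y) \<longlonglongrightarrow> x + 0 - X y" by (intro tendsto_intros s)
          then have "(\<lambda>n. majorant (x + s n - X y)) \<longlonglongrightarrow> majorant (x - X y)" using elim True by (intro majorant_tendsto) auto
          then have "(\<lambda>n. ennreal (R * 1) * (majorant (x + s n - X y) + majorant (x - X y)) + ennreal (R * 1) * (majorant (x - X y) + majorant (x - X y)))
            \<longlonglongrightarrow> ennreal (R * 1) * (majorant (x - X y) + majorant (x - X y)) + ennreal (R * 1) * (majorant (x - X y) + majorant (x - X y))"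
            by (intro tendsto_add ennreal_tendsto_cmult tendsto_const) auto
          then show ?thesis using True by (simp add: g_def G_def)
        qed (simp add: g_def G_def)
      qed
      show "(\<integral>\<^sup>+y. g n y \<partial>lborel) = ennreal (C_vel * 1 + C_vel * 1)" for n by (rule gint)
      show "(\<integral>\<^sup>+y. G y \<partial>lborel) = ennreal (C_vel * 1 + C_vel * 1)"
      proof -
        have "(\<integral>\<^sup>+y. G y \<partial>lborel) = ennreal (C_vel * 1) + ennreal (C_vel * 1)"
          unfolding G_def by (subst nn_integral_add) (measurable, simp only: weighted_majorant[OF X X zero_le_one])
        also have "\<dots> = ennreal (C_vel * 1 + C_vel * 1)" using C_vel_nonneg by (subst ennreal_plus) auto
        finally show ?thesis .
      qed
    qed (unfold f_def g_def G_def, measurable)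
    then have lim: "(\<lambda>n. enn2real (\<integral>\<^sup>+y. f n y \<partial>lborel)) \<longlonglongrightarrow> 0"
      by (intro tendsto_enn2real) simp_all
    have fin: "(\<integral>\<^sup>+y. f n y \<partial>lborel) \<le> ennreal (C_vel * 1 + C_vel * 1)" for n
      unfolding gint[of n, symmetric] by (rule nn_integral_mono_AE[OF fg])
    have bd: "norm (transport_velocity \<rho> X (x + s n) - transport_velocity \<rho> X x - D (s n)) / norm (s n) \<le> enn2real (\<integral>\<^sup>+y. f n y \<partial>lborel)" for n
    proof -
      have ir: "integrable lborel (\<lambda>y. indicator cell y *\<^sub>R (\<rho> y *\<^sub>R r n y))"
        unfolding r_def scaleR_diff_right
        by (intro Bochner_Integration.integrable_diff transport_velocity_integrable Dint)
      have "transport_velocity \<rho> X (x + s n) - transport_velocity \<rho> X x - D (s n) = (LBINT y. indicator cell y *\<^sub>R (\<rho> y *\<^sub>R r n y))"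
        unfolding r_def scaleR_diff_right transport_velocity_def D_def
        by (simp only: Bochner_Integration.integral_diff[OF Bochner_Integration.integrable_diff[OF transport_velocity_integrable transport_velocity_integrable] Dint]
          Bochner_Integration.integral_diff[OF transport_velocity_integrable transport_velocity_integrable])
      then have "ennreal (norm (transport_velocity \<rho> X (x + s n) - transport_velocity \<rho> X x - D (s n))) \<le> (\<integral>\<^sup>+y. ennreal (norm (indicator cell y *\<^sub>R (\<rho> y *\<^sub>R r n y))) \<partial>lborel)"
        using integral_norm_bound_ennreal[OF ir] by simp
      also have "\<dots> \<le> (\<integral>\<^sup>+y. ennreal (norm (s n)) * f n y \<partial>lborel)"
      proof (rule nn_integral_mono)
        fix y
        have "ennreal (norm (\<rho> y *\<^sub>R r n y)) = ennreal \<bar>\<rho> y\<bar> * ennreal (norm (r n y))" by (simp add: ennreal_mult)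
        also have "\<dots> \<le> ennreal R * ennreal (norm (r n y))" by (intro mult_right_mono ennreal_leI \<rho>_bound) auto
        also have "\<dots> = ennreal R * (ennreal (norm (s n)) * ennreal (norm (r n y) / norm (s n)))"
          using sn[of n] by (simp add: ennreal_mult[symmetric])
        finally show "ennreal (norm (indicator cell y *\<^sub>R (\<rho> y *\<^sub>R r n y))) \<le> ennreal (norm (s n)) * f n y"
          unfolding f_def by (auto simp: indicator_def mult_ac)
      qed
      also have "\<dots> = ennreal (norm (s n)) * (\<integral>\<^sup>+y. f n y \<partial>lborel)" by (rule nn_integral_cmult) (unfold f_def, measurable)
      also have "(\<integral>\<^sup>+y. f n y \<partial>lborel) = ennreal (enn2real (\<integral>\<^sup>+y. f n y \<partial>lborel))"
        using order.strict_trans1[OF fin[of n] ennreal_less_top] by (simp add: ennreal_enn2real_if)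
      also have "ennreal (norm (s n)) * \<dots> = ennreal (norm (s n) * enn2real (\<integral>\<^sup>+y. f n y \<partial>lborel))" by (simp add: ennreal_mult)
      finally have "norm (transport_velocity \<rho> X (x + s n) - transport_velocity \<rho> X x - D (s n)) \<le> norm (s n) * enn2real (\<integral>\<^sup>+y. f n y \<partial>lborel)"
        by (simp add: ennreal_le_iff)
      then show ?thesis using sn[of n] by (simp add: field_simps)
    qed
    show "(\<lambda>n. norm (transport_velocity \<rho> X (x + s n) - transport_velocity \<rho> X x - D (s n)) / norm (s n)) \<longlonglongrightarrow> 0"
      by (rule tendsto_sandwich[OF _ _ tendsto_const lim]) (use bd in auto)
  qed
  ultimately have "(transport_velocity \<rho> X has_derivative D) (at x)" unfolding has_derivative_at by blast
  moreover have "fst (D (1, 0)) + snd (D (0, 1)) = 0"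
  proof -
    have "fst (D (1, 0)) = (LBINT y. fst (indicator cell y *\<^sub>R (\<rho> y *\<^sub>R kern_deriv (x - X y) (1, 0))))"
      unfolding D_def by (rule integral_bounded_linear[OF bounded_linear_fst Dint, symmetric])
    moreover have "snd (D (0, 1)) = (LBINT y. snd (indicator cell y *\<^sub>R (\<rho> y *\<^sub>R kern_deriv (x - X y) (0, 1))))"
      unfolding D_def by (rule integral_bounded_linear[OF bounded_linear_snd Dint, symmetric])
    moreover have "snd (indicator cell y *\<^sub>R (\<rho> y *\<^sub>R kern_deriv (x - X y) (0, 1))) = - fst (indicator cell y *\<^sub>R (\<rho> y *\<^sub>R kern_deriv (x - X y) (1, 0)))" for y
    proof -
      have "snd (kern_deriv (x - X y) (0, 1)) = - fst (kern_deriv (x - X y) (1, 0))" using kern_deriv_trace[of "x - X y"] by linarith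
      then show ?thesis by simp
    qed
    ultimately show ?thesis by simp
  qed
  ultimately show ?thesis by blast
qed

end
end

section \<open>Midpoint steps preserve the area\<close>

text \<open>The Jacobian formula for images is phrased with matrices over \<open>real^2\<close>;
  areas are transferred there and back by this measure preserving identification.\<close>

definition vec2 :: "plane \<Rightarrow> real^2" where "vec2 p = vector [fst p, snd p]"
definition pair2 :: "real^2 \<Rightarrow> plane" where "pair2 v = (v $ 1, v $ 2)"

lemma vec2_nth [simp]: "vec2 p $ 1 = fst p" "vec2 p $ 2 = snd p"
  by (simp_all add: vec2_def)

lemma vec2_pair2 [simp]: "vec2 (pair2 v) = v" and pair2_vec2 [simp]: "pair2 (vec2 p) = p"
  by (simp_all add: vec_eq_iff forall_2 pair2_def)

lemma bounded_linear_vec2: "bounded_linear vec2"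
  by (rule linear_conv_bounded_linear[THEN iffD1]) (simp add: linear_iff vec_eq_iff forall_2)

lemma bounded_linear_pair2: "bounded_linear pair2"
  by (rule linear_conv_bounded_linear[THEN iffD1]) (simp add: linear_iff pair2_def)

lemma continuous_on_vec2: "continuous_on S vec2" and continuous_on_pair2: "continuous_on S' pair2"
  by (simp_all add: linear_continuous_on bounded_linear_vec2 bounded_linear_pair2)

lemma vec2_image: "vec2 ` S = pair2 -` S" 
  by (auto simp: image_iff) (metis vec2_pair2)

lemma lborel_distr_vec2: "distr lborel borel vec2 = lborel"
proof (rule lborel_eqI[symmetric])
  have [measurable]: "vec2 \<in> borel_measurable borel"
    by (rule borel_measurable_continuous_onI[OF continuous_on_vec2])
  fix l u :: "real^2" assume lu: "\<And>b. b \<in> Basis \<Longrightarrow> l \<bullet> b \<le> u \<bullet> b"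
  have "axis i 1 \<in> (Basis :: (real^2) set)" for i by simp
  then have le: "l $ i \<le> u $ i" for i using lu[of "axis i 1"] by (simp add: inner_axis)
  have "vec2 -` box l u = box (l $ 1, l $ 2) (u $ 1, u $ 2)"
  proof -
    have "(a, b) \<in> box (p, q) (r, s) \<longleftrightarrow> p < a \<and> a < r \<and> q < b \<and> b < s" for a b p q r s :: real
      by (auto simp: box_def Basis_prod_def)
    then show ?thesis by (auto simp add: mem_box_cart(1) forall_2)
  qed
  moreover have "(\<Prod>b\<in>Basis. ((u $ 1, u $ 2) - (l $ 1, l $ 2)) \<bullet> b) = (u $ 1 - l $ 1) * (u $ 2 - l $ 2)"
    by (simp add: Basis_prod_def image_iff)
  moreover have "(\<Prod>b\<in>Basis. (u - l) \<bullet> b) = (u $ 1 - l $ 1) * (u $ 2 - l $ 2)"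
  proof -
    have B: "(Basis :: (real^2) set) = {axis 1 1, axis 2 1}" by (auto simp: Basis_vec_def UNIV_2)
    have "axis 1 1 \<noteq> (axis 2 1 :: real^2)" by (simp add: axis_eq_axis)
    then show ?thesis unfolding B by (simp add: inner_axis)
  qed
  moreover have "\<forall>b\<in>Basis. (l $ 1, l $ 2) \<bullet> b \<le> (u $ 1, u $ 2) \<bullet> b"
    using le by (auto simp: Basis_prod_def)
  ultimately show "emeasure (distr lborel borel vec2) (box l u) = ennreal (\<Prod>b\<in>Basis. (u - l) \<bullet> b)"
    by (simp add: emeasure_distr emeasure_lborel_box_eq)
qed simp

lemma emeasure_vec2_image:
  assumes "B \<in> sets borel" shows "emeasure lborel (vec2 ` B) = emeasure lborel B"
proof -
  have [measurable]: "vec2 \<in> borel_measurable borel" "pair2 \<in> borel_measurable borel"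
    by (auto intro: borel_measurable_continuous_onI continuous_on_vec2 continuous_on_pair2)
  have "pair2 -` B \<inter> space borel \<in> sets borel" using assms by measurable
  then have m: "vec2 ` B \<in> sets borel" by (simp add: vec2_image)
  have "emeasure lborel (vec2 ` B) = emeasure (distr lborel borel vec2) (vec2 ` B)" by (simp add: lborel_distr_vec2)
  also have "\<dots> = emeasure lborel (vec2 -` (vec2 ` B))" using m by (subst emeasure_distr) auto
  also have "vec2 -` (vec2 ` B) = B" unfolding vec2_image by auto
  finally show ?thesis .
qed

definition det2 :: "(plane \<Rightarrow> plane) \<Rightarrow> real" where
  "det2 D = fst (D (1, 0)) * snd (D (0, 1)) - fst (D (0, 1)) * snd (D (1, 0))"

lemma det_matrix_vec2: "det (matrix (\<lambda>v. vec2 (D (pair2 v)))) = det2 D"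
proof -
  have "pair2 (axis 1 1) = (1, 0)" "pair2 (axis 2 1) = (0, 1)" by (auto simp: pair2_def axis_def)
  then show ?thesis by (simp add: det_2 matrix_def det2_def)
qed

text \<open>Both areas are the integral of the same absolute Jacobian over \<open>S\<close>.
  Comparing two images of one set avoids differentiating an inverse map and works with derivatives
  that merely exist at each point.\<close>

lemma emeasure_image_eq:
  assumes S: "open S"
    and f: "\<And>x. (f has_derivative f' x) (at x)" "inj f" "open (f ` S)" "bounded (f ` S)"
    and g: "\<And>x. (g has_derivative g' x) (at x)" "inj g" "open (g ` S)" "bounded (g ` S)"
    and det: "\<And>x. det2 (f' x) = det2 (g' x)"
  shows "emeasure lborel (f ` S) = emeasure lborel (g ` S)"
proof -
  define S' where "S' = vec2 ` S"
  have S': "open S'" unfolding S'_def vec2_image using S continuous_on_pair2[of UNIV] by (simp add: open_vimage)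
  define c where "c f v = vec2 (f (pair2 v))" for f :: "plane \<Rightarrow> plane" and v
  have cim: "c f ` S' = vec2 ` (f ` S)" for f unfolding c_def S'_def by (auto simp: image_iff)
  have op: "open (c f ` S')" if "open (f ` S)" for f unfolding cim unfolding vec2_image[of "f ` S"] using that continuous_on_pair2[of UNIV] by (simp add: open_vimage)
  have bd: "bounded (c f ` S')" if "bounded (f ` S)" for f unfolding cim using that by (rule bounded_linear_image[OF _ bounded_linear_vec2])
  have lm: "c f ` S' \<in> lmeasurable" if "open (f ` S)" "bounded (f ` S)" for f
    using op[OF that(1)] bd[OF that(2)] by (rule lmeasurable_open[rotated])
  have der: "(c f has_derivative c (f' (pair2 v))) (at v within S')" if "\<And>x. (f has_derivative f' x) (at x)" for f f' v
  proof -
    have "((\<lambda>v. f (pair2 v)) has_derivative (\<lambda>v'. f' (pair2 v) (pair2 v'))) (at v)"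
      by (rule has_derivative_compose[OF bounded_linear_imp_has_derivative[OF bounded_linear_pair2] that])
    then have "((\<lambda>v. vec2 (f (pair2 v))) has_derivative (\<lambda>v'. vec2 (f' (pair2 v) (pair2 v')))) (at v)"
      by (rule bounded_linear.has_derivative[OF bounded_linear_vec2])
    then show ?thesis unfolding c_def by (rule has_derivative_at_withinI)
  qed
  have inj: "inj_on (c f) S'" if "inj f" for f
    using that unfolding c_def inj_on_def by (metis pair2_vec2 vec2_pair2 UNIV_I)
  have S'l: "S' \<in> sets lebesgue" using borel_open[OF S'] by (metis sets_completionI_sets sets_lborel)
  have "((\<lambda>v. \<bar>det (matrix (c (f' (pair2 v))))\<bar>) has_integral measure lebesgue (c f ` S')) S'"
    by (rule has_measure_differentiable_image[THEN iffD1, OF S'l der[OF f(1)] inj[OF f(2)]]) (simp_all add: lm f)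
  moreover have "((\<lambda>v. \<bar>det (matrix (c (g' (pair2 v))))\<bar>) has_integral measure lebesgue (c g ` S')) S'"
    by (rule has_measure_differentiable_image[THEN iffD1, OF S'l der[OF g(1)] inj[OF g(2)]]) (simp_all add: lm g)
  moreover have "det (matrix (c (f' (pair2 v)))) = det (matrix (c (g' (pair2 v))))" for v
    unfolding c_def det_matrix_vec2 by (rule det)
  ultimately have "measure lebesgue (c f ` S') = measure lebesgue (c g ` S')"
    using has_integral_unique by simp
  then have "emeasure lebesgue (c f ` S') = emeasure lebesgue (c g ` S')"
    using lm[OF f(3,4)] lm[OF g(3,4)] by (simp add: emeasure_eq_measure2 fmeasurableD2)
  then have "emeasure lborel (c f ` S') = emeasure lborel (c g ` S')"
    using op[OF f(3)] op[OF g(3)] by simp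
  then show ?thesis unfolding cim using emeasure_vec2_image[of "f ` S"] emeasure_vec2_image[of "g ` S"] f(3) g(3) by simp
qed

text \<open>The perturbation \<open>k *\<^sub>R v\<close> has Lipschitz constant at most 1/2. This
  gives injectivity and the bound on the inverse; a value \<open>b\<close> is attained at the fixed
  point of the contraction \<open>x \<mapsto> b - k *\<^sub>R v x\<close>.\<close>

lemma small_perturbation_homeo:
  fixes v :: "'a::euclidean_space \<Rightarrow> 'a"
  assumes lip: "\<And>x y. norm (v x - v y) \<le> L * norm (x - y)" and k: "\<bar>k\<bar> * L \<le> 1 / 2" and L0: "0 \<le> L"
  shows "bij (\<lambda>x. x + k *\<^sub>R v x)" "norm (inv (\<lambda>x. x + k *\<^sub>R v x) a - inv (\<lambda>x. x + k *\<^sub>R v x) b) \<le> 2 * norm (a - b)"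
proof -
  define A where "A x = x + k *\<^sub>R v x" for x
  have kv: "norm (k *\<^sub>R (v x - v y)) \<le> norm (x - y) / 2" for x y
  proof -
    have "norm (k *\<^sub>R (v x - v y)) \<le> \<bar>k\<bar> * (L * norm (x - y))" using lip by (simp add: mult_left_mono)
    also have "\<dots> \<le> 1 / 2 * norm (x - y)" using k mult_right_mono[of "\<bar>k\<bar> * L" "1/2" "norm (x - y)"] by simp
    finally show ?thesis by simp
  qed
  have low: "norm (x - y) \<le> 2 * norm (A x - A y)" for x y
  proof -
    have "x - y = (A x - A y) - k *\<^sub>R (v x - v y)" by (simp add: A_def algebra_simps)
    then have "norm (x - y) \<le> norm (A x - A y) + norm (k *\<^sub>R (v x - v y))" by (metis norm_triangle_ineq4)
    then show ?thesis using kv[of x y] by linarith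
  qed
  have inj: "inj A"
  proof (rule injI)
    fix x y assume "A x = A y" then show "x = y" using low[of x y] by simp
  qed
  have surj: "surj A"
  proof -
    have "\<exists>x. A x = b" for b
    proof -
    have "\<exists>!x. b - k *\<^sub>R v x = x"
    proof (rule banach_fix_type)
      show "\<forall>x y. dist (b - k *\<^sub>R v x) (b - k *\<^sub>R v y) \<le> 1 / 2 * dist x y"
      proof (intro allI)
        fix x y
        have "(b - k *\<^sub>R v x) - (b - k *\<^sub>R v y) = - (k *\<^sub>R (v x - v y))" by (simp add: algebra_simps)
        then show "dist (b - k *\<^sub>R v x) (b - k *\<^sub>R v y) \<le> 1 / 2 * dist x y" using kv[of x y] by (simp add: dist_norm del: scaleR_right_diff_distrib)
      qed
    qed auto
    then obtain x where "b - k *\<^sub>R v x = x" by auto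
    then show "\<exists>x. A x = b" by (metis A_def diff_add_cancel)
    qed
    then show ?thesis unfolding surj_def by metis
  qed
  show "bij (\<lambda>x. x + k *\<^sub>R v x)" using inj surj unfolding bij_def A_def[abs_def] by blast
  have "A (inv A z) = z" for z using surj by (rule surj_f_inv_f)
  then show "norm (inv (\<lambda>x. x + k *\<^sub>R v x) a - inv (\<lambda>x. x + k *\<^sub>R v x) b) \<le> 2 * norm (a - b)"
    using low[of "inv A a" "inv A b"] unfolding A_def[abs_def] by simp
qed

text \<open>\<open>m\<close> is the midpoint between \<open>x\<close> and its image: half a step
  backwards from \<open>m\<close> leads to \<open>x\<close>, half a step forwards to the image, with
  the field \<open>v\<close> frozen during the step.\<close>

definition midpoint_step :: "real \<Rightarrow> (plane \<Rightarrow> plane) \<Rightarrow> plane \<Rightarrow> plane" where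
  "midpoint_step h v x = (let m = inv (\<lambda>m. m - (h / 2) *\<^sub>R v m) x in m + (h / 2) *\<^sub>R v m)"

text \<open>The preimage of a box under the step is the image under \<open>Am\<close> of the set
  \<open>S\<close> that \<open>Ap\<close> maps onto the box. \<open>Am\<close> and \<open>Ap\<close>
  have the same Jacobian at each point because the trace vanishes, so the two images of
  \<open>S\<close> have equal area. The local error is quadratic because the midpoint is within
  \<open>h / 2 * U\<close> of \<open>x\<close>.\<close>

lemma midpoint_step:
  fixes v :: "plane \<Rightarrow> plane"
  assumes lip: "\<And>x y. norm (v x - v y) \<le> L * norm (x - y)" and L0: "0 \<le> L"
    and bdd: "\<And>x. norm (v x) \<le> U"
    and per: "\<And>x. v (x + (2 * pi, 0)) = v x"
    and der: "\<And>x. \<exists>D. (v has_derivative D) (at x) \<and> fst (D (1, 0)) + snd (D (0, 1)) = 0"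
    and h: "0 < h" "h * L \<le> 1"
  shows "measure_preserving_map (midpoint_step h v)"
    and "norm (midpoint_step h v x - x - h *\<^sub>R v x) \<le> (L * U) * h\<^sup>2"
proof -
  define Am Ap where "Am m = m - (h / 2) *\<^sub>R v m" and "Ap m = m + (h / 2) *\<^sub>R v m" for m
  have Am': "Am = (\<lambda>m. m + (- (h / 2)) *\<^sub>R v m)" by (auto simp: Am_def)
  have Ap': "Ap = (\<lambda>m. m + (h / 2) *\<^sub>R v m)" by (auto simp: Ap_def)
  have kL: "\<bar>- (h / 2)\<bar> * L \<le> 1 / 2" "\<bar>h / 2\<bar> * L \<le> 1 / 2" using h by auto
  have bm: "bij Am" and bp: "bij Ap"
    unfolding Am' Ap' by (rule small_perturbation_homeo[OF lip _ L0], rule kL)+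
  have lm: "norm (inv Am a - inv Am b) \<le> 2 * norm (a - b)" and lp: "norm (inv Ap a - inv Ap b) \<le> 2 * norm (a - b)" for a b
    unfolding Am' Ap' by (rule small_perturbation_homeo(2)[OF lip _ L0], rule kL)+
  have lipc: "continuous_on UNIV F" if "\<And>a b. norm (F a - F b) \<le> c * norm (a - b)" "0 \<le> c" for F :: "plane \<Rightarrow> plane" and c
  proof (rule lipschitz_on_continuous_on)
    show "c-lipschitz_on UNIV F" using that by (auto simp: lipschitz_on_def dist_norm)
  qed
  have cv: "continuous_on UNIV v" by (rule lipc[OF lip L0])
  have cAm: "continuous_on UNIV Am" and cAp: "continuous_on UNIV Ap" unfolding Am_def Ap_def by (intro continuous_intros cv)+
  have cim: "continuous_on UNIV (inv Am)" and cip: "continuous_on UNIV (inv Ap)" by (rule lipc[OF lm], simp, rule lipc[OF lp], simp)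
  define \<Phi> where "\<Phi> x = Ap (inv Am x)" for x
  have \<Phi>: "midpoint_step h v = \<Phi>" unfolding midpoint_step_def \<Phi>_def Let_def Ap_def Am_def[abs_def] by auto
  have Ami: "Am (inv Am x) = x" "inv Am (Am x) = x" "Ap (inv Ap x) = x" "inv Ap (Ap x) = x" for x
    using bm bp by (simp_all add: bij_def surj_f_inv_f)
  have near: "norm (inv Am x - x) \<le> h / 2 * U" for x
  proof -
    have "inv Am x - x = (h / 2) *\<^sub>R v (inv Am x)" using Ami(1)[of x] unfolding Am_def by (simp add: algebra_simps)
    then show ?thesis using bdd h by (simp add: mult_left_mono)
  qed
  have \<Phi>x: "\<Phi> x = x + h *\<^sub>R v (inv Am x)" for x
  proof -
    have "\<Phi> x - Am (inv Am x) = h *\<^sub>R v (inv Am x)" unfolding \<Phi>_def Am_def Ap_def by (simp add: algebra_simps flip: scaleR_2)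
    then show ?thesis using Ami(1)[of x] by (simp add: algebra_simps)
  qed
  have U0: "0 \<le> U" using bdd[of 0] norm_ge_zero order_trans by blast
  show "norm (midpoint_step h v x - x - h *\<^sub>R v x) \<le> (L * U) * h\<^sup>2" for x
  proof -
    have "norm (\<Phi> x - x - h *\<^sub>R v x) = h * norm (v (inv Am x) - v x)" unfolding \<Phi>x using h by (simp flip: scaleR_right_diff_distrib)
    also have "\<dots> \<le> h * (L * (h / 2 * U))" using h L0 near lip[of "inv Am x" x] by (intro mult_left_mono order_trans[OF lip] ) auto
    also have "\<dots> \<le> (L * U) * h\<^sup>2" using h L0 U0 by (simp add: power2_eq_square mult_ac)
    finally show ?thesis unfolding \<Phi> .
  qed
  have c\<Phi>: "continuous_on UNIV \<Phi>" unfolding \<Phi>_def by (rule continuous_on_compose2[OF cAp cim]) auto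
  have eq\<Phi>: "\<Phi> (y + (2 * pi, 0)) = \<Phi> y + (2 * pi, 0)" for y
  proof -
    have "Am (inv Am y + (2 * pi, 0)) = y + (2 * pi, 0)" unfolding Am_def[of "inv Am y + (2 * pi, 0)"] per using Ami(1)[of y] by (simp add: Am_def algebra_simps)
    then have "inv Am (y + (2 * pi, 0)) = inv Am y + (2 * pi, 0)" by (metis Ami(2))
    then show ?thesis unfolding \<Phi>_def Ap_def by (simp only: per) (simp add: algebra_simps)
  qed
  obtain D where D: "\<And>x. (v has_derivative D x) (at x)" and tr: "\<And>x. fst (D x (1, 0)) + snd (D x (0, 1)) = 0"
    using der by metis
  have dAm: "(Am has_derivative (\<lambda>d. d - (h / 2) *\<^sub>R D x d)) (at x)" and dAp: "(Ap has_derivative (\<lambda>d. d + (h / 2) *\<^sub>R D x d)) (at x)" for x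
    unfolding Am_def Ap_def by (auto intro!: derivative_eq_intros D)
  have dets: "det2 (\<lambda>d. d - (h / 2) *\<^sub>R D x d) = det2 (\<lambda>d. d + (h / 2) *\<^sub>R D x d)" for x
  proof -
    have s: "snd (D x (0, 1)) = - fst (D x (1, 0))" using tr[of x] by linarith
    show ?thesis unfolding det2_def by (simp add: s algebra_simps)
  qed
  have "lborel = distr lborel borel \<Phi>"
  proof (rule lborel_eqI)
    fix l u :: "plane"
    assume lu: "\<And>b. b \<in> Basis \<Longrightarrow> l \<bullet> b \<le> u \<bullet> b"
    define S where "S = inv Ap ` box l u"
    have SA: "S = Ap -` box l u" unfolding S_def using Ami by (auto simp: image_iff) (metis Ami(4))
    have oS: "open S" unfolding SA using cAp by (intro open_vimage open_box)
    have ApS: "Ap ` S = box l u" unfolding S_def image_image using Ami by simp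
    have AmS: "Am ` S = \<Phi> -` box l u"
    proof (intro set_eqI iffI)
      fix x assume "x \<in> Am ` S" then show "x \<in> \<Phi> -` box l u" unfolding SA \<Phi>_def using Ami by auto
    next
      fix x assume "x \<in> \<Phi> -` box l u"
      then have "inv Am x \<in> S" unfolding SA \<Phi>_def by auto
      then show "x \<in> Am ` S" using Ami(1)[of x] by (metis image_eqI)
    qed
    have oAm: "open (Am ` S)" unfolding AmS using c\<Phi> by (intro open_vimage open_box)
    have "bounded (Am ` S)"
    proof -
      obtain B where B: "\<And>x. x \<in> box l u \<Longrightarrow> norm x \<le> B" using bounded_box[of l u] unfolding bounded_iff by blast
      show ?thesis unfolding AmS bounded_iff
      proof (intro exI ballI)
        fix x assume "x \<in> \<Phi> -` box l u"
        then have 1: "norm (\<Phi> x) \<le> B" using B by auto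
        have "norm x \<le> norm (\<Phi> x) + norm (h *\<^sub>R v (inv Am x))" unfolding \<Phi>x by (metis add_diff_cancel norm_triangle_ineq4)
        also have "norm (h *\<^sub>R v (inv Am x)) \<le> h * U" using bdd h by (simp add: mult_left_mono)
        finally show "norm x \<le> B + h * U" using 1 by simp
      qed
    qed
    then have "emeasure lborel (Am ` S) = emeasure lborel (Ap ` S)"
      using oAm bounded_box[of l u] bm bp ApS
      by (intro emeasure_image_eq[OF oS dAm _ _ _ dAp _ _ _ dets]) (auto simp: bij_def)
    also have "\<dots> = ennreal (prod ((\<bullet>) (u - l)) Basis)" unfolding ApS using lu by (simp add: emeasure_lborel_box_eq)
    finally have "emeasure lborel (\<Phi> -` box l u) = ennreal (prod ((\<bullet>) (u - l)) Basis)" unfolding AmS .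
    moreover have [measurable]: "\<Phi> \<in> borel_measurable borel" by (rule borel_measurable_continuous_onI[OF c\<Phi>])
    ultimately show "emeasure (distr lborel borel \<Phi>) (box l u) = ennreal (prod ((\<bullet>) (u - l)) Basis)"
      by (subst emeasure_distr) auto
  qed simp
  then show "measure_preserving_map (midpoint_step h v)" unfolding \<Phi> measure_preserving_map_def using c\<Phi> eq\<Phi> by auto
qed

section \<open>Existence of the flow\<close>

text \<open>Displacements are elements of this function space, and \<open>one_step_evolution\<close>
  is phrased for the class \<open>banach\<close>.\<close>

instance bcontfun :: (metric_space, banach) banach ..

context bounded_density
begin

text \<open>The unknown is the displacement of a map from the identity: it is bounded and
  continuous, hence in a Banach space under the supremum norm, whereas the maps themselves are
  unbounded.\<close>

definition disp_map :: "(plane \<Rightarrow>\<^sub>C plane) \<Rightarrow> plane \<Rightarrow> plane" where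
  "disp_map w x = x + apply_bcontfun w x"

definition disp_field :: "(plane \<Rightarrow>\<^sub>C plane) \<Rightarrow> (plane \<Rightarrow>\<^sub>C plane)" where
  "disp_field w = Bcontfun (\<lambda>x. transport_velocity \<rho> (disp_map w) (disp_map w x))"

lemma transport_velocity_continuous:
  assumes "measure_preserving_map X" shows "continuous_on UNIV (transport_velocity \<rho> X)"
proof (rule lipschitz_on_continuous_on)
  show "C_vel-lipschitz_on UNIV (transport_velocity \<rho> X)"
    using transport_velocity_lipschitz[OF assms] C_vel_nonneg by (auto simp: lipschitz_on_def dist_norm)
qed

lemma bcontfunI': "continuous_on UNIV f \<Longrightarrow> (\<And>x. norm (f x) \<le> b) \<Longrightarrow> f \<in> bcontfun"
  by (auto simp: bcontfun_def bounded_iff)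

lemma apply_disp_field:
  assumes "measure_preserving_map (disp_map w)"
  shows "apply_bcontfun (disp_field w) x = transport_velocity \<rho> (disp_map w) (disp_map w x)"
proof -
  have "(\<lambda>x. transport_velocity \<rho> (disp_map w) (disp_map w x)) \<in> bcontfun"
    by (rule bcontfunI'[OF continuous_on_compose2[OF transport_velocity_continuous[OF assms] measure_preserving_mapD(1)[OF assms]]])
      (auto intro: transport_velocity_bound[OF assms])
  then show ?thesis unfolding disp_field_def by (simp add: Bcontfun_inverse)
qed

lemma flow_exists:
  obtains X :: "real \<Rightarrow> plane \<Rightarrow> plane"
  where "\<And>x. X 0 x = x" "\<And>t. 0 \<le> t \<Longrightarrow> measure_preserving_map (X t)"
    "\<And>x t T. t \<in> {0..T} \<Longrightarrow> ((\<lambda>s. X s x) has_vector_derivative transport_velocity \<rho> (X t) (X t x)) (at t within {0..T})"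
proof -
  define E where "E = {w. measure_preserving_map (disp_map w)}"
  define \<Psi> where "\<Psi> h w = Bcontfun (\<lambda>x. midpoint_step h (transport_velocity \<rho> (disp_map w)) (disp_map w x) - x)" for h w
  \<comment> \<open>Ensures \<open>h * C_vel \<le> 1\<close>, under which the implicit step is
    solvable; the 1 in the denominator covers \<open>C_vel = 0\<close>.\<close>
  have h0: "0 < 1 / (C_vel + 1)" using C_vel_nonneg by simp
  have hC: "h * C_vel \<le> 1" if "0 < h" "h \<le> 1 / (C_vel + 1)" for h
  proof -
    have "h * (C_vel + 1) \<le> 1" using that C_vel_nonneg by (simp add: pos_le_divide_eq)
    then show ?thesis using that by (simp add: algebra_simps)
  qed
  have cl: "closed E" unfolding closed_sequential_limits
  proof (intro allI impI, elim conjE)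
    fix s w assume s: "\<forall>n. s n \<in> E" and lim: "s \<longlonglongrightarrow> w"
    have "measure_preserving_map (disp_map w)"
    proof (rule measure_preserving_map_limit)
      show "continuous_on UNIV (disp_map w)" unfolding disp_map_def by (intro continuous_intros) auto
      have mp: "measure_preserving_map (disp_map (s n))" for n using s by (simp add: E_def)
      show "disp_map w (y + (2 * pi, 0)) = disp_map w y + (2 * pi, 0)" for y
      proof -
        have eq: "apply_bcontfun (s n) (y + (2 * pi, 0)) = apply_bcontfun (s n) y" for n
          using measure_preserving_mapD(2)[OF mp[of n], of y] by (simp add: disp_map_def algebra_simps)
        have l: "(\<lambda>n. apply_bcontfun (s n) z) \<longlonglongrightarrow> apply_bcontfun w z" for z
          by (rule tendsto_bcontfun_uniform_limit[OF lim, THEN tendsto_uniform_limitI]) simp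
        have "apply_bcontfun w (y + (2 * pi, 0)) = apply_bcontfun w y"
          by (rule LIMSEQ_unique[OF l[of "y + (2 * pi, 0)", unfolded eq] l])
        then show ?thesis by (simp add: disp_map_def algebra_simps)
      qed
      fix e :: real assume "0 < e"
      then obtain n where "norm (s n - w) < e" using LIMSEQ_D[OF lim] by blast
      then have "norm (disp_map (s n) y - disp_map w y) \<le> e" for y
        using norm_bounded[of "s n - w" y] by (simp add: disp_map_def)
      then show "\<exists>Y. measure_preserving_map Y \<and> (\<forall>y. norm (Y y - disp_map w y) \<le> e)" using mp by blast
    qed
    then show "w \<in> E" by (simp add: E_def)
  qed
  have z: "0 \<in> E" by (simp add: E_def disp_map_def[abs_def] measure_preserving_map_id)
  have U: "norm (disp_field w) \<le> C_vel" if "w \<in> E" for w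
    using that by (intro norm_bound) (simp add: E_def apply_disp_field transport_velocity_bound)
  \<comment> \<open>The factor 2 arises because a change of displacement moves both the point of
    evaluation and the source.\<close>
  have L: "norm (disp_field v - disp_field w) \<le> (2 * C_vel) * norm (v - w)" if v: "v \<in> E" and w: "w \<in> E" for v w
  proof (rule norm_bound)
    fix x
    have mv: "measure_preserving_map (disp_map v)" and mw: "measure_preserving_map (disp_map w)" using v w by (auto simp: E_def)
    have "norm ((disp_map v x - disp_map v y) - (disp_map w x - disp_map w y)) \<le> 2 * norm (v - w)" for y
    proof -
      have "(disp_map v x - disp_map v y) - (disp_map w x - disp_map w y) = apply_bcontfun (v - w) x - apply_bcontfun (v - w) y"
        by (simp add: disp_map_def algebra_simps)
      also have "norm \<dots> \<le> norm (apply_bcontfun (v - w) x) + norm (apply_bcontfun (v - w) y)" by (rule norm_triangle_ineq4)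
      also have "\<dots> \<le> 2 * norm (v - w)" using norm_bounded[of "v - w" x] norm_bounded[of "v - w" y] by linarith
      finally show ?thesis .
    qed
    from transport_velocity_diff[OF mv mw this]
    show "norm (apply_bcontfun (disp_field v - disp_field w) x) \<le> 2 * C_vel * norm (v - w)"
      by (simp add: apply_disp_field mv mw mult_ac)
  qed
  have step: "disp_map (\<Psi> h w) = (\<lambda>x. midpoint_step h (transport_velocity \<rho> (disp_map w)) (disp_map w x))"
    "measure_preserving_map (midpoint_step h (transport_velocity \<rho> (disp_map w)))"
    "norm (\<Psi> h w - w - h *\<^sub>R disp_field w) \<le> (C_vel * C_vel) * h\<^sup>2"
    if h: "0 < h" "h \<le> 1 / (C_vel + 1)" and w: "w \<in> E" for h w
  proof -
    have mw: "measure_preserving_map (disp_map w)" using w by (simp add: E_def)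
    note ms = midpoint_step[OF transport_velocity_lipschitz[OF mw] C_vel_nonneg transport_velocity_bound[OF mw]
      transport_velocity_shift[OF mw] transport_velocity_derivative[OF mw] h(1) hC[OF h]]
    show mp: "measure_preserving_map (midpoint_step h (transport_velocity \<rho> (disp_map w)))" by (rule ms(1))
    define f where "f x = midpoint_step h (transport_velocity \<rho> (disp_map w)) (disp_map w x) - x" for x
    have fx: "f x = (midpoint_step h (transport_velocity \<rho> (disp_map w)) (disp_map w x) - disp_map w x - h *\<^sub>R transport_velocity \<rho> (disp_map w) (disp_map w x))
       + apply_bcontfun w x + h *\<^sub>R transport_velocity \<rho> (disp_map w) (disp_map w x)" for x
      by (simp add: f_def disp_map_def algebra_simps)
    have "f \<in> bcontfun"
    proof (rule bcontfunI')
      show "continuous_on UNIV f" unfolding f_def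
        by (intro continuous_intros continuous_on_compose2[OF measure_preserving_mapD(1)[OF mp] measure_preserving_mapD(1)[OF mw]]) auto
      show "norm (f x) \<le> (C_vel * C_vel) * h\<^sup>2 + norm w + h * C_vel" for x
        unfolding fx using ms(2)[of "disp_map w x"] norm_bounded[of w x] transport_velocity_bound[OF mw, of "disp_map w x"] h
        by (intro norm_triangle_mono) (auto intro: mult_left_mono)
    qed
    then have ap: "apply_bcontfun (\<Psi> h w) x = f x" for x unfolding \<Psi>_def f_def[symmetric] by (simp add: Bcontfun_inverse)
    show "disp_map (\<Psi> h w) = (\<lambda>x. midpoint_step h (transport_velocity \<rho> (disp_map w)) (disp_map w x))"
      by (rule ext) (simp add: disp_map_def ap f_def)
    show "norm (\<Psi> h w - w - h *\<^sub>R disp_field w) \<le> (C_vel * C_vel) * h\<^sup>2"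
    proof (rule norm_bound)
      fix x
      have "apply_bcontfun (\<Psi> h w - w - h *\<^sub>R disp_field w) x = midpoint_step h (transport_velocity \<rho> (disp_map w)) (disp_map w x) - disp_map w x - h *\<^sub>R transport_velocity \<rho> (disp_map w) (disp_map w x)"
        by (simp add: ap apply_disp_field[OF mw] f_def) (simp add: disp_map_def)
      then show "norm (apply_bcontfun (\<Psi> h w - w - h *\<^sub>R disp_field w) x) \<le> (C_vel * C_vel) * h\<^sup>2"
        using ms(2)[of "disp_map w x"] by simp
    qed
  qed
  have stepE: "\<Psi> h w \<in> E" if "0 < h" "h \<le> 1 / (C_vel + 1)" "w \<in> E" for h w
    using step(1,2)[OF that] measure_preserving_map_comp[of "midpoint_step h (transport_velocity \<rho> (disp_map w))" "disp_map w"] that(3)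
    by (simp add: E_def)
  have C2: "0 \<le> 2 * C_vel" "0 \<le> C_vel * C_vel" using C_vel_nonneg by auto
  obtain W K where W0: "W 0 = 0" and WE: "\<And>t. 0 \<le> t \<Longrightarrow> W t \<in> E" and K0: "0 \<le> K"
    and WK: "\<And>s t. 0 \<le> s \<Longrightarrow> s \<le> t \<Longrightarrow> norm (W t - W s - (t - s) *\<^sub>R disp_field (W s)) \<le> K * (t - s)\<^sup>2"
    by (rule one_step_evolution[where E = E and ?w0.0 = 0 and F = disp_field and \<Psi> = \<Psi> and U = C_vel and L = "2 * C_vel"
        and ?h0.0 = "1 / (C_vel + 1)" and C = "C_vel * C_vel", OF cl z U L h0 C2 stepE step(3)]) blast+
  have WD: "(W has_vector_derivative disp_field (W t)) (at t within {0..T})" if "t \<in> {0..T}" for t T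
    by (rule evolution_has_vector_derivative[OF WK U[OF WE] L[OF WE WE] C2(1) K0 that]) 
  show thesis
  proof (rule that[of "\<lambda>t. disp_map (W t)"])
    show "disp_map (W 0) x = x" for x by (simp add: disp_map_def W0)
    show mp: "measure_preserving_map (disp_map (W t))" if "0 \<le> t" for t using WE[OF that] by (simp add: E_def)
    show "((\<lambda>s. disp_map (W s) x) has_vector_derivative transport_velocity \<rho> (disp_map (W t)) (disp_map (W t) x)) (at t within {0..T})"
      if "t \<in> {0..T}" for x t T
    proof -
      \<comment> \<open>Evaluation at a point is bounded and linear on displacements, so
        differentiability in the supremum norm gives the trajectory equation for each
        \<open>x\<close>.\<close>
      have bl: "bounded_linear (\<lambda>w. apply_bcontfun w x)"
        by (rule bounded_linear_intro[where K = 1]) (auto simp: norm_bounded)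
      have "((\<lambda>s. apply_bcontfun (W s) x) has_vector_derivative apply_bcontfun (disp_field (W t)) x) (at t within {0..T})"
        by (rule bounded_linear.has_vector_derivative[OF bl WD[OF that]])
      then have "((\<lambda>s. disp_map (W s) x) has_vector_derivative apply_bcontfun (disp_field (W t)) x) (at t within {0..T})"
        unfolding disp_map_def by (auto intro!: derivative_eq_intros simp: has_vector_derivative_def)
      then show ?thesis using apply_disp_field[OF mp] that by simp
    qed
  qed
qed

end

section \<open>Separation by periodic Jordan curves\<close>

text \<open>Heights become radii: the upper end of the cylinder goes to infinity and the lower end
  to 0. Points with equal image differ by a period, so above the curve means outside the loop and
  below it means inside.\<close>

definition annulus_map :: "plane \<Rightarrow> complex" where
  "annulus_map x = exp (Complex (snd x) (fst x))"

lemma norm_annulus_map: "norm (annulus_map x) = exp (snd x)"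
  by (simp add: annulus_map_def)

lemma continuous_on_annulus_map: "continuous_on S annulus_map"
  unfolding annulus_map_def by (intro continuous_intros)

lemma annulus_map_shift: "annulus_map ((2 * pi * of_int k, 0) + x) = annulus_map x"
  by (simp add: annulus_map_def complex_eq_iff Re_exp Im_exp cos_add sin_add cos_int_2pin sin_int_2pin)

lemma annulus_map_eqD:
  assumes "annulus_map x = annulus_map y" obtains k :: int where "x = y + (2 * pi * of_int k, 0)"
proof -
  obtain k :: int where "Complex (snd x) (fst x) = Complex (snd y) (fst y) + of_int (2 * k) * pi * \<i>"
    using assms unfolding annulus_map_def exp_eq by auto
  then have "snd x = snd y" "fst x = fst y + 2 * pi * of_int k" by (auto simp: complex_eq_iff algebra_simps)
  then show thesis by (intro that[of k]) (simp add: prod_eq_iff)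
qed

context
  fixes z :: "real \<Rightarrow> plane"
  assumes z: "interface z" and inj: "inj z"
begin

lemma interface_shift: "z (\<alpha> + 2 * pi * of_int k) = (2 * pi * of_int k, 0) + z \<alpha>"
  using z by (simp add: interface_def)

lemma interface_continuous: "continuous_on UNIV z"
  using z by (simp add: interface_def)

definition loop :: "real \<Rightarrow> complex" where "loop t = annulus_map (z (2 * pi * t))"

lemma loop_image: "path_image loop = annulus_map ` range z"
proof (intro equalityI subsetI)
  fix w assume "w \<in> annulus_map ` range z"
  then obtain \<alpha> where w: "w = annulus_map (z \<alpha>)" by auto
  define k where "k = \<lfloor>\<alpha> / (2 * pi)\<rfloor>"
  define t where "t = \<alpha> / (2 * pi) - of_int k"
  have "0 \<le> t" "t \<le> 1" unfolding t_def k_def by linarith+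
  have "\<alpha> = 2 * pi * t + 2 * pi * of_int k" by (simp add: t_def field_simps)
  then have "z \<alpha> = (2 * pi * of_int k, 0) + z (2 * pi * t)" using interface_shift by metis
  then have "w = loop t" unfolding w loop_def using annulus_map_shift by metis
  then show "w \<in> path_image loop" using \<open>0 \<le> t\<close> \<open>t \<le> 1\<close> by (auto simp: path_image_def)
qed (auto simp: path_image_def loop_def)

lemma not_in_loop: "x \<notin> range z \<Longrightarrow> annulus_map x \<notin> path_image loop"
proof
  assume x: "x \<notin> range z" and "annulus_map x \<in> path_image loop"
  then obtain \<alpha> where "annulus_map x = annulus_map (z \<alpha>)" by (auto simp: loop_image)
  then obtain k :: int where "x = z \<alpha> + (2 * pi * of_int k, 0)" by (rule annulus_map_eqD)
  then have "x = z (\<alpha> + 2 * pi * of_int k)" by (simp add: interface_shift add.commute)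
  then show False using x by auto
qed

lemma loop_path: "path loop"
  unfolding path_def loop_def
  by (intro continuous_on_compose2[OF continuous_on_annulus_map] continuous_on_compose2[OF interface_continuous] continuous_intros) auto

lemma loop_closed: "pathfinish loop = pathstart loop"
proof -
  have "z (0 + 2 * pi * of_int 1) = (2 * pi * of_int 1, 0) + z 0" by (rule interface_shift)
  then show ?thesis unfolding pathfinish_def pathstart_def loop_def using annulus_map_shift[of 1 "z 0"] by simp
qed

lemma loop_simple: "simple_path loop"
  unfolding simple_path_def loop_free_def
proof (intro conjI ballI impI loop_path)
  fix s t :: real assume s: "s \<in> {0..1}" and t: "t \<in> {0..1}" and "loop s = loop t"
  then obtain k :: int where "z (2 * pi * s) = z (2 * pi * t) + (2 * pi * of_int k, 0)"
    unfolding loop_def by (metis annulus_map_eqD)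
  then have "z (2 * pi * s) = z (2 * pi * t + 2 * pi * of_int k)" by (simp add: interface_shift add.commute)
  then have "2 * pi * s = 2 * pi * (t + of_int k)" using inj by (simp add: inj_def distrib_left)
  then have "s = t + of_int k" by simp
  then show "s = t \<or> s = 0 \<and> t = 1 \<or> s = 1 \<and> t = 0" using s t
    by (cases "k = 0"; cases "k = 1"; cases "k = -1") (auto simp: )
qed

lemma interface_height: obtains B where "\<And>\<alpha>. \<bar>snd (z \<alpha>)\<bar> \<le> B"
proof -
  have "compact (path_image loop)" by (rule compact_path_image[OF loop_path])
  have "compact (z ` {0..2 * pi})" by (intro compact_continuous_image continuous_on_subset[OF interface_continuous]) auto
  then obtain B where B: "\<And>\<alpha>. \<alpha> \<in> {0..2 * pi} \<Longrightarrow> norm (z \<alpha>) \<le> B" using compact_imp_bounded bounded_iff by (metis imageI)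
  have "\<bar>snd (z \<alpha>)\<bar> \<le> B" for \<alpha>
  proof -
    define k where "k = \<lfloor>\<alpha> / (2 * pi)\<rfloor>"
    define t where "t = \<alpha> / (2 * pi) - of_int k"
    have t: "0 \<le> t" "t \<le> 1" unfolding t_def k_def by linarith+
    have "\<alpha> = 2 * pi * t + 2 * pi * of_int k" by (simp add: t_def field_simps)
    then have "z \<alpha> = (2 * pi * of_int k, 0) + z (2 * pi * t)" using interface_shift by metis
    then have "\<bar>snd (z \<alpha>)\<bar> = \<bar>snd (z (2 * pi * t))\<bar>" by simp
    also have "\<dots> \<le> norm (z (2 * pi * t))" using norm_snd_le[of "snd (z (2 * pi * t))" "fst (z (2 * pi * t))"] by simp
    also have "\<dots> \<le> B" using t by (intro B) auto
    finally show ?thesis .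
  qed
  then show thesis by (rule that)
qed

text \<open>Path lifting for the exponential covering, for which \<open>S\<close> must avoid 0. The
  lift starting at \<open>x\<close> ends over the image of \<open>y\<close>, at a point that may be
  a translate of \<open>y\<close>; its height is enough to know that it lies in a given half
  plane.\<close>

lemma lift_connection:
  assumes S: "open S" "connected S" "0 \<notin> S" "S \<inter> path_image loop = {}"
    and x: "annulus_map x \<in> S" and y: "annulus_map y \<in> S"
  obtains y' where "snd y' = snd y" "connected_component (- range z) x y'"
proof -
  have "path_connected S" using S connected_open_path_connected by blast
  then obtain g where g: "path g" "path_image g \<subseteq> S" "pathstart g = annulus_map x" "pathfinish g = annulus_map y"
    using x y unfolding path_connected_def by blast
  define c where "c p = Complex (snd p) (fst p)" for p :: "plane"
  define d where "d w = (Im w, Re w)" for w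
  have cd: "c (d w) = w" "d (c p) = p" for w p by (auto simp: c_def d_def)
  have E: "annulus_map p = exp (c p)" for p by (simp add: annulus_map_def c_def)
  have gsub: "path_image g \<subseteq> - {0}" using g S by auto
  obtain h where h: "path h" "pathstart h = c x" "\<And>t. t \<in> {0..1} \<Longrightarrow> exp (h t) = g t"
    using covering_space_lift_path_strong[OF covering_space_exp_punctured_plane, of "c x" g] g gsub by (auto simp: E)
  have cont: "continuous_on UNIV d" unfolding d_def by (intro continuous_intros)
  define D where "D = d ` path_image h"
  have "connected D" unfolding D_def
    by (intro connected_continuous_image continuous_on_subset[OF cont] connected_path_image h) auto
  moreover have "D \<subseteq> - range z"
  proof
    fix p assume "p \<in> D"
    then obtain t where t: "t \<in> {0..1}" "p = d (h t)" by (auto simp: D_def path_image_def)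
    then have "annulus_map p = g t" using h(3) by (simp add: E cd)
    then have "annulus_map p \<in> S" using t g by (auto simp: path_image_def)
    then have "annulus_map p \<notin> annulus_map ` range z" using S by (auto simp: loop_image)
    then show "p \<in> - range z" by auto
  qed
  moreover have "x \<in> D"
  proof -
    have "h 0 = c x" using h(2) by (simp add: pathstart_def)
    then have "d (h 0) = x" by (simp add: cd)
    then show ?thesis unfolding D_def path_image_def by force
  qed
  moreover have "d (h 1) \<in> D" unfolding D_def path_image_def by force
  moreover have "snd (d (h 1)) = snd y"
  proof -
    have "exp (snd (d (h 1))) = norm (exp (h 1))" by (simp add: d_def)
    also have "exp (h 1) = annulus_map y" using h(3)[of 1] g(4) by (simp add: pathfinish_def)
    finally show ?thesis by (simp add: norm_annulus_map)
  qed
  ultimately show thesis by (intro that[of "d (h 1)"]) (auto simp: connected_component_def)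
qed

text \<open>The logarithm \<open>p\<close> of the loop gains \<open>2 * pi * i\<close> over one
  period, so the winding number about 0 is 1, whereas it vanishes at points outside.\<close>

lemma zero_inside: "0 \<in> inside (path_image loop)"
proof (rule ccontr)
  assume n: "0 \<notin> inside (path_image loop)"
  have "0 \<notin> path_image loop" by (auto simp: loop_image annulus_map_def)
  then have "0 \<in> outside (path_image loop)" using n by (metis ComplI UnE inside_Un_outside)
  then have w0: "winding_number loop 0 = 0"
    by (rule winding_number_zero_in_outside[OF loop_path loop_closed])
  define p where "p t = Complex (snd (z (2 * pi * t))) (fst (z (2 * pi * t)))" for t
  have "path p" unfolding path_def p_def
    by (intro continuous_intros continuous_on_compose2[OF interface_continuous]) auto
  then have "winding_number (exp \<circ> p) 0 = (pathfinish p - pathstart p) / (2 * of_real pi * \<i>)"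
    by (rule winding_number_compose_exp)
  moreover have "exp \<circ> p = loop" by (auto simp: loop_def annulus_map_def p_def)
  moreover have "pathfinish p - pathstart p = 2 * of_real pi * \<i>"
  proof -
    have "z (0 + 2 * pi * of_int 1) = (2 * pi * of_int 1, 0) + z 0" by (rule interface_shift)
    then have "z (2 * pi) = (2 * pi, 0) + z 0" by simp
    then show ?thesis by (simp add: pathfinish_def pathstart_def p_def complex_eq_iff)
  qed
  ultimately show False using w0 by simp
qed

text \<open>Points are joined to a far half plane by lifting paths inside the two connected sides of
  the Jordan curve. The two domains are disjoint because a connected set joining the two half planes
  off the curve would have a connected image meeting both sides of the loop.\<close>

lemma interface_separating: "separating z"
proof -
  obtain B where B: "\<And>\<alpha>. \<bar>snd (z \<alpha>)\<bar> \<le> B" using interface_height by blast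
  note J = Jordan_inside_outside[OF loop_simple loop_closed]
  have img: "exp (- B) \<le> norm w \<and> norm w \<le> exp B" if w: "w \<in> path_image loop" for w
  proof -
    obtain \<alpha> where "w = annulus_map (z \<alpha>)" using w by (auto simp: loop_image)
    then show ?thesis using B[of \<alpha>] by (simp add: norm_annulus_map abs_le_iff)
  qed
  have far: "w \<in> outside (path_image loop)" if "exp B < norm w" for w
  proof -
    have "- cball 0 (exp B) \<subseteq> outside (path_image loop)"
      by (intro outside_subset_convex) (use img in auto)
    then show ?thesis using that by auto
  qed
  have near: "w \<in> inside (path_image loop)" if "norm w < exp (- B)" for w
  proof -
    have c: "connected (ball 0 (exp (- B)) :: complex set)" by simp
    have sub: "ball 0 (exp (- B)) \<subseteq> inside (path_image loop) \<union> outside (path_image loop)"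
      using img J by (auto simp: not_less) fastforce
    have "outside (path_image loop) \<inter> ball 0 (exp (- B)) = {} \<or> inside (path_image loop) \<inter> ball 0 (exp (- B)) = {}"
    proof (rule connectedD[OF c])
      show "outside (path_image loop) \<inter> inside (path_image loop) \<inter> ball 0 (exp (- B)) = {}" using inside_Int_outside by blast
      show "ball 0 (exp (- B)) \<subseteq> outside (path_image loop) \<union> inside (path_image loop)"
        using sub by blast
    qed (use J in auto)
    moreover have "0 \<in> inside (path_image loop) \<inter> ball 0 (exp (- B))" using zero_inside by simp
    ultimately have "outside (path_image loop) \<inter> ball 0 (exp (- B)) = {}" by blast
    moreover have "w \<in> ball 0 (exp (- B))" using that by simp
    ultimately show ?thesis using sub by blast
  qed
  have half: "connected_component (- range z) y y'" if "snd y > B \<and> snd y' > B \<or> snd y < - B \<and> snd y' < - B" for y y'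
  proof -
    have c1: "convex {p :: plane. snd p > B}" "convex {p :: plane. snd p < - B}"
      using convex_halfspace_gt[of B "(0, 1) :: plane"] convex_halfspace_lt[of "(0, 1) :: plane" "- B"]
      by (simp_all add: inner_prod_def)
    have s1: "{p. snd p > B} \<subseteq> - range z" "{p. snd p < - B} \<subseteq> - range z"
    proof -
      have "snd (z \<alpha>) \<le> B" "- B \<le> snd (z \<alpha>)" for \<alpha> using B[of \<alpha>] by (simp_all add: abs_le_iff)
      then show "{p. snd p > B} \<subseteq> - range z" "{p. snd p < - B} \<subseteq> - range z" by (auto simp: not_less[symmetric])
    qed
    show ?thesis unfolding connected_component_def
      using that c1 s1 convex_connected by blast
  qed
  have up: "x \<in> upper_domain z" if x_in: "annulus_map x \<in> outside (path_image loop)" for x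
  proof -
    obtain y' where y': "snd y' = snd (0 :: real, B + 1)" "connected_component (- range z) x y'"
    proof (rule lift_connection[of "outside (path_image loop)" x "(0, B + 1)"])
      show "0 \<notin> outside (path_image loop)" using zero_inside inside_Int_outside by blast
      show "outside (path_image loop) \<inter> path_image loop = {}" by (simp add: outside_no_overlap)
      show "annulus_map (0, B + 1) \<in> outside (path_image loop)" by (intro far) (simp add: norm_annulus_map)
    qed (use J x_in in auto)
    have "connected_component (- range z) x y" if "snd y > B" for y
      using y' half[of y' y] that by (intro connected_component_trans[OF y'(2)]) auto
    then show ?thesis unfolding upper_domain_def by blast
  qed
  have lo: "x \<in> lower_domain z" if x_in: "annulus_map x \<in> inside (path_image loop)" for x
  proof -
    have nz: "annulus_map p \<noteq> 0" for p by (simp add: annulus_map_def)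
    \<comment> \<open>0 is not a value of the covering and has to be removed before lifting; an open
      connected set in the plane stays connected without a point.\<close>
    obtain y' where y': "snd y' = snd (0 :: real, - B - 1)" "connected_component (- range z) x y'"
    proof (rule lift_connection[of "inside (path_image loop) - {0}" x "(0, - B - 1)"])
      show "connected (inside (path_image loop) - {0})" using J by (intro connected_open_delete) auto
      show "(inside (path_image loop) - {0}) \<inter> path_image loop = {}" using inside_no_overlap by blast
      have "annulus_map (0, - B - 1) \<in> inside (path_image loop)" by (intro near) (simp add: norm_annulus_map)
      with nz show "annulus_map (0, - B - 1) \<in> inside (path_image loop) - {0}" by blast
      show "annulus_map x \<in> inside (path_image loop) - {0}" using nz x_in by blast
    qed (use J in auto)
    have "connected_component (- range z) x y" if "snd y < - B" for y
      using y' half[of y' y] that by (intro connected_component_trans[OF y'(2)]) auto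
    then show ?thesis unfolding lower_domain_def by blast
  qed
  have "upper_domain z \<inter> lower_domain z = {}"
  proof (rule ccontr)
    assume "upper_domain z \<inter> lower_domain z \<noteq> {}"
    then obtain x M N where M: "\<And>y. snd y > M \<Longrightarrow> connected_component (- range z) x y"
      and N: "\<And>y. snd y < N \<Longrightarrow> connected_component (- range z) x y"
      unfolding upper_domain_def lower_domain_def by blast
    define y1 y2 where "y1 = (0 :: real, max M B + 1)" and "y2 = (0 :: real, min N (- B) - 1)"
    have "connected_component (- range z) y1 y2"
    proof (rule connected_component_trans[OF connected_component_sym])
      show "connected_component (- range z) x y1" by (rule M) (simp add: y1_def)
      show "connected_component (- range z) x y2" by (rule N) (simp add: y2_def)
    qed
    then obtain T where T: "connected T" "T \<subseteq> - range z" "y1 \<in> T" "y2 \<in> T" unfolding connected_component_def by blast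
    have "connected (annulus_map ` T)" by (intro connected_continuous_image continuous_on_annulus_map T)
    moreover have "annulus_map ` T \<subseteq> inside (path_image loop) \<union> outside (path_image loop)"
      using T(2) not_in_loop unfolding inside_Un_outside by blast
    moreover have "annulus_map y1 \<in> outside (path_image loop)" unfolding y1_def by (intro far) (simp add: norm_annulus_map)
    moreover have "annulus_map y2 \<in> inside (path_image loop)" unfolding y2_def by (intro near) (simp add: norm_annulus_map)
    moreover have "open (inside (path_image loop))" "open (outside (path_image loop))" using J by auto
    ultimately have "inside (path_image loop) \<inter> annulus_map ` T = {} \<or> outside (path_image loop) \<inter> annulus_map ` T = {}"
      by (intro connectedD) auto
    then show False using T(3,4) \<open>annulus_map y1 \<in> _\<close> \<open>annulus_map y2 \<in> _\<close> by blast
  qed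
  moreover have "upper_domain z \<union> lower_domain z = - range z"
  proof (intro equalityI subsetI)
    fix x assume "x \<in> upper_domain z \<union> lower_domain z"
    then obtain M where "(\<forall>y. snd y > M \<longrightarrow> connected_component (- range z) x y) \<or> (\<forall>y. snd y < M \<longrightarrow> connected_component (- range z) x y)"
      unfolding upper_domain_def lower_domain_def by blast
    then have "connected_component (- range z) x (0, M + 1) \<or> connected_component (- range z) x (0, M - 1)" by auto
    then show "x \<in> - range z" using connected_component_in(1) by blast
  next
    fix x assume "x \<in> - range z"
    then have "annulus_map x \<notin> path_image loop" by (intro not_in_loop) auto
    then have "annulus_map x \<in> inside (path_image loop) \<union> outside (path_image loop)" by (simp only: inside_Un_outside) simp
    then show "x \<in> upper_domain z \<union> lower_domain z" using up lo by blast
  qed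
  ultimately show ?thesis unfolding separating_def by blast
qed

end

section \<open>Transport of the interface\<close>

lemma vector_derivative_lipschitz:
  fixes f :: "real \<Rightarrow> 'a::real_normed_vector"
  assumes "\<And>t. t \<in> {a..b} \<Longrightarrow> (f has_vector_derivative f' t) (at t within {a..b})"
    and "\<And>t. t \<in> {a..b} \<Longrightarrow> norm (f' t) \<le> B" and "s \<in> {a..b}" "t \<in> {a..b}"
  shows "norm (f t - f s) \<le> B * \<bar>t - s\<bar>"
proof -
  have "norm (f t - f s) \<le> B * norm (t - s)"
  proof (rule differentiable_bound[where S = "{a..b}" and f' = "\<lambda>t x. x *\<^sub>R f' t"])
    show "onorm (\<lambda>x. x *\<^sub>R f' u) \<le> B" if "u \<in> {a..b}" for u
    proof (rule onorm_le)
      show "norm (x *\<^sub>R f' u) \<le> B * norm x" for x using mult_right_mono[OF assms(2)[OF that], of "\<bar>x\<bar>"] by (simp add: mult.commute)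
    qed
  qed (use assms in \<open>auto simp: has_vector_derivative_def\<close>)
  then show ?thesis by simp
qed

text \<open>The squared norm of \<open>w\<close>, weighted by \<open>exp (2 * c * L * t)\<close>,
  does not fall below its initial value for \<open>c = 1\<close> and does not exceed it for
  \<open>c = -1\<close>, by the mean value theorem and Cauchy-Schwarz. The second estimate is the
  source of injectivity of the flow maps and of the Lipschitz bound on their inverses.\<close>

lemma gronwall_two_sided:
  fixes w :: "real \<Rightarrow> 'a::real_inner"
  assumes w: "\<And>t. t \<in> {0..T} \<Longrightarrow> (w has_vector_derivative w' t) (at t within {0..T})"
    and le: "\<And>t. t \<in> {0..T} \<Longrightarrow> norm (w' t) \<le> L * norm (w t)"
    and t: "t \<in> {0..T}"
  shows "norm (w t) \<le> exp (L * t) * norm (w 0)" and "norm (w 0) \<le> exp (L * t) * norm (w t)"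
proof -
  have mono: "0 \<le> c * (exp (2 * c * L * t) * (norm (w t))\<^sup>2 - (norm (w 0))\<^sup>2)" if c: "c = 1 \<or> c = -1" for c :: real
  proof (cases "t = 0")
    case False
    then have t0: "0 < t" using t by simp
    define g where "g s = exp (2 * c * L * s) * (w s \<bullet> w s)" for s
    have der: "(g has_derivative (\<lambda>h. h * (exp (2 * c * L * s) * (2 * c * L * (w s \<bullet> w s) + 2 * (w s \<bullet> w' s))))) (at s within {0..t})"
      if s: "0 \<le> s" "s \<le> t" for s
    proof -
      have "(w has_derivative (\<lambda>h. h *\<^sub>R w' s)) (at s within {0..t})"
        using has_vector_derivative_within_subset[OF w[of s], of "{0..t}"] s t by (auto simp: has_vector_derivative_def)
      then show ?thesis unfolding g_def
        by (auto intro!: derivative_eq_intros simp: inner_commute algebra_simps fun_eq_iff)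
    qed
    obtain s where s: "s \<in> {0<..<t}" and gs: "g t - g 0 = (t - 0) * (exp (2 * c * L * s) * (2 * c * L * (w s \<bullet> w s) + 2 * (w s \<bullet> w' s)))"
      using mvt_simple[OF t0 der] by auto
    have "\<bar>w s \<bullet> w' s\<bar> \<le> norm (w s) * norm (w' s)" by (rule Cauchy_Schwarz_ineq2)
    also have "\<dots> \<le> norm (w s) * (L * norm (w s))" using le[of s] s t by (intro mult_left_mono) auto
    also have "\<dots> = L * (w s \<bullet> w s)" by (simp add: power2_norm_eq_inner[symmetric] power2_eq_square)
    finally have cn: "0 \<le> c * (2 * c * L * (w s \<bullet> w s) + 2 * (w s \<bullet> w' s))" using c by (auto simp: abs_le_iff algebra_simps)
    have "0 \<le> (t * exp (2 * c * L * s)) * (c * (2 * c * L * (w s \<bullet> w s) + 2 * (w s \<bullet> w' s)))" by (rule mult_nonneg_nonneg[OF _ cn]) (use t0 in simp)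
    then have "0 \<le> c * (g t - g 0)" unfolding gs by (simp add: mult_ac)
    then show ?thesis by (simp add: g_def power2_norm_eq_inner)
  qed simp
  have sq: "exp (2 * L * t) * x\<^sup>2 = (exp (L * t) * x)\<^sup>2" for x :: real
    by (simp add: power_mult_distrib exp_double[symmetric] mult.assoc)
  have "(norm (w 0))\<^sup>2 \<le> (exp (L * t) * norm (w t))\<^sup>2" using mono[of 1] sq by simp
  then show "norm (w 0) \<le> exp (L * t) * norm (w t)" by (rule power2_le_imp_le) simp
  have "exp (- (2 * L * t)) * (norm (w t))\<^sup>2 \<le> (norm (w 0))\<^sup>2" using mono[of "-1"] by simp
  then have "exp (2 * L * t) * (exp (- (2 * L * t)) * (norm (w t))\<^sup>2) \<le> exp (2 * L * t) * (norm (w 0))\<^sup>2"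
    by (intro mult_left_mono) auto
  then have "(norm (w t))\<^sup>2 \<le> (exp (L * t) * norm (w 0))\<^sup>2" unfolding sq by (simp add: exp_minus mult.assoc[symmetric])
  then show "norm (w t) \<le> exp (L * t) * norm (w 0)" by (rule power2_le_imp_le) simp
qed

text \<open>Brouwer: \<open>x \<mapsto> y - (X x - x)\<close> sends a ball about \<open>y\<close>
  into itself, and its fixed point is a preimage of \<open>y\<close>.\<close>

lemma bounded_displacement_surj:
  fixes X :: "plane \<Rightarrow> plane"
  assumes c: "continuous_on UNIV X" and b: "\<And>x. norm (X x - x) \<le> B"
  shows "surj X"
proof -
  have "\<exists>x. X x = y" for y
  proof -
    have B0: "0 < B + 1" using b[of 0] norm_ge_zero[of "X 0 - 0"] by linarith
    obtain x where "y - (X x - x) = x"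
    proof (rule brouwer_ball[OF B0, of y "\<lambda>x. y - (X x - x)"])
      show "continuous_on (cball y (B + 1)) (\<lambda>x. y - (X x - x))" by (intro continuous_intros continuous_on_subset[OF c]) auto
      show "(\<lambda>x. y - (X x - x)) \<in> cball y (B + 1) \<rightarrow> cball y (B + 1)"
      proof
        fix x have "dist y (y - (X x - x)) = norm (X x - x)" by (simp add: dist_norm)
        then show "y - (X x - x) \<in> cball y (B + 1)" using b[of x] by simp
      qed
    qed blast
    then have "X x = y" by (simp add: algebra_simps)
    then show ?thesis by blast
  qed
  then show ?thesis unfolding surj_def by metis
qed

text \<open>A connected set avoiding the curve is carried to one avoiding the image curve, and the
  threshold of a half plane moves by at most the displacement bound \<open>B\<close>.\<close>

lemma upper_domain_image_subset:
  fixes X :: "plane \<Rightarrow> plane"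
  assumes c: "continuous_on UNIV X" and bij: "bij X" and b: "\<And>x. norm (X x - x) \<le> B"
    and x: "x \<in> upper_domain z"
  shows "X x \<in> upper_domain (\<lambda>\<alpha>. X (z \<alpha>))"
proof -
  obtain M where M: "\<And>y. snd y > M \<Longrightarrow> connected_component (- range z) x y" using x unfolding upper_domain_def by blast
  have "connected_component (- range (\<lambda>\<alpha>. X (z \<alpha>))) (X x) y" if y: "snd y > M + B" for y
  proof -
    obtain v where v: "y = X v" using bij by (metis bij_pointE)
    have "\<bar>snd (X v - v)\<bar> \<le> B" using b[of v] abs_snd_le_norm[of "X v - v"] by linarith
    then have "snd v > M" using y v by simp
    then obtain S where S: "connected S" "S \<subseteq> - range z" "x \<in> S" "v \<in> S" using M unfolding connected_component_def by blast
    have "connected (X ` S)" by (intro connected_continuous_image continuous_on_subset[OF c] S) auto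
    moreover have "X ` S \<subseteq> - range (\<lambda>\<alpha>. X (z \<alpha>))" 
    proof
      fix p assume "p \<in> X ` S"
      then obtain q where q: "q \<in> S" "p = X q" by auto
      have "X q \<noteq> X (z \<alpha>)" for \<alpha> using q S(2) bij by (metis Compl_iff bij_is_inj inj_eq rangeI subsetD)
      then show "p \<in> - range (\<lambda>\<alpha>. X (z \<alpha>))" using q by auto
    qed
    ultimately show ?thesis unfolding connected_component_def using S v by blast
  qed
  then show ?thesis unfolding upper_domain_def by blast
qed

lemma upper_domain_image_iff:
  fixes X :: "plane \<Rightarrow> plane"
  assumes c: "continuous_on UNIV X" and bij: "bij X" and ci: "continuous_on UNIV (inv X)" and b: "\<And>x. norm (X x - x) \<le> B"
  shows "X x \<in> upper_domain (\<lambda>\<alpha>. X (z \<alpha>)) \<longleftrightarrow> x \<in> upper_domain z"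
proof
  assume "X x \<in> upper_domain (\<lambda>\<alpha>. X (z \<alpha>))"
  moreover have "norm (inv X y - y) \<le> B" for y
    using b[of "inv X y"] bij by (simp add: bij_is_surj surj_f_inv_f norm_minus_commute)
  ultimately have "inv X (X x) \<in> upper_domain (\<lambda>\<alpha>. inv X (X (z \<alpha>)))"
    by (intro upper_domain_image_subset[OF ci bij_imp_bij_inv[OF bij]])
  then show "x \<in> upper_domain z" using bij by (simp add: bij_is_inj)
qed (rule upper_domain_image_subset[OF c bij b])

lemma open_upper_domain:
  assumes c: "closed (range z)" shows "open (upper_domain z)"
proof (rule openI)
  fix x assume "x \<in> upper_domain z"
  then obtain M where M: "\<And>y. snd y > M \<Longrightarrow> connected_component (- range z) x y" unfolding upper_domain_def by blast
  have "x \<in> - range z" using connected_component_in(1)[OF M[of "(0, M + 1)"]] by simp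
  then obtain e where e: "0 < e" "ball x e \<subseteq> - range z" using c by (metis open_Compl open_contains_ball)
  have "ball x e \<subseteq> upper_domain z"
  proof
    fix y assume "y \<in> ball x e"
    then have "connected_component (- range z) y x"
      unfolding connected_component_def using e by (intro exI[of _ "ball x e"]) auto
    then show "y \<in> upper_domain z" unfolding upper_domain_def using M connected_component_trans by blast
  qed
  then show "\<exists>e>0. ball x e \<subseteq> upper_domain z" using e by blast
qed

text \<open>The curve is one compact period plus the closed set of horizontal translations by
  periods; a compact set plus a closed set is closed.\<close>

lemma closed_range_interface: 
  assumes z: "interface z" shows "closed (range z)"
proof -
  have c: "continuous_on UNIV z" using z by (simp add: interface_def)
  have K: "compact (z ` {0..2 * pi})" by (intro compact_continuous_image continuous_on_subset[OF c]) auto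
  have "closed (\<Union>x\<in>z ` {0..2 * pi}. \<Union>y\<in>range (\<lambda>k::int. (2 * pi * of_int k, 0 :: real)). {x + y})"
  proof (rule compact_closed_sums[OF K])
    have "closed ((\<lambda>k::int. (of_int k :: real)) ` UNIV)" using closed_Ints by (simp add: Ints_def)
    then have "closed ({x. fst x / (2 * pi) \<in> range of_int} \<inter> {x :: plane. snd x = 0})"
      by (intro closed_Int closed_vimage[of _ "\<lambda>x. fst x / (2 * pi)", unfolded vimage_def] closed_Collect_eq continuous_intros) auto
    moreover have "{x. fst x / (2 * pi) \<in> range of_int} \<inter> {x :: plane. snd x = 0} = range (\<lambda>k::int. (2 * pi * of_int k, 0 :: real))"
      by (force simp: image_iff field_simps)
    ultimately show "closed (range (\<lambda>k::int. (2 * pi * of_int k, 0 :: real)))" by simp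
  qed
  moreover have "(\<Union>x\<in>z ` {0..2 * pi}. \<Union>y\<in>range (\<lambda>k::int. (2 * pi * of_int k, 0 :: real)). {x + y}) = range z"
  proof (intro equalityI subsetI)
    fix p assume "p \<in> range z"
    then obtain \<alpha> where p: "p = z \<alpha>" by auto
    define k where "k = \<lfloor>\<alpha> / (2 * pi)\<rfloor>"
    define t where "t = \<alpha> / (2 * pi) - of_int k"
    have t: "0 \<le> t" "t \<le> 1" unfolding t_def k_def by linarith+
    have "\<alpha> = 2 * pi * t + 2 * pi * of_int k" by (simp add: t_def field_simps)
    then have "p = (2 * pi * of_int k, 0) + z (2 * pi * t)" using z unfolding p interface_def by metis
    then have "p = z (2 * pi * t) + (2 * pi * of_int k, 0)" by (simp add: add.commute)
    then show "p \<in> (\<Union>x\<in>z ` {0..2 * pi}. \<Union>y\<in>range (\<lambda>k::int. (2 * pi * of_int k, 0 :: real)). {x + y})"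
      using t by (intro UN_I[of "z (2 * pi * t)"] UN_I[of "(2 * pi * of_int k, 0)"]) auto
  next
    fix p assume "p \<in> (\<Union>x\<in>z ` {0..2 * pi}. \<Union>y\<in>range (\<lambda>k::int. (2 * pi * of_int k, 0 :: real)). {x + y})"
    then obtain \<alpha> and k :: int where "p = z \<alpha> + (2 * pi * of_int k, 0)" by auto
    then have "p = z (\<alpha> + 2 * pi * of_int k)" using z unfolding interface_def by (simp add: add.commute)
    then show "p \<in> range z" by auto
  qed
  ultimately show ?thesis by simp
qed

lemma upper_domain_shift:
  assumes z: "interface z" shows "x + (2 * pi, 0) \<in> upper_domain z \<longleftrightarrow> x \<in> upper_domain z"
proof -
  have zz: "z (\<alpha> - 2 * pi) + (2 * pi, 0) = z \<alpha>" "z (\<alpha> + 2 * pi) = z \<alpha> + (2 * pi, 0)" for \<alpha>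
  proof -
    have s: "z (\<alpha> + 2 * pi) = z \<alpha> + (2 * pi, 0)" for \<alpha>
      using z[unfolded interface_def, THEN conjunct2, rule_format, of \<alpha> 1] by (simp add: add.commute)
    show "z (\<alpha> + 2 * pi) = z \<alpha> + (2 * pi, 0)" by (rule s)
    show "z (\<alpha> - 2 * pi) + (2 * pi, 0) = z \<alpha>" using s[of "\<alpha> - 2 * pi"] by simp
  qed
  have r: "range (\<lambda>\<alpha>. z \<alpha> + (2 * pi, 0)) = range z"
  proof (intro equalityI subsetI)
    fix p assume "p \<in> range z" then obtain \<alpha> where "p = z \<alpha>" by auto
    then have "p = z (\<alpha> - 2 * pi) + (2 * pi, 0)" using zz by simp
    then show "p \<in> range (\<lambda>\<alpha>. z \<alpha> + (2 * pi, 0))" by blast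
  qed (auto simp: zz(2)[symmetric])
  have "upper_domain (\<lambda>\<alpha>. z \<alpha> + (2 * pi, 0)) = upper_domain z" unfolding upper_domain_def r ..
  moreover have "inv (\<lambda>x. x + (2 * pi, 0)) = (\<lambda>x :: plane. x - (2 * pi, 0))" 
    by (rule inv_equality) auto
  moreover have "bij (\<lambda>x :: plane. x + (2 * pi, 0))" by (rule bij_plus_right)
  ultimately show ?thesis
    using upper_domain_image_iff[of "\<lambda>x. x + (2 * pi, 0)" "norm (2 * pi, 0 :: real)" x z] by (simp add: continuous_intros)
qed

lemma patch_measurable:
  assumes "interface z" shows "patch a b z \<in> borel_measurable borel"
proof -
  have [measurable]: "upper_domain z \<in> sets borel" by (intro borel_open open_upper_domain closed_range_interface assms)
  show ?thesis unfolding patch_def[abs_def] by measurable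
qed

lemma arc_chord_inj: "arc_chord z \<Longrightarrow> inj z"
  unfolding arc_chord_def by (rule injI) (metis abs_le_zero_iff add_diff_cancel_left' cancel_comm_monoid_add_class.diff_cancel diff_add_cancel eq_iff_diff_eq_0 linorder_not_le mult_pos_pos norm_zero zero_less_abs_iff order_antisym_conv)

lemma joint_lipschitz_continuous:
  fixes f :: "real \<Rightarrow> plane \<Rightarrow> 'a::real_normed_vector"
  assumes A: "0 \<le> A" "0 \<le> B" and le: "\<And>s t x y. s \<in> S \<Longrightarrow> t \<in> S \<Longrightarrow> norm (f t x - f s y) \<le> A * \<bar>t - s\<bar> + B * norm (x - y)"
  shows "continuous_on (S \<times> UNIV) (\<lambda>p. f (fst p) (snd p))"
proof (rule lipschitz_on_continuous_on)
  show "(A + B)-lipschitz_on (S \<times> UNIV) (\<lambda>p. f (fst p) (snd p))"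
  proof (rule lipschitz_onI)
    fix p q :: "real \<times> plane" assume "p \<in> S \<times> UNIV" "q \<in> S \<times> UNIV"
    then have "norm (f (fst p) (snd p) - f (fst q) (snd q)) \<le> A * \<bar>fst p - fst q\<bar> + B * norm (snd p - snd q)" by (intro le) auto
    also have "\<dots> \<le> A * norm (p - q) + B * norm (p - q)"
    proof (intro add_mono mult_left_mono A)
      have "p - q = (fst p - fst q, snd p - snd q)" by (simp add: prod_eq_iff)
      then show "\<bar>fst p - fst q\<bar> \<le> norm (p - q)" "norm (snd p - snd q) \<le> norm (p - q)"
        using norm_fst_le[of "fst p - fst q" "snd p - snd q"] norm_snd_le[of "snd p - snd q" "fst p - fst q"] by simp_all
    qed
    finally show "dist (f (fst p) (snd p)) (f (fst q) (snd q)) \<le> (A + B) * dist p q"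
      by (simp add: dist_norm distrib_right)
  qed (use A in simp)
qed

locale flow = bounded_density +
  fixes T :: real and X :: "real \<Rightarrow> plane \<Rightarrow> plane"
  assumes T: "0 < T" and X0: "\<And>x. X 0 x = x" and mp: "\<And>t. 0 \<le> t \<Longrightarrow> measure_preserving_map (X t)"
    and der: "\<And>x t. t \<in> {0..T} \<Longrightarrow> ((\<lambda>s. X s x) has_vector_derivative transport_velocity \<rho> (X t) (X t x)) (at t within {0..T})"
begin

abbreviation "field t \<equiv> transport_velocity \<rho> (X t)"

lemma mp': "t \<in> {0..T} \<Longrightarrow> measure_preserving_map (X t)" by (rule mp) simp

lemma field_bound: "t \<in> {0..T} \<Longrightarrow> norm (field t x) \<le> C_vel"
  and field_lipschitz: "t \<in> {0..T} \<Longrightarrow> norm (field t x - field t y) \<le> C_vel * norm (x - y)"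
  by (rule transport_velocity_bound[OF mp'] transport_velocity_lipschitz[OF mp'], assumption)+

lemma time_lipschitz: "s \<in> {0..T} \<Longrightarrow> t \<in> {0..T} \<Longrightarrow> norm (X t x - X s x) \<le> C_vel * \<bar>t - s\<bar>"
  by (rule vector_derivative_lipschitz[OF der field_bound])

definition "E = exp (C_vel * T)"

lemma E_pos: "0 < E" by (simp add: E_def)

lemma der_diff: "t \<in> {0..T} \<Longrightarrow> ((\<lambda>s. X s x - X s y) has_vector_derivative field t (X t x) - field t (X t y)) (at t within {0..T})"
  by (intro has_vector_derivative_diff der)

lemma exp_le_E: "t \<in> {0..T} \<Longrightarrow> exp (C_vel * t) \<le> E"
  using C_vel_nonneg by (simp add: E_def mult_left_mono)

lemma space_lipschitz:
  assumes t: "t \<in> {0..T}"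
  shows "norm (X t x - X t y) \<le> E * norm (x - y)" "norm (x - y) \<le> E * norm (X t x - X t y)"
proof -
  note g = gronwall_two_sided[OF der_diff field_lipschitz t, of x y, unfolded X0]
  show "norm (X t x - X t y) \<le> E * norm (x - y)" "norm (x - y) \<le> E * norm (X t x - X t y)"
    using g mult_right_mono[OF exp_le_E[OF t] norm_ge_zero[of "x - y"]] mult_right_mono[OF exp_le_E[OF t] norm_ge_zero[of "X t x - X t y"]]
    by linarith+
qed

text \<open>The time derivative of \<open>X t x - X t y\<close> is a difference of field values,
  hence of order \<open>norm (x - y)\<close>. Continuity in time in the Hoelder and Lipschitz norms
  depends on this; uniform closeness of \<open>X t\<close> and \<open>X s\<close> would not control
  difference quotients.\<close>

lemma mixed_lipschitz:
  assumes s: "s \<in> {0..T}" and t: "t \<in> {0..T}"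
  shows "norm ((X t x - X s x) - (X t y - X s y)) \<le> C_vel * E * norm (x - y) * \<bar>t - s\<bar>"
proof -
  have "norm (field u (X u x) - field u (X u y)) \<le> C_vel * E * norm (x - y)" if u: "u \<in> {0..T}" for u
  proof -
    have "norm (field u (X u x) - field u (X u y)) \<le> C_vel * norm (X u x - X u y)" by (rule field_lipschitz[OF u])
    also have "\<dots> \<le> C_vel * (E * norm (x - y))" by (intro mult_left_mono space_lipschitz(1)[OF u] C_vel_nonneg)
    finally show ?thesis by simp
  qed
  from vector_derivative_lipschitz[OF der_diff this s t] have "norm ((X t x - X t y) - (X s x - X s y)) \<le> C_vel * E * norm (x - y) * \<bar>t - s\<bar>" .
  moreover have "(X t x - X t y) - (X s x - X s y) = (X t x - X s x) - (X t y - X s y)" by simp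
  ultimately show ?thesis by simp
qed

lemma displacement: "t \<in> {0..T} \<Longrightarrow> norm (X t x - x) \<le> C_vel * T"
proof -
  assume t: "t \<in> {0..T}"
  then have "norm (X t x - x) \<le> C_vel * \<bar>t - 0\<bar>" using time_lipschitz[of 0 t x] X0 by simp
  also have "\<dots> \<le> C_vel * T" using t C_vel_nonneg by (intro mult_left_mono) auto
  finally show ?thesis .
qed

lemma X_continuous: "t \<in> {0..T} \<Longrightarrow> continuous_on UNIV (X t)"
  by (rule measure_preserving_mapD(1)[OF mp'])

lemma X_bij: assumes t: "t \<in> {0..T}" shows "bij (X t)"
proof (rule bijI)
  show "inj (X t)" using space_lipschitz(2)[OF t] by (intro injI) (metis diff_self mult_zero_right norm_le_zero_iff norm_zero right_minus_eq)
  show "surj (X t)" by (rule bounded_displacement_surj[OF X_continuous[OF t] displacement[OF t]])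
qed

abbreviation "Y t \<equiv> inv (X t)"

lemma X_Y: "t \<in> {0..T} \<Longrightarrow> X t (Y t x) = x" and Y_X: "t \<in> {0..T} \<Longrightarrow> Y t (X t x) = x"
  using X_bij by (simp_all add: bij_is_surj surj_f_inv_f bij_is_inj)

lemma XC: "continuous_on ({0..T} \<times> UNIV) (\<lambda>p. X (fst p) (snd p))"
proof (rule joint_lipschitz_continuous[OF C_vel_nonneg less_imp_le[OF E_pos]])
  fix s t x y assume st: "s \<in> {0..T}" "t \<in> {0..T}"
  have "X t x - X s y = (X t y - X s y) + (X t x - X t y)" by simp
  then have "norm (X t x - X s y) \<le> norm (X t y - X s y) + norm (X t x - X t y)" by (metis norm_triangle_ineq)
  then show "norm (X t x - X s y) \<le> C_vel * \<bar>t - s\<bar> + E * norm (x - y)"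
    using time_lipschitz[OF st, of y] space_lipschitz(1)[OF st(2), of x y] by linarith
qed

text \<open>The lower Gronwall bound converts distances at time \<open>t\<close> into distances of
  labels, so the time regularity of \<open>X\<close> is inherited by its inverse.\<close>

lemma Y_lipschitz:
  assumes st: "s \<in> {0..T}" "t \<in> {0..T}"
  shows "norm (Y t x - Y s y) \<le> (E * C_vel) * \<bar>t - s\<bar> + E * norm (x - y)"
proof -
  have "norm (Y t x - Y s y) \<le> E * norm (X t (Y t x) - X t (Y s y))" by (rule space_lipschitz(2)[OF st(2)])
  also have "X t (Y t x) - X t (Y s y) = (x - y) - (X t (Y s y) - X s (Y s y))" using X_Y st by simp
  also have "E * norm \<dots> \<le> E * (norm (x - y) + C_vel * \<bar>t - s\<bar>)"
    using norm_triangle_ineq4[of "x - y" "X t (Y s y) - X s (Y s y)"] time_lipschitz[OF st, of "Y s y"] E_pos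
    by (intro mult_left_mono) auto
  finally show ?thesis by (simp add: algebra_simps)
qed

lemma YC: "continuous_on ({0..T} \<times> UNIV) (\<lambda>p. Y (fst p) (snd p))"
  by (rule joint_lipschitz_continuous[OF _ _ Y_lipschitz]) (use E_pos C_vel_nonneg in auto)

lemma Y_continuous: assumes t: "t \<in> {0..T}" shows "continuous_on UNIV (Y t)"
proof (rule lipschitz_on_continuous_on)
  show "E-lipschitz_on UNIV (Y t)" using Y_lipschitz[OF t t] E_pos by (intro lipschitz_onI) (auto simp: dist_norm)
qed

lemma fieldC: "continuous_on ({0..T} \<times> UNIV) (\<lambda>p. field (fst p) (snd p))"
proof (rule joint_lipschitz_continuous)
  fix s t x x' assume st: "s \<in> {0..T}" "t \<in> {0..T}"
  have "norm (field t x - field s x') \<le> C_vel * (C_vel * \<bar>t - s\<bar> + norm (x - x'))"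
  proof (rule transport_velocity_diff[OF mp'[OF st(2)] mp'[OF st(1)]])
    show "norm ((x - X t y) - (x' - X s y)) \<le> C_vel * \<bar>t - s\<bar> + norm (x - x')" for y
    proof -
      have e: "(x - X t y) - (x' - X s y) = (x - x') - (X t y - X s y)" by simp
      show ?thesis unfolding e using norm_triangle_ineq4[of "x - x'" "X t y - X s y"] time_lipschitz[OF st, of y] by linarith
    qed
    show "0 \<le> C_vel * \<bar>t - s\<bar> + norm (x - x')" using C_vel_nonneg by simp
  qed
  then show "norm (field t x - field s x') \<le> (C_vel * C_vel) * \<bar>t - s\<bar> + C_vel * norm (x - x')" by (simp add: algebra_simps)
qed (use C_vel_nonneg in auto)

end

section \<open>Test functions on the cylinder\<close>

text \<open>Derivatives are carried as explicit pairs of numbers, so that the divergence identities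
  below reduce to polynomial identities in the values of functions and partials.\<close>

definition partials :: "(plane \<Rightarrow> real) \<Rightarrow> real \<Rightarrow> real \<Rightarrow> plane \<Rightarrow> bool" where
  "partials f a b y \<longleftrightarrow> (f has_derivative (\<lambda>h. a * fst h + b * snd h)) (at y)"

lemma partials_mult:
  assumes "partials f a b y" "partials g c d y"
  shows "partials (\<lambda>y. f y * g y) (a * g y + f y * c) (b * g y + f y * d) y"
  using has_derivative_mult[OF assms[unfolded partials_def]] unfolding partials_def
  by (rule has_derivative_eq_rhs) (auto simp: algebra_simps)

lemma partials_add:
  assumes "partials f a b y" "partials g c d y"
  shows "partials (\<lambda>y. f y + g y) (a + c) (b + d) y"
  using has_derivative_add[OF assms[unfolded partials_def]] unfolding partials_def
  by (rule has_derivative_eq_rhs) (auto simp: algebra_simps)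

lemma partials_diff:
  assumes "partials f a b y" "partials g c d y"
  shows "partials (\<lambda>y. f y - g y) (a - c) (b - d) y"
  using has_derivative_diff[OF assms[unfolded partials_def]] unfolding partials_def
  by (rule has_derivative_eq_rhs) (auto simp: algebra_simps)

lemma partials_const: "partials (\<lambda>y. c) 0 0 y" and partials_snd: "partials snd 0 1 y"
  and partials_fst: "partials fst 1 0 y"
  unfolding partials_def by (auto intro!: derivative_eq_intros)

lemma partials_compose:
  assumes f: "(f has_real_derivative f') (at (g y))" and g: "partials g a b y"
  shows "partials (\<lambda>y. f (g y)) (f' * a) (f' * b) y"
proof -
  have "(f has_derivative (\<lambda>x. f' * x)) (at (g y))" using f by (simp add: has_field_derivative_def)
  from has_derivative_compose[OF g[unfolded partials_def] this]
  show ?thesis unfolding partials_def by (rule has_derivative_eq_rhs) (auto simp: algebra_simps)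
qed

lemma partials_continuous:
  assumes "\<And>y. partials f (a y) (b y) y" shows "continuous_on UNIV f"
  by (intro continuous_at_imp_continuous_on ballI has_derivative_continuous[OF assms[unfolded partials_def]])

lemma partials_fst_real: assumes "partials f a b (s, t)" shows "((\<lambda>s. f (s, t)) has_real_derivative a) (at s)"
proof -
  have "((\<lambda>s. (s, t)) has_derivative (\<lambda>h. (h, 0))) (at s)" by (auto intro!: derivative_eq_intros)
  from has_derivative_compose[OF this assms[unfolded partials_def]] show ?thesis
    by (simp add: has_field_derivative_def)
qed

lemma partials_snd_real: assumes "partials f a b (s, t)" shows "((\<lambda>t. f (s, t)) has_real_derivative b) (at t)"
proof -
  have "((\<lambda>t. (s, t)) has_derivative (\<lambda>h. (0, h))) (at t)" by (auto intro!: derivative_eq_intros)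
  from has_derivative_compose[OF this assms[unfolded partials_def]] show ?thesis
    by (simp add: has_field_derivative_def)
qed

text \<open>The second difference of \<open>f\<close> over a small square is evaluated in both
  orders by the mean value theorem; as the square shrinks, continuity of the two mixed partials
  makes them agree.\<close>

lemma partials_symmetric:
  assumes f: "\<And>y. partials f (f1 y) (f2 y) y" and f1: "\<And>y. partials f1 (f11 y) (f12 y) y" and f2: "\<And>y. partials f2 (f21 y) (f22 y) y"
    and c12: "continuous_on UNIV f12" and c21: "continuous_on UNIV f21"
  shows "f12 y = f21 y"
proof -
  obtain s t where y: "y = (s, t)" by (cases y)
  have ex: "\<exists>p q. norm (p - y) \<le> 2 * h \<and> norm (q - y) \<le> 2 * h \<and> f12 p = f21 q" if h: "0 < h" for h
  proof -
    have near: "norm ((u, v) - y) \<le> 2 * h" if "s < u" "u < s + h" "t < v" "v < t + h" for u v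
      using norm_le_abs_sum[of "(u, v) - y"] that by (simp add: y)
    obtain u where u: "s < u" "u < s + h" and e1: "(f (s + h, t + h) - f (s + h, t)) - (f (s, t + h) - f (s, t)) = (s + h - s) * (f1 (u, t + h) - f1 (u, t))"
    proof -
      have "\<exists>u>s. u < s + h \<and> (f (s + h, t + h) - f (s + h, t)) - (f (s, t + h) - f (s, t)) = (s + h - s) * (f1 (u, t + h) - f1 (u, t))"
        by (rule MVT2) (use h in \<open>auto intro!: DERIV_diff partials_fst_real f\<close>)
      then show thesis using that by blast
    qed
    obtain v where v: "t < v" "v < t + h" and e2: "f1 (u, t + h) - f1 (u, t) = (t + h - t) * f12 (u, v)"
    proof -
      have "\<exists>v>t. v < t + h \<and> f1 (u, t + h) - f1 (u, t) = (t + h - t) * f12 (u, v)"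
        by (rule MVT2) (use h in \<open>auto intro!: partials_snd_real f1\<close>)
      then show thesis using that by blast
    qed
    obtain v' where v': "t < v'" "v' < t + h" and e3: "(f (s + h, t + h) - f (s, t + h)) - (f (s + h, t) - f (s, t)) = (t + h - t) * (f2 (s + h, v') - f2 (s, v'))"
    proof -
      have "\<exists>v>t. v < t + h \<and> (f (s + h, t + h) - f (s, t + h)) - (f (s + h, t) - f (s, t)) = (t + h - t) * (f2 (s + h, v) - f2 (s, v))"
        by (rule MVT2) (use h in \<open>auto intro!: DERIV_diff partials_snd_real f\<close>)
      then show thesis using that by blast
    qed
    obtain u' where u': "s < u'" "u' < s + h" and e4: "f2 (s + h, v') - f2 (s, v') = (s + h - s) * f21 (u', v')"
    proof -
      have "\<exists>u>s. u < s + h \<and> f2 (s + h, v') - f2 (s, v') = (s + h - s) * f21 (u, v')"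
        by (rule MVT2) (use h in \<open>auto intro!: partials_fst_real f2\<close>)
      then show thesis using that by blast
    qed
    have "h * (h * f12 (u, v)) = h * (h * f21 (u', v'))" using e1 e2 e3 e4 by (simp add: algebra_simps)
    then have "f12 (u, v) = f21 (u', v')" using h by simp
    then show ?thesis using near[OF u v] near[OF u' v'] by blast
  qed
  define t where "t n = 1 / real (Suc n)" for n
  have t0: "t \<longlonglongrightarrow> 0" unfolding t_def using LIMSEQ_inverse_real_of_nat by (simp add: inverse_eq_divide)
  have tp: "0 < t n" for n by (simp add: t_def)
  obtain p q where pq: "\<And>n. norm (p n - y) \<le> 2 * t n" "\<And>n. norm (q n - y) \<le> 2 * t n" "\<And>n. f12 (p n) = f21 (q n)"
    using ex[OF tp] by metis
  have t2: "(\<lambda>n. 2 * t n) \<longlonglongrightarrow> 0" using tendsto_mult_right_zero[OF t0] by simp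
  have p: "p \<longlonglongrightarrow> y" by (rule LIM_zero_cancel, rule Lim_null_comparison[OF _ t2]) (use pq in auto)
  have q: "q \<longlonglongrightarrow> y" by (rule LIM_zero_cancel, rule Lim_null_comparison[OF _ t2]) (use pq in auto)
  have "(\<lambda>n. f12 (p n)) \<longlonglongrightarrow> f12 y" by (rule isCont_tendsto_compose[OF _ p]) (use c12 in \<open>unfold continuous_on_eq_continuous_at[OF open_UNIV], blast\<close>)
  moreover have "(\<lambda>n. f21 (q n)) \<longlonglongrightarrow> f21 y" by (rule isCont_tendsto_compose[OF _ q]) (use c21 in \<open>unfold continuous_on_eq_continuous_at[OF open_UNIV], blast\<close>)
  ultimately show ?thesis using pq(3) LIMSEQ_unique by simp
qed

section \<open>Divergence theorem on the cylinder\<close>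

lemma rect_integrable:
  fixes A :: "plane \<Rightarrow> real"
  assumes "continuous_on UNIV A"
  shows "integrable lborel (\<lambda>p. indicator ({a..b} \<times> {c..d}) p * A p)"
  using borel_integrable_compact[of "{a..b} \<times> {c..d}" A] continuous_on_subset[OF assms] by (simp add: compact_Times)

lemma rect_integral_d1:
  assumes F: "\<And>y. partials F (A y) (B y) y" and A: "continuous_on UNIV A" and ab: "a \<le> b"
  shows "(LBINT p. indicator ({a..b} \<times> {c..d}) p * A p) = (LBINT t. indicator {c..d} t * (F (b, t) - F (a, t)))"
proof -
  have "integrable (lborel \<Otimes>\<^sub>M lborel) (case_prod (\<lambda>s t. indicator ({a..b} \<times> {c..d}) (s, t) * A (s, t)))"
    using rect_integrable[OF A, of a b c d] by (simp add: lborel_prod case_prod_beta')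
  from lborel_pair.integral_snd[OF this]
  have "(LBINT p. indicator ({a..b} \<times> {c..d}) p * A p) = (LBINT t. (LBINT s. indicator ({a..b} \<times> {c..d}) (s, t) * A (s, t)))"
    by (simp add: lborel_prod case_prod_beta')
  also have "\<dots> = (LBINT t. indicator {c..d} t * (F (b, t) - F (a, t)))"
  proof (intro Bochner_Integration.integral_cong refl)
    fix t
    have "(LBINT s. indicator ({a..b} \<times> {c..d}) (s, t) * A (s, t)) = (LBINT s. indicator {c..d} t * (indicator {a..b} s * A (s, t)))"
      by (intro Bochner_Integration.integral_cong refl) (auto simp: indicator_def)
    also have "\<dots> = indicator {c..d} t * (LBINT s. indicator {a..b} s * A (s, t))" by simp
    also have "(LBINT s. indicator {a..b} s * A (s, t)) = F (b, t) - F (a, t)"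
      by (rule FTC_lint[OF partials_fst_real[OF F] _ ab]) (intro continuous_on_compose2[OF A] continuous_intros, auto)
    finally show "(LBINT s. indicator ({a..b} \<times> {c..d}) (s, t) * A (s, t)) = indicator {c..d} t * (F (b, t) - F (a, t))" .
  qed
  finally show ?thesis .
qed

lemma rect_integral_d2:
  assumes F: "\<And>y. partials F (A y) (B y) y" and B: "continuous_on UNIV B" and cd: "c \<le> d"
  shows "(LBINT p. indicator ({a..b} \<times> {c..d}) p * B p) = (LBINT s. indicator {a..b} s * (F (s, d) - F (s, c)))"
proof -
  have "integrable (lborel \<Otimes>\<^sub>M lborel) (case_prod (\<lambda>s t. indicator ({a..b} \<times> {c..d}) (s, t) * B (s, t)))"
    using rect_integrable[OF B, of a b c d] by (simp add: lborel_prod case_prod_beta')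
  from lborel_pair.integral_fst[OF this]
  have "(LBINT p. indicator ({a..b} \<times> {c..d}) p * B p) = (LBINT s. (LBINT t. indicator ({a..b} \<times> {c..d}) (s, t) * B (s, t)))"
    by (simp add: lborel_prod case_prod_beta')
  also have "\<dots> = (LBINT s. indicator {a..b} s * (F (s, d) - F (s, c)))"
  proof (intro Bochner_Integration.integral_cong refl)
    fix s
    have "(LBINT t. indicator ({a..b} \<times> {c..d}) (s, t) * B (s, t)) = (LBINT t. indicator {a..b} s * (indicator {c..d} t * B (s, t)))"
      by (intro Bochner_Integration.integral_cong refl) (auto simp: indicator_def)
    also have "\<dots> = indicator {a..b} s * (LBINT t. indicator {c..d} t * B (s, t))" by simp
    also have "(LBINT t. indicator {c..d} t * B (s, t)) = F (s, d) - F (s, c)"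
      by (rule FTC_lint[OF partials_snd_real[OF F] _ cd]) (intro continuous_on_compose2[OF B] continuous_intros, auto)
    finally show "(LBINT t. indicator ({a..b} \<times> {c..d}) (s, t) * B (s, t)) = indicator {a..b} s * (F (s, d) - F (s, c))" .
  qed
  finally show ?thesis .
qed

lemma cell_indicator:
  fixes A :: "plane \<Rightarrow> real"
  assumes "\<And>y. \<bar>snd y\<bar> > M \<Longrightarrow> A y = 0"
  shows "indicator cell p * A p = indicator ({0..2 * pi} \<times> {- M..M}) p * A p"
  using assms[of p] by (cases p) (auto simp: cell_def indicator_def abs_le_iff not_less[symmetric])

lemma cell_integrable:
  fixes A :: "plane \<Rightarrow> real"
  assumes "continuous_on UNIV A" "\<And>y. \<bar>snd y\<bar> > M \<Longrightarrow> A y = 0"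
  shows "integrable lborel (\<lambda>y. indicator cell y * A y)"
proof -
  have "(\<lambda>y. indicator cell y * A y) = (\<lambda>y. indicator ({0..2 * pi} \<times> {- M..M}) y * A y)"
    by (rule ext, rule cell_indicator, rule assms(2))
  then show ?thesis using rect_integrable[OF assms(1)] by simp
qed

text \<open>The flux through the vertical sides cancels by periodicity of \<open>F\<close>, and the
  flux through the horizontal ones vanishes with \<open>G\<close>.\<close>

lemma cell_divergence:
  assumes F: "\<And>y. partials F (A y) (B y) y" and A: "continuous_on UNIV A" 
    and G: "\<And>y. partials G (C y) (D y) y" and D: "continuous_on UNIV D"
    and per: "\<And>y. F (y + (2 * pi, 0)) = F y"
    and supp: "\<And>y. \<bar>snd y\<bar> > M \<Longrightarrow> F y = 0" "\<And>y. \<bar>snd y\<bar> > M \<Longrightarrow> G y = 0"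
    and supp': "\<And>y. \<bar>snd y\<bar> > M \<Longrightarrow> A y + D y = 0" 
  shows "(LBINT y. indicator cell y * (A y + D y)) = 0"
proof -
  \<comment> \<open>Strictly beyond the support, so that \<open>G\<close> vanishes on the horizontal
    edges of the rectangle.\<close>
  define N where "N = \<bar>M\<bar> + 1"
  have "(LBINT y. indicator cell y * (A y + D y)) = (LBINT y. indicator ({0..2 * pi} \<times> {- N..N}) y * (A y + D y))"
    by (subst cell_indicator[of N]) (auto simp: N_def supp')
  also have "\<dots> = (LBINT y. indicator ({0..2 * pi} \<times> {- N..N}) y * A y + indicator ({0..2 * pi} \<times> {- N..N}) y * D y)"
    by (simp only: distrib_left)
  also have "\<dots> = (LBINT y. indicator ({0..2 * pi} \<times> {- N..N}) y * A y) + (LBINT y. indicator ({0..2 * pi} \<times> {- N..N}) y * D y)"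
    by (rule Bochner_Integration.integral_add[OF rect_integrable[OF A] rect_integrable[OF D]])
  also have "(LBINT y. indicator ({0..2 * pi} \<times> {- N..N}) y * A y) = 0"
  proof -
    have "F (2 * pi, t) = F (0, t)" for t using per[of "(0, t)"] by simp
    then show ?thesis by (subst rect_integral_d1[OF F A]) auto
  qed
  also have "(LBINT y. indicator ({0..2 * pi} \<times> {- N..N}) y * D y) = 0"
  proof -
    have "G (s, N) = 0" "G (s, - N) = 0" for s by (auto intro!: supp(2) simp: N_def)
    then show ?thesis by (subst rect_integral_d2[OF G D]) (auto simp: N_def)
  qed
  finally show ?thesis by simp
qed

text \<open>The partial derivatives are parameters of the locale, so that a translate of a test
  function is again an instance, with translated parameters; this serves to move a point source to
  the origin.\<close>

locale test_function =
  fixes \<psi> \<psi>1 \<psi>2 \<psi>11 \<psi>12 \<psi>21 \<psi>22 :: "plane \<Rightarrow> real" and M :: real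
  assumes d0: "\<And>y. partials \<psi> (\<psi>1 y) (\<psi>2 y) y" and d1: "\<And>y. partials \<psi>1 (\<psi>11 y) (\<psi>12 y) y" and d2: "\<And>y. partials \<psi>2 (\<psi>21 y) (\<psi>22 y) y"
    and cont2: "continuous_on UNIV \<psi>11" "continuous_on UNIV \<psi>12" "continuous_on UNIV \<psi>21" "continuous_on UNIV \<psi>22"
    and per0: "\<And>y. \<psi> (y + (2 * pi, 0)) = \<psi> y" and per1: "\<And>y. \<psi>1 (y + (2 * pi, 0)) = \<psi>1 y" "\<And>y. \<psi>2 (y + (2 * pi, 0)) = \<psi>2 y"
    and per2: "\<And>y. \<psi>11 (y + (2 * pi, 0)) = \<psi>11 y" "\<And>y. \<psi>22 (y + (2 * pi, 0)) = \<psi>22 y"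
    and supp0: "\<And>y. \<bar>snd y\<bar> > M \<Longrightarrow> \<psi> y = 0" and supp1: "\<And>y. \<bar>snd y\<bar> > M \<Longrightarrow> \<psi>1 y = 0" "\<And>y. \<bar>snd y\<bar> > M \<Longrightarrow> \<psi>2 y = 0"
    and supp2: "\<And>y. \<bar>snd y\<bar> > M \<Longrightarrow> \<psi>11 y = 0" "\<And>y. \<bar>snd y\<bar> > M \<Longrightarrow> \<psi>22 y = 0" "\<And>y. \<bar>snd y\<bar> > M \<Longrightarrow> \<psi>12 y = 0" "\<And>y. \<bar>snd y\<bar> > M \<Longrightarrow> \<psi>21 y = 0"
begin

lemma cont0: "continuous_on UNIV \<psi>" and cont1: "continuous_on UNIV \<psi>1" "continuous_on UNIV \<psi>2"
  by (rule partials_continuous[OF d0] partials_continuous[OF d1] partials_continuous[OF d2])+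

lemma mixed: "\<psi>12 y = \<psi>21 y"
  by (rule partials_symmetric[OF d0 d1 d2 cont2(2,3)])

lemma shift: "test_function (\<lambda>x. \<psi> (x + c)) (\<lambda>x. \<psi>1 (x + c)) (\<lambda>x. \<psi>2 (x + c)) (\<lambda>x. \<psi>11 (x + c)) (\<lambda>x. \<psi>12 (x + c))
   (\<lambda>x. \<psi>21 (x + c)) (\<lambda>x. \<psi>22 (x + c)) (\<bar>M\<bar> + \<bar>snd c\<bar>)"
proof -
  have p: "partials (\<lambda>x. f (x + c)) (a (y + c)) (b (y + c)) y" if "\<And>y. partials f (a y) (b y) y" for f a b y
  proof -
    have "((\<lambda>x. x + c) has_derivative (\<lambda>h. h)) (at y)" by (auto intro!: derivative_eq_intros)
    from has_derivative_compose[OF this that[of "y + c", unfolded partials_def]] show ?thesis unfolding partials_def .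
  qed
  have k: "continuous_on UNIV (\<lambda>x. f (x + c))" if "continuous_on UNIV f" for f :: "plane \<Rightarrow> real"
    by (intro continuous_on_compose2[OF that] continuous_intros) auto
  have q: "f (y + (2 * pi, 0) + c) = f (y + c)" if "\<And>y. f (y + (2 * pi, 0)) = f y" for f :: "plane \<Rightarrow> real" and y
    using that[of "y + c"] by (simp add: add_ac)
  have s: "f (y + c) = 0" if "\<And>y. \<bar>snd y\<bar> > M \<Longrightarrow> f y = 0" "\<bar>snd y\<bar> > \<bar>M\<bar> + \<bar>snd c\<bar>" for f :: "plane \<Rightarrow> real" and y
    by (rule that(1)) (use that(2) in auto)
  show ?thesis
    by unfold_locales (rule p d0 d1 d2 k cont2 q per0 per1 per2 | erule s[rotated], rule supp0 supp1 supp2, assumption)+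
qed

end

lemma frechet_derivative_vanishes:
  fixes \<phi> :: "'a::euclidean_space \<Rightarrow> real"
  assumes "open U" "p \<in> U" "\<And>q. q \<in> U \<Longrightarrow> \<phi> q = 0"
  shows "frechet_derivative \<phi> (at p) v = 0"
proof -
  have "((\<lambda>q. 0) has_derivative (\<lambda>h. 0)) (at p)" by (rule has_derivative_const)
  then have "(\<phi> has_derivative (\<lambda>h. 0)) (at p)" by (rule has_derivative_transform_within_open[OF _ assms(1,2)]) (simp add: assms(3))
  from frechet_derivative_at[OF this] show ?thesis by metis
qed

lemma frechet_derivative_periodic:
  fixes \<phi> :: "'a::euclidean_space \<Rightarrow> real"
  assumes "\<phi> differentiable (at (p + c))" "\<And>q. \<phi> (q + c) = \<phi> q"
  shows "frechet_derivative \<phi> (at (p + c)) = frechet_derivative \<phi> (at p)"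
proof -
  have "((\<lambda>q. q + c) has_derivative (\<lambda>h. h)) (at p)" by (auto intro!: derivative_eq_intros)
  from has_derivative_compose[OF this assms(1)[unfolded frechet_derivative_works]]
  have "(\<phi> has_derivative frechet_derivative \<phi> (at (p + c))) (at p)" by (simp add: assms(2))
  then show ?thesis by (rule frechet_derivative_at)
qed

abbreviation "fd v f \<equiv> (\<lambda>x. frechet_derivative f (at x) v)"

lemma test_function_of_space_test:
  assumes "space_test \<phi>"
  obtains M where "test_function \<phi> (fd (1, 0) \<phi>) (fd (0, 1) \<phi>)
    (fd (1, 0) (fd (1, 0) \<phi>)) (fd (0, 1) (fd (1, 0) \<phi>))
    (fd (1, 0) (fd (0, 1) \<phi>)) (fd (0, 1) (fd (0, 1) \<phi>)) M"
    "\<And>x. laplacian \<phi> x = fd (1, 0) (fd (1, 0) \<phi>) x + fd (0, 1) (fd (0, 1) \<phi>) x"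
proof -
  obtain M where M: "\<And>x. \<phi> x \<noteq> 0 \<Longrightarrow> \<bar>snd x\<bar> \<le> M" and per: "\<And>x. \<phi> (x + (2 * pi, 0)) = \<phi> x" and sm: "smooth \<phi>"
    using assms unfolding space_test_def periodic_x1_def by blast
  have D: "partials f (frechet_derivative f (at y) (1, 0)) (frechet_derivative f (at y) (0, 1)) y" if "f differentiable (at y)" for f y
  proof -
    have 1: "(f has_derivative frechet_derivative f (at y)) (at y)" using that frechet_derivative_works by blast
    interpret linear "frechet_derivative f (at y)" by (rule has_derivative_linear[OF 1])
    have "frechet_derivative f (at y) h = frechet_derivative f (at y) (1, 0) * fst h + frechet_derivative f (at y) (0, 1) * snd h" for h
    proof -
      have h: "h = fst h *\<^sub>R (1, 0) + snd h *\<^sub>R (0, 1)" by (cases h) simp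
      have "frechet_derivative f (at y) h = frechet_derivative f (at y) (fst h *\<^sub>R (1, 0) + snd h *\<^sub>R (0, 1))" using h by (simp only: )
      then show ?thesis by (simp only: add scaleR) simp
    qed
    then have "frechet_derivative f (at y) = (\<lambda>h. frechet_derivative f (at y) (1, 0) * fst h + frechet_derivative f (at y) (0, 1) * snd h)" by (rule ext)
    then show ?thesis using 1 unfolding partials_def by simp
  qed
  have c2: "C_k (Suc (Suc 0)) \<phi>" using sm by (simp only: smooth_def)
  have df: "\<phi> differentiable (at y)" "(\<lambda>x. frechet_derivative \<phi> (at x) v) differentiable (at y)" 
    "continuous_on UNIV (\<lambda>x. frechet_derivative (\<lambda>x. frechet_derivative \<phi> (at x) v) (at x) w)" for y v w
    using c2 unfolding C_k.simps by blast+
  have o: "open {x :: plane. \<bar>snd x\<bar> > M}" by (intro open_Collect_less continuous_intros)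
  have suppD: "fd v f y = 0" if "\<And>x. \<bar>snd x\<bar> > M \<Longrightarrow> f x = 0" "\<bar>snd y\<bar> > M" for f :: "plane \<Rightarrow> real" and y v
    by (rule frechet_derivative_vanishes[OF o]) (use that in auto)
  have s0: "\<phi> x = 0" if "\<bar>snd x\<bar> > M" for x using M[of x] that by linarith
  note s1 = suppD[OF s0]
  note s2 = suppD[OF s1]
  have p1: "fd v \<phi> (y + (2 * pi, 0)) = fd v \<phi> y" for v y by (simp only: frechet_derivative_periodic[OF df(1) per])
  have p2: "fd w (fd v \<phi>) (y + (2 * pi, 0)) = fd w (fd v \<phi>) y" for v w y by (simp only: frechet_derivative_periodic[OF df(2) p1])
  show thesis
  proof (rule that)
    show "test_function \<phi> (fd (1, 0) \<phi>) (fd (0, 1) \<phi>)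
    (fd (1, 0) (fd (1, 0) \<phi>)) (fd (0, 1) (fd (1, 0) \<phi>))
    (fd (1, 0) (fd (0, 1) \<phi>)) (fd (0, 1) (fd (0, 1) \<phi>)) M"
      by unfold_locales (rule D df per p1 p2 s0 s1 s2 | assumption)+
    show "laplacian \<phi> x = fd (1, 0) (fd (1, 0) \<phi>) x + fd (0, 1) (fd (0, 1) \<phi>) x" for x
    proof -
      have B: "(Basis :: plane set) = {(1, 0), (0, 1)}" by (auto simp: Basis_prod_def)
      show ?thesis unfolding laplacian_def B by simp
    qed
  qed
qed

abbreviation strip :: "real \<Rightarrow> plane set" where "strip N \<equiv> {0..2 * pi} \<times> {- N..N}"

lemma velocity_eq: "velocity \<rho> = transport_velocity \<rho> (\<lambda>y. y)"
  unfolding velocity_def transport_velocity_def set_lebesgue_integral_def stokeslet_eq by (simp add: fun_eq_iff)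

section \<open>The continuity equation\<close>

lemma compact_integrable:
  fixes f s :: "'a::euclidean_space \<Rightarrow> real"
  assumes K: "compact K" "continuous_on K f" and s: "s \<in> borel_measurable borel" "\<And>x. \<bar>s x\<bar> \<le> R"
  shows "integrable lborel (\<lambda>x. indicator K x * (s x * f x))"
proof (rule Bochner_Integration.integrable_bound)
  have i: "integrable lborel (\<lambda>x. indicator K x * f x)" using borel_integrable_compact[OF K] by simp
  then show "integrable lborel (\<lambda>x. R * (indicator K x * f x))" by simp
  show "(\<lambda>x. indicator K x * (s x * f x)) \<in> borel_measurable lborel"
  proof -
    have "(\<lambda>x. s x * (indicator K x * f x)) \<in> borel_measurable lborel"
      by (rule borel_measurable_times[OF _ borel_measurable_integrable[OF i]]) (use s(1) in simp)
    then show ?thesis by (simp add: mult.left_commute)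
  qed
  have "0 \<le> R" using s(2) abs_ge_zero by (rule order_trans[rotated])
  then show "AE x in lborel. norm (indicator K x * (s x * f x)) \<le> norm (R * (indicator K x * f x))"
    using s(2) by (intro AE_I2) (auto simp: indicator_def abs_mult intro!: mult_right_mono)
qed

text \<open>The map \<open>X t\<close> is substituted for the variable of integration in the
  convolution with the transported density; along trajectories that density is the initial
  one.\<close>

lemma (in flow) velocity_transported:
  assumes t: "t \<in> {0..T}" and r: "\<And>x. r x = \<rho> (Y t x)" and per: "\<And>x. r (x + (2 * pi, 0)) = r x"
  shows "velocity r = field t" "bounded_density r R"
proof -
  have rm: "r \<in> borel_measurable borel"
    unfolding r[abs_def] by (rule measurable_compose[OF borel_measurable_continuous_onI[OF Y_continuous[OF t]] \<rho>_measurable])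
  show B: "bounded_density r R" by standard (use rm \<rho>_bound r in auto)
  interpret r: bounded_density r R by (rule B)
  show "velocity r = field t"
  proof
    fix x
    have km: "(\<lambda>y. kern (x - y)) \<in> borel_measurable borel"
      by (rule measurable_compose[OF borel_measurable_continuous_onI kern_measurable]) (intro continuous_intros)
    have kp: "kern (x - (y + (2 * pi, 0))) = kern (x - y)" for y using kern_shift[of "x - (y + (2 * pi, 0))"] by simp
    have "(LBINT y. indicator cell y *\<^sub>R (r (X t y) *\<^sub>R kern (x - X t y))) = (LBINT y. indicator cell y *\<^sub>R (r y *\<^sub>R kern (x - y)))"
    proof (rule integral_cell_fold[OF mp'[OF t]])
      show "(\<lambda>y. r y *\<^sub>R kern (x - y)) \<in> borel_measurable borel" by (intro borel_measurable_scaleR rm km)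
      show "r (y + (2 * pi, 0)) *\<^sub>R kern (x - (y + (2 * pi, 0))) = r y *\<^sub>R kern (x - y)" for y by (simp only: per kp)
      show "integrable lborel (\<lambda>y. indicator cell y *\<^sub>R r y *\<^sub>R kern (x - y))" by (rule r.transport_velocity_integrable[OF measure_preserving_map_id])
    qed
    then show "velocity r x = field t x" unfolding velocity_eq transport_velocity_def r Y_X[OF t] by simp
  qed
qed

lemma (in flow) continuity_equation_transported:
  assumes r: "\<And>t x. t \<in> {0..T} \<Longrightarrow> r t x = \<rho> (Y t x)" and per: "\<And>t x. t \<in> {0..T} \<Longrightarrow> r t (x + (2 * pi, 0)) = r t x"
  shows "continuity_equation T r (\<lambda>t. velocity (r t))"
  unfolding continuity_equation_def
proof (intro allI impI)
  fix \<phi> assume \<phi>: "spacetime_test T \<phi>"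
  note vel = velocity_transported(1)[OF _ r per]
  from \<phi> have sm: "C_k (Suc 0) \<phi>" unfolding spacetime_test_def smooth_def by blast
  have diff: "\<phi> differentiable (at p)" for p using sm by (simp only: C_k.simps)
  have dc: "continuous_on UNIV (\<lambda>p. frechet_derivative \<phi> (at p) v)" for v using sm by (simp only: C_k.simps)
  have p\<phi>: "\<phi> (q + (0, 2 * pi, 0)) = \<phi> q" for q
    using \<phi> unfolding spacetime_test_def periodic_x1_def by (cases q) auto
  obtain a b M where ab: "0 < a" "b < T" and sp: "\<forall>t x. \<phi> (t, x) \<noteq> 0 \<longrightarrow> a \<le> t \<and> t \<le> b \<and> \<bar>snd x\<bar> \<le> M"
    using \<phi> unfolding spacetime_test_def by blast
  have supp: "a \<le> t \<and> t \<le> b \<and> \<bar>snd x\<bar> \<le> M" if "\<phi> (t, x) \<noteq> 0" for t x using sp that by blast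
  \<comment> \<open>\<open>G\<close> is the material derivative of \<open>\<phi>\<close>: along a
    trajectory it is the time derivative of \<open>\<phi> (t, X t y)\<close>.\<close>
  define G where "G p = frechet_derivative \<phi> (at p) (1, 0, 0) + frechet_derivative \<phi> (at p) (0, 1, 0) * fst (field (fst p) (snd p))
    + frechet_derivative \<phi> (at p) (0, 0, 1) * snd (field (fst p) (snd p))" for p
  have lin: "frechet_derivative \<phi> (at p) (1, v) = frechet_derivative \<phi> (at p) (1, 0, 0) + frechet_derivative \<phi> (at p) (0, 1, 0) * fst v
    + frechet_derivative \<phi> (at p) (0, 0, 1) * snd v" for p v
  proof -
    have L: "linear (frechet_derivative \<phi> (at p))" by (rule linear_frechet_derivative[OF diff])
    have e: "(1, v) = (1, 0, 0) + fst v *\<^sub>R (0, 1, 0) + snd v *\<^sub>R (0, 0, 1 :: real)" by (simp add: prod_eq_iff)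
    show ?thesis unfolding e linear_add[OF L] linear_scale[OF L] by (simp add: mult.commute)
  qed
  have G: "frechet_derivative \<phi> (at (t, x)) (1, field t x) = G (t, x)" for t x
    unfolding G_def fst_conv snd_conv by (rule lin)
  have Gc: "continuous_on ({0..T} \<times> UNIV) G"
    unfolding G_def by (intro continuous_intros fieldC continuous_on_subset[OF dc] subset_UNIV)
  have Gs: "G (t, x) = 0" if "\<bar>snd x\<bar> > M" for t x
  proof -
    have "open {p :: real \<times> plane. \<bar>snd (snd p)\<bar> > M}" by (intro open_Collect_less continuous_intros)
    then have "frechet_derivative \<phi> (at (t, x)) v = 0" for v
      by (rule frechet_derivative_vanishes) (use that supp in force)+
    then show ?thesis by (simp add: G_def)
  qed
  have Gp: "G (t, x + (2 * pi, 0)) = G (t, x)" if "t \<in> {0..T}" for t x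
    using frechet_derivative_periodic[OF diff p\<phi>, of "(t, x)"] transport_velocity_shift[OF mp'[OF that], of x]
    by (simp add: G_def)
  define S where "S = {0..T} \<times> (UNIV :: plane set)"
  have Sm: "S \<in> sets borel" unfolding S_def by (intro borel_closed closed_Times) auto
  \<comment> \<open>A version of \<open>r\<close> on all of space-time, whose joint measurability
    follows from the joint continuity of \<open>Y\<close>; outside the time interval the label is
    the default 0.\<close>
  define s where "s p = \<rho> (indicator S p *\<^sub>R Y (fst p) (snd p))" for p
  have sm: "s \<in> borel_measurable borel" unfolding s_def
    by (rule measurable_compose[OF borel_measurable_continuous_on_indicator[OF Sm YC[folded S_def]] \<rho>_measurable])
  have sr: "s (t, x) = r t x" if "t \<in> {0..T}" for t x using that r by (simp add: s_def S_def)
  \<comment> \<open>Particles whose path meets the support of \<open>\<phi>\<close> start within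
    \<open>C_vel * T\<close> of it in height.\<close>
  define M' where "M' = M + C_vel * T"
  define F1 where "F1 t x = indicator ({0..T} \<times> strip M) (t, x) * (s (t, x) * G (t, x))" for t x
  define F2 where "F2 t y = indicator ({0..T} \<times> strip M') (t, y) * (\<rho> y * G (t, X t y))" for t y
  have GXs: "G (t, X t y) = 0" if "t \<in> {0..T}" "\<bar>snd y\<bar> > M'" for t y
  proof (rule Gs)
    have "\<bar>snd (X t y - y)\<bar> \<le> C_vel * T" using displacement[OF that(1), of y] abs_snd_le_norm[of "X t y - y"] by linarith
    then show "\<bar>snd (X t y)\<bar> > M" using that(2) unfolding M'_def by simp
  qed
  have GXc: "continuous_on ({0..T} \<times> UNIV) (\<lambda>p. G (fst p, X (fst p) (snd p)))"
    by (rule continuous_on_compose2[OF Gc]) (auto intro!: continuous_intros XC)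
  have cp: "compact ({0..T} \<times> strip N)" for N by (intro compact_Times compact_Icc)
  have i1: "integrable (lborel \<Otimes>\<^sub>M lborel) (\<lambda>(t, x). F1 t x)"
  proof -
    have "integrable lborel (\<lambda>p. indicator ({0..T} \<times> strip M) p * (s p * G p))"
      by (rule compact_integrable[OF cp continuous_on_subset[OF Gc] sm, of M R]) (use \<rho>_bound in \<open>auto simp: s_def\<close>)
    then show ?thesis by (simp add: F1_def lborel_prod case_prod_beta')
  qed
  have i2: "integrable (lborel \<Otimes>\<^sub>M lborel) (\<lambda>(t, y). F2 t y)"
  proof -
    have m: "(\<lambda>p. \<rho> (snd p)) \<in> borel_measurable (borel :: (real \<times> plane) measure)"
      by (rule measurable_compose[OF borel_measurable_continuous_onI \<rho>_measurable]) (intro continuous_intros)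
    have "integrable lborel (\<lambda>p. indicator ({0..T} \<times> strip M') p * (\<rho> (snd p) * G (fst p, X (fst p) (snd p))))"
      by (rule compact_integrable[OF cp continuous_on_subset[OF GXc] m, of M' R]) (use \<rho>_bound in auto)
    then show ?thesis by (simp add: F2_def lborel_prod case_prod_beta')
  qed
  have cut: "indicator cell x * h x = indicator (strip N) x * h x" if "\<And>x. \<bar>snd x\<bar> > N \<Longrightarrow> h x = 0" for N x and h :: "plane \<Rightarrow> real"
    by (rule cell_indicator) (rule that)
  have inner: "(LBINT x. F1 t x) = (LBINT y. F2 t y)" for t
  proof (cases "t \<in> {0..T}")
    case True
    have c: "continuous_on UNIV (\<lambda>x. G (t, x))" by (rule continuous_on_compose2[OF Gc]) (auto intro!: continuous_intros simp: True[simplified])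
    have rm: "r t \<in> borel_measurable borel" using velocity_transported(2)[OF True r[OF True] per[OF True]] by (simp add: bounded_density_def)
    have "(LBINT x. F1 t x) = (LBINT x. indicator cell x *\<^sub>R (r t x * G (t, x)))"
    proof (rule Bochner_Integration.integral_cong[OF refl])
      fix x
      have "F1 t x = indicator (strip M) x * (r t x * G (t, x))" using True by (simp add: F1_def sr[OF True] indicator_def mem_Times_iff)
      also have "\<dots> = indicator cell x * (r t x * G (t, x))" by (rule cut[symmetric]) (simp add: Gs)
      finally show "F1 t x = indicator cell x *\<^sub>R (r t x * G (t, x))" by simp
    qed
    also have "\<dots> = (LBINT y. indicator cell y *\<^sub>R (r t (X t y) * G (t, X t y)))"
    proof (rule integral_cell_fold_real[OF mp'[OF True], symmetric])
      show "(\<lambda>x. r t x * G (t, x)) \<in> borel_measurable borel" by (intro borel_measurable_times rm borel_measurable_continuous_onI c)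
      show "r t (x + (2 * pi, 0)) * G (t, x + (2 * pi, 0)) = r t x * G (t, x)" for x by (simp only: Gp[OF True] per[OF True])
      have "integrable lborel (\<lambda>x. indicator (strip M) x * (r t x * G (t, x)))"
        by (rule compact_integrable[OF _ continuous_on_subset[OF c] rm, of _ R]) (auto intro!: compact_Times compact_Icc \<rho>_bound simp: r[OF True])
      moreover have "indicator cell x *\<^sub>R (r t x * G (t, x)) = indicator (strip M) x * (r t x * G (t, x))" for x
        unfolding real_scaleR_def by (rule cut) (simp add: Gs)
      ultimately show "integrable lborel (\<lambda>x. indicator cell x *\<^sub>R (r t x * G (t, x)))" by presburger
    qed
    also have "\<dots> = (LBINT y. F2 t y)"
    proof (rule Bochner_Integration.integral_cong[OF refl])
      fix y
      have "F2 t y = indicator (strip M') y * (\<rho> y * G (t, X t y))" using True by (simp add: F2_def indicator_def mem_Times_iff)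
      also have "\<dots> = indicator cell y * (\<rho> y * G (t, X t y))" by (rule cut[symmetric]) (simp add: GXs[OF True])
      finally show "indicator cell y *\<^sub>R (r t (X t y) * G (t, X t y)) = F2 t y" by (simp add: r[OF True] Y_X[OF True])
    qed
    finally show ?thesis .
  next
    case False
    then have "F1 t = (\<lambda>x. 0)" "F2 t = (\<lambda>y. 0)" by (auto simp: F1_def F2_def fun_eq_iff indicator_def)
    then show ?thesis by simp
  qed
  \<comment> \<open>For each label the integral is an increment of \<open>\<phi>\<close> along the
    trajectory. It is 0 because the support in time is contained in \<open>[a, b]\<close> with
    \<open>0 < a\<close> and \<open>b < T\<close>, so \<open>\<phi>\<close> vanishes at both end
    times.\<close>
  have zero: "(LBINT t. F2 t y) = 0" for y
  proof -
    define f where "f t = \<phi> (t, X t y)" for t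
    have fd: "(f has_vector_derivative G (t, X t y)) (at t within {0..T})" if t: "t \<in> {0..T}" for t
    proof -
      have "((\<lambda>s. (s, X s y)) has_vector_derivative (1, field t (X t y))) (at t within {0..T})"
        by (intro has_vector_derivative_Pair der[OF t] has_vector_derivative_id)
      from has_derivative_compose[OF this[unfolded has_vector_derivative_def] diff[of "(t, X t y)", unfolded frechet_derivative_works]]
      have "(f has_derivative (\<lambda>h. frechet_derivative \<phi> (at (t, X t y)) (h *\<^sub>R (1, field t (X t y))))) (at t within {0..T})" unfolding f_def .
      then show ?thesis unfolding has_vector_derivative_def linear_scale[OF linear_frechet_derivative[OF diff]] G .
    qed
    have fc: "continuous_on {0..T} (\<lambda>t. G (t, X t y))"
      by (rule continuous_on_compose2[OF GXc, of _ "\<lambda>t. (t, y)", simplified]) (auto intro!: continuous_intros)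
    have ends: "f 0 = 0" "f T = 0" using supp[of 0 "X 0 y"] supp[of T "X T y"] ab unfolding f_def by linarith+
    have "(LBINT t. indicator {0..T} t *\<^sub>R G (t, X t y)) = f T - f 0"
      by (rule integral_FTC_atLeastAtMost[OF less_imp_le[OF T] fd fc]) auto
    then have z: "(LBINT t. indicator {0..T} t * G (t, X t y)) = 0" using ends by simp
    have "(LBINT t. F2 t y) = (LBINT t. (indicator (strip M') y * \<rho> y) * (indicator {0..T} t * G (t, X t y)))"
      unfolding F2_def indicator_times by (simp add: mult_ac)
    also have "\<dots> = 0" unfolding integral_mult_right_zero z by simp
    finally show ?thesis .
  qed
  have "(\<integral>p. (\<lambda>(t, x). F1 t x) p \<partial>(lborel \<Otimes>\<^sub>M lborel)) = (LBINT t. LBINT x. F1 t x)"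
    by (rule lborel_pair.integral_fst[OF i1, symmetric])
  also have "\<dots> = (LBINT t. LBINT y. F2 t y)" by (simp only: inner)
  also have "\<dots> = (LBINT y. LBINT t. F2 t y)" by (rule lborel_pair.Fubini_integral[OF i2, symmetric])
  also have "\<dots> = 0" by (simp add: zero)
  finally have "has_bochner_integral lborel (\<lambda>(t, x). F1 t x) 0" using i1 by (simp add: has_bochner_integral_iff lborel_prod)
  moreover have "F1 t x = indicator ({0..T} \<times> cell) (t, x) * (r t x * frechet_derivative \<phi> (at (t, x)) (1, velocity (r t) x))" for t x
  proof (cases "t \<in> {0..T}")
    case True
    have "F1 t x = indicator (strip M) x * (r t x * G (t, x))" using True by (simp add: F1_def sr[OF True] indicator_def mem_Times_iff)
    also have "\<dots> = indicator cell x * (r t x * G (t, x))" by (rule cut[symmetric]) (simp add: Gs)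
    finally show ?thesis using True by (simp add: vel[OF True] G indicator_def)
  next
    case False
    then show ?thesis by (auto simp: F1_def indicator_def)
  qed
  ultimately show "has_bochner_integral lborel (\<lambda>(t, x). indicator ({0..T} \<times> cell) (t, x) *
      (r t x * frechet_derivative \<phi> (at (t, x)) (1, velocity (r t) x))) 0" by simp
qed

section \<open>The Stokes equations\<close>

text \<open>The Green function of the cylinder is \<open>(1 / 4 \<pi>) ln (2 gap)\<close>; adding \<open>\<epsilon>\<close> to the gap makes it
  smooth, and the Laplacian of the regularised function is the approximate identity \<open>rlap\<close>.\<close>

definition rgap :: "real \<Rightarrow> plane \<Rightarrow> real" where "rgap \<epsilon> y = gap y + \<epsilon>"
definition rlog :: "real \<Rightarrow> plane \<Rightarrow> real" where "rlog \<epsilon> y = ln (2 * rgap \<epsilon> y)"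
definition rlog1 :: "real \<Rightarrow> plane \<Rightarrow> real" where "rlog1 \<epsilon> y = sin (fst y) / rgap \<epsilon> y"
definition rlog2 :: "real \<Rightarrow> plane \<Rightarrow> real" where "rlog2 \<epsilon> y = sinh (snd y) / rgap \<epsilon> y"
definition rlog11 :: "real \<Rightarrow> plane \<Rightarrow> real" where
  "rlog11 \<epsilon> y = cos (fst y) / rgap \<epsilon> y - (sin (fst y))\<^sup>2 / (rgap \<epsilon> y)\<^sup>2"
definition rlog12 :: "real \<Rightarrow> plane \<Rightarrow> real" where
  "rlog12 \<epsilon> y = - (sin (fst y) * sinh (snd y) / (rgap \<epsilon> y)\<^sup>2)"
definition rlog22 :: "real \<Rightarrow> plane \<Rightarrow> real" where
  "rlog22 \<epsilon> y = cosh (snd y) / rgap \<epsilon> y - (sinh (snd y))\<^sup>2 / (rgap \<epsilon> y)\<^sup>2"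
definition rlap :: "real \<Rightarrow> plane \<Rightarrow> real" where
  "rlap \<epsilon> y = \<epsilon> * (cosh (snd y) + cos (fst y)) / (rgap \<epsilon> y)\<^sup>2"

lemma rgap_pos: "0 < \<epsilon> \<Longrightarrow> 0 < rgap \<epsilon> y"
  using gap_nonneg[of y] by (simp add: rgap_def)

lemma partials_sin: "partials (\<lambda>y. sin (fst y)) (cos (fst y)) 0 y"
  and partials_cos: "partials (\<lambda>y. cos (fst y)) (- sin (fst y)) 0 y"
  and partials_sinh: "partials (\<lambda>y. sinh (snd y)) 0 (cosh (snd y)) y"
  and partials_cosh: "partials (\<lambda>y. cosh (snd y)) 0 (sinh (snd y)) y"
proof -
  have h: "(sinh has_real_derivative cosh (snd y)) (at (snd y))" "(cosh has_real_derivative sinh (snd y)) (at (snd y))"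
    by (auto intro!: derivative_eq_intros)
  show "partials (\<lambda>y. sin (fst y)) (cos (fst y)) 0 y" "partials (\<lambda>y. cos (fst y)) (- sin (fst y)) 0 y"
    "partials (\<lambda>y. sinh (snd y)) 0 (cosh (snd y)) y" "partials (\<lambda>y. cosh (snd y)) 0 (sinh (snd y)) y"
    using partials_compose[OF DERIV_sin partials_fst, of y] partials_compose[OF DERIV_cos partials_fst, of y]
      partials_compose[OF h(1) partials_snd] partials_compose[OF h(2) partials_snd] by simp_all
qed

lemma partials_rgap: "partials (rgap \<epsilon>) (sin (fst y)) (sinh (snd y)) y"
proof -
  have "partials (\<lambda>y. (cosh (snd y) - cos (fst y)) + \<epsilon>) (0 - (- sin (fst y)) + 0) (sinh (snd y) - 0 + 0) y"
    by (intro partials_add partials_diff partials_cosh partials_cos partials_const)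
  then show ?thesis by (simp add: rgap_def[abs_def] gap_def)
qed

lemma partials_divide:
  assumes f: "partials f a b y" and g: "partials g c d y" and g0: "g y \<noteq> 0"
  shows "partials (\<lambda>y. f y / g y) (a / g y - f y * c / (g y)\<^sup>2) (b / g y - f y * d / (g y)\<^sup>2) y"
proof -
  have "((\<lambda>x. inverse x) has_real_derivative - (inverse (g y) * inverse (g y))) (at (g y))"
    using DERIV_inverse[OF g0, of UNIV] by (simp add: power2_eq_square)
  from partials_mult[OF f partials_compose[OF this g]]
  show ?thesis by (simp add: divide_inverse power2_eq_square mult_ac)
qed

context
  fixes \<epsilon> :: real assumes \<epsilon>: "0 < \<epsilon>"
begin

lemma rgap_nz: "rgap \<epsilon> y \<noteq> 0"
  using rgap_pos[OF \<epsilon>, of y] by simp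

lemma partials_rlog: "partials (rlog \<epsilon>) (rlog1 \<epsilon> y) (rlog2 \<epsilon> y) y"
proof -
  have "((\<lambda>x. ln (2 * x)) has_real_derivative inverse (rgap \<epsilon> y)) (at (rgap \<epsilon> y))"
    using rgap_pos[OF \<epsilon>, of y] by (auto intro!: derivative_eq_intros simp: field_simps)
  from partials_compose[OF this partials_rgap] show ?thesis
    unfolding rlog_def[abs_def] rlog1_def rlog2_def by (simp add: divide_inverse mult.commute)
qed

lemma partials_rlog1: "partials (rlog1 \<epsilon>) (rlog11 \<epsilon> y) (rlog12 \<epsilon> y) y"
  using partials_divide[OF partials_sin partials_rgap rgap_nz, of y]
  unfolding rlog1_def[abs_def] rlog11_def rlog12_def by (simp add: power2_eq_square)

lemma partials_rlog2: "partials (rlog2 \<epsilon>) (rlog12 \<epsilon> y) (rlog22 \<epsilon> y) y"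
  using partials_divide[OF partials_sinh partials_rgap rgap_nz, of y]
  unfolding rlog2_def[abs_def] rlog12_def rlog22_def by (simp add: power2_eq_square mult.commute)

text \<open>\<open>sin^2 + sinh^2\<close> is \<open>(cosh + cos) * (cosh - cos)\<close>, so
  everything cancels except the term produced by \<open>\<epsilon>\<close> in the
  denominator.\<close>

lemma rlog_laplace: "rlog11 \<epsilon> y + rlog22 \<epsilon> y = rlap \<epsilon> y"
proof -
  define r where "r = rgap \<epsilon> y"
  have r0: "r \<noteq> 0" using rgap_nz by (simp add: r_def)
  have r: "r = cosh (snd y) - cos (fst y) + \<epsilon>" by (simp add: r_def rgap_def gap_def)
  have a: "(sin (fst y))\<^sup>2 = 1 - (cos (fst y))\<^sup>2" and b: "(sinh (snd y))\<^sup>2 = (cosh (snd y))\<^sup>2 - 1"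
    by (simp_all add: sin_squared_eq sinh_square_eq)
  have "rlog11 \<epsilon> y + rlog22 \<epsilon> y = ((cos (fst y) + cosh (snd y)) * r - ((sin (fst y))\<^sup>2 + (sinh (snd y))\<^sup>2)) / r\<^sup>2"
    using r0 unfolding rlog11_def rlog22_def r_def[symmetric] by (simp add: field_simps power2_eq_square)
  also have "(cos (fst y) + cosh (snd y)) * r - ((sin (fst y))\<^sup>2 + (sinh (snd y))\<^sup>2) = \<epsilon> * (cosh (snd y) + cos (fst y))"
    unfolding a b r by algebra
  finally show ?thesis by (simp add: rlap_def r_def)
qed

lemma continuous_regularised:
  "continuous_on UNIV (rlog \<epsilon>)" "continuous_on UNIV (rlog1 \<epsilon>)" "continuous_on UNIV (rlog2 \<epsilon>)"
  "continuous_on UNIV (rlog11 \<epsilon>)" "continuous_on UNIV (rlog12 \<epsilon>)" "continuous_on UNIV (rlog22 \<epsilon>)" "continuous_on UNIV (rlap \<epsilon>)"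
proof -
  show "continuous_on UNIV (rlog \<epsilon>)" "continuous_on UNIV (rlog1 \<epsilon>)" "continuous_on UNIV (rlog2 \<epsilon>)"
    by (rule partials_continuous[OF partials_rlog] partials_continuous[OF partials_rlog1] partials_continuous[OF partials_rlog2])+
  have c: "continuous_on UNIV (rgap \<epsilon>)" by (rule partials_continuous[OF partials_rgap])
  show "continuous_on UNIV (rlog11 \<epsilon>)" "continuous_on UNIV (rlog12 \<epsilon>)" "continuous_on UNIV (rlog22 \<epsilon>)" "continuous_on UNIV (rlap \<epsilon>)"
    unfolding rlog11_def[abs_def] rlog12_def[abs_def] rlog22_def[abs_def] rlap_def[abs_def]
    by (intro continuous_intros c; simp add: rgap_nz)+
qed

lemma regularised_shift:
  "rlog \<epsilon> (y + (2 * pi, 0)) = rlog \<epsilon> y" "rlog1 \<epsilon> (y + (2 * pi, 0)) = rlog1 \<epsilon> y" "rlog2 \<epsilon> (y + (2 * pi, 0)) = rlog2 \<epsilon> y"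
  by (simp_all add: rlog_def rlog1_def rlog2_def rgap_def gap_def)

end

section \<open>Exact divergence identities for the regularised kernel\<close>

context test_function
begin

text \<open>With \<open>l = rlog \<epsilon>\<close>, the regularised velocity and pressure are given
  by \<open>8 pi u = (- y2 l1, l - y2 l2)\<close> and \<open>8 pi p = - 2 l2\<close>. The integrand
  is \<open>8 pi\<close> times \<open>u2 (\<psi>11 + \<psi>22) + p \<psi>2\<close>, corrected by a
  \<open>rlap\<close> term that makes it the divergence of \<open>(F, G)\<close>. This is exact for
  every \<open>\<epsilon>\<close>; once \<open>rlap\<close> concentrates at 0 with mass
  \<open>4 * pi\<close>, the weight \<open>2 * \<psi> y + snd y * \<psi>2 y\<close> leaves
  \<open>8 * pi * \<psi> (0, 0)\<close>.\<close>

lemma regularised_momentum2: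
  assumes \<epsilon>: "0 < \<epsilon>"
  shows "(LBINT y. indicator cell y * ((rlog \<epsilon> y - snd y * rlog2 \<epsilon> y) * (\<psi>11 y + \<psi>22 y) - 2 * rlog2 \<epsilon> y * \<psi>2 y - rlap \<epsilon> y * (2 * \<psi> y + snd y * \<psi>2 y))) = 0"
proof -
  note p = partials_rlog[OF \<epsilon>] partials_rlog1[OF \<epsilon>] partials_rlog2[OF \<epsilon>]
  define F where "F y = (rlog \<epsilon> y * \<psi>1 y - 2 * (\<psi> y * rlog1 \<epsilon> y)) - snd y * (rlog2 \<epsilon> y * \<psi>1 y + rlog1 \<epsilon> y * \<psi>2 y)" for y
  define G where "G y = ((rlog \<epsilon> y * \<psi>2 y - 2 * (\<psi> y * rlog2 \<epsilon> y)) - snd y * (rlog2 \<epsilon> y * \<psi>2 y)) + snd y * (rlog1 \<epsilon> y * \<psi>1 y)" for y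
  define A where "A y = ((rlog1 \<epsilon> y * \<psi>1 y + rlog \<epsilon> y * \<psi>11 y) - (0 * (\<psi> y * rlog1 \<epsilon> y) + 2 * (\<psi>1 y * rlog1 \<epsilon> y + \<psi> y * rlog11 \<epsilon> y)))
     - (0 * (rlog2 \<epsilon> y * \<psi>1 y + rlog1 \<epsilon> y * \<psi>2 y) + snd y * ((rlog12 \<epsilon> y * \<psi>1 y + rlog2 \<epsilon> y * \<psi>11 y) + (rlog11 \<epsilon> y * \<psi>2 y + rlog1 \<epsilon> y * \<psi>21 y)))" for y
  define D where "D y = (((rlog2 \<epsilon> y * \<psi>2 y + rlog \<epsilon> y * \<psi>22 y) - (0 * (\<psi> y * rlog2 \<epsilon> y) + 2 * (\<psi>2 y * rlog2 \<epsilon> y + \<psi> y * rlog22 \<epsilon> y)))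
     - (1 * (rlog2 \<epsilon> y * \<psi>2 y) + snd y * (rlog22 \<epsilon> y * \<psi>2 y + rlog2 \<epsilon> y * \<psi>22 y))) + (1 * (rlog1 \<epsilon> y * \<psi>1 y) + snd y * (rlog12 \<epsilon> y * \<psi>1 y + rlog1 \<epsilon> y * \<psi>12 y))" for y
  have eq: "(rlog \<epsilon> y - snd y * rlog2 \<epsilon> y) * (\<psi>11 y + \<psi>22 y) - 2 * rlog2 \<epsilon> y * \<psi>2 y - rlap \<epsilon> y * (2 * \<psi> y + snd y * \<psi>2 y) = A y + D y" for y
    unfolding rlog_laplace[OF \<epsilon>, symmetric] A_def D_def mixed by algebra
  have F: "partials F (A y) ((rlog2 \<epsilon> y * \<psi>1 y + rlog \<epsilon> y * \<psi>12 y - (0 * (\<psi> y * rlog1 \<epsilon> y) + 2 * (\<psi>2 y * rlog1 \<epsilon> y + \<psi> y * rlog12 \<epsilon> y)))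
     - (1 * (rlog2 \<epsilon> y * \<psi>1 y + rlog1 \<epsilon> y * \<psi>2 y) + snd y * ((rlog22 \<epsilon> y * \<psi>1 y + rlog2 \<epsilon> y * \<psi>12 y) + (rlog12 \<epsilon> y * \<psi>2 y + rlog1 \<epsilon> y * \<psi>22 y)))) y" for y
    unfolding F_def A_def by (intro partials_diff partials_add partials_mult partials_const partials_snd p d0 d1 d2)
  have G: "partials G ((((rlog1 \<epsilon> y * \<psi>2 y + rlog \<epsilon> y * \<psi>21 y) - (0 * (\<psi> y * rlog2 \<epsilon> y) + 2 * (\<psi>1 y * rlog2 \<epsilon> y + \<psi> y * rlog12 \<epsilon> y)))
     - (0 * (rlog2 \<epsilon> y * \<psi>2 y) + snd y * (rlog12 \<epsilon> y * \<psi>2 y + rlog2 \<epsilon> y * \<psi>21 y))) + (0 * (rlog1 \<epsilon> y * \<psi>1 y) + snd y * (rlog11 \<epsilon> y * \<psi>1 y + rlog1 \<epsilon> y * \<psi>11 y))) (D y) y" for y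
    unfolding G_def D_def by (intro partials_diff partials_add partials_mult partials_const partials_snd p d0 d1 d2)
  show ?thesis unfolding eq
    by (rule cell_divergence[OF F _ G, where M = M])
      (auto simp: F_def G_def A_def D_def supp0 supp1 supp2 per0 per1 regularised_shift[OF \<epsilon>]
        intro!: continuous_intros continuous_regularised[OF \<epsilon>] cont0 cont1 cont2)
qed

text \<open>The terms \<open>rlog1 * \<psi>\<close> in \<open>G\<close> and
  \<open>- rlog2 * \<psi>\<close> in \<open>F\<close> contribute the divergence
  \<open>rlog1 * \<psi>2 - rlog2 * \<psi>1\<close>; this cancels the \<open>rlog1 * \<psi>2\<close>
  left over from the remaining terms and doubles the pressure term. The weight of
  \<open>rlap\<close> vanishes at 0, so the horizontal equation has no source in the limit.\<close>

lemma regularised_momentum1: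
  assumes \<epsilon>: "0 < \<epsilon>"
  shows "(LBINT y. indicator cell y * (- (snd y * rlog1 \<epsilon> y) * (\<psi>11 y + \<psi>22 y) - 2 * rlog2 \<epsilon> y * \<psi>1 y - rlap \<epsilon> y * (snd y * \<psi>1 y))) = 0"
proof -
  note p = partials_rlog[OF \<epsilon>] partials_rlog1[OF \<epsilon>] partials_rlog2[OF \<epsilon>]
  define F where "F y = (snd y * (rlog2 \<epsilon> y * \<psi>2 y) - snd y * (rlog1 \<epsilon> y * \<psi>1 y)) - rlog2 \<epsilon> y * \<psi> y" for y
  define G where "G y = rlog1 \<epsilon> y * \<psi> y - snd y * (rlog1 \<epsilon> y * \<psi>2 y + \<psi>1 y * rlog2 \<epsilon> y)" for y
  define A where "A y = ((0 * (rlog2 \<epsilon> y * \<psi>2 y) + snd y * (rlog12 \<epsilon> y * \<psi>2 y + rlog2 \<epsilon> y * \<psi>21 y)) - (0 * (rlog1 \<epsilon> y * \<psi>1 y) + snd y * (rlog11 \<epsilon> y * \<psi>1 y + rlog1 \<epsilon> y * \<psi>11 y)))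
     - (rlog12 \<epsilon> y * \<psi> y + rlog2 \<epsilon> y * \<psi>1 y)" for y
  define D where "D y = (rlog12 \<epsilon> y * \<psi> y + rlog1 \<epsilon> y * \<psi>2 y) - (1 * (rlog1 \<epsilon> y * \<psi>2 y + \<psi>1 y * rlog2 \<epsilon> y)
     + snd y * ((rlog12 \<epsilon> y * \<psi>2 y + rlog1 \<epsilon> y * \<psi>22 y) + (\<psi>12 y * rlog2 \<epsilon> y + \<psi>1 y * rlog22 \<epsilon> y)))" for y
  have eq: "- (snd y * rlog1 \<epsilon> y) * (\<psi>11 y + \<psi>22 y) - 2 * rlog2 \<epsilon> y * \<psi>1 y - rlap \<epsilon> y * (snd y * \<psi>1 y) = A y + D y" for y
    unfolding rlog_laplace[OF \<epsilon>, symmetric] A_def D_def mixed by algebra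
  have F: "partials F (A y) (((1 * (rlog2 \<epsilon> y * \<psi>2 y) + snd y * (rlog22 \<epsilon> y * \<psi>2 y + rlog2 \<epsilon> y * \<psi>22 y)) - (1 * (rlog1 \<epsilon> y * \<psi>1 y) + snd y * (rlog12 \<epsilon> y * \<psi>1 y + rlog1 \<epsilon> y * \<psi>12 y)))
     - (rlog22 \<epsilon> y * \<psi> y + rlog2 \<epsilon> y * \<psi>2 y)) y" for y
    unfolding F_def A_def by (intro partials_diff partials_add partials_mult partials_const partials_snd p d0 d1 d2)
  have G: "partials G ((rlog11 \<epsilon> y * \<psi> y + rlog1 \<epsilon> y * \<psi>1 y) - (0 * (rlog1 \<epsilon> y * \<psi>2 y + \<psi>1 y * rlog2 \<epsilon> y)
     + snd y * ((rlog11 \<epsilon> y * \<psi>2 y + rlog1 \<epsilon> y * \<psi>21 y) + (\<psi>11 y * rlog2 \<epsilon> y + \<psi>1 y * rlog12 \<epsilon> y)))) (D y) y" for y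
    unfolding G_def D_def by (intro partials_diff partials_add partials_mult partials_const partials_snd p d0 d1 d2)
  show ?thesis unfolding eq
    by (rule cell_divergence[OF F _ G, where M = M])
      (auto simp: F_def G_def A_def D_def supp0 supp1 supp2 per0 per1 regularised_shift[OF \<epsilon>]
        intro!: continuous_intros continuous_regularised[OF \<epsilon>] cont0 cont1 cont2)
qed

text \<open>The regularised velocity has divergence \<open>- snd y * rlap \<epsilon> y\<close> up to
  the factor \<open>8 * pi\<close>; its weight vanishes at 0, where \<open>rlap\<close>
  concentrates.\<close>

lemma regularised_divergence:
  assumes \<epsilon>: "0 < \<epsilon>"
  shows "(LBINT y. indicator cell y * (rlog \<epsilon> y * \<psi>2 y - snd y * (rlog1 \<epsilon> y * \<psi>1 y + rlog2 \<epsilon> y * \<psi>2 y) - rlap \<epsilon> y * (snd y * \<psi> y))) = 0"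
proof -
  note p = partials_rlog[OF \<epsilon>] partials_rlog1[OF \<epsilon>] partials_rlog2[OF \<epsilon>]
  define F where "F y = 0 - snd y * (rlog1 \<epsilon> y * \<psi> y)" for y
  define G where "G y = rlog \<epsilon> y * \<psi> y - snd y * (rlog2 \<epsilon> y * \<psi> y)" for y
  define A where "A y = 0 - (0 * (rlog1 \<epsilon> y * \<psi> y) + snd y * (rlog11 \<epsilon> y * \<psi> y + rlog1 \<epsilon> y * \<psi>1 y))" for y
  define D where "D y = (rlog2 \<epsilon> y * \<psi> y + rlog \<epsilon> y * \<psi>2 y) - (1 * (rlog2 \<epsilon> y * \<psi> y) + snd y * (rlog22 \<epsilon> y * \<psi> y + rlog2 \<epsilon> y * \<psi>2 y))" for y
  have eq: "rlog \<epsilon> y * \<psi>2 y - snd y * (rlog1 \<epsilon> y * \<psi>1 y + rlog2 \<epsilon> y * \<psi>2 y) - rlap \<epsilon> y * (snd y * \<psi> y) = A y + D y" for y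
    unfolding rlog_laplace[OF \<epsilon>, symmetric] A_def D_def by algebra
  have F: "partials F (A y) (0 - (1 * (rlog1 \<epsilon> y * \<psi> y) + snd y * (rlog12 \<epsilon> y * \<psi> y + rlog1 \<epsilon> y * \<psi>2 y))) y" for y
    unfolding F_def A_def by (intro partials_diff partials_add partials_mult partials_const partials_snd p d0 d1 d2)
  have G: "partials G ((rlog1 \<epsilon> y * \<psi> y + rlog \<epsilon> y * \<psi>1 y) - (0 * (rlog2 \<epsilon> y * \<psi> y) + snd y * (rlog12 \<epsilon> y * \<psi> y + rlog2 \<epsilon> y * \<psi>1 y))) (D y) y" for y
    unfolding G_def D_def by (intro partials_diff partials_add partials_mult partials_const partials_snd p d0 d1 d2)
  show ?thesis unfolding eq
    by (rule cell_divergence[OF F _ G, where M = M])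
      (auto simp: F_def G_def A_def D_def supp0 supp1 supp2 per0 per1 regularised_shift[OF \<epsilon>]
        intro!: continuous_intros continuous_regularised[OF \<epsilon>] cont0 cont1 cont2)
qed

end

text \<open>Real version of \<open>majorant\<close> for use with Bochner integrals. It has the
  default value 0 where \<open>nome y = 1\<close>; bounds for the regularised terms therefore assume
  \<open>0 < gap y\<close>, which holds almost everywhere on the cell.\<close>

definition rmaj :: "plane \<Rightarrow> real" where "rmaj y = (2 + \<bar>snd y\<bar>) * norm (nome_ratio y)"

lemma rmaj_nonneg: "0 \<le> rmaj y" by (simp add: rmaj_def)

lemma rmaj_measurable [measurable]: "rmaj \<in> borel_measurable borel"
proof -
  have [measurable]: "(\<lambda>y. snd y) \<in> borel_measurable (borel :: plane measure)"
    by (intro borel_measurable_continuous_onI continuous_intros)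
  show ?thesis unfolding rmaj_def[abs_def] nome_ratio_def by measurable
qed

lemma rmaj_integrable: "integrable lborel (\<lambda>y. indicator cell y * rmaj y)"
proof -
  have "(\<integral>\<^sup>+y. indicator cell y * ennreal (norm (rmaj y)) \<partial>lborel) \<le> (\<integral>\<^sup>+y. indicator cell y * majorant y \<partial>lborel)"
  proof (intro nn_integral_mono mult_left_mono)
    show "ennreal (norm (rmaj y)) \<le> majorant y" for y
      by (cases "nome y = 1") (simp_all add: majorant_top majorant_ennreal rmaj_def abs_mult)
  qed simp
  then have "(\<integral>\<^sup>+y. indicator cell y * ennreal (norm (rmaj y)) \<partial>lborel) < \<infinity>" using majorant_integral_finite by (rule order_le_less_trans)
  then show ?thesis using integrable_cell_iff[of rmaj] by simp
qed

lemma AE_gap_pos: "AE y in lborel. y \<in> cell \<longrightarrow> 0 < gap y"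
proof -
  have "AE y in lborel. y \<in> cell \<longrightarrow> nome (0 - - y) \<noteq> 1"
  proof -
    have "AE y in lborel. indicator cell y * majorant y \<noteq> \<infinity>"
      by (rule nn_integral_PInf_AE) (use majorant_integral_finite in auto)
    then show ?thesis by eventually_elim (auto simp: majorant_top)
  qed
  then show ?thesis
  proof eventually_elim
    case (elim y) then show ?case using gap_nonneg[of y] by (auto simp: nome_eq_1_iff order_less_le)
  qed
qed

lemma sinh_gap: "0 < gap y \<Longrightarrow> \<bar>sinh (snd y)\<bar> / gap y \<le> 1 + 2 * norm (nome_ratio y)"
proof -
  assume g: "0 < gap y"
  define r where "r = \<bar>snd y\<bar>"
  have s: "\<bar>sinh (snd y)\<bar> = sinh r" by (simp add: r_def)
  have c: "cosh (snd y) = cosh r" by (cases "snd y \<ge> 0") (auto simp: r_def)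
  have cs: "cosh r - sinh r = exp (- r)" by (rule cosh_minus_sinh)
  have "sinh r / gap y = 1 + 2 * Re (nome_ratio y)"
    unfolding nome_ratio_parts r_def[symmetric] using g cs c by (simp add: field_simps gap_def)
  also have "\<dots> \<le> 1 + 2 * norm (nome_ratio y)" using complex_Re_le_cmod[of "nome_ratio y"] by simp
  finally show ?thesis by (simp add: s)
qed

lemma norm_nome_ratio_le: "2 * norm (nome_ratio y) \<le> rmaj y" "\<bar>snd y\<bar> * norm (nome_ratio y) \<le> rmaj y"
  unfolding rmaj_def by (auto intro!: mult_right_mono)

lemma rlog1_bound: "0 < gap y \<Longrightarrow> 0 < \<epsilon> \<Longrightarrow> \<bar>rlog1 \<epsilon> y\<bar> \<le> rmaj y"
proof -
  assume g: "0 < gap y" and e: "0 < \<epsilon>"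
  have "\<bar>rlog1 \<epsilon> y\<bar> \<le> \<bar>sin (fst y)\<bar> / gap y" unfolding rlog1_def rgap_def abs_divide using g e by (intro frac_le) auto
  also have "\<dots> = 2 * \<bar>Im (nome_ratio y)\<bar>" unfolding nome_ratio_parts using g by (simp add: abs_divide)
  also have "\<dots> \<le> 2 * norm (nome_ratio y)" using abs_Im_le_cmod[of "nome_ratio y"] by simp
  finally show ?thesis using norm_nome_ratio_le(1)[of y] by linarith
qed

lemma rlog2_bound: "0 < gap y \<Longrightarrow> 0 < \<epsilon> \<Longrightarrow> \<bar>rlog2 \<epsilon> y\<bar> \<le> 1 + rmaj y"
proof -
  assume g: "0 < gap y" and e: "0 < \<epsilon>"
  have "\<bar>rlog2 \<epsilon> y\<bar> \<le> \<bar>sinh (snd y)\<bar> / gap y" unfolding rlog2_def rgap_def abs_divide using g e by (intro frac_le) auto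
  then show ?thesis using sinh_gap[OF g] norm_nome_ratio_le(1)[of y] by linarith
qed

text \<open>The logarithm is read off from \<open>kern\<close>, whose size is known, and the
  quotient that accompanies it there. The constant is 32, from \<open>8 * pi < 32\<close>, plus 2,
  rounded up.\<close>

lemma log_gap_bound: assumes g: "0 < gap y" shows "\<bar>ln (2 * gap y)\<bar> \<le> \<bar>snd y\<bar> + 35 * rmaj y"
proof -
  have n: "nome y \<noteq> 1" using g nome_eq_1_iff[of y] by simp
  have "ln (2 * gap y) = 8 * pi * snd (kern y) + snd y * sinh (snd y) / gap y"
    unfolding kern_gap by (simp add: field_simps)
  moreover have "\<bar>8 * pi * snd (kern y)\<bar> \<le> 8 * pi * rmaj y"
    using kern_bound_real[OF n] abs_snd_le_norm[of "kern y"] unfolding rmaj_def[symmetric] by (simp add: abs_mult)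
  moreover have "8 * pi * rmaj y \<le> 32 * rmaj y" using pi_less_4 rmaj_nonneg[of y] by (intro mult_right_mono) auto
  moreover have "\<bar>snd y * sinh (snd y) / gap y\<bar> \<le> \<bar>snd y\<bar> + 2 * rmaj y"
  proof -
    have "\<bar>snd y * sinh (snd y) / gap y\<bar> = \<bar>snd y\<bar> * (\<bar>sinh (snd y)\<bar> / gap y)" using g by (simp add: abs_mult abs_divide)
    also have "\<dots> \<le> \<bar>snd y\<bar> * (1 + 2 * norm (nome_ratio y))" by (intro mult_left_mono sinh_gap[OF g]) simp
    also have "\<dots> \<le> \<bar>snd y\<bar> + 2 * rmaj y" using norm_nome_ratio_le(2)[of y] by (simp add: algebra_simps)
    finally show ?thesis .
  qed
  ultimately show ?thesis using rmaj_nonneg[of y] unfolding abs_le_iff by linarith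
qed

text \<open>Uniform in \<open>\<epsilon>\<close>: from below \<open>rlog\<close> is at least
  \<open>ln (2 * gap y)\<close>, from above \<open>ln t \<le> t - 1\<close> and
  \<open>gap y \<le> cosh N + 1\<close>. The 40 covers the constants 35 and 4 that appear on the
  way.\<close>

lemma rlog_bound: assumes g: "0 < gap y" and e: "0 < \<epsilon>" "\<epsilon> \<le> 1" and N: "\<bar>snd y\<bar> \<le> N"
  shows "\<bar>rlog \<epsilon> y\<bar> \<le> (N + 2 * cosh N + 40) * (1 + rmaj y)"
proof -
  have lo: "ln (2 * gap y) \<le> rlog \<epsilon> y" unfolding rlog_def rgap_def using g e by simp
  have gN: "gap y \<le> cosh N + 1"
  proof -
    have "cosh \<bar>snd y\<bar> \<le> cosh N" using N cosh_real_nonneg_le_iff[of "\<bar>snd y\<bar>" N] by simp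
    then have "cosh (snd y) \<le> cosh N" by (cases "snd y \<ge> 0") auto
    then show ?thesis using cos_ge_minus_one[of "fst y"] unfolding gap_def by linarith
  qed
  have "rlog \<epsilon> y \<le> 2 * rgap \<epsilon> y - 1" unfolding rlog_def using rgap_pos[OF e(1), of y] by (intro ln_le_minus_one) auto
  also have "\<dots> \<le> 2 * cosh N + 4" using gN e by (simp add: rgap_def)
  finally have up: "rlog \<epsilon> y \<le> 2 * cosh N + 4" .
  have "\<bar>rlog \<epsilon> y\<bar> \<le> N + 35 * rmaj y + 2 * cosh N + 4"
    using lo up log_gap_bound[OF g] N rmaj_nonneg[of y] cosh_real_ge_1[of N] by (auto simp: abs_le_iff)
  also have "\<dots> \<le> (N + 2 * cosh N + 40) * (1 + rmaj y)"
  proof -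
    have "0 \<le> (N + 2 * cosh N) * rmaj y" using N cosh_real_ge_1[of N] rmaj_nonneg[of y] by (intro mult_nonneg_nonneg) auto
    then show ?thesis using rmaj_nonneg[of y] by (simp add: algebra_simps)
  qed
  finally show ?thesis .
qed

lemma cell_bounded:
  fixes h :: "plane \<Rightarrow> real"
  assumes "continuous_on UNIV h" "\<And>y. \<bar>snd y\<bar> > N \<Longrightarrow> h y = 0"
  obtains B where "0 \<le> B" "\<And>y. y \<in> cell \<Longrightarrow> \<bar>h y\<bar> \<le> B"
proof -
  have "compact (h ` ({0..2 * pi} \<times> {- N..N}))"
    by (intro compact_continuous_image continuous_on_subset[OF assms(1)] compact_Times) auto
  from compact_imp_bounded[OF this] obtain B where B: "\<forall>x\<in>h ` ({0..2 * pi} \<times> {- N..N}). norm x \<le> B" unfolding bounded_iff by (elim exE)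
  have "\<bar>h y\<bar> \<le> \<bar>B\<bar>" if "y \<in> cell" for y
  proof (cases "\<bar>snd y\<bar> > N")
    case False
    then have "y \<in> {0..2 * pi} \<times> {- N..N}" using that by (cases y) (auto simp: cell_def abs_le_iff)
    then show ?thesis using B by force
  qed (simp add: assms(2))
  then show thesis by (intro that[of "\<bar>B\<bar>"]) auto
qed

lemma strip_integrable: "integrable lborel (\<lambda>y. indicator ({0..2 * pi} \<times> {- N..N}) y * (c * (1 + rmaj y)))"
proof -
  have "integrable lborel (\<lambda>y. indicator ({0..2 * pi} \<times> {- N..N}) y * rmaj y)"
  proof (rule Bochner_Integration.integrable_bound[OF rmaj_integrable])
    show "AE y in lborel. norm (indicator ({0..2 * pi} \<times> {- N..N}) y * rmaj y) \<le> norm (indicator cell y * rmaj y)"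
      by (intro AE_I2) (auto simp: indicator_def cell_def)
    have "{0..2 * pi} \<times> {- N..N} \<in> sets (borel :: plane measure)" by (intro borel_closed closed_Times) auto
    then show "(\<lambda>y. indicator ({0..2 * pi} \<times> {- N..N}) y * rmaj y) \<in> borel_measurable lborel" by measurable
  qed
  moreover have "integrable lborel (\<lambda>y. indicator ({0..2 * pi} \<times> {- N..N}) y * (1 :: real))"
    by (rule rect_integrable) simp
  ultimately have "integrable lborel (\<lambda>y. c * (indicator ({0..2 * pi} \<times> {- N..N}) y * 1 + indicator ({0..2 * pi} \<times> {- N..N}) y * rmaj y))"
    by (intro integrable_mult_right Bochner_Integration.integrable_add)
  then show ?thesis by (simp add: algebra_simps)
qed

text \<open>Dominated convergence shared by \<open>rlog\<close>, \<open>rlog1\<close> and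
  \<open>rlog2\<close>. In the weight \<open>1 + rmaj\<close>, the 1 is for bounded parts such as
  the limits of \<open>sinh / gap\<close> at infinity and \<open>rmaj\<close> for the singularity;
  on a strip both are integrable.\<close>

lemma reg_limit:
  fixes r :: "nat \<Rightarrow> plane \<Rightarrow> real"
  assumes rc: "\<And>n. continuous_on UNIV (r n)" and s: "s \<in> borel_measurable borel"
    and conv: "\<And>y. 0 < gap y \<Longrightarrow> (\<lambda>n. r n y) \<longlonglongrightarrow> s y"
    and bd: "\<And>n y. 0 < gap y \<Longrightarrow> \<bar>snd y\<bar> \<le> N \<Longrightarrow> \<bar>r n y\<bar> \<le> C * (1 + rmaj y)"
    and h: "continuous_on UNIV h" and supp: "\<And>y. \<bar>snd y\<bar> > N \<Longrightarrow> h y = 0"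
  shows "integrable lborel (\<lambda>y. indicator cell y * (s y * h y))"
    and "(\<lambda>n. LBINT y. indicator cell y * (r n y * h y)) \<longlonglongrightarrow> (LBINT y. indicator cell y * (s y * h y))"
proof -
  obtain B where B: "0 \<le> B" "\<And>y. y \<in> cell \<Longrightarrow> \<bar>h y\<bar> \<le> B" using cell_bounded[OF h supp] by blast
  note [measurable] = s borel_measurable_continuous_onI[OF h] borel_measurable_continuous_onI[OF rc]
  define w where "w y = indicator ({0..2 * pi} \<times> {- N..N}) y * ((B * C) * (1 + rmaj y))" for y
  have w: "integrable lborel w" unfolding w_def by (rule strip_integrable)
  have l: "AE y in lborel. (\<lambda>n. indicator cell y * (r n y * h y)) \<longlonglongrightarrow> indicator cell y * (s y * h y)"
    using AE_gap_pos
  proof eventually_elim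
    case (elim y) then show ?case by (cases "y \<in> cell") (auto intro!: tendsto_intros conv)
  qed
  have b: "AE y in lborel. norm (indicator cell y * (r n y * h y)) \<le> w y" for n
    using AE_gap_pos
  proof eventually_elim
    case (elim y)
    show ?case
    proof (cases "y \<in> cell \<and> \<bar>snd y\<bar> \<le> N")
      case True
      then have "\<bar>r n y * h y\<bar> \<le> (C * (1 + rmaj y)) * B"
        unfolding abs_mult using bd[of y n] B elim by (intro mult_mono) auto
      moreover have "y \<in> {0..2 * pi} \<times> {- N..N}" using True by (cases y) (auto simp: cell_def abs_le_iff)
      ultimately show ?thesis using True by (simp add: w_def mult_ac)
    next
      case False
      have "y \<notin> {0..2 * pi} \<times> {- N..N}" using False by (cases y) (auto simp: cell_def abs_le_iff)
      moreover have "y \<notin> cell \<or> h y = 0" using False supp[of y] by auto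
      ultimately show ?thesis by (auto simp: w_def)
    qed
  qed
  show "integrable lborel (\<lambda>y. indicator cell y * (s y * h y))"
    by (rule integrable_dominated_convergence[OF _ _ w l b]) measurable
  show "(\<lambda>n. LBINT y. indicator cell y * (r n y * h y)) \<longlonglongrightarrow> (LBINT y. indicator cell y * (s y * h y))"
    by (rule integral_dominated_convergence[OF _ _ w l b]) measurable
qed

definition eps :: "nat \<Rightarrow> real" where "eps n = 1 / real (Suc n)"

lemma eps: "0 < eps n" "eps n \<le> 1" "eps \<longlonglongrightarrow> 0"
proof -
  show "0 < eps n" "eps n \<le> 1" by (simp_all add: eps_def)
  show "eps \<longlonglongrightarrow> 0" unfolding eps_def[abs_def] using LIMSEQ_inverse_real_of_nat by (simp add: inverse_eq_divide)
qed

lemma rgap_tendsto: "(\<lambda>n. rgap (eps n) y) \<longlonglongrightarrow> gap y"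
  unfolding rgap_def using tendsto_add[OF tendsto_const[of "gap y"] eps(3)] by simp

lemma gap_measurable [measurable]: "gap \<in> borel_measurable borel"
  unfolding gap_def[abs_def] by (intro borel_measurable_continuous_onI continuous_intros)

lemma rlog_limit:
  assumes h: "continuous_on UNIV h" and supp: "\<And>y. \<bar>snd y\<bar> > N \<Longrightarrow> h y = 0"
  shows "integrable lborel (\<lambda>y. indicator cell y * (ln (2 * gap y) * h y))"
    and "(\<lambda>n. LBINT y. indicator cell y * (rlog (eps n) y * h y)) \<longlonglongrightarrow> (LBINT y. indicator cell y * (ln (2 * gap y) * h y))"
proof -
  have c: "(\<lambda>n. rlog (eps n) y) \<longlonglongrightarrow> ln (2 * gap y)" if "0 < gap y" for y
    unfolding rlog_def using that by (intro tendsto_intros rgap_tendsto) auto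
  note R = reg_limit[where r = "\<lambda>n. rlog (eps n)" and s = "\<lambda>y. ln (2 * gap y)" and C = "N + 2 * cosh N + 40" and N = N,
      OF continuous_regularised(1)[OF eps(1)] _ c rlog_bound[OF _ eps(1,2)] h supp]
  show "integrable lborel (\<lambda>y. indicator cell y * (ln (2 * gap y) * h y))" by (rule R(1)) measurable
  show "(\<lambda>n. LBINT y. indicator cell y * (rlog (eps n) y * h y)) \<longlonglongrightarrow> (LBINT y. indicator cell y * (ln (2 * gap y) * h y))"
    by (rule R(2)) measurable
qed

lemma rlog1_limit:
  assumes h: "continuous_on UNIV h" and supp: "\<And>y. \<bar>snd y\<bar> > N \<Longrightarrow> h y = 0"
  shows "integrable lborel (\<lambda>y. indicator cell y * (sin (fst y) / gap y * h y))"
    and "(\<lambda>n. LBINT y. indicator cell y * (rlog1 (eps n) y * h y)) \<longlonglongrightarrow> (LBINT y. indicator cell y * (sin (fst y) / gap y * h y))"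
proof -
  have c: "(\<lambda>n. rlog1 (eps n) y) \<longlonglongrightarrow> sin (fst y) / gap y" if "0 < gap y" for y
    unfolding rlog1_def using that by (intro tendsto_intros rgap_tendsto) auto
  have b: "\<bar>rlog1 (eps n) y\<bar> \<le> 1 * (1 + rmaj y)" if "0 < gap y" "\<bar>snd y\<bar> \<le> N" for n y
    using rlog1_bound[OF that(1) eps(1)[of n]] by simp
  have m: "(\<lambda>y. sin (fst y) / gap y) \<in> borel_measurable borel"
    by (intro borel_measurable_divide gap_measurable borel_measurable_continuous_onI continuous_intros)
  note R = reg_limit[where r = "\<lambda>n. rlog1 (eps n)" and s = "\<lambda>y. sin (fst y) / gap y", OF continuous_regularised(2)[OF eps(1)] m c b h supp]
  show "integrable lborel (\<lambda>y. indicator cell y * (sin (fst y) / gap y * h y))" by (rule R(1))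
  show "(\<lambda>n. LBINT y. indicator cell y * (rlog1 (eps n) y * h y)) \<longlonglongrightarrow> (LBINT y. indicator cell y * (sin (fst y) / gap y * h y))"
    by (rule R(2))
qed

lemma rlog2_limit:
  assumes h: "continuous_on UNIV h" and supp: "\<And>y. \<bar>snd y\<bar> > N \<Longrightarrow> h y = 0"
  shows "integrable lborel (\<lambda>y. indicator cell y * (sinh (snd y) / gap y * h y))"
    and "(\<lambda>n. LBINT y. indicator cell y * (rlog2 (eps n) y * h y)) \<longlonglongrightarrow> (LBINT y. indicator cell y * (sinh (snd y) / gap y * h y))"
proof -
  have c: "(\<lambda>n. rlog2 (eps n) y) \<longlonglongrightarrow> sinh (snd y) / gap y" if "0 < gap y" for y
    unfolding rlog2_def using that by (intro tendsto_intros rgap_tendsto) auto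
  have b: "\<bar>rlog2 (eps n) y\<bar> \<le> 1 * (1 + rmaj y)" if "0 < gap y" "\<bar>snd y\<bar> \<le> N" for n y
    using rlog2_bound[OF that(1) eps(1)[of n]] by simp
  have m: "(\<lambda>y. sinh (snd y) / gap y) \<in> borel_measurable borel"
    by (intro borel_measurable_divide gap_measurable borel_measurable_continuous_onI continuous_intros)
  note R = reg_limit[where r = "\<lambda>n. rlog2 (eps n)" and s = "\<lambda>y. sinh (snd y) / gap y", OF continuous_regularised(3)[OF eps(1)] m c b h supp]
  show "integrable lborel (\<lambda>y. indicator cell y * (sinh (snd y) / gap y * h y))" by (rule R(1))
  show "(\<lambda>n. LBINT y. indicator cell y * (rlog2 (eps n) y * h y)) \<longlonglongrightarrow> (LBINT y. indicator cell y * (sinh (snd y) / gap y * h y))"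
    by (rule R(2))
qed

text \<open>From \<open>2 * gap * |q| = |1 - q|^2\<close>. It is the bound that remains once a
  Lipschitz function has contributed a factor \<open>sqrt (gap y)\<close> against
  \<open>1 / gap y\<close>.\<close>

lemma sqrt_gap: assumes g: "0 < gap y" shows "1 / sqrt (gap y) \<le> exp (\<bar>snd y\<bar> / 2) * rmaj y"
proof -
  define q where "q = norm (nome y)"
  define A where "A = norm (1 - nome y)"
  have q0: "0 < q" by (simp add: q_def nome_def)
  have n: "nome y \<noteq> 1" using g nome_eq_1_iff[of y] by simp
  then have A0: "0 < A" by (simp add: A_def)
  have e: "2 * gap y * q = A\<^sup>2" using gap_eq[of y] by (simp add: q_def A_def)
  have "sqrt (2 * gap y * q) = A" unfolding e using A0 by simp
  then have "sqrt 2 * sqrt (gap y) * sqrt q = A" by (simp add: real_sqrt_mult)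
  then have "1 / sqrt (gap y) = sqrt 2 * sqrt q / A" using A0 g q0 by (simp add: field_simps)
  also have "\<dots> = sqrt 2 * (q / A) * (1 / sqrt q)" using q0 A0 by (simp add: field_simps)
  also have "1 / sqrt q = exp (\<bar>snd y\<bar> / 2)"
  proof -
    have "q = (exp (- (\<bar>snd y\<bar> / 2)))\<^sup>2" by (simp add: q_def norm_nome power2_eq_square exp_add[symmetric])
    then have "sqrt q = exp (- (\<bar>snd y\<bar> / 2))" by (simp add: real_sqrt_abs)
    then show ?thesis by (simp add: exp_minus inverse_eq_divide)
  qed
  also have "sqrt 2 * (q / A) * exp (\<bar>snd y\<bar> / 2) \<le> 2 * (q / A) * exp (\<bar>snd y\<bar> / 2)"
  proof (intro mult_right_mono)
    have "sqrt 2 \<le> sqrt (2 * 2)" by (intro real_sqrt_le_mono) simp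
    then show "sqrt 2 \<le> 2" by simp
  qed (use q0 A0 in auto)
  also have "\<dots> \<le> rmaj y * exp (\<bar>snd y\<bar> / 2)"
  proof (intro mult_right_mono)
    show "2 * (q / A) \<le> rmaj y" using norm_nome_ratio_le(1)[of y] by (simp add: nome_ratio_def norm_divide q_def A_def)
  qed simp
  also have "\<dots> = exp (\<bar>snd y\<bar> / 2) * rmaj y" by (rule mult.commute)
  finally show ?thesis .
qed

text \<open>Integrating the Laplacian over the strip leaves the flux through top and bottom, which
  at abscissa \<open>s\<close> is \<open>2 * sinh R / (cosh R - cos s + \<epsilon>)\<close>. It
  differs from 2 by at most \<open>6 / (cosh R - 1)\<close>, uniformly in \<open>\<epsilon>\<close>,
  and the width is \<open>2 * pi\<close>.\<close>

lemma rlap_mass: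
  assumes \<epsilon>: "0 < \<epsilon>" "\<epsilon> \<le> 1" and R: "0 < R"
  shows "\<bar>(LBINT y. indicator ({0..2 * pi} \<times> {- R..R}) y * rlap \<epsilon> y) - 4 * pi\<bar> \<le> 12 * pi / (cosh R - 1)"
proof -
  have c1: "1 < cosh R" using R cosh_real_strict_mono[of 0 R] by simp
  define k where "k s = rlog2 \<epsilon> (s, R) - rlog2 \<epsilon> (s, - R)" for s
  have kc: "continuous_on UNIV k" unfolding k_def
    by (intro continuous_intros continuous_on_compose2[OF continuous_regularised(3)[OF \<epsilon>(1)]]) auto
  have kb: "\<bar>k s - 2\<bar> \<le> 6 / (cosh R - 1)" for s
  proof -
    define d where "d = cosh R - cos s + \<epsilon>"
    have d: "cosh R - 1 \<le> d" "0 < d" using c1 \<epsilon> cos_le_one[of s] unfolding d_def by linarith+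
    have "k s = 2 * sinh R / d" by (simp add: k_def rlog2_def rgap_def gap_def d_def)
    then have "k s - 2 = 2 * (sinh R - d) / d" using d by (simp add: field_simps)
    moreover have "\<bar>sinh R - d\<bar> \<le> 3"
    proof -
      have "sinh R - d = - exp (- R) + cos s - \<epsilon>" using cosh_minus_sinh[of R] unfolding d_def by linarith
      moreover have "exp (- R) \<le> 1" "0 < exp (- R)" using R by auto
      ultimately show ?thesis using \<epsilon> cos_le_one[of s] cos_ge_minus_one[of s] unfolding abs_le_iff by linarith
    qed
    ultimately have "\<bar>k s - 2\<bar> \<le> 6 / d" using d by (simp add: abs_mult abs_divide divide_right_mono)
    also have "\<dots> \<le> 6 / (cosh R - 1)" using d c1 by (intro divide_left_mono) auto
    finally show ?thesis .
  qed
  have "(LBINT y. indicator ({0..2 * pi} \<times> {- R..R}) y * rlap \<epsilon> y)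
    = (LBINT y. indicator ({0..2 * pi} \<times> {- R..R}) y * rlog11 \<epsilon> y + indicator ({0..2 * pi} \<times> {- R..R}) y * rlog22 \<epsilon> y)"
    unfolding rlog_laplace[OF \<epsilon>(1), symmetric] by (simp only: distrib_left)
  also have "\<dots> = (LBINT y. indicator ({0..2 * pi} \<times> {- R..R}) y * rlog11 \<epsilon> y) + (LBINT y. indicator ({0..2 * pi} \<times> {- R..R}) y * rlog22 \<epsilon> y)"
    by (rule Bochner_Integration.integral_add) (rule rect_integrable continuous_regularised[OF \<epsilon>(1)])+
  also have "(LBINT y. indicator ({0..2 * pi} \<times> {- R..R}) y * rlog11 \<epsilon> y) = 0"
    by (subst rect_integral_d1[OF partials_rlog1[OF \<epsilon>(1)] continuous_regularised(4)[OF \<epsilon>(1)]]) (auto simp: rlog1_def rgap_def gap_def)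
  also have "(LBINT y. indicator ({0..2 * pi} \<times> {- R..R}) y * rlog22 \<epsilon> y) = (LBINT s. indicator {0..2 * pi} s * k s)"
    unfolding k_def by (rule rect_integral_d2[OF partials_rlog2[OF \<epsilon>(1)] continuous_regularised(6)[OF \<epsilon>(1)]]) (use R in simp)
  finally have e: "(LBINT y. indicator ({0..2 * pi} \<times> {- R..R}) y * rlap \<epsilon> y) = (LBINT s. indicator {0..2 * pi} s * k s)" by simp
  have i2: "integrable lborel (\<lambda>s. indicator {0..2 * pi} s * (2 :: real))" by (rule set_lint_continuous) simp
  have ik: "integrable lborel (\<lambda>s. indicator {0..2 * pi} s * k s)" by (rule set_lint_continuous[OF continuous_on_subset[OF kc]]) simp
  have "(LBINT s. indicator {0..2 * pi} s * k s) - 4 * pi = (LBINT s. indicator {0..2 * pi} s * k s - indicator {0..2 * pi} s * 2)"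
    by (subst Bochner_Integration.integral_diff[OF ik i2]) simp
  also have "\<dots> = (LBINT s. indicator {0..2 * pi} s * (k s - 2))" by (simp only: right_diff_distrib)
  finally have "\<bar>(LBINT s. indicator {0..2 * pi} s * k s) - 4 * pi\<bar> \<le> 6 / (cosh R - 1) * (2 * pi - 0)"
    using set_lint_bounded_le[of "\<lambda>s. k s - 2" "6 / (cosh R - 1)" 0 "2 * pi"] kb kc
    by (simp add: borel_measurable_continuous_onI continuous_on_diff)
  then show ?thesis unfolding e by (simp add: field_simps)
qed

text \<open>\<open>F - F (0, 0)\<close> need not vanish far up, so mass is counted on a strip
  \<open>Q\<close>, independent of \<open>n\<close>, so high that its defect is below
  \<open>e / 2\<close>. On \<open>Q\<close>, \<open>rlap\<close> tends to 0 pointwise off the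
  singularity and is at most a constant over \<open>gap\<close>; the hypothesis on \<open>F\<close>
  supplies \<open>sqrt (gap y)\<close>, and the product is integrable by
  \<open>sqrt_gap\<close>.\<close>

lemma approximate_identity:
  assumes F: "continuous_on UNIV F" and supp: "\<And>y. \<bar>snd y\<bar> > N \<Longrightarrow> F y = 0"
    and K: "\<And>y. y \<in> cell \<Longrightarrow> \<bar>F y - F (0, 0)\<bar> \<le> K * sqrt (gap y)"
  shows "(\<lambda>n. LBINT y. indicator cell y * (rlap (eps n) y * F y)) \<longlonglongrightarrow> 4 * pi * F (0, 0)"
proof (rule LIMSEQ_I)
  fix e :: real assume e: "0 < e"
  define F0 where "F0 = F (0, 0)"
  \<comment> \<open>Chosen so that the error of \<open>rlap_mass\<close>, multiplied by
    \<open>\<bar>F0\<bar>\<close>, is below \<open>e / 2\<close>, which amounts to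
    \<open>a < cosh R - 1\<close>; \<open>R\<close> is linear in \<open>a\<close> because only
    \<open>cosh R \<ge> (1 + R) / 2\<close> is used.\<close>
  define a where "a = 24 * pi * \<bar>F0\<bar> / e"
  define R where "R = \<bar>N\<bar> + 2 + 2 * a"
  have a0: "0 \<le> a" using e by (simp add: a_def)
  have R0: "0 < R" and RN: "N \<le> R" using a0 unfolding R_def by linarith+
  have chR: "a < cosh R - 1"
  proof -
    have "1 + R \<le> exp R" by (rule exp_ge_add_one_self)
    also have "exp R \<le> 2 * cosh R" by (simp add: cosh_def)
    finally have "(1 + R) / 2 \<le> cosh R" by simp
    moreover have "a < (1 + R) / 2 - 1" unfolding R_def using a0 abs_ge_zero[of N] by (simp add: field_simps)
    ultimately show ?thesis by linarith
  qed
  have tail: "\<bar>F0\<bar> * (12 * pi / (cosh R - 1)) < e / 2"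
  proof -
    have "0 < cosh R - 1" using chR a0 by linarith
    then show ?thesis using chR e by (simp add: a_def field_simps)
  qed
  define Q where "Q = {0..2 * pi} \<times> {- R..R}"
  have [measurable]: "Q \<in> sets borel" unfolding Q_def by (intro borel_closed closed_Times) auto
  note [measurable] = borel_measurable_continuous_onI[OF F] borel_measurable_continuous_onI[OF continuous_regularised(7)[OF eps(1)]]
  define w where "w y = indicator Q y * ((2 * cosh R * \<bar>K\<bar> * exp (R / 2)) * (1 + rmaj y))" for y
  have w: "integrable lborel w" unfolding w_def Q_def by (rule strip_integrable)
  have inQ: "y \<in> cell \<and> \<bar>snd y\<bar> \<le> R" if "y \<in> Q" for y using that by (auto simp: Q_def cell_def abs_le_iff)
  have lim: "(\<lambda>n. LBINT y. indicator Q y * (rlap (eps n) y * (F y - F0))) \<longlonglongrightarrow> (LBINT y. indicator Q y * 0)"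
  proof (rule integral_dominated_convergence[OF _ _ w])
    show "AE y in lborel. (\<lambda>n. indicator Q y * (rlap (eps n) y * (F y - F0))) \<longlonglongrightarrow> indicator Q y * 0"
      using AE_gap_pos
    proof eventually_elim
      case (elim y)
      show ?case
      proof (cases "y \<in> Q")
        case True
        then have g: "0 < gap y" using elim inQ by auto
        have "(\<lambda>n. eps n * (cosh (snd y) + cos (fst y)) / (rgap (eps n) y)\<^sup>2) \<longlonglongrightarrow> 0 * (cosh (snd y) + cos (fst y)) / (gap y)\<^sup>2"
          by (intro tendsto_intros eps(3) rgap_tendsto) (use g in auto)
        then have "(\<lambda>n. rlap (eps n) y) \<longlonglongrightarrow> 0" by (simp add: rlap_def)
        then have "(\<lambda>n. indicator Q y * (rlap (eps n) y * (F y - F0))) \<longlonglongrightarrow> indicator Q y * (0 * (F y - F0))" by (intro tendsto_intros)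
        then show ?thesis by simp
      qed simp
    qed
    show "AE y in lborel. norm (indicator Q y * (rlap (eps n) y * (F y - F0))) \<le> w y" for n
      using AE_gap_pos
    proof eventually_elim
      case (elim y)
      show ?case
      proof (cases "y \<in> Q")
        case True
        then have g: "0 < gap y" and yc: "y \<in> cell" and yR: "\<bar>snd y\<bar> \<le> R" using elim inQ by auto
        define p where "p = rgap (eps n) y"
        have p: "gap y \<le> p" "eps n \<le> p" "0 < p" using eps(1)[of n] g by (auto simp: p_def rgap_def)
        have cR: "cosh (snd y) \<le> cosh R"
        proof -
          have "cosh \<bar>snd y\<bar> \<le> cosh R" using yR R0 cosh_real_nonneg_le_iff[of "\<bar>snd y\<bar>" R] by simp
          then show ?thesis by (cases "snd y \<ge> 0") auto
        qed
        have cc: "0 \<le> cosh (snd y) + cos (fst y)" "cosh (snd y) + cos (fst y) \<le> 2 * cosh R"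
          using cR cosh_real_ge_1[of "snd y"] cos_le_one[of "fst y"] cos_ge_minus_one[of "fst y"] by linarith+
        have "\<bar>rlap (eps n) y\<bar> = (eps n / p) * ((cosh (snd y) + cos (fst y)) / p)"
          unfolding rlap_def p_def[symmetric] using eps(1)[of n] cc p by (simp add: power2_eq_square abs_mult)
        also have "\<dots> \<le> 1 * (2 * cosh R / gap y)"
          using p cc g eps(1)[of n] by (intro mult_mono frac_le) (auto simp: less_imp_le)
        finally have r: "\<bar>rlap (eps n) y\<bar> \<le> 2 * cosh R / gap y" by simp
        have "\<bar>rlap (eps n) y * (F y - F0)\<bar> \<le> (2 * cosh R / gap y) * (\<bar>K\<bar> * sqrt (gap y))"
          unfolding abs_mult
        proof (intro mult_mono r)
          have "K * sqrt (gap y) \<le> \<bar>K\<bar> * sqrt (gap y)" using g by (intro mult_right_mono) auto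
          then show "\<bar>F y - F0\<bar> \<le> \<bar>K\<bar> * sqrt (gap y)" using K[OF yc] by (simp add: F0_def)
        qed (use g cosh_real_pos[of R] in auto)
        also have "\<dots> = 2 * cosh R * \<bar>K\<bar> * (1 / sqrt (gap y))"
        proof -
          have "sqrt (gap y) / gap y = 1 / sqrt (gap y)" using sqrt_divide_self_eq[of "gap y"] g by (simp add: inverse_eq_divide)
          have "(2 * cosh R / gap y) * (\<bar>K\<bar> * sqrt (gap y)) = 2 * cosh R * \<bar>K\<bar> * (sqrt (gap y) / gap y)" by simp
          then show ?thesis using \<open>sqrt (gap y) / gap y = 1 / sqrt (gap y)\<close> by presburger
        qed
        also have "\<dots> \<le> 2 * cosh R * \<bar>K\<bar> * (exp (R / 2) * (1 + rmaj y))"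
        proof (intro mult_left_mono)
          have "1 / sqrt (gap y) \<le> exp (\<bar>snd y\<bar> / 2) * rmaj y" by (rule sqrt_gap[OF g])
          also have "\<dots> \<le> exp (R / 2) * (1 + rmaj y)" using yR rmaj_nonneg[of y] by (intro mult_mono) auto
          finally show "1 / sqrt (gap y) \<le> exp (R / 2) * (1 + rmaj y)" .
        qed (use cosh_real_pos[of R] in auto)
        finally show ?thesis using True by (simp add: w_def mult_ac)
      qed (simp add: w_def)
    qed
  qed measurable
  then have "\<exists>n0. \<forall>n\<ge>n0. norm ((LBINT y. indicator Q y * (rlap (eps n) y * (F y - F0))) - (LBINT y. indicator Q y * 0)) < e / 2"
    by (rule LIMSEQ_D) (use e in simp)
  then obtain n0 where n0: "\<bar>LBINT y. indicator Q y * (rlap (eps n) y * (F y - F0))\<bar> < e / 2" if "n \<ge> n0" for n by auto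
  show "\<exists>n0. \<forall>n\<ge>n0. norm ((LBINT y. indicator cell y * (rlap (eps n) y * F y)) - 4 * pi * F (0, 0)) < e"
  proof (intro exI allI impI)
    fix n assume n: "n0 \<le> n"
    have i1: "integrable lborel (\<lambda>y. indicator Q y * (rlap (eps n) y * (F y - F0)))" unfolding Q_def
      by (intro rect_integrable continuous_intros F continuous_regularised(7)[OF eps(1)])
    have i2: "integrable lborel (\<lambda>y. F0 * (indicator Q y * rlap (eps n) y))" unfolding Q_def
      by (intro integrable_mult_right rect_integrable continuous_regularised(7)[OF eps(1)])
    have "(LBINT y. indicator cell y * (rlap (eps n) y * F y)) = (LBINT y. indicator Q y * (rlap (eps n) y * F y))"
      unfolding Q_def by (subst cell_indicator[of R]) (use supp RN in auto)
    also have "\<dots> = (LBINT y. indicator Q y * (rlap (eps n) y * (F y - F0)) + F0 * (indicator Q y * rlap (eps n) y))"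
      by (intro Bochner_Integration.integral_cong refl) (simp add: algebra_simps)
    also have "\<dots> = (LBINT y. indicator Q y * (rlap (eps n) y * (F y - F0))) + F0 * (LBINT y. indicator Q y * rlap (eps n) y)"
      unfolding Bochner_Integration.integral_add[OF i1 i2] by simp
    finally have "(LBINT y. indicator cell y * (rlap (eps n) y * F y)) - 4 * pi * F0
      = (LBINT y. indicator Q y * (rlap (eps n) y * (F y - F0))) + F0 * ((LBINT y. indicator Q y * rlap (eps n) y) - 4 * pi)"
      by (simp add: algebra_simps)
    moreover have "\<bar>F0 * ((LBINT y. indicator Q y * rlap (eps n) y) - 4 * pi)\<bar> \<le> \<bar>F0\<bar> * (12 * pi / (cosh R - 1))"
      unfolding abs_mult Q_def by (intro mult_left_mono rlap_mass eps R0) simp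
    ultimately show "norm ((LBINT y. indicator cell y * (rlap (eps n) y * F y)) - 4 * pi * F (0, 0)) < e"
      using n0[OF n] tail unfolding F0_def[symmetric] real_norm_def by linarith
  qed
qed

lemma real_lipschitz_bound:
  fixes f f' :: "real \<Rightarrow> real"
  assumes "\<And>t. t \<in> S \<Longrightarrow> (f has_real_derivative f' t) (at t)" "\<And>t. t \<in> S \<Longrightarrow> \<bar>f' t\<bar> \<le> B" "convex S" "a \<in> S" "b \<in> S"
  shows "\<bar>f a - f b\<bar> \<le> B * \<bar>a - b\<bar>"
  using field_differentiable_bound[of S f f' B b a] assms DERIV_subset[of f _ _ UNIV S] by (auto simp: abs_minus_commute[of "f a"] abs_minus_commute[of a])

lemma gap_lower: "(snd y)\<^sup>2 / 4 \<le> gap y" "2 * (sin (fst y / 2))\<^sup>2 \<le> gap y"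
proof -
  have c: "1 + r\<^sup>2 / 4 \<le> cosh r" if "0 \<le> r" for r :: real
  proof -
    have "1 + r + r\<^sup>2 / 2 \<le> exp r" using exp_lower_Taylor_quadratic[OF that] by simp
    moreover have "1 - r \<le> exp (- r)" using exp_ge_add_one_self[of "- r"] by simp
    ultimately show ?thesis by (simp add: cosh_def)
  qed
  have "1 + (snd y)\<^sup>2 / 4 \<le> cosh (snd y)" using c[of "snd y"] c[of "- snd y"] by (cases "0 \<le> snd y") auto
  then show "(snd y)\<^sup>2 / 4 \<le> gap y" using cos_le_one[of "fst y"] unfolding gap_def by linarith
  have "cos (fst y) = 1 - 2 * (sin (fst y / 2))\<^sup>2" using cos_double_sin[of "fst y / 2"] by simp
  then show "2 * (sin (fst y / 2))\<^sup>2 \<le> gap y" using cosh_real_ge_1[of "snd y"] unfolding gap_def by linarith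
qed

text \<open>On the cylinder the distance to the singular point is at most a multiple of
  \<open>sqrt (gap y)\<close>: the height is at most 2 times it, the horizontal distance to the
  nearer of 0 and \<open>2 * pi\<close> at most 4 times it, hence the 6. Periodicity lets either end
  serve as the singular point.\<close>

lemma gap_lipschitz:
  assumes F: "\<And>y. partials F (A y) (D y) y" and per: "F (2 * pi, 0) = F (0, 0)"
    and B: "\<And>y. y \<in> cell \<Longrightarrow> \<bar>A y\<bar> \<le> B" "\<And>y. y \<in> cell \<Longrightarrow> \<bar>D y\<bar> \<le> B" and y: "y \<in> cell"
  shows "\<bar>F y - F (0, 0)\<bar> \<le> (6 * B) * sqrt (gap y)"
proof -
  obtain a b where yab: "y = (a, b)" by (cases y)
  have a: "0 \<le> a" "a \<le> 2 * pi" using y yab by (auto simp: cell_def)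
  have B0: "0 \<le> B" using B(1)[OF y] by linarith
  have 1: "\<bar>F (a, b) - F (a, 0)\<bar> \<le> B * \<bar>b - 0\<bar>"
    by (rule real_lipschitz_bound[where S = UNIV, OF partials_snd_real[OF F]]) (use a B in \<open>auto simp: cell_def\<close>)
  have 2: "\<bar>F (a, 0) - F (c, 0)\<bar> \<le> B * \<bar>a - c\<bar>" if "c \<in> {0..2 * pi}" for c
    by (rule real_lipschitz_bound[where S = "{0..2 * pi}", OF partials_fst_real[OF F]]) (use a B that in \<open>auto simp: cell_def\<close>)
  define c where "c = (if a \<le> pi then 0 else 2 * pi)"
  have c: "c \<in> {0..2 * pi}" "F (c, 0) = F (0, 0)" using per by (auto simp: c_def)
  have "\<bar>a - c\<bar> / 2 / 2 \<le> sin (\<bar>a - c\<bar> / 2)" by (rule sin_ge_half) (use a in \<open>auto simp: c_def\<close>)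
  moreover have "sin (\<bar>a - c\<bar> / 2) = sin (a / 2)"
    using sin_pi_minus[of "a / 2"] a by (auto simp: c_def diff_divide_distrib)
  ultimately have "(\<bar>a - c\<bar> / 4)\<^sup>2 \<le> (sin (a / 2))\<^sup>2" by (intro power_mono) auto
  moreover have g: "2 * (sin (a / 2))\<^sup>2 \<le> gap y" "b\<^sup>2 / 4 \<le> gap y" using gap_lower[of y] yab by auto
  ultimately have "(\<bar>a - c\<bar> / 4)\<^sup>2 \<le> gap y" using zero_le_power2[of "sin (a / 2)"] by linarith
  then have s1: "\<bar>a - c\<bar> / 4 \<le> sqrt (gap y)" by (rule real_le_rsqrt)
  have "(\<bar>b\<bar> / 2)\<^sup>2 \<le> gap y" using g(2) by (simp add: power_divide)
  then have s2: "\<bar>b\<bar> / 2 \<le> sqrt (gap y)" by (rule real_le_rsqrt)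
  have "\<bar>F y - F (0, 0)\<bar> \<le> B * \<bar>b\<bar> + B * \<bar>a - c\<bar>" using 1 2[OF c(1)] unfolding yab c(2) by simp
  also have "\<dots> = B * (\<bar>b\<bar> + \<bar>a - c\<bar>)" by (simp add: algebra_simps)
  also have "\<dots> \<le> B * (6 * sqrt (gap y))" using s1 s2 by (intro mult_left_mono B0) auto
  finally show ?thesis by simp
qed

lemma approximate_identity_C1:
  assumes F: "\<And>y. partials F (A y) (D y) y" and c: "continuous_on UNIV A" "continuous_on UNIV D" and per: "F (2 * pi, 0) = F (0, 0)"
    and supp: "\<And>y. \<bar>snd y\<bar> > N \<Longrightarrow> F y = 0" "\<And>y. \<bar>snd y\<bar> > N \<Longrightarrow> A y = 0" "\<And>y. \<bar>snd y\<bar> > N \<Longrightarrow> D y = 0"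
  shows "(\<lambda>n. LBINT y. indicator cell y * (rlap (eps n) y * F y)) \<longlonglongrightarrow> 4 * pi * F (0, 0)"
proof -
  obtain B1 where B1: "0 \<le> B1" "\<And>y. y \<in> cell \<Longrightarrow> \<bar>A y\<bar> \<le> B1" using cell_bounded[OF c(1) supp(2)] by blast
  obtain B2 where B2: "0 \<le> B2" "\<And>y. y \<in> cell \<Longrightarrow> \<bar>D y\<bar> \<le> B2" using cell_bounded[OF c(2) supp(3)] by blast
  have "\<bar>F y - F (0, 0)\<bar> \<le> (6 * (B1 + B2)) * sqrt (gap y)" if "y \<in> cell" for y
  proof (rule gap_lipschitz[OF F per])
    show "\<bar>A y\<bar> \<le> B1 + B2" "\<bar>D y\<bar> \<le> B1 + B2" if "y \<in> cell" for y using B1(1) B2(1) B1(2)[OF that] B2(2)[OF that] by linarith+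
  qed fact
  from approximate_identity[OF partials_continuous[OF F] supp(1) this] show ?thesis by simp
qed

text \<open>Passage to the limit in all three identities: the terms with \<open>rlog\<close>,
  \<open>rlog1\<close> and \<open>rlog2\<close> converge under the integral, and \<open>rlap\<close>
  acts as \<open>4 * pi\<close> times the point mass at 0.\<close>

lemma regularised_limit:
  assumes g: "continuous_on UNIV a" "continuous_on UNIV b" "continuous_on UNIV c"
    and gs: "\<And>y. \<bar>snd y\<bar> > N \<Longrightarrow> a y = 0" "\<And>y. \<bar>snd y\<bar> > N \<Longrightarrow> b y = 0" "\<And>y. \<bar>snd y\<bar> > N \<Longrightarrow> c y = 0"
    and F: "\<And>y. partials F (A y) (D y) y" "continuous_on UNIV A" "continuous_on UNIV D" "F (2 * pi, 0) = F (0, 0)"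
    and Fs: "\<And>y. \<bar>snd y\<bar> > N \<Longrightarrow> F y = 0" "\<And>y. \<bar>snd y\<bar> > N \<Longrightarrow> A y = 0" "\<And>y. \<bar>snd y\<bar> > N \<Longrightarrow> D y = 0"
    and eq: "\<And>n. (LBINT y. indicator cell y * (rlog (eps n) y * a y + rlog1 (eps n) y * b y + rlog2 (eps n) y * c y - rlap (eps n) y * F y)) = 0"
  shows "(LBINT y. indicator cell y * (ln (2 * gap y) * a y + sin (fst y) / gap y * b y + sinh (snd y) / gap y * c y)) = 4 * pi * F (0, 0)"
proof -
  note r = rlog_limit[OF g(1) gs(1)] rlog1_limit[OF g(2) gs(2)] rlog2_limit[OF g(3) gs(3)]
  have "(LBINT y. indicator cell y * (rlog (eps n) y * a y)) + (LBINT y. indicator cell y * (rlog1 (eps n) y * b y))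
    + (LBINT y. indicator cell y * (rlog2 (eps n) y * c y)) = (LBINT y. indicator cell y * (rlap (eps n) y * F y))" for n
  proof -
    have i: "integrable lborel (\<lambda>y. indicator cell y * (rlog (eps n) y * a y))" "integrable lborel (\<lambda>y. indicator cell y * (rlog1 (eps n) y * b y))"
      "integrable lborel (\<lambda>y. indicator cell y * (rlog2 (eps n) y * c y))" "integrable lborel (\<lambda>y. indicator cell y * (rlap (eps n) y * F y))"
      by (rule cell_integrable[where M = N]; use gs Fs in \<open>auto intro!: continuous_intros continuous_regularised[OF eps(1)] g partials_continuous[OF F(1)]\<close>)+
    show ?thesis using eq[of n]
      by (simp only: distrib_left right_diff_distrib Bochner_Integration.integral_diff Bochner_Integration.integral_add
        Bochner_Integration.integrable_diff Bochner_Integration.integrable_add i)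
  qed
  with tendsto_add[OF tendsto_add[OF r(2,4)] r(6)]
  have "(\<lambda>n. LBINT y. indicator cell y * (rlap (eps n) y * F y)) \<longlonglongrightarrow> (LBINT y. indicator cell y * (ln (2 * gap y) * a y))
    + (LBINT y. indicator cell y * (sin (fst y) / gap y * b y)) + (LBINT y. indicator cell y * (sinh (snd y) / gap y * c y))" by simp
  from LIMSEQ_unique[OF this approximate_identity_C1[OF F Fs]] show ?thesis
    by (simp only: distrib_left Bochner_Integration.integral_add Bochner_Integration.integrable_add r)
qed

text \<open>Pressure of a unit vertical point force: minus the vertical derivative of the Green
  function \<open>ln (2 * gap y) / (4 * pi)\<close>.\<close>

definition pres :: "plane \<Rightarrow> real" where "pres y = - (sinh (snd y) / gap y) / (4 * pi)"

lemma kern_parts: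
  "8 * pi * fst (kern y) = - (sin (fst y) / gap y * snd y)"
  "8 * pi * snd (kern y) = ln (2 * gap y) - sinh (snd y) / gap y * snd y"
  unfolding kern_gap by (simp_all add: field_simps)

lemma pres_part: "4 * pi * pres y = - (sinh (snd y) / gap y)"
  by (simp add: pres_def)

section \<open>The fundamental solution against test functions\<close>

context test_function
begin

lemma kern_integrable:
  assumes h: "continuous_on UNIV h" and supp: "\<And>y. \<bar>snd y\<bar> > N \<Longrightarrow> h y = 0"
  shows "integrable lborel (\<lambda>y. indicator cell y * (fst (kern y) * h y))"
    "integrable lborel (\<lambda>y. indicator cell y * (snd (kern y) * h y))"
    "integrable lborel (\<lambda>y. indicator cell y * (pres y * h y))"
proof -
  have h': "continuous_on UNIV (\<lambda>y. snd y * h y)" by (intro continuous_intros h)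
  have s': "\<And>y. \<bar>snd y\<bar> > N \<Longrightarrow> snd y * h y = 0" using supp by simp
  have "(\<lambda>y. indicator cell y * (fst (kern y) * h y)) = (\<lambda>y. (- 1 / (8 * pi)) * (indicator cell y * (sin (fst y) / gap y * (snd y * h y))))"
    unfolding kern_gap by (simp add: fun_eq_iff)
  then show "integrable lborel (\<lambda>y. indicator cell y * (fst (kern y) * h y))"
    using rlog1_limit(1)[OF h' s'] by (simp only: integrable_mult_right)
  have "(\<lambda>y. indicator cell y * (snd (kern y) * h y)) = (\<lambda>y. (1 / (8 * pi)) * (indicator cell y * (ln (2 * gap y) * h y))
     + (- 1 / (8 * pi)) * (indicator cell y * (sinh (snd y) / gap y * (snd y * h y))))"
    unfolding kern_gap by (auto simp: fun_eq_iff algebra_simps)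
  then show "integrable lborel (\<lambda>y. indicator cell y * (snd (kern y) * h y))"
    using rlog2_limit(1)[OF h' s'] rlog_limit(1)[OF h supp] by (simp only: integrable_mult_right Bochner_Integration.integrable_add)
  have "(\<lambda>y. indicator cell y * (pres y * h y)) = (\<lambda>y. (- 1 / (4 * pi)) * (indicator cell y * (sinh (snd y) / gap y * h y)))"
    unfolding pres_def by (simp add: fun_eq_iff)
  then show "integrable lborel (\<lambda>y. indicator cell y * (pres y * h y))"
    using rlog2_limit(1)[OF h supp] by (simp only: integrable_mult_right)
qed

abbreviation "lap y \<equiv> \<psi>11 y + \<psi>22 y"

lemma lap_continuous: "continuous_on UNIV lap" and lap_supp: "\<bar>snd y\<bar> > M \<Longrightarrow> lap y = 0"
  using supp2 by (auto intro!: continuous_intros cont2)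

text \<open>Vertical momentum equation with a unit source at 0. Both sides of the limit identity
  carry the factor \<open>8 * pi\<close>, which clears the denominators of \<open>kern\<close> and
  \<open>pres\<close> on the left and is \<open>4 * pi\<close> times the weight 2 on the
  right.\<close>

lemma fundamental_2: "(LBINT y. indicator cell y * (snd (kern y) * lap y + pres y * \<psi>2 y)) = \<psi> (0, 0)"
proof -
  have F: "partials (\<lambda>y. 2 * \<psi> y + snd y * \<psi>2 y) ((0 * \<psi> y + 2 * \<psi>1 y) + (0 * \<psi>2 y + snd y * \<psi>21 y)) ((0 * \<psi> y + 2 * \<psi>2 y) + (1 * \<psi>2 y + snd y * \<psi>22 y)) y" for y
    by (intro partials_add partials_mult partials_const partials_snd d0 d2)
  have "(LBINT y. indicator cell y * (ln (2 * gap y) * lap y + sin (fst y) / gap y * 0 + sinh (snd y) / gap y * - (snd y * lap y + 2 * \<psi>2 y)))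
    = 4 * pi * (2 * \<psi> (0, 0) + snd (0 :: real, 0 :: real) * \<psi>2 (0, 0))"
  proof (rule regularised_limit[OF _ _ _ _ _ _ F, where N = M])
    show "(LBINT y. indicator cell y * (rlog (eps n) y * lap y + rlog1 (eps n) y * 0 + rlog2 (eps n) y * - (snd y * lap y + 2 * \<psi>2 y)
      - rlap (eps n) y * (2 * \<psi> y + snd y * \<psi>2 y))) = 0" for n
      by (rule trans[OF Bochner_Integration.integral_cong[OF refl] regularised_momentum2[OF eps(1)[of n]]]) (simp add: algebra_simps)
  qed (use lap_supp supp0 supp1 supp2 per0[of "(0, 0)"] in \<open>auto intro!: continuous_intros lap_continuous cont1 cont2\<close>)
  also have "(LBINT y. indicator cell y * (ln (2 * gap y) * lap y + sin (fst y) / gap y * 0 + sinh (snd y) / gap y * - (snd y * lap y + 2 * \<psi>2 y)))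
    = (LBINT y. 8 * pi * (indicator cell y * (snd (kern y) * lap y + pres y * \<psi>2 y)))"
  proof (intro Bochner_Integration.integral_cong refl)
    fix y
    show "indicator cell y * (ln (2 * gap y) * lap y + sin (fst y) / gap y * 0 + sinh (snd y) / gap y * - (snd y * lap y + 2 * \<psi>2 y))
      = 8 * pi * (indicator cell y * (snd (kern y) * lap y + pres y * \<psi>2 y))" using kern_parts[of y] pres_part[of y] by algebra
  qed
  finally show ?thesis by simp
qed

lemma fundamental_1: "(LBINT y. indicator cell y * (fst (kern y) * lap y + pres y * \<psi>1 y)) = 0"
proof -
  have F: "partials (\<lambda>y. snd y * \<psi>1 y) (0 * \<psi>1 y + snd y * \<psi>11 y) (1 * \<psi>1 y + snd y * \<psi>12 y) y" for y
    by (intro partials_add partials_mult partials_const partials_snd d0 d1)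
  have "(LBINT y. indicator cell y * (ln (2 * gap y) * 0 + sin (fst y) / gap y * - (snd y * lap y) + sinh (snd y) / gap y * - (2 * \<psi>1 y)))
    = 4 * pi * (snd (0 :: real, 0 :: real) * \<psi>1 (0, 0))"
  proof (rule regularised_limit[OF _ _ _ _ _ _ F, where N = M])
    show "(LBINT y. indicator cell y * (rlog (eps n) y * 0 + rlog1 (eps n) y * - (snd y * lap y) + rlog2 (eps n) y * - (2 * \<psi>1 y)
      - rlap (eps n) y * (snd y * \<psi>1 y))) = 0" for n
      by (rule trans[OF Bochner_Integration.integral_cong[OF refl] regularised_momentum1[OF eps(1)[of n]]]) (simp add: algebra_simps)
  qed (use lap_supp supp0 supp1 supp2 in \<open>auto intro!: continuous_intros lap_continuous cont1 cont2\<close>)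
  also have "(LBINT y. indicator cell y * (ln (2 * gap y) * 0 + sin (fst y) / gap y * - (snd y * lap y) + sinh (snd y) / gap y * - (2 * \<psi>1 y)))
    = (LBINT y. 8 * pi * (indicator cell y * (fst (kern y) * lap y + pres y * \<psi>1 y)))"
  proof (intro Bochner_Integration.integral_cong refl)
    fix y
    show "indicator cell y * (ln (2 * gap y) * 0 + sin (fst y) / gap y * - (snd y * lap y) + sinh (snd y) / gap y * - (2 * \<psi>1 y))
      = 8 * pi * (indicator cell y * (fst (kern y) * lap y + pres y * \<psi>1 y))" using kern_parts[of y] pres_part[of y] by algebra
  qed
  finally show ?thesis by simp
qed

lemma fundamental_div: "(LBINT y. indicator cell y * (fst (kern y) * \<psi>1 y + snd (kern y) * \<psi>2 y)) = 0"
proof -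
  have F: "partials (\<lambda>y. snd y * \<psi> y) (0 * \<psi> y + snd y * \<psi>1 y) (1 * \<psi> y + snd y * \<psi>2 y) y" for y
    by (intro partials_add partials_mult partials_const partials_snd d0 d1)
  have "(LBINT y. indicator cell y * (ln (2 * gap y) * \<psi>2 y + sin (fst y) / gap y * - (snd y * \<psi>1 y) + sinh (snd y) / gap y * - (snd y * \<psi>2 y)))
    = 4 * pi * (snd (0 :: real, 0 :: real) * \<psi> (0, 0))"
  proof (rule regularised_limit[OF _ _ _ _ _ _ F, where N = M])
    show "(LBINT y. indicator cell y * (rlog (eps n) y * \<psi>2 y + rlog1 (eps n) y * - (snd y * \<psi>1 y) + rlog2 (eps n) y * - (snd y * \<psi>2 y)
      - rlap (eps n) y * (snd y * \<psi> y))) = 0" for n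
      by (rule trans[OF Bochner_Integration.integral_cong[OF refl] regularised_divergence[OF eps(1)[of n]]]) (simp add: algebra_simps)
  qed (use supp0 supp1 in \<open>auto intro!: continuous_intros cont0 cont1\<close>)
  also have "(LBINT y. indicator cell y * (ln (2 * gap y) * \<psi>2 y + sin (fst y) / gap y * - (snd y * \<psi>1 y) + sinh (snd y) / gap y * - (snd y * \<psi>2 y)))
    = (LBINT y. 8 * pi * (indicator cell y * (fst (kern y) * \<psi>1 y + snd (kern y) * \<psi>2 y)))"
  proof (intro Bochner_Integration.integral_cong refl)
    fix y
    show "indicator cell y * (ln (2 * gap y) * \<psi>2 y + sin (fst y) / gap y * - (snd y * \<psi>1 y) + sinh (snd y) / gap y * - (snd y * \<psi>2 y))
      = 8 * pi * (indicator cell y * (fst (kern y) * \<psi>1 y + snd (kern y) * \<psi>2 y))" using kern_parts[of y] by algebra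
  qed
  finally show ?thesis by simp
qed

end

section \<open>Superposition of point sources\<close>

lemma strip_measurable [measurable]: "strip N \<in> sets borel"
  by (intro borel_closed closed_Times) auto

lemma emeasure_strip: "emeasure lborel (strip N) < \<infinity>"
  by (intro emeasure_bounded_finite bounded_Times) auto

lemma rmaj_majorant: "ennreal (rmaj y) \<le> majorant y"
  by (cases "nome y = 1") (simp_all add: majorant_top majorant_ennreal rmaj_def)

lemma rmaj_minus: "rmaj (x - y) = rmaj (y - x)"
proof -
  have "nome (- z) = cnj (nome z)" for z by (simp add: complex_eq_iff Re_nome Im_nome)
  then have "nome (x - y) = cnj (nome (y - x))" by (metis minus_diff_eq)
  then have "nome_ratio (x - y) = cnj (nome_ratio (y - x))" by (simp add: nome_ratio_def)
  then show ?thesis unfolding rmaj_def by (simp add: abs_minus_commute)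
qed

lemma kern_rmaj: "\<bar>fst (kern y)\<bar> \<le> rmaj y" "\<bar>snd (kern y)\<bar> \<le> rmaj y"
proof -
  have "norm (kern y) \<le> rmaj y"
  proof (cases "gap y = 0")
    case True
    then have "kern y = 0" by (simp add: kern_gap zero_prod_def)
    then show ?thesis using rmaj_nonneg[of y] by simp
  next
    case False
    then have "nome y \<noteq> 1" using nome_eq_1_iff by simp
    then show ?thesis using kern_bound_real unfolding rmaj_def by blast
  qed
  then show "\<bar>fst (kern y)\<bar> \<le> rmaj y" "\<bar>snd (kern y)\<bar> \<le> rmaj y"
    using abs_fst_le_norm[of "kern y"] abs_snd_le_norm[of "kern y"] by linarith+
qed

text \<open>\<open>sinh (snd y) / gap y\<close> is \<open>sgn (snd y)\<close> times
  \<open>1 + 2 * Re (nome_ratio y)\<close>, so the pressure differs from its limits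
  \<open>- sgn (snd y) / (4 * pi)\<close> at the two ends by an exponentially small term.\<close>

lemma pres_sgn: "\<bar>pres y + sgn (snd y) / (4 * pi)\<bar> \<le> rmaj y"
proof (cases "snd y = 0 \<or> gap y = 0")
  case True
  have "snd y = 0" if "gap y = 0" using gap_lower(1)[of y] that by simp
  with True have "snd y = 0" by blast
  then show ?thesis using rmaj_nonneg[of y] by (simp add: pres_def)
next
  case False
  then have g: "0 < gap y" using gap_nonneg[of y] by linarith
  have r: "2 * Re (nome_ratio y) * gap y = cos (fst y) - exp (- \<bar>snd y\<bar>)" using g by (simp add: nome_ratio_parts)
  have "sinh (snd y) = sgn (snd y) * (cosh (snd y) - exp (- \<bar>snd y\<bar>))"
    using False by (auto simp: sgn_if sinh_def cosh_def)
  moreover have "gap y + 2 * Re (nome_ratio y) * gap y = cosh (snd y) - exp (- \<bar>snd y\<bar>)" unfolding r by (simp add: gap_def)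
  ultimately have s: "sinh (snd y) = sgn (snd y) * (gap y + 2 * Re (nome_ratio y) * gap y)" by simp
  have "sinh (snd y) / gap y = sgn (snd y) * (1 + 2 * Re (nome_ratio y))" unfolding s using g by (simp add: field_simps)
  then have "pres y + sgn (snd y) / (4 * pi) = - (sgn (snd y) * (2 * Re (nome_ratio y)) / (4 * pi))"
    unfolding pres_def by (simp add: field_simps)
  then have "\<bar>pres y + sgn (snd y) / (4 * pi)\<bar> = 2 * \<bar>Re (nome_ratio y)\<bar> / (4 * pi)" using False by (simp add: abs_mult)
  also have "\<dots> \<le> 2 * \<bar>Re (nome_ratio y)\<bar> / 1" using pi_gt3 by (intro divide_left_mono) auto
  also have "\<dots> \<le> 2 * norm (nome_ratio y)" using abs_Re_le_cmod[of "nome_ratio y"] by simp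
  also have "\<dots> \<le> rmaj y" by (rule norm_nome_ratio_le)
  finally show ?thesis .
qed

lemma pres_measurable [measurable]: "pres \<in> borel_measurable borel"
proof -
  have [measurable]: "(\<lambda>y. sinh (snd y)) \<in> borel_measurable (borel :: plane measure)"
    by (intro borel_measurable_continuous_onI continuous_intros)
  show ?thesis unfolding pres_def[abs_def] by measurable
qed

lemma kern_parts_measurable [measurable]: "(\<lambda>y. fst (kern y)) \<in> borel_measurable borel" "(\<lambda>y. snd (kern y)) \<in> borel_measurable borel"
  by (rule measurable_compose[OF kern_measurable borel_measurable_continuous_onI], intro continuous_intros)+

lemma sgn_snd_measurable [measurable]: "(\<lambda>y :: plane. sgn (snd y)) \<in> borel_measurable borel"
  by (rule measurable_compose[OF borel_measurable_continuous_onI borel_measurable_sgn]) (intro continuous_intros)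

text \<open>Subtracting \<open>sgn (snd y) / (4 * pi)\<close> makes the pressure of each point source decay as \<open>snd y\<close>
  tends to infinity; test functions only see the gradient of the pressure, and the correction does not depend on \<open>x\<close>.\<close>
definition cpres :: "plane \<Rightarrow> plane \<Rightarrow> real" where
  "cpres x y = pres (x - y) - sgn (snd y) / (4 * pi)"

text \<open>For \<open>y\<close> beyond the strip the sign of \<open>snd x - snd y\<close> is
  opposite to that of \<open>snd y\<close>, and the correction removes exactly the limit of the
  pressure. For \<open>y\<close> in the strip a term of size at most 1 remains.\<close>

lemma cpres_bound: assumes "\<bar>snd x\<bar> \<le> N" "y \<in> cell" shows "\<bar>cpres x y\<bar> \<le> rmaj (x - y) + indicator (strip N) y"
proof -
  have "\<bar>cpres x y\<bar> \<le> \<bar>pres (x - y) + sgn (snd (x - y)) / (4 * pi)\<bar> + \<bar>(sgn (snd x - snd y) + sgn (snd y)) / (4 * pi)\<bar>"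
    unfolding cpres_def by (simp add: add_divide_distrib)
  also have "\<bar>(sgn (snd x - snd y) + sgn (snd y)) / (4 * pi)\<bar> \<le> indicator (strip N) y"
  proof (cases "y \<in> strip N")
    case True
    have "\<bar>sgn (snd x - snd y) + sgn (snd y)\<bar> \<le> 2" by (auto simp: sgn_if)
    moreover have "4 * pi > 2" using pi_gt3 by simp
    ultimately show ?thesis using True by (simp add: divide_le_eq abs_divide)
  next
    case False
    then have "\<bar>snd y\<bar> > N" using assms(2) by (cases y) (auto simp: cell_def)
    then have "sgn (snd x - snd y) + sgn (snd y) = 0" using assms(1) by (auto simp: sgn_if)
    then show ?thesis by simp
  qed
  finally show ?thesis using pres_sgn[of "x - y"] by simp
qed

lemma rmaj_shift_integrable: "integrable lborel (\<lambda>y. indicator cell y * rmaj (x - y))"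
proof (rule integrableI_bounded)
  have "(\<integral>\<^sup>+y. ennreal (norm (indicator cell y * rmaj (x - y))) \<partial>lborel) \<le> (\<integral>\<^sup>+y. indicator cell y * majorant (x - y) \<partial>lborel)"
    using rmaj_majorant by (intro nn_integral_mono) (auto simp: indicator_def rmaj_nonneg)
  also have "\<dots> = ennreal majorant_mass" using majorant_reflect[OF measure_preserving_map_id] majorant_mass by simp
  finally show "(\<integral>\<^sup>+y. ennreal (norm (indicator cell y * rmaj (x - y))) \<partial>lborel) < \<infinity>" by (simp add: le_less_trans)
qed measurable

lemma dominated_integrable:
  assumes [measurable]: "h \<in> borel_measurable borel"
    and bd: "\<And>y. y \<in> cell \<Longrightarrow> \<bar>h y :: real\<bar> \<le> B * (rmaj (x - y) + indicator (strip N) y)"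
  shows "integrable lborel (\<lambda>y. indicator cell y * h y)"
proof (rule Bochner_Integration.integrable_bound)
  have "integrable lborel (\<lambda>y. indicator (strip N) y :: real)" using emeasure_strip[of N] by (intro integrable_real_indicator) auto
  then show "integrable lborel (\<lambda>y. B * (indicator cell y * rmaj (x - y) + indicator (strip N) y))"
    using rmaj_shift_integrable by (intro integrable_mult_right Bochner_Integration.integrable_add)
  show "AE y in lborel. norm (indicator cell y * h y) \<le> norm (B * (indicator cell y * rmaj (x - y) + indicator (strip N) y))"
    using bd by (intro AE_I2) (force simp: indicator_def)
qed measurable

text \<open>The double integral converges absolutely: in \<open>x\<close> the kernel lives on a
  strip, and in \<open>y\<close> the majorant centred at \<open>x\<close> has a mass independent of
  \<open>x\<close>.\<close>

lemma kernel_exchange: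
  fixes k :: "plane \<Rightarrow> plane \<Rightarrow> real"
  assumes k[measurable]: "(\<lambda>(x, y). k x y) \<in> borel_measurable (borel \<Otimes>\<^sub>M borel)"
    and B: "0 \<le> B" and bd: "\<And>x y. x \<in> cell \<Longrightarrow> y \<in> cell \<Longrightarrow> \<bar>snd x\<bar> \<le> N \<Longrightarrow> \<bar>k x y\<bar> \<le> B * (rmaj (x - y) + indicator (strip N) y)"
    and supp: "\<And>x y. \<bar>snd x\<bar> > N \<Longrightarrow> k x y = 0"
  shows "integrable lborel (\<lambda>x. LBINT y. indicator cell x * (indicator cell y * k x y))"
    and "(LBINT x. LBINT y. indicator cell x * (indicator cell y * k x y)) = (LBINT y. LBINT x. indicator cell x * (indicator cell y * k x y))"
proof -
  define c where "c = ennreal B * (ennreal majorant_mass + emeasure lborel (strip N))"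
  have c: "c < \<infinity>" using emeasure_strip[of N] by (simp add: c_def ennreal_mult_less_top)
  have I: "integrable (lborel \<Otimes>\<^sub>M lborel) (\<lambda>(x, y). indicator cell x * (indicator cell y * k x y))"
  proof (rule integrableI_bounded)
    have le: "ennreal (norm (indicator cell x * (indicator cell y * k x y)))
      \<le> indicator (strip N) x * (ennreal B * (indicator cell y * majorant (x - y) + indicator (strip N) y))" for x y
    proof (cases "x \<in> cell \<and> y \<in> cell \<and> \<bar>snd x\<bar> \<le> N")
      case True
      then have xs: "x \<in> strip N" by (cases x) (auto simp: cell_def)
      have "ennreal \<bar>k x y\<bar> \<le> ennreal (B * (rmaj (x - y) + indicator (strip N) y))" using bd True by (intro ennreal_leI) auto
      also have "\<dots> = ennreal B * (ennreal (rmaj (x - y)) + ennreal (indicator (strip N) y))"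
        using B rmaj_nonneg by (simp add: ennreal_mult ennreal_plus)
      also have "\<dots> \<le> ennreal B * (majorant (x - y) + indicator (strip N) y)"
        by (intro mult_left_mono add_mono rmaj_majorant) (auto simp: indicator_def)
      finally show ?thesis using True xs by simp
    next
      case False
      then have z: "norm (indicator cell x * (indicator cell y * k x y)) = 0" using supp[of x y] by (auto simp: indicator_def)
      show ?thesis unfolding z by simp
    qed
    have [measurable]: "(\<lambda>p. majorant (fst p - snd p)) \<in> borel_measurable (borel \<Otimes>\<^sub>M (borel :: plane measure))" by measurable
    have "(\<integral>\<^sup>+p. ennreal (norm ((\<lambda>(x, y). indicator cell x * (indicator cell y * k x y)) p)) \<partial>(lborel \<Otimes>\<^sub>M lborel))
      \<le> (\<integral>\<^sup>+p. (\<lambda>(x, y). indicator (strip N) x * (ennreal B * (indicator cell y * majorant (x - y) + indicator (strip N) y))) p \<partial>(lborel \<Otimes>\<^sub>M lborel))"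
      by (intro nn_integral_mono) (use le in auto)
    also have "\<dots> = (\<integral>\<^sup>+x. \<integral>\<^sup>+y. indicator (strip N) x * (ennreal B * (indicator cell y * majorant (x - y) + indicator (strip N) y)) \<partial>lborel \<partial>lborel)"
      by (subst lborel.nn_integral_fst[symmetric]) auto
    also have "\<dots> = (\<integral>\<^sup>+x. indicator (strip N) x * c \<partial>lborel)"
    proof (intro nn_integral_cong)
      fix x
      have "(\<integral>\<^sup>+y. indicator cell y * majorant (x - y) + indicator (strip N) y \<partial>lborel) = ennreal majorant_mass + emeasure lborel (strip N)"
        using majorant_reflect[OF measure_preserving_map_id] majorant_mass by (subst nn_integral_add) auto
      then show "(\<integral>\<^sup>+y. indicator (strip N) x * (ennreal B * (indicator cell y * majorant (x - y) + indicator (strip N) y)) \<partial>lborel) = indicator (strip N) x * c"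
        by (simp add: nn_integral_cmult c_def)
    qed
    also have "\<dots> = emeasure lborel (strip N) * c" by (simp add: nn_integral_multc)
    also have "\<dots> < \<infinity>" using c emeasure_strip[of N] by (simp add: ennreal_mult_less_top)
    finally show "(\<integral>\<^sup>+p. ennreal (norm ((\<lambda>(x, y). indicator cell x * (indicator cell y * k x y)) p)) \<partial>(lborel \<Otimes>\<^sub>M lborel)) < \<infinity>" .
  qed measurable
  show "integrable lborel (\<lambda>x. LBINT y. indicator cell x * (indicator cell y * k x y))"
    using lborel_pair.integrable_fst[OF I] .
  show "(LBINT x. LBINT y. indicator cell x * (indicator cell y * k x y)) = (LBINT y. LBINT x. indicator cell x * (indicator cell y * k x y))"
    using lborel_pair.Fubini_integral[OF I] by simp
qed

context bounded_density
begin

definition pressure :: "plane \<Rightarrow> real" where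
  "pressure x = (LBINT y. indicator cell y * (\<rho> y * cpres x y))"

lemma pressure_integrable: "integrable lborel (\<lambda>y. indicator cell y * (\<rho> y * cpres x y))"
proof (rule dominated_integrable[where x = x and N = "\<bar>snd x\<bar>" and B = R])
  show "(\<lambda>y. \<rho> y * cpres x y) \<in> borel_measurable borel" unfolding cpres_def by measurable
  show "\<bar>\<rho> y * cpres x y\<bar> \<le> R * (rmaj (x - y) + indicator (strip \<bar>snd x\<bar>) y)" if "y \<in> cell" for y
    unfolding abs_mult using cpres_bound[OF _ that, of x "\<bar>snd x\<bar>"] \<rho>_bound[of y] R_nonneg by (intro mult_mono) auto
qed

lemma pressure_shift: "pressure (x + (2 * pi, 0)) = pressure x"
proof -
  have "pres (y + (2 * pi, 0)) = pres y" for y by (simp add: pres_def gap_def)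
  from this[of "x - y" for y] have "cpres (x + (2 * pi, 0)) y = cpres x y" for y by (simp add: cpres_def algebra_simps)
  then show ?thesis by (simp add: pressure_def)
qed

lemma pressure_locally_integrable: "set_integrable lborel (strip N) pressure"
proof -
  define k where "k x y = indicator {x. \<bar>snd x\<bar> \<le> N} x * (\<rho> y * cpres x y)" for x y
  have [measurable]: "{x :: plane. \<bar>snd x\<bar> \<le> N} \<in> sets borel" by (intro borel_closed closed_Collect_le continuous_intros)
  have "(\<lambda>(x, y). k x y) \<in> borel_measurable (borel \<Otimes>\<^sub>M borel)" unfolding k_def cpres_def by measurable
  moreover have "\<bar>k x y\<bar> \<le> R * (rmaj (x - y) + indicator (strip N) y)" if "y \<in> cell" "\<bar>snd x\<bar> \<le> N" for x y
  proof -
    have "\<bar>k x y\<bar> = \<bar>\<rho> y\<bar> * \<bar>cpres x y\<bar>" using that by (simp add: k_def abs_mult)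
    also have "\<dots> \<le> R * (rmaj (x - y) + indicator (strip N) y)" by (intro mult_mono \<rho>_bound cpres_bound that R_nonneg) simp
    finally show ?thesis .
  qed
  moreover have "k x y = 0" if "\<bar>snd x\<bar> > N" for x y using that by (simp add: k_def)
  ultimately have "integrable lborel (\<lambda>x. LBINT y. indicator cell x * (indicator cell y * k x y))"
    by (intro kernel_exchange(1)[OF _ R_nonneg]) auto
  moreover have "(LBINT y. indicator cell x * (indicator cell y * k x y)) = indicator (strip N) x *\<^sub>R pressure x" for x
  proof -
    have e: "indicator cell x * (indicator cell y * k x y) = indicator (strip N) x * (indicator cell y * (\<rho> y * cpres x y))" for y
      unfolding k_def by (cases x) (auto simp: cell_def indicator_def)
    show ?thesis unfolding e pressure_def integral_mult_right_zero by simp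
  qed
  ultimately show ?thesis unfolding set_integrable_def by simp
qed

abbreviation "vel \<equiv> transport_velocity \<rho> (\<lambda>y. y)"

lemma vel_parts:
  "integrable lborel (\<lambda>y. indicator cell y * (\<rho> y * fst (kern (x - y))))" "fst (vel x) = (LBINT y. indicator cell y * (\<rho> y * fst (kern (x - y))))"
  "integrable lborel (\<lambda>y. indicator cell y * (\<rho> y * snd (kern (x - y))))" "snd (vel x) = (LBINT y. indicator cell y * (\<rho> y * snd (kern (x - y))))"
proof -
  note i = transport_velocity_integrable[OF measure_preserving_map_id, of x]
  from integrable_bounded_linear[OF bounded_linear_fst i] integral_bounded_linear[OF bounded_linear_fst i]
  show "integrable lborel (\<lambda>y. indicator cell y * (\<rho> y * fst (kern (x - y))))" "fst (vel x) = (LBINT y. indicator cell y * (\<rho> y * fst (kern (x - y))))"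
    by (simp_all add: transport_velocity_def mult.assoc)
  from integrable_bounded_linear[OF bounded_linear_snd i] integral_bounded_linear[OF bounded_linear_snd i]
  show "integrable lborel (\<lambda>y. indicator cell y * (\<rho> y * snd (kern (x - y))))" "snd (vel x) = (LBINT y. indicator cell y * (\<rho> y * snd (kern (x - y))))"
    by (simp_all add: transport_velocity_def mult.assoc)
qed

text \<open>Fubini reduces a weak equation for the superposition to the same equation for each point
  source \<open>y\<close>, with value \<open>v y\<close>. The correction of the pressure contributes
  a constant times the integral of \<open>d\<close>, which vanishes: in the applications
  \<open>d\<close> is a first derivative of the test function or 0.\<close>

lemma stokes_exchange:
  assumes c: "continuous_on UNIV a" "continuous_on UNIV b" "continuous_on UNIV d"
    and s: "\<And>x. \<bar>snd x\<bar> > N \<Longrightarrow> a x = 0" "\<And>x. \<bar>snd x\<bar> > N \<Longrightarrow> b x = 0" "\<And>x. \<bar>snd x\<bar> > N \<Longrightarrow> d x = 0"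
    and v: "\<And>y. (LBINT x. indicator cell x * (fst (kern (x - y)) * a x + snd (kern (x - y)) * b x + pres (x - y) * d x)) = v y"
    and d0: "(LBINT x. indicator cell x * d x) = 0"
  shows "has_bochner_integral lborel (\<lambda>x. indicator cell x * (fst (vel x) * a x + snd (vel x) * b x + pressure x * d x))
    (LBINT y. indicator cell y * (\<rho> y * v y))"
proof -
  note [measurable] = borel_measurable_continuous_onI[OF c(1)] borel_measurable_continuous_onI[OF c(2)] borel_measurable_continuous_onI[OF c(3)]
  obtain Ba where Ba: "0 \<le> Ba" "\<And>y. y \<in> cell \<Longrightarrow> \<bar>a y\<bar> \<le> Ba" using cell_bounded[OF c(1) s(1)] by blast
  obtain Bb where Bb: "0 \<le> Bb" "\<And>y. y \<in> cell \<Longrightarrow> \<bar>b y\<bar> \<le> Bb" using cell_bounded[OF c(2) s(2)] by blast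
  obtain Bd where Bd: "0 \<le> Bd" "\<And>y. y \<in> cell \<Longrightarrow> \<bar>d y\<bar> \<le> Bd" using cell_bounded[OF c(3) s(3)] by blast
  define B where "B = Ba + Bb + Bd"
  have B: "0 \<le> B" using Ba Bb Bd by (simp add: B_def)
  define k where "k x y = \<rho> y * (fst (kern (x - y)) * a x + snd (kern (x - y)) * b x + cpres x y * d x)" for x y
  have group: "\<bar>fst (kern z) * a x + snd (kern z) * b x + q * d x\<bar> \<le> B * (rmaj z + w)"
    if "x \<in> cell" "\<bar>q\<bar> \<le> rmaj z + w" "0 \<le> w" for x z q w
  proof -
    have m: "\<bar>f * h\<bar> \<le> C * (rmaj z + w)" if "\<bar>f\<bar> \<le> rmaj z + w" "\<bar>h\<bar> \<le> C" "0 \<le> C" for f h C :: real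
      unfolding abs_mult mult.commute[of C] using that by (intro mult_mono) auto
    have kz: "\<bar>fst (kern z)\<bar> \<le> rmaj z + w" "\<bar>snd (kern z)\<bar> \<le> rmaj z + w" using kern_rmaj[of z] that(3) by linarith+
    have "\<bar>fst (kern z) * a x\<bar> \<le> Ba * (rmaj z + w)" "\<bar>snd (kern z) * b x\<bar> \<le> Bb * (rmaj z + w)" "\<bar>q * d x\<bar> \<le> Bd * (rmaj z + w)"
      by (rule m[OF kz(1) Ba(2)[OF that(1)] Ba(1)] m[OF kz(2) Bb(2)[OF that(1)] Bb(1)] m[OF that(2) Bd(2)[OF that(1)] Bd(1)])+
    then show ?thesis unfolding B_def distrib_right abs_le_iff by linarith
  qed
  have km: "(\<lambda>(x, y). k x y) \<in> borel_measurable (borel \<Otimes>\<^sub>M borel)" unfolding k_def cpres_def by measurable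
  have kb: "\<bar>k x y\<bar> \<le> (R * B) * (rmaj (x - y) + indicator (strip N) y)" if "x \<in> cell" "y \<in> cell" "\<bar>snd x\<bar> \<le> N" for x y
  proof -
    have "\<bar>k x y\<bar> \<le> R * (B * (rmaj (x - y) + indicator (strip N) y))"
      unfolding k_def abs_mult by (intro mult_mono \<rho>_bound group that cpres_bound R_nonneg) auto
    then show ?thesis by (simp add: mult.assoc)
  qed
  have ks: "k x y = 0" if "\<bar>snd x\<bar> > N" for x y using s[OF that] by (simp add: k_def)
  have RB: "0 \<le> R * B" using R_nonneg B by simp
  note ex = kernel_exchange[OF km RB kb ks]
  have inner_y: "(LBINT y. indicator cell x * (indicator cell y * k x y)) = indicator cell x * (fst (vel x) * a x + snd (vel x) * b x + pressure x * d x)" for x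
  proof -
    have "(LBINT y. indicator cell x * (indicator cell y * k x y))
      = (LBINT y. indicator cell x * (((indicator cell y * (\<rho> y * fst (kern (x - y)))) * a x + (indicator cell y * (\<rho> y * snd (kern (x - y)))) * b x) + (indicator cell y * (\<rho> y * cpres x y)) * d x))"
      unfolding k_def by (intro Bochner_Integration.integral_cong refl) (simp only: algebra_simps)
    also have "\<dots> = indicator cell x * (LBINT y. ((indicator cell y * (\<rho> y * fst (kern (x - y)))) * a x + (indicator cell y * (\<rho> y * snd (kern (x - y)))) * b x) + (indicator cell y * (\<rho> y * cpres x y)) * d x)"
      by (rule integral_mult_right_zero)
    also have "(LBINT y. ((indicator cell y * (\<rho> y * fst (kern (x - y)))) * a x + (indicator cell y * (\<rho> y * snd (kern (x - y)))) * b x) + (indicator cell y * (\<rho> y * cpres x y)) * d x)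
      = fst (vel x) * a x + snd (vel x) * b x + pressure x * d x"
      unfolding vel_parts(2,4) pressure_def
      by (simp only: Bochner_Integration.integral_add Bochner_Integration.integrable_add integrable_mult_left vel_parts(1,3) pressure_integrable integral_mult_left_zero)
    finally show ?thesis .
  qed
  have inner_x: "(LBINT x. indicator cell x * (indicator cell y * k x y)) = indicator cell y * (\<rho> y * v y)" for y
  proof -
    define g where "g x = fst (kern (x - y)) * a x + snd (kern (x - y)) * b x + pres (x - y) * d x" for x
    have gm: "g \<in> borel_measurable borel" unfolding g_def by measurable
    have "\<bar>g x\<bar> \<le> B * (rmaj (y - x) + indicator (strip N) x)" if "x \<in> cell" for x
    proof (cases "\<bar>snd x\<bar> \<le> N")
      case True
      then have xs: "x \<in> strip N" using that by (cases x) (auto simp: cell_def)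
      have "\<bar>sgn (snd (x - y)) / (4 * pi)\<bar> \<le> 1" using pi_gt3 by (simp add: abs_divide abs_sgn_eq)
      then have "\<bar>pres (x - y)\<bar> \<le> rmaj (x - y) + 1" using pres_sgn[of "x - y"] by linarith
      from group[OF that this] show ?thesis unfolding g_def rmaj_minus[of y] using xs by simp
    next
      case False
      then show ?thesis using s[of x] B rmaj_nonneg[of "y - x"] by (simp add: g_def)
    qed
    then have ig: "integrable lborel (\<lambda>x. indicator cell x * g x)" by (rule dominated_integrable[OF gm])
    have id: "integrable lborel (\<lambda>x. (sgn (snd y) / (4 * pi)) * (indicator cell x * d x))"
      by (intro integrable_mult_right cell_integrable[OF c(3) s(3)])
    have "(LBINT x. indicator cell x * (indicator cell y * k x y))
      = (LBINT x. (indicator cell y * \<rho> y) * (indicator cell x * g x - (sgn (snd y) / (4 * pi)) * (indicator cell x * d x)))"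
      unfolding k_def cpres_def g_def by (intro Bochner_Integration.integral_cong refl) (simp only: algebra_simps)
    also have "\<dots> = (indicator cell y * \<rho> y) * ((LBINT x. indicator cell x * g x) - (sgn (snd y) / (4 * pi)) * (LBINT x. indicator cell x * d x))"
      unfolding integral_mult_right_zero Bochner_Integration.integral_diff[OF ig id] by simp
    also have "\<dots> = indicator cell y * (\<rho> y * v y)" unfolding d0 using v[of y] by (simp add: g_def)
    finally show ?thesis .
  qed
  show ?thesis using ex unfolding inner_x inner_y by (simp add: has_bochner_integral_iff)
qed

text \<open>Two momentum equations and the divergence equation are three instances of
  \<open>stokes_exchange\<close>. For each source a translation moves the kernel to the origin and
  replaces \<open>\<phi>\<close> by a translate, again a \<open>test_function\<close>, to which the
  fundamental identities apply.\<close>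

lemma stokes_weak_form:
  assumes tf: "test_function \<phi> \<phi>1 \<phi>2 \<phi>11 \<phi>12 \<phi>21 \<phi>22 N" and lap: "\<And>x. laplacian \<phi> x = \<phi>11 x + \<phi>22 x"
  shows "(\<forall>e\<in>Basis. has_bochner_integral lborel (\<lambda>x. indicator cell x *
      ((vel x \<bullet> e) * laplacian \<phi> x + pressure x * frechet_derivative \<phi> (at x) e - ((0, \<rho> x) \<bullet> e) * \<phi> x)) 0) \<and>
    has_bochner_integral lborel (\<lambda>x. indicator cell x * frechet_derivative \<phi> (at x) (vel x)) 0"
proof
  interpret test_function \<phi> \<phi>1 \<phi>2 \<phi>11 \<phi>12 \<phi>21 \<phi>22 N by fact
  have zero: "continuous_on UNIV (\<lambda>x :: plane. 0 :: real)" by simp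
  have mean: "(LBINT x. indicator cell x * \<phi>1 x) = 0" "(LBINT x. indicator cell x * \<phi>2 x) = 0"
  proof -
    have z: "partials (\<lambda>y. 0) 0 0 y" for y by (rule partials_const)
    show "(LBINT x. indicator cell x * \<phi>1 x) = 0"
      using cell_divergence[OF d0 cont1(1) z zero per0 supp0, of N] supp1 by simp
    show "(LBINT x. indicator cell x * \<phi>2 x) = 0"
      using cell_divergence[OF z zero d0 cont1(2) _ _ supp0, of N] supp1 by simp
  qed
  have translate: "(LBINT x. indicator cell x * G (x - y)) = (LBINT x. indicator cell x * G x)"
    if "G \<in> borel_measurable borel" "\<And>z. G (z + (2 * pi, 0)) = G z" "integrable lborel (\<lambda>z. indicator cell z * G z)" for G :: "plane \<Rightarrow> real" and y
    using integral_cell_fold[OF measure_preserving_map_shift[of "- y"] that(1,2)] that(3) by simp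
  have tr: "(LBINT x. indicator cell x * (fst (kern (x - y)) * a x + snd (kern (x - y)) * b x + pres (x - y) * d x))
     = (LBINT x. indicator cell x * (fst (kern x) * a (x + y) + snd (kern x) * b (x + y) + pres x * d (x + y)))"
    if c: "continuous_on UNIV a" "continuous_on UNIV b" "continuous_on UNIV d"
      and s: "\<And>x. \<bar>snd x\<bar> > N \<Longrightarrow> a x = 0" "\<And>x. \<bar>snd x\<bar> > N \<Longrightarrow> b x = 0" "\<And>x. \<bar>snd x\<bar> > N \<Longrightarrow> d x = 0"
      and p: "\<And>x. a (x + (2 * pi, 0)) = a x" "\<And>x. b (x + (2 * pi, 0)) = b x" "\<And>x. d (x + (2 * pi, 0)) = d x" for a b d and y
  proof -
    define G where "G z = fst (kern z) * a (z + y) + snd (kern z) * b (z + y) + pres z * d (z + y)" for z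
    have c': "continuous_on UNIV (\<lambda>x. f (x + y))" if "continuous_on UNIV f" for f :: "plane \<Rightarrow> real"
      by (intro continuous_on_compose2[OF that] continuous_intros) auto
    have s': "f (x + y) = 0" if "\<And>x. \<bar>snd x\<bar> > N \<Longrightarrow> f x = 0" "\<bar>snd x\<bar> > \<bar>N\<bar> + \<bar>snd y\<bar>" for f :: "plane \<Rightarrow> real" and x
      by (rule that(1)) (use that(2) in auto)
    note [measurable] = borel_measurable_continuous_onI[OF c'[OF c(1)]] borel_measurable_continuous_onI[OF c'[OF c(2)]] borel_measurable_continuous_onI[OF c'[OF c(3)]]
    have "G \<in> borel_measurable borel" unfolding G_def by measurable
    moreover have "G (z + (2 * pi, 0)) = G z" for z
    proof -
      have q: "f (z + (2 * pi, 0) + y) = f (z + y)" if "\<And>x. f (x + (2 * pi, 0)) = f x" for f :: "plane \<Rightarrow> real"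
        using that[of "z + y"] by (simp add: add_ac)
      have pz: "pres (z + (2 * pi, 0)) = pres z" by (simp add: pres_def gap_def)
      show ?thesis unfolding G_def kern_shift pz q[of a, OF p(1)] q[of b, OF p(2)] q[of d, OF p(3)] by (rule refl)
    qed
    moreover have "integrable lborel (\<lambda>z. indicator cell z * G z)"
    proof -
      have "(\<lambda>z. indicator cell z * G z) = (\<lambda>z. (indicator cell z * (fst (kern z) * a (z + y)) + indicator cell z * (snd (kern z) * b (z + y))) + indicator cell z * (pres z * d (z + y)))"
        by (simp add: G_def fun_eq_iff distrib_left)
      then show ?thesis
        using kern_integrable(1)[OF c'[OF c(1)] s'[of a, OF s(1)]] kern_integrable(2)[OF c'[OF c(2)] s'[of b, OF s(2)]] kern_integrable(3)[OF c'[OF c(3)] s'[of d, OF s(3)]]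
        by (simp only: Bochner_Integration.integrable_add)
    qed
    ultimately have "(LBINT x. indicator cell x * G (x - y)) = (LBINT x. indicator cell x * G x)" by (rule translate)
    then show ?thesis by (simp add: G_def)
  qed
  have D: "frechet_derivative \<phi> (at x) h = \<phi>1 x * fst h + \<phi>2 x * snd h" for x h
    using frechet_derivative_at[OF d0[of x, unfolded partials_def]] by (simp add: fun_eq_iff)
  show "\<forall>e\<in>Basis. has_bochner_integral lborel (\<lambda>x. indicator cell x *
      ((vel x \<bullet> e) * laplacian \<phi> x + pressure x * frechet_derivative \<phi> (at x) e - ((0, \<rho> x) \<bullet> e) * \<phi> x)) 0"
  proof
    fix e :: "plane" assume "e \<in> Basis"
    then consider "e = (1, 0)" | "e = (0, 1)" by (auto simp: Basis_prod_def)
    then show "has_bochner_integral lborel (\<lambda>x. indicator cell x *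
      ((vel x \<bullet> e) * laplacian \<phi> x + pressure x * frechet_derivative \<phi> (at x) e - ((0, \<rho> x) \<bullet> e) * \<phi> x)) 0"
    proof cases
      case 1
      have "has_bochner_integral lborel (\<lambda>x. indicator cell x * (fst (vel x) * lap x + snd (vel x) * 0 + pressure x * \<phi>1 x))
        (LBINT y. indicator cell y * (\<rho> y * 0))"
      proof (rule stokes_exchange[OF lap_continuous zero cont1(1) _ _ _ _ mean(1)])
        fix y
        show "(LBINT x. indicator cell x * (fst (kern (x - y)) * lap x + snd (kern (x - y)) * 0 + pres (x - y) * \<phi>1 x)) = 0"
          using test_function.fundamental_1[OF shift[of y]] by (subst tr) (use lap_supp supp1 lap_continuous cont1 per1 per2 in auto)
      qed (use lap_supp supp1 in auto)
      then show ?thesis unfolding 1 lap by (simp add: inner_prod_def D mult.commute)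
    next
      case 2
      have h: "has_bochner_integral lborel (\<lambda>x. indicator cell x * (fst (vel x) * 0 + snd (vel x) * lap x + pressure x * \<phi>2 x))
        (LBINT y. indicator cell y * (\<rho> y * \<phi> y))"
      proof (rule stokes_exchange[OF zero lap_continuous cont1(2) _ _ _ _ mean(2)])
        fix y
        show "(LBINT x. indicator cell x * (fst (kern (x - y)) * 0 + snd (kern (x - y)) * lap x + pres (x - y) * \<phi>2 x)) = \<phi> y"
          using test_function.fundamental_2[OF shift[of y]] by (subst tr) (use lap_supp supp1 lap_continuous cont1 per1 per2 in \<open>auto simp: zero_prod_def[symmetric]\<close>)
      qed (use lap_supp supp1 in auto)
      have "integrable lborel (\<lambda>y. indicator cell y * (\<rho> y * \<phi> y))"
      proof (rule Bochner_Integration.integrable_bound)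
        show "integrable lborel (\<lambda>y. R * (indicator cell y * \<phi> y))" by (intro integrable_mult_right cell_integrable[OF cont0 supp0])
        show "AE y in lborel. norm (indicator cell y * (\<rho> y * \<phi> y)) \<le> norm (R * (indicator cell y * \<phi> y))"
          using \<rho>_bound R_nonneg by (intro AE_I2) (auto simp: indicator_def abs_mult intro!: mult_right_mono)
        have "(\<lambda>y. \<rho> y * \<phi> y) \<in> borel_measurable borel"
          by (intro borel_measurable_times \<rho>_measurable borel_measurable_continuous_onI cont0)
        then show "(\<lambda>y. indicator cell y * (\<rho> y * \<phi> y)) \<in> borel_measurable lborel" by simp
      qed
      then have "has_bochner_integral lborel (\<lambda>y. indicator cell y * (\<rho> y * \<phi> y)) (LBINT y. indicator cell y * (\<rho> y * \<phi> y))" by (rule has_bochner_integral_integrable)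
      from has_bochner_integral_diff[OF h this] show ?thesis unfolding 2 lap
        by (simp add: inner_prod_def D right_diff_distrib mult_ac)
    qed
  qed
  have "has_bochner_integral lborel (\<lambda>x. indicator cell x * (fst (vel x) * \<phi>1 x + snd (vel x) * \<phi>2 x + pressure x * 0))
    (LBINT y. indicator cell y * (\<rho> y * 0))"
  proof (rule stokes_exchange[OF cont1 zero _ _ _ _ _])
    fix y
    show "(LBINT x. indicator cell x * (fst (kern (x - y)) * \<phi>1 x + snd (kern (x - y)) * \<phi>2 x + pres (x - y) * 0)) = 0"
      using test_function.fundamental_div[OF shift[of y]] by (subst tr) (use supp1 cont1 per1 in auto)
  qed (use supp1 in auto)
  then show "has_bochner_integral lborel (\<lambda>x. indicator cell x * frechet_derivative \<phi> (at x) (vel x)) 0"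
    unfolding D by (simp add: mult.commute)
qed

lemma stokes_solution: "stokes \<rho> vel pressure"
  unfolding stokes_def
proof (intro conjI[OF _ conjI] allI impI)
  show "periodic_x1 pressure" unfolding periodic_x1_def using pressure_shift by blast
  show "set_integrable lborel ({0..2 * pi} \<times> {- N..N}) pressure" for N by (rule pressure_locally_integrable)
  fix \<phi> assume "space_test \<phi>"
  then show "(\<forall>e\<in>Basis. has_bochner_integral lborel (\<lambda>x. indicator cell x *
      ((vel x \<bullet> e) * laplacian \<phi> x + pressure x * frechet_derivative \<phi> (at x) e - ((0, \<rho> x) \<bullet> e) * \<phi> x)) 0) \<and>
    has_bochner_integral lborel (\<lambda>x. indicator cell x * frechet_derivative \<phi> (at x) (vel x)) 0"
    by (rule test_function_of_space_test) (rule stokes_weak_form)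
qed

end

section \<open>The weak solution\<close>

lemma perturbation_periodic: "interface z \<Longrightarrow> perturbation z (\<alpha> + 2 * pi) = perturbation z \<alpha>"
  unfolding interface_def perturbation_def
  by (drule conjunct2, drule spec[of _ \<alpha>], drule spec[of _ 1]) (simp add: prod_eq_iff)

lemma perturbation_diff: "perturbation z \<alpha> - perturbation z \<beta> = (z \<alpha> - z \<beta>) - (\<alpha> - \<beta>, 0)"
  by (simp add: perturbation_def)

text \<open>The limit in time is over punctured neighbourhoods; restricting to
  \<open>s \<noteq> t\<close> lets the estimate for \<open>W1inf_norm\<close> work with a strictly
  positive Lipschitz constant.\<close>

lemma continuous_into_lipschitz:
  assumes fin: "\<And>t. t \<in> {0..T} \<Longrightarrow> N (perturbation (z t)) < \<infinity>"
    and lip: "\<And>s t. s \<in> {0..T} \<Longrightarrow> t \<in> {0..T} \<Longrightarrow> s \<noteq> t \<Longrightarrow> N (\<lambda>\<alpha>. perturbation (z t) \<alpha> - perturbation (z s) \<alpha>) \<le> ennreal (K * \<bar>t - s\<bar>)"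
  shows "continuous_into N T z"
  unfolding continuous_into_def
proof (intro conjI ballI fin)
  fix s assume s: "s \<in> {0..T}"
  have "((\<lambda>t. K * \<bar>t - s\<bar>) \<longlongrightarrow> K * \<bar>s - s\<bar>) (at s within {0..T})" by (intro tendsto_intros)
  then have "((\<lambda>t. ennreal (K * \<bar>t - s\<bar>)) \<longlongrightarrow> ennreal (K * \<bar>s - s\<bar>)) (at s within {0..T})" by (rule tendsto_ennrealI)
  then have lim: "((\<lambda>t. ennreal (K * \<bar>t - s\<bar>)) \<longlongrightarrow> 0) (at s within {0..T})" by simp
  have "eventually (\<lambda>t. N (\<lambda>\<alpha>. perturbation (z t) \<alpha> - perturbation (z s) \<alpha>) \<le> ennreal (K * \<bar>t - s\<bar>)) (at s within {0..T})"
    unfolding eventually_at_filter using lip[OF s] by (intro always_eventually) auto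
  then show "((\<lambda>t. N (\<lambda>\<alpha>. perturbation (z t) \<alpha> - perturbation (z s) \<alpha>)) \<longlongrightarrow> 0) (at s within {0..T})"
    by (rule tendsto_sandwich[OF _ _ tendsto_const lim, rotated]) (auto intro: always_eventually)
qed

context flow
begin

context
  fixes z0 :: "real \<Rightarrow> plane"
  assumes z0: "interface z0"
begin

definition curve :: "real \<Rightarrow> real \<Rightarrow> plane" where "curve t \<alpha> = X t (z0 \<alpha>)"

lemma curve_0: "curve 0 = z0"
  by (simp add: curve_def X0 fun_eq_iff)

lemma curve_interface: assumes t: "t \<in> {0..T}" shows "interface (curve t)"
proof -
  have "continuous_on UNIV (curve t)" unfolding curve_def
    using z0 by (intro continuous_on_compose2[OF X_continuous[OF t]]) (auto simp: interface_def)
  moreover have "curve t (\<alpha> + 2 * pi * of_int k) = (2 * pi * of_int k, 0) + curve t \<alpha>" for \<alpha> and k :: int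
  proof -
    have "z0 (\<alpha> + 2 * pi * of_int k) = z0 \<alpha> + (2 * pi * of_int k, 0)" using z0 unfolding interface_def by (simp add: add.commute)
    then show ?thesis unfolding curve_def using equivariant_int[of "X t", OF measure_preserving_mapD(2)[OF mp'[OF t]]] by (simp add: add.commute)
  qed
  ultimately show ?thesis by (simp add: interface_def)
qed

lemma displacement_curve: "perturbation (curve t) \<alpha> - perturbation (curve s) \<alpha> = X t (z0 \<alpha>) - X s (z0 \<alpha>)"
  by (simp add: perturbation_def curve_def)

lemma perturbation_curve: "perturbation (curve t) \<alpha> = perturbation z0 \<alpha> + (X t (z0 \<alpha>) - X 0 (z0 \<alpha>))"
  by (simp add: perturbation_def curve_def X0)

lemma holder_continuous:
  assumes \<gamma>: "0 < \<gamma>" "\<gamma> < 1" and h: "holder_norm \<gamma> (perturbation z0) < \<infinity>"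
  shows "continuous_into (holder_norm \<gamma>) T curve"
proof -
  obtain B H where B: "0 \<le> B" and H: "0 \<le> H" and b: "\<And>\<alpha>. norm (perturbation z0 \<alpha>) \<le> B"
    and hol: "\<And>\<alpha> \<beta>. norm (perturbation z0 \<alpha> - perturbation z0 \<beta>) \<le> H * \<bar>\<alpha> - \<beta>\<bar> powr \<gamma>"
    using holder_norm_finite[OF h] by metis
  define K where "K = C_vel * E * (H + 1) + 2 * C_vel"
  have CE: "0 \<le> C_vel * E" using C_vel_nonneg E_pos by simp
  have K: "0 \<le> K" using CE H C_vel_nonneg by (simp add: K_def)
  have D: "norm ((X t (z0 \<alpha>) - X s (z0 \<alpha>)) - (X t (z0 \<beta>) - X s (z0 \<beta>))) \<le> (K * \<bar>t - s\<bar>) * \<bar>\<alpha> - \<beta>\<bar> powr \<gamma>"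
    if st: "s \<in> {0..T}" "t \<in> {0..T}" for s t \<alpha> \<beta>
  \<comment> \<open>\<open>z0\<close> is its perturbation plus the identity, and
    \<open>|\<alpha> - \<beta>|\<close> is below \<open>|\<alpha> - \<beta>| powr \<gamma>\<close>
    only up to distance 1. Beyond that the power is at least 1 and the supremum bound on
    \<open>X t - X s\<close> suffices.\<close>
  proof (cases "\<bar>\<alpha> - \<beta>\<bar> \<le> 1")
    case True
    have "\<bar>\<alpha> - \<beta>\<bar> powr 1 \<le> \<bar>\<alpha> - \<beta>\<bar> powr \<gamma>" by (rule powr_mono') (use True \<gamma> in auto)
    then have p: "\<bar>\<alpha> - \<beta>\<bar> \<le> \<bar>\<alpha> - \<beta>\<bar> powr \<gamma>" by simp
    have "norm (z0 \<alpha> - z0 \<beta>) \<le> norm (perturbation z0 \<alpha> - perturbation z0 \<beta>) + norm (\<alpha> - \<beta>, 0 :: real)"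
      unfolding perturbation_diff using norm_triangle_ineq[of "(z0 \<alpha> - z0 \<beta>) - (\<alpha> - \<beta>, 0)" "(\<alpha> - \<beta>, 0)"] by simp
    also have "\<dots> \<le> H * \<bar>\<alpha> - \<beta>\<bar> powr \<gamma> + \<bar>\<alpha> - \<beta>\<bar> powr \<gamma>" using hol[of \<alpha> \<beta>] p by (simp add: norm_Pair)
    finally have zl: "norm (z0 \<alpha> - z0 \<beta>) \<le> (H + 1) * \<bar>\<alpha> - \<beta>\<bar> powr \<gamma>" by (simp add: distrib_right)
    have "norm ((X t (z0 \<alpha>) - X s (z0 \<alpha>)) - (X t (z0 \<beta>) - X s (z0 \<beta>))) \<le> C_vel * E * norm (z0 \<alpha> - z0 \<beta>) * \<bar>t - s\<bar>"
      by (rule mixed_lipschitz[OF st])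
    also have "\<dots> \<le> C_vel * E * ((H + 1) * \<bar>\<alpha> - \<beta>\<bar> powr \<gamma>) * \<bar>t - s\<bar>" by (intro mult_right_mono mult_left_mono zl CE) auto
    also have "\<dots> = (C_vel * E * (H + 1)) * (\<bar>t - s\<bar> * \<bar>\<alpha> - \<beta>\<bar> powr \<gamma>)" by simp
    also have "\<dots> \<le> K * (\<bar>t - s\<bar> * \<bar>\<alpha> - \<beta>\<bar> powr \<gamma>)" using C_vel_nonneg by (intro mult_right_mono) (auto simp: K_def)
    finally show ?thesis by simp
  next
    case False
    have "1 = \<bar>\<alpha> - \<beta>\<bar> powr 0" using False by simp
    also have "\<dots> \<le> \<bar>\<alpha> - \<beta>\<bar> powr \<gamma>" using False \<gamma> by (intro powr_mono) auto
    finally have p: "1 \<le> \<bar>\<alpha> - \<beta>\<bar> powr \<gamma>" .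
    have "norm ((X t (z0 \<alpha>) - X s (z0 \<alpha>)) - (X t (z0 \<beta>) - X s (z0 \<beta>))) \<le> (2 * C_vel) * \<bar>t - s\<bar>"
      using norm_triangle_ineq4[of "X t (z0 \<alpha>) - X s (z0 \<alpha>)" "X t (z0 \<beta>) - X s (z0 \<beta>)"] time_lipschitz[OF st, of "z0 \<alpha>"] time_lipschitz[OF st, of "z0 \<beta>"]
      by simp
    also have "\<dots> \<le> (K * \<bar>t - s\<bar>) * 1" using CE H by (simp add: K_def mult_right_mono)
    also have "\<dots> \<le> (K * \<bar>t - s\<bar>) * \<bar>\<alpha> - \<beta>\<bar> powr \<gamma>" using K by (intro mult_left_mono p) auto
    finally show ?thesis .
  qed
  have zero: "0 \<in> {0..T}" using T by simp
  show ?thesis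
  proof (rule continuous_into_lipschitz)
    fix t assume t: "t \<in> {0..T}"
    have "holder_norm \<gamma> (perturbation (curve t)) \<le> ennreal ((B + C_vel * \<bar>t - 0\<bar>) + (H + K * \<bar>t - 0\<bar>))"
    proof (rule holder_norm_le)
      show "norm (perturbation (curve t) \<alpha>) \<le> B + C_vel * \<bar>t - 0\<bar>" for \<alpha>
        unfolding perturbation_curve by (rule norm_triangle_le[OF add_mono[OF b time_lipschitz[OF zero t]]])
      show "norm (perturbation (curve t) \<alpha> - perturbation (curve t) \<beta>) \<le> (H + K * \<bar>t - 0\<bar>) * \<bar>\<alpha> - \<beta>\<bar> powr \<gamma>" for \<alpha> \<beta>
        unfolding perturbation_curve add_diff_add distrib_right by (rule norm_triangle_le[OF add_mono[OF hol D[OF zero t]]])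
    qed (use B H K C_vel_nonneg in auto)
    then show "holder_norm \<gamma> (perturbation (curve t)) < \<infinity>" by (rule le_less_trans) simp
  next
    fix s t assume st: "s \<in> {0..T}" "t \<in> {0..T}"
    have "holder_norm \<gamma> (\<lambda>\<alpha>. perturbation (curve t) \<alpha> - perturbation (curve s) \<alpha>) \<le> ennreal (C_vel * \<bar>t - s\<bar> + K * \<bar>t - s\<bar>)"
      unfolding displacement_curve
      by (rule holder_norm_le[OF time_lipschitz[OF st] D[OF st]]) (use K C_vel_nonneg in auto)
    then show "holder_norm \<gamma> (\<lambda>\<alpha>. perturbation (curve t) \<alpha> - perturbation (curve s) \<alpha>) \<le> ennreal ((C_vel + K) * \<bar>t - s\<bar>)"
      by (simp add: distrib_right)
  qed
qed

lemma W1inf_continuous: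
  assumes w: "W1inf_norm (perturbation z0) < \<infinity>"
  shows "continuous_into W1inf_norm T curve"
proof -
  have c: "continuous_on UNIV (perturbation z0)"
    using z0 unfolding interface_def perturbation_def by (intro continuous_intros) auto
  obtain B where B: "0 \<le> B" and b: "\<And>\<alpha>. norm (perturbation z0 \<alpha>) \<le> B"
    using continuous_periodic_bounded[OF c perturbation_periodic[OF z0]] by metis
  obtain L where L: "0 \<le> L" and lip: "\<And>\<alpha> \<beta>. norm (perturbation z0 \<alpha> - perturbation z0 \<beta>) \<le> L * \<bar>\<alpha> - \<beta>\<bar>"
    using W1inf_norm_finite[OF c perturbation_periodic[OF z0] w] by metis
  define K where "K = C_vel * E * (L + 1)"
  have CE: "0 \<le> C_vel * E" using C_vel_nonneg E_pos by simp
  have K: "0 \<le> K" using CE L by (simp add: K_def)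
  have D: "norm ((X t (z0 \<alpha>) - X s (z0 \<alpha>)) - (X t (z0 \<beta>) - X s (z0 \<beta>))) \<le> (K * \<bar>t - s\<bar>) * \<bar>\<alpha> - \<beta>\<bar>"
    if st: "s \<in> {0..T}" "t \<in> {0..T}" for s t \<alpha> \<beta>
  proof -
    have "norm (z0 \<alpha> - z0 \<beta>) \<le> norm (perturbation z0 \<alpha> - perturbation z0 \<beta>) + norm (\<alpha> - \<beta>, 0 :: real)"
      unfolding perturbation_diff using norm_triangle_ineq[of "(z0 \<alpha> - z0 \<beta>) - (\<alpha> - \<beta>, 0)" "(\<alpha> - \<beta>, 0)"] by simp
    also have "\<dots> \<le> L * \<bar>\<alpha> - \<beta>\<bar> + \<bar>\<alpha> - \<beta>\<bar>" using lip[of \<alpha> \<beta>] by (simp add: norm_Pair)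
    finally have zl: "norm (z0 \<alpha> - z0 \<beta>) \<le> (L + 1) * \<bar>\<alpha> - \<beta>\<bar>" by (simp add: distrib_right)
    have "norm ((X t (z0 \<alpha>) - X s (z0 \<alpha>)) - (X t (z0 \<beta>) - X s (z0 \<beta>))) \<le> C_vel * E * norm (z0 \<alpha> - z0 \<beta>) * \<bar>t - s\<bar>"
      by (rule mixed_lipschitz[OF st])
    also have "\<dots> \<le> C_vel * E * ((L + 1) * \<bar>\<alpha> - \<beta>\<bar>) * \<bar>t - s\<bar>" by (intro mult_right_mono mult_left_mono zl CE) auto
    also have "\<dots> = (K * \<bar>t - s\<bar>) * \<bar>\<alpha> - \<beta>\<bar>" by (simp add: K_def)
    finally show ?thesis .
  qed
  have zero: "0 \<in> {0..T}" using T by simp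
  show ?thesis
  proof (rule continuous_into_lipschitz)
    fix t assume t: "t \<in> {0..T}"
    have "W1inf_norm (perturbation (curve t)) \<le> ennreal ((B + C_vel * \<bar>t - 0\<bar>) + 2 * ((L + 1) + K * \<bar>t - 0\<bar>))"
    proof (rule W1inf_norm_le)
      show "norm (perturbation (curve t) \<alpha>) \<le> B + C_vel * \<bar>t - 0\<bar>" for \<alpha>
        unfolding perturbation_curve by (rule norm_triangle_le[OF add_mono[OF b time_lipschitz[OF zero t]]])
      have "norm (perturbation z0 \<alpha> - perturbation z0 \<beta>) \<le> (L + 1) * \<bar>\<alpha> - \<beta>\<bar>" for \<alpha> \<beta>
        using lip[of \<alpha> \<beta>] by (simp add: distrib_right)
      then show "norm (perturbation (curve t) \<alpha> - perturbation (curve t) \<beta>) \<le> ((L + 1) + K * \<bar>t - 0\<bar>) * \<bar>\<alpha> - \<beta>\<bar>" for \<alpha> \<beta>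
        unfolding perturbation_curve add_diff_add distrib_right[of "L + 1"] by (rule norm_triangle_le[OF add_mono[OF _ D[OF zero t]]])
      show "0 < (L + 1) + K * \<bar>t - 0\<bar>" by (rule add_pos_nonneg) (use L K in auto)
    qed (rule perturbation_periodic[OF curve_interface[OF t]])
    then show "W1inf_norm (perturbation (curve t)) < \<infinity>" by (rule le_less_trans) simp
  next
    fix s t assume st: "s \<in> {0..T}" "t \<in> {0..T}" "s \<noteq> t"
    have "W1inf_norm (\<lambda>\<alpha>. perturbation (curve t) \<alpha> - perturbation (curve s) \<alpha>) \<le> ennreal (C_vel * \<bar>t - s\<bar> + 2 * ((K + 1) * \<bar>t - s\<bar>))"
    proof (rule W1inf_norm_le)
      show "perturbation (curve t) (\<alpha> + 2 * pi) - perturbation (curve s) (\<alpha> + 2 * pi) = perturbation (curve t) \<alpha> - perturbation (curve s) \<alpha>" for \<alpha>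
        by (simp only: perturbation_periodic[OF curve_interface[OF st(1)]] perturbation_periodic[OF curve_interface[OF st(2)]])
      \<comment> \<open>1 is added because \<open>W1inf_norm_le\<close> takes a positive constant
        and \<open>K\<close> may be 0.\<close>
      have "(K * \<bar>t - s\<bar>) * \<bar>\<alpha> - \<beta>\<bar> \<le> ((K + 1) * \<bar>t - s\<bar>) * \<bar>\<alpha> - \<beta>\<bar>" for \<alpha> \<beta> by (intro mult_right_mono) auto
      then show "norm ((perturbation (curve t) \<alpha> - perturbation (curve s) \<alpha>) - (perturbation (curve t) \<beta> - perturbation (curve s) \<beta>)) \<le> ((K + 1) * \<bar>t - s\<bar>) * \<bar>\<alpha> - \<beta>\<bar>" for \<alpha> \<beta>
        unfolding displacement_curve by (rule order_trans[OF D[OF st(1,2)]])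
      show "norm (perturbation (curve t) \<alpha> - perturbation (curve s) \<alpha>) \<le> C_vel * \<bar>t - s\<bar>" for \<alpha>
        unfolding displacement_curve by (rule time_lipschitz[OF st(1,2)])
      show "0 < (K + 1) * \<bar>t - s\<bar>" using K st(3) by (intro mult_pos_pos) auto
    qed
    then show "W1inf_norm (\<lambda>\<alpha>. perturbation (curve t) \<alpha> - perturbation (curve s) \<alpha>) \<le> ennreal ((C_vel + 2 * (K + 1)) * \<bar>t - s\<bar>)"
      by (simp add: distrib_right mult.assoc)
  qed
qed

text \<open>The homeomorphism \<open>X t\<close> carries the upper domain of \<open>z0\<close> onto
  that of the moved curve, so the patch at time \<open>t\<close> is the initial patch read at the
  label \<open>Y t x\<close>, also on the curve itself, which carries \<open>\<rho>m\<close> at all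
  times. The equations are then statements on transported densities.\<close>

lemma curve_weak_solution:
  assumes inj: "inj z0" and \<rho>: "\<rho> = patch \<rho>p \<rho>m z0"
  shows "weak_solution \<rho>p \<rho>m T curve"
proof -
  define r where "r t = patch \<rho>p \<rho>m (curve t)" for t
  have r: "r t x = \<rho> (Y t x)" if t: "t \<in> {0..T}" for t x
  proof -
    have "X t (Y t x) \<in> upper_domain (\<lambda>\<alpha>. X t (z0 \<alpha>)) \<longleftrightarrow> Y t x \<in> upper_domain z0"
      by (rule upper_domain_image_iff[OF X_continuous[OF t] X_bij[OF t] Y_continuous[OF t] displacement[OF t]])
    then show ?thesis by (simp add: r_def \<rho> patch_def X_Y[OF t] curve_def[abs_def])
  qed
  have per: "r t (x + (2 * pi, 0)) = r t x" if t: "t \<in> {0..T}" for t x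
    by (simp add: r_def patch_def upper_domain_shift[OF curve_interface[OF t]])
  have vel: "velocity (r t) = field t" "bounded_density (r t) R" if t: "t \<in> {0..T}" for t
    by (rule velocity_transported[OF t r[OF t] per[OF t]])+
  have zero: "0 \<in> {0..T}" using T by simp
  have sep: "separating (curve t)" if t: "t \<in> {0..T}" for t
  proof (rule interface_separating[OF curve_interface[OF t]])
    show "inj (curve t)" using inj_compose[OF bij_is_inj[OF X_bij[OF t]] inj] by (simp add: curve_def[abs_def] o_def)
  qed
  have "lagrangian T r (\<lambda>t. velocity (r t)) curve"
    unfolding lagrangian_def is_flow_def
  proof (intro exI[of _ X] conjI allI ballI)
    show "X 0 x = x" for x by (rule X0)
    show "((\<lambda>s. X s x) has_vector_derivative velocity (r t) (X t x)) (at t within {0..T})" if "t \<in> {0..T}" for t x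
      using der[OF that] vel(1)[OF that] by simp
    show "curve t \<alpha> = X t (curve 0 \<alpha>)" for t \<alpha> by (simp add: curve_def X0)
    show "r t (X t x) = r 0 x" if "t \<in> {0..T}" for t x
      using r[OF that, of "X t x"] r[OF zero, of "X 0 x"] Y_X[OF that] Y_X[OF zero] X0 by simp
  qed
  moreover have "continuity_equation T r (\<lambda>t. velocity (r t))" by (rule continuity_equation_transported[OF r per])
  moreover have "\<exists>p. stokes (r t) (velocity (r t)) p" if t: "t \<in> {0..T}" for t
    using bounded_density.stokes_solution[OF vel(2)[OF t]] unfolding velocity_eq by blast
  ultimately show ?thesis
    unfolding weak_solution_def Let_def r_def using curve_interface sep by blast
qed

end

end

theorem corollary1:
  fixes \<gamma> \<rho>p \<rho>m :: real and z0 :: "real \<Rightarrow> real \<times> real"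
  assumes "0 < \<gamma>" and "\<gamma> < 1"
    and "interface z0" and "arc_chord z0"
  shows "(holder_norm \<gamma> (perturbation z0) < \<infinity> \<longrightarrow>
           (\<forall>T>0. \<exists>z. weak_solution \<rho>p \<rho>m T z \<and>
              continuous_into (holder_norm \<gamma>) T z \<and> z 0 = z0)) \<and>
         (W1inf_norm (perturbation z0) < \<infinity> \<longrightarrow>
           (\<forall>T>0. \<exists>z. weak_solution \<rho>p \<rho>m T z \<and>
              continuous_into W1inf_norm T z \<and> z 0 = z0))"
proof -
  interpret bounded_density "patch \<rho>p \<rho>m z0" "\<bar>\<rho>p\<bar> + \<bar>\<rho>m\<bar>"
    by standard (use patch_measurable[OF assms(3)] in \<open>auto simp: patch_def\<close>)
  obtain X where X: "\<And>x. X 0 x = x" "\<And>t. 0 \<le> t \<Longrightarrow> measure_preserving_map (X t)"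
    "\<And>x t T. t \<in> {0..T} \<Longrightarrow> ((\<lambda>s. X s x) has_vector_derivative transport_velocity (patch \<rho>p \<rho>m z0) (X t) (X t x)) (at t within {0..T})"
    using flow_exists by blast
  \<comment> \<open>The trajectories exist for all times, so one \<open>X\<close> serves every
    \<open>T\<close> and both regularity classes.\<close>
  have flow: "flow (patch \<rho>p \<rho>m z0) (\<bar>\<rho>p\<bar> + \<bar>\<rho>m\<bar>) T X" if "0 < T" for T
    by (intro flow.intro bounded_density_axioms flow_axioms.intro that X)
  show ?thesis
  proof (intro conjI impI allI)
    fix T :: real assume T: "0 < T"
    interpret flow "patch \<rho>p \<rho>m z0" "\<bar>\<rho>p\<bar> + \<bar>\<rho>m\<bar>" T X by (rule flow[OF T])
    note ws = curve_weak_solution[OF assms(3) arc_chord_inj[OF assms(4)] refl]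
    show "\<exists>z. weak_solution \<rho>p \<rho>m T z \<and> continuous_into (holder_norm \<gamma>) T z \<and> z 0 = z0" if "holder_norm \<gamma> (perturbation z0) < \<infinity>"
      using ws holder_continuous[OF assms(3,1,2) that] curve_0[OF assms(3)] by blast
    show "\<exists>z. weak_solution \<rho>p \<rho>m T z \<and> continuous_into W1inf_norm T z \<and> z 0 = z0" if "W1inf_norm (perturbation z0) < \<infinity>"
      using ws W1inf_continuous[OF assms(3) that] curve_0[OF assms(3)] by blast
  qed
qed

end
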